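(* Let $\nu>0$, let $f\in L^{2^\#}(\Omega)$, and let $G:H^\sigma_0(\Omega)\to L^\infty_\nu(\mathbb{R}^N)$ be a (nonlinear, nonlocal) operator that is bounded and completely continuous. Then there exists a solution $u$ of the quasi-variational inequality $$u\in\mathbb{K}^\sigma_{G[u]}:\qquad\int_{\mathbb{R}^N}AD^\sigma u\cdot D^\sigma(v-u)\,dx\ge\int_\Omega f(v-u)\,dx\qquad\text{for all }v\in\mathbb{K}^\sigma_{G[u]}.$$
   Context: Let $0<\sigma<1$ and let $\Omega\subset\mathbb{R}^N$ be a bounded domain with Lipschitz boundary. Functions on $\Omega$ are extended by zero outside $\Omega$, with the same notation. The $\sigma$-gradient (distributional Riesz fractional gradient) of $u\in L^p(\mathbb{R}^N)$, $1<p<\infty$, is $D^\sigma u=D(I_{1-\sigma}u)$, i.e. $(D^\sigma u)_j=\frac{\partial}{\partial x_j}I_{1-\sigma}u$ in the sense of distributions, where for $0<\alpha<1$, $I_\alpha u(x)=\gamma_{N,\alpha}\int_{\mathbb{R}^N}\frac{u(y)}{|x-y|^{N-\alpha}}dy$ and $\gamma_{N,\alpha}=\frac{\Gamma(\frac{N-\alpha}{2})}{\pi^{N/2}2^\alpha\Gamma(\frac\alpha2)}$. $H^\sigma_0(\Omega)$ is the closure of $C^\infty_0(\Omega)$ in $H^\sigma(\mathbb{R}^N)$, with the (equivalent) norm $\|u\|_{H^\sigma_0(\Omega)}=\|D^\sigma u\|_{L^2(\mathbb{R}^N)^N}$. For $\nu>0$, $L^\infty_\nu(\mathbb{R}^N)=\{v\in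 L^\infty(\mathbb{R}^N):v(x)\ge\nu\text{ for a.e. }x\in\mathbb{R}^N\}$, and $\mathbb{K}^\sigma_{G[u]}=\{v\in H^\sigma_0(\Omega):|D^\sigma v|\le G[u]\text{ a.e. in }\mathbb{R}^N\}$. A bounded operator is one that maps bounded sets into bounded sets; $G$ is completely continuous if $u_n\rightharpoonup u$ weakly in $H^\sigma_0(\Omega)$ implies $G[u_n]\to G[u]$ in $L^\infty(\mathbb{R}^N)$. The matrix $A:\mathbb{R}^N\to\mathbb{R}^{N\times N}$ is bounded and measurable, not necessarily symmetric, and for some $a_*,a^*>0$, for a.e. $x\in\mathbb{R}^N$ and all $\xi,\eta\in\mathbb{R}^N$: $a_*|\xi|^2\le A(x)\xi\cdot\xi$ and $A(x)\xi\cdot\eta\le a^*|\xi||\eta|$. $2^\#=\frac{2N}{N+2\sigma}$ when $\sigma<\frac N2$; if $N=1$ and $\sigma=\frac12$, $2^\#=q'=\frac q{q-1}$ for an arbitrary fixed $q\in(1,\infty)$; if $N=1$ and $\sigma>\frac12$, $2^\#=1$. *)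

theory Defs
  imports "HOL-Analysis.Analysis" "HOL-Probability.Essential_Supremum"
begin

text \<open>
  Elements of Lebesgue and Sobolev spaces are represented by functions, identified only up to
  equality almost everywhere with respect to \<^const>\<open>lebesgue\<close>. Functions on \<open>\<Omega>\<close>
  belonging to \<open>H0 \<sigma> \<Omega>\<close> are functions on the whole space (extension by zero).
\<close>

section \<open>Lipschitz domains\<close>

text \<open>Near each boundary point, \<open>\<Omega>\<close> is the strict epigraph, in some unit direction \<open>e\<close>, of a
  Lipschitz function \<open>g\<close> on the hyperplane orthogonal to \<open>e\<close>.\<close>

definition lipschitz_boundary :: "(real^'n) set \<Rightarrow> bool" where
  "lipschitz_boundary \<Omega> \<longleftrightarrow>
     (\<forall>x0 \<in> frontier \<Omega>. \<exists>r>0. \<exists>e g L.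
        norm e = 1 \<and> L-lipschitz_on {y. y \<bullet> e = 0} (g :: real^'n \<Rightarrow> real) \<and>
        \<Omega> \<inter> ball x0 r = {x \<in> ball x0 r. g (x - (x \<bullet> e) *\<^sub>R e) < x \<bullet> e})"

definition bounded_lipschitz_domain :: "(real^'n) set \<Rightarrow> bool" where
  "bounded_lipschitz_domain \<Omega> \<longleftrightarrow>
     open \<Omega> \<and> connected \<Omega> \<and> \<Omega> \<noteq> {} \<and> bounded \<Omega> \<and> lipschitz_boundary \<Omega>"

section \<open>Test functions and distributional derivatives\<close>

definition partial_deriv :: "'n \<Rightarrow> (real^'n \<Rightarrow> real) \<Rightarrow> real^'n \<Rightarrow> real" where
  "partial_deriv j \<phi> x = frechet_derivative \<phi> (at x) (axis j 1)"

primrec Ck :: "nat \<Rightarrow> (real^'n \<Rightarrow> real) \<Rightarrow> bool" where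
  "Ck 0 \<phi> \<longleftrightarrow> continuous_on UNIV \<phi>"
| "Ck (Suc k) \<phi> \<longleftrightarrow> (\<forall>x. \<phi> differentiable at x) \<and> (\<forall>j. Ck k (partial_deriv j \<phi>))"

definition test_functions :: "(real^'n) set \<Rightarrow> (real^'n \<Rightarrow> real) set" where
  "test_functions \<Omega> =
     {\<phi>. (\<forall>k. Ck k \<phi>) \<and> compact (closure {x. \<phi> x \<noteq> 0}) \<and> closure {x. \<phi> x \<noteq> 0} \<subseteq> \<Omega>}"

definition locally_integrable :: "(real^'n \<Rightarrow> real) \<Rightarrow> bool" where
  "locally_integrable w \<longleftrightarrow> (\<forall>K. compact K \<longrightarrow> w absolutely_integrable_on K)"

definition distr_partial_deriv :: "'n \<Rightarrow> (real^'n \<Rightarrow> real) \<Rightarrow> (real^'n \<Rightarrow> real) \<Rightarrow> bool" where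
  "distr_partial_deriv j w h \<longleftrightarrow> locally_integrable w \<and> locally_integrable h \<and>
     (\<forall>\<phi> \<in> test_functions UNIV.
        (LINT x|lebesgue. w x * partial_deriv j \<phi> x) = - (LINT x|lebesgue. h x * \<phi> x))"

section \<open>The Riesz fractional gradient\<close>

definition riesz_const :: "nat \<Rightarrow> real \<Rightarrow> real" where
  "riesz_const N \<alpha> =
     Gamma ((real N - \<alpha>) / 2) / (pi powr (real N / 2) * 2 powr \<alpha> * Gamma (\<alpha> / 2))"

definition riesz_potential :: "real \<Rightarrow> (real^'n \<Rightarrow> real) \<Rightarrow> real^'n \<Rightarrow> real" where
  "riesz_potential \<alpha> u x =
     riesz_const CARD('n) \<alpha> *
       (LINT y|lebesgue. u y / norm (x - y) powr (real CARD('n) - \<alpha>))"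

definition is_frac_grad :: "real \<Rightarrow> (real^'n \<Rightarrow> real) \<Rightarrow> (real^'n \<Rightarrow> real^'n) \<Rightarrow> bool" where
  "is_frac_grad \<sigma> u g \<longleftrightarrow>
     (\<forall>j. distr_partial_deriv j (riesz_potential (1 - \<sigma>) u) (\<lambda>x. g x $ j))"

text \<open>The fractional gradient is unique up to null sets, so any representative may be chosen. It is
  only applied to elements of \<open>H0 \<sigma> \<Omega>\<close> below, with \<open>\<Omega>\<close> bounded, for which the distribution
  \<open>D(I\<^bsub>1-\<sigma>\<^esub> u)\<close> is a square integrable function.\<close>

definition frac_grad :: "real \<Rightarrow> (real^'n \<Rightarrow> real) \<Rightarrow> real^'n \<Rightarrow> real^'n" where
  "frac_grad \<sigma> u = (SOME g. is_frac_grad \<sigma> u g)"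

section \<open>Fractional Sobolev spaces\<close>

text \<open>The squared Sobolev--Slobodeckij (Gagliardo) norm.\<close>

definition Hs_norm_sq :: "real \<Rightarrow> (real^'n \<Rightarrow> real) \<Rightarrow> ennreal" where
  "Hs_norm_sq \<sigma> u =
     (\<integral>\<^sup>+ x. ennreal ((u x)\<^sup>2) \<partial>lebesgue) +
     (\<integral>\<^sup>+ x. (\<integral>\<^sup>+ y. ennreal ((u x - u y)\<^sup>2 / norm (x - y) powr (real CARD('n) + 2 * \<sigma>))
        \<partial>lebesgue) \<partial>lebesgue)"

definition Hs :: "real \<Rightarrow> (real^'n \<Rightarrow> real) set" where
  "Hs \<sigma> = {u \<in> borel_measurable lebesgue. Hs_norm_sq \<sigma> u < \<infinity>}"

definition H0 :: "real \<Rightarrow> (real^'n) set \<Rightarrow> (real^'n \<Rightarrow> real) set" where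
  "H0 \<sigma> \<Omega> =
     {u \<in> Hs \<sigma>. \<exists>\<phi> :: nat \<Rightarrow> real^'n \<Rightarrow> real. (\<forall>n. \<phi> n \<in> test_functions \<Omega>) \<and>
        (\<lambda>n. Hs_norm_sq \<sigma> (\<lambda>x. \<phi> n x - u x)) \<longlonglongrightarrow> 0}"

definition H0_norm :: "real \<Rightarrow> (real^'n \<Rightarrow> real) \<Rightarrow> real" where
  "H0_norm \<sigma> u = sqrt (LINT x|lebesgue. (norm (frac_grad \<sigma> u x))\<^sup>2)"

definition H0_dual :: "real \<Rightarrow> (real^'n) set \<Rightarrow> ((real^'n \<Rightarrow> real) \<Rightarrow> real) set" where
  "H0_dual \<sigma> \<Omega> =
     {F. (\<forall>u \<in> H0 \<sigma> \<Omega>. \<forall>v \<in> H0 \<sigma> \<Omega>. \<forall>a b. F (\<lambda>x. a * u x + b * v x) = a * F u + b * F v) \<and>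
         (\<exists>C. \<forall>u \<in> H0 \<sigma> \<Omega>. \<bar>F u\<bar> \<le> C * H0_norm \<sigma> u)}"

definition H0_weak_conv ::
  "real \<Rightarrow> (real^'n) set \<Rightarrow> (nat \<Rightarrow> real^'n \<Rightarrow> real) \<Rightarrow> (real^'n \<Rightarrow> real) \<Rightarrow> bool" where
  "H0_weak_conv \<sigma> \<Omega> us u \<longleftrightarrow>
     (\<forall>n. us n \<in> H0 \<sigma> \<Omega>) \<and> u \<in> H0 \<sigma> \<Omega> \<and> (\<forall>F \<in> H0_dual \<sigma> \<Omega>. (\<lambda>n. F (us n)) \<longlonglongrightarrow> F u)"

section \<open>Lebesgue spaces\<close>

definition Lp_on :: "real \<Rightarrow> (real^'n) set \<Rightarrow> (real^'n \<Rightarrow> real) set" where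
  "Lp_on p \<Omega> = {f \<in> borel_measurable (lebesgue_on \<Omega>).
                  integrable (lebesgue_on \<Omega>) (\<lambda>x. \<bar>f x\<bar> powr p)}"

definition Linf_norm :: "(real^'n \<Rightarrow> real) \<Rightarrow> ereal" where
  "Linf_norm v = esssup lebesgue (\<lambda>x. ereal \<bar>v x\<bar>)"

definition Linf_ge :: "real \<Rightarrow> (real^'n \<Rightarrow> real) set" where
  "Linf_ge \<nu> =
     {v \<in> borel_measurable lebesgue. Linf_norm v < \<infinity> \<and> (AE x in lebesgue. \<nu> \<le> v x)}"

text \<open>The exponent \<open>2\<^sup>#\<close>. As \<open>0 < \<sigma> < 1\<close>, the last two cases only occur for \<open>N = 1\<close>; the parameter
  \<open>q\<close> is relevant only if \<open>\<sigma> = N / 2\<close>.\<close>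

definition two_sharp :: "nat \<Rightarrow> real \<Rightarrow> real \<Rightarrow> real" where
  "two_sharp N \<sigma> q =
     (if \<sigma> < real N / 2 then 2 * real N / (real N + 2 * \<sigma>)
      else if \<sigma> = real N / 2 then q / (q - 1)
      else 1)"

section \<open>Operators from \<open>H0\<close> to \<open>L\<^sup>\<infinity>\<close>\<close>

text \<open>The second condition says that the operator is well defined on equivalence classes.\<close>

definition operator_H0_Linf_ge ::
  "real \<Rightarrow> (real^'n) set \<Rightarrow> real \<Rightarrow> ((real^'n \<Rightarrow> real) \<Rightarrow> (real^'n \<Rightarrow> real)) \<Rightarrow> bool" where
  "operator_H0_Linf_ge \<sigma> \<Omega> \<nu> G \<longleftrightarrow>
     (\<forall>u \<in> H0 \<sigma> \<Omega>. G u \<in> Linf_ge \<nu>) \<and>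
     (\<forall>u \<in> H0 \<sigma> \<Omega>. \<forall>v \<in> H0 \<sigma> \<Omega>.
        (AE x in lebesgue. u x = v x) \<longrightarrow> (AE x in lebesgue. G u x = G v x))"

definition bounded_operator ::
  "real \<Rightarrow> (real^'n) set \<Rightarrow> ((real^'n \<Rightarrow> real) \<Rightarrow> (real^'n \<Rightarrow> real)) \<Rightarrow> bool" where
  "bounded_operator \<sigma> \<Omega> G \<longleftrightarrow>
     (\<forall>B \<subseteq> H0 \<sigma> \<Omega>. (\<exists>R. \<forall>u \<in> B. H0_norm \<sigma> u \<le> R) \<longrightarrow>
        (\<exists>M::real. \<forall>u \<in> B. Linf_norm (G u) \<le> ereal M))"

definition completely_continuous ::
  "real \<Rightarrow> (real^'n) set \<Rightarrow> ((real^'n \<Rightarrow> real) \<Rightarrow> (real^'n \<Rightarrow> real)) \<Rightarrow> bool" where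
  "completely_continuous \<sigma> \<Omega> G \<longleftrightarrow>
     (\<forall>us u. H0_weak_conv \<sigma> \<Omega> us u \<longrightarrow>
        (\<lambda>n. Linf_norm (\<lambda>x. G (us n) x - G u x)) \<longlonglongrightarrow> 0)"

definition constraint_set ::
  "real \<Rightarrow> (real^'n) set \<Rightarrow> (real^'n \<Rightarrow> real) \<Rightarrow> (real^'n \<Rightarrow> real) set" where
  "constraint_set \<sigma> \<Omega> g = {v \<in> H0 \<sigma> \<Omega>. AE x in lebesgue. norm (frac_grad \<sigma> v x) \<le> g x}"

end

theory Submission
 imports Defs "HOL-Library.Diagonal_Subsequence" "HOL-Probability.Distributions"
begin

text \<open>
Passing to fractional gradients turns the problem into one in a Hilbert space: the space \<open>V\<close> of all
fields \<open>D\<^sup>\<sigma> u\<close>, \<open>u \<in> H0 \<sigma> \<Omega>\<close>, is a closed subspace of the square integrable fields, its norm is the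
norm of \<open>H0 \<sigma> \<Omega>\<close>, and the constraint is a pointwise bound on the elements of \<open>V\<close>.

For a fixed threshold \<open>\<gamma> = G u\<close> the variational inequality has exactly one solution \<open>S u\<close>: this is the
Lions--Stampacchia argument, a contraction built from the metric projection. A solution of the
quasi-variational inequality is a fixed point of \<open>S\<close>. If \<open>u\<^sub>n\<close> converges weakly to \<open>u\<close> then \<open>G u\<^sub>n\<close>
converges uniformly to \<open>G u\<close>, and since both thresholds are at least \<open>\<nu>\<close>, the factor
\<open>c\<^sub>n = \<nu> / (\<nu> + \<epsilon>\<^sub>n)\<close>, with \<open>\<epsilon>\<^sub>n\<close> the distance of the thresholds, maps each of the two constraint
sets into the other one. Inserting the rescaled solutions as competitors into each other's
inequalities gives \<open>S u\<^sub>n \<longlonglongrightarrow> S u\<close> in norm. As bounded sequences have weakly convergent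
subsequences, \<open>S\<close> is continuous and maps a ball into a compact set, and Schauder's theorem yields
the fixed point (\<open>quasi_variational_inequality_solvable\<close>).

What remains is the analysis of the fractional gradient. It rests on the identity
\<open>\<parallel>D\<^sup>\<sigma> \<phi>\<parallel>\<^sup>2 = E [\<phi>]\<^sup>2\<close> between the gradient norm and the Gagliardo seminorm of a test function
(\<open>riesz_gradient_energy\<close>). It is proved without the Fourier transform: with
\<open>F r = \<Sum>\<^sub>j \<langle>P\<^sub>r \<partial>\<^sub>j \<phi>, \<partial>\<^sub>j \<phi>\<rangle>\<close> for the heat semigroup \<open>P\<close>, both sides are constant multiples of
\<open>\<integral> F r r\<^sup>-\<^sup>\<sigma> dr\<close> over the positive half line, because powers of \<open>\<bar>x\<bar>\<close> are time integrals of heat kernels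
(\<open>subordination\<close>). The identity makes the fractional gradient continuous in \<open>H\<^sup>\<sigma>\<close>; together with the
fractional Poincare inequality it also makes the gradient norm dominate the norm of \<open>H\<^sup>\<sigma>\<close>, which
gives the closedness of \<open>V\<close>. Uniqueness of the fractional gradient almost everywhere is the
fundamental lemma of the calculus of variations. The load \<open>f\<close> is a bounded functional by the
fractional Sobolev inequalities in the subcritical, critical and supercritical range; all of them
follow from one lower bound for the kernel mass outside a set of small measure.
\<close>

text \<open>The two binders are Lebesgue integrals of nonnegative functions, with respect to Borel and to
completed Lebesgue measure.\<close>

abbreviation (input) Borel_functions ("\<B>") where "\<B> == borel_measurable borel"
abbreviation (input) Lebesgue_functions ("\<L>") where "\<L> == borel_measurable lebesgue"
abbreviation (input) nn_integral_lborel :: "('a::euclidean_space => ennreal) => ennreal" (binder "NN " 10)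
  where "nn_integral_lborel f == integral\<^sup>N lborel f"
abbreviation (input) nn_integral_lebesgue :: "('a::euclidean_space => ennreal) => ennreal" (binder "NL " 10)
  where "nn_integral_lebesgue f == integral\<^sup>N lebesgue f"

section \<open>Schauder's fixed point theorem\<close>

lemma compact_infinite_cube: "compact {x :: nat => real. \<forall>i. 0 <= x i \<and> x i <= 1}"
proof -
 have eq: "{x :: nat => real. \<forall>i. 0 <= x i \<and> x i <= 1} = (\<Pi>\<^sub>E i\<in>UNIV. {0..1})"
  by (auto simp: PiE_def Pi_def)
 have "compactin (product_topology (%_. euclidean) UNIV) (\<Pi>\<^sub>E i\<in>(UNIV :: nat set). {0..1::real})"
  by (simp add: compactin_PiE)
 then show ?thesis
  unfolding eq by (simp add: euclidean_product_topology)
qed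

lemma tendsto_funI:
 fixes x :: "nat => nat => real"
 assumes "!!i. (%k. x k i) \<longlonglongrightarrow> l i"
 shows "x \<longlonglongrightarrow> l"
proof -
 have "limitin (product_topology (%_. euclidean) UNIV) x l sequentially"
  using assms by (simp add: limitin_componentwise)
 then show ?thesis
  by (simp add: euclidean_product_topology)
qed

text \<open>Brouwer's theorem for a cube whose dimension is a number instead of a type, as needed for the finite
dimensional approximations in Schauder's theorem. The cube consists of sequences, of which only the
first \<open>n\<close> coordinates are discretised; Kuhn's labelling lemma provides, for every mesh width, a cell
in which each of these coordinates is both raised and lowered by \<open>f\<close>, and the limit of such cells
is fixed in the first \<open>n\<close> coordinates.\<close>

lemma cube_fixed_point:
 fixes f :: "(nat => real) => nat => real" and n :: nat
 defines "C \<equiv> {x :: nat => real. \<forall>i. 0 <= x i \<and> x i <= 1}"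
 assumes cont: "continuous_on C f" and maps: "f ` C \<subseteq> C"
 shows "\<exists>x\<in>C. \<forall>i<n. f x i = x i"
proof -
 obtain l :: "(nat => real) => nat => nat" where l:
  "!!x i. l x i <= 1" "!!x i. x \<in> C ==> x i = 0 ==> l x i = 0"
  "!!x i. x \<in> C ==> x i = 1 ==> l x i = 1"
  "!!x i. x \<in> C ==> l x i = 0 ==> x i <= f x i"
  "!!x i. x \<in> C ==> l x i = 1 ==> f x i <= x i"
 proof -
  have "\<forall>x. x \<in> C --> f x \<in> C" "\<forall>x. x \<in> C --> (\<forall>i. True --> 0 <= x i \<and> x i <= 1)"
   using maps by (auto simp: C_def)
  from kuhn_labelling_lemma'[OF this] obtain l where
   l: "(\<forall>x i. l x i <= (1::nat)) \<and> (\<forall>x i. x \<in> C \<and> True \<and> x i = 0 --> l x i = 0) \<and>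
   (\<forall>x i. x \<in> C \<and> True \<and> x i = 1 --> l x i = 1) \<and>
   (\<forall>x i. x \<in> C \<and> True \<and> l x i = 0 --> x i <= f x i) \<and>
   (\<forall>x i. x \<in> C \<and> True \<and> l x i = 1 --> f x i <= x i)" ..
  show ?thesis
  proof (rule that[of l])
   show "l x i <= 1" for x i using l by simp
   show "x \<in> C ==> x i = 0 ==> l x i = 0" for x i
    using conjunct1[OF conjunct2[OF l]] by simp
   show "x \<in> C ==> x i = 1 ==> l x i = 1" for x i
    using conjunct1[OF conjunct2[OF conjunct2[OF l]]] by simp
   show "x \<in> C ==> l x i = 0 ==> x i <= f x i" for x i
    using conjunct1[OF conjunct2[OF conjunct2[OF conjunct2[OF l]]]] by simp
   show "x \<in> C ==> l x i = 1 ==> f x i <= x i" for x i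
    using conjunct2[OF conjunct2[OF conjunct2[OF conjunct2[OF l]]]] by simp
  qed
 qed
 (* Near x, coordinate i is raised at one point of C and lowered at another one. *)
 define Q where "Q p x \<longleftrightarrow> (\<forall>i<n. \<exists>y\<in>C. \<exists>z\<in>C. (\<forall>j. \<bar>y j - x j\<bar> <= 1 / real (Suc p)) \<and>
   (\<forall>j. \<bar>z j - x j\<bar> <= 1 / real (Suc p)) \<and> y i <= f y i \<and> f z i <= z i)" for p :: nat and x
 have "\<exists>x\<in>C. Q p x" for p
  unfolding Q_def
 proof -
  define X where "X q i = (if i < n then real (q i) / real (Suc p) else 0)" for q :: "nat => nat" and i
  have XC: "X q \<in> C" if "\<forall>i<n. q i <= Suc p" for q
   using that by (auto simp: C_def X_def divide_simps)
  have lX: "l (X q) i = 0 \<or> l (X q) i = 1" for q i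
   using l(1)[of "X q" i] by linarith
  obtain q where q: "\<forall>i<n. q i < Suc p"
   "\<forall>i<n. \<exists>r s. (\<forall>j<n. q j <= r j \<and> r j <= q j + 1) \<and> (\<forall>j<n. q j <= s j \<and> s j <= q j + 1) \<and>
    l (X r) i ~= l (X s) i"
  proof (rule kuhn_lemma[of "Suc p" n "%x. l (X x)"])
   show "\<forall>x. (\<forall>i<n. x i <= Suc p) --> (\<forall>i<n. x i = 0 --> l (X x) i = 0)"
    using XC l(2) by (auto simp: X_def)
   show "\<forall>x. (\<forall>i<n. x i <= Suc p) --> (\<forall>i<n. x i = Suc p --> l (X x) i = 1)"
    using XC l(3) by (auto simp: X_def)
  qed (use lX in auto)
  have close: "\<bar>X r j - X q j\<bar> <= 1 / real (Suc p)" if "\<forall>j<n. q j <= r j \<and> r j <= q j + 1" for r j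
  proof (cases "j < n")
   case True
   then have "X r j - X q j = (real (r j) - real (q j)) / real (Suc p)"
    by (simp add: X_def diff_divide_distrib)
   moreover have "\<bar>real (r j) - real (q j)\<bar> <= 1"
    using that[rule_format, OF True] by linarith
   ultimately show ?thesis
    by (simp add: divide_simps)
  qed (simp add: X_def)
  have rC: "X r \<in> C" if "\<forall>j<n. q j <= r j \<and> r j <= q j + 1" for r
   by (rule XC) (use that q(1) in force)
  have witnesses: "\<exists>y\<in>C. \<exists>z\<in>C. (\<forall>j. \<bar>y j - X q j\<bar> <= 1 / real (Suc p)) \<and>
   (\<forall>j. \<bar>z j - X q j\<bar> <= 1 / real (Suc p)) \<and> y i <= f y i \<and> f z i <= z i" if i: "i < n" for i
  proof -
   obtain r s where rs: "\<forall>j<n. q j <= r j \<and> r j <= q j + 1" "\<forall>j<n. q j <= s j \<and> s j <= q j + 1"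
    "l (X r) i ~= l (X s) i" using q(2)[rule_format, OF i] by (elim exE conjE)
   then consider "l (X r) i = 0" "l (X s) i = 1" | "l (X r) i = 1" "l (X s) i = 0"
    using lX by metis
   then show ?thesis
   proof cases
    case 1
    then show ?thesis
     using rC[OF rs(1)] rC[OF rs(2)] close[OF rs(1)] close[OF rs(2)] l(4,5)
     by (intro bexI[of _ "X r"] bexI[of _ "X s"]) simp_all
   next
    case 2
    then show ?thesis
     using rC[OF rs(1)] rC[OF rs(2)] close[OF rs(1)] close[OF rs(2)] l(4,5)
     by (intro bexI[of _ "X s"] bexI[of _ "X r"]) simp_all
   qed
  qed
  show "\<exists>x\<in>C. \<forall>i<n. \<exists>y\<in>C. \<exists>z\<in>C. (\<forall>j. \<bar>y j - x j\<bar> <= 1 / real (Suc p)) \<and>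
   (\<forall>j. \<bar>z j - x j\<bar> <= 1 / real (Suc p)) \<and> y i <= f y i \<and> f z i <= z i"
  proof (rule bexI[of _ "X q"])
   show "X q \<in> C" using q(1) by (intro XC) auto
  qed (intro allI impI witnesses)
 qed
 then have "\<forall>p. \<exists>x. x \<in> C \<and> Q p x" by blast
 then obtain x where "\<forall>p. x p \<in> C \<and> Q p (x p)" by (rule choice[THEN exE])
 then have x: "!!p. x p \<in> C" "!!p. Q p (x p)" by simp_all
 have "seq_compact C"
  using compact_infinite_cube compact_eq_seq_compact_metric unfolding C_def by blast
 then obtain a r where a: "a \<in> C" "strict_mono r" "(x \<circ> r) \<longlonglongrightarrow> a"
  using x(1) unfolding seq_compact_def by metis
 have lim: "(%k. f (w k) i) \<longlonglongrightarrow> f a i \<and> (%k. w k i) \<longlonglongrightarrow> a i"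
  if w: "!!k. w k \<in> C" "!!k j. \<bar>w k j - x (r k) j\<bar> <= 1 / real (Suc (r k))" for w i
 proof -
  have xa: "(%k. x (r k) j) \<longlonglongrightarrow> a j" for j
   using continuous_on_tendsto_compose[OF continuous_on_product_coordinates a(3)]
   by (simp add: o_def)
  have "(%k. 1 / real (Suc (r k))) \<longlonglongrightarrow> 0"
   using LIMSEQ_subseq_LIMSEQ[OF lim_1_over_n[THEN LIMSEQ_Suc] a(2)] by (simp add: o_def)
  then have "(%k. w k j - x (r k) j) \<longlonglongrightarrow> 0" for j
   by (rule Lim_null_comparison[rotated]) (use w(2) in auto)
  then have wa: "(%k. w k j) \<longlonglongrightarrow> a j" for j
   using tendsto_add[OF _ xa[of j], of "%k. w k j - x (r k) j" 0] by simp
  then have wa': "w \<longlonglongrightarrow> a" by (rule tendsto_funI)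
  have "(%k. f (w k)) \<longlonglongrightarrow> f a"
   by (rule continuous_on_tendsto_compose[OF cont wa' a(1)]) (simp add: w(1))
  from continuous_on_tendsto_compose[OF continuous_on_product_coordinates[of i] this]
  have "(%k. f (w k) i) \<longlonglongrightarrow> f a i" by simp
  then show ?thesis using wa by blast
 qed
 have "f a i = a i" if i: "i < n" for i
 proof -
  have "\<forall>k. \<exists>y z. y \<in> C \<and> z \<in> C \<and> (\<forall>j. \<bar>y j - x (r k) j\<bar> <= 1 / real (Suc (r k))) \<and>
   (\<forall>j. \<bar>z j - x (r k) j\<bar> <= 1 / real (Suc (r k))) \<and> y i <= f y i \<and> f z i <= z i"
   using x(2) i unfolding Q_def by blast
  then have "\<exists>y z. \<forall>k. y k \<in> C \<and> z k \<in> C \<and> (\<forall>j. \<bar>y k j - x (r k) j\<bar> <= 1 / real (Suc (r k))) \<and>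
   (\<forall>j. \<bar>z k j - x (r k) j\<bar> <= 1 / real (Suc (r k))) \<and> y k i <= f (y k) i \<and> f (z k) i <= z k i"
   by (subst (asm) choice_iff, elim exE, subst (asm) choice_iff) blast
  then obtain y z where yz: "\<forall>k. y k \<in> C \<and> z k \<in> C \<and> (\<forall>j. \<bar>y k j - x (r k) j\<bar> <= 1 / real (Suc (r k))) \<and>
   (\<forall>j. \<bar>z k j - x (r k) j\<bar> <= 1 / real (Suc (r k))) \<and> y k i <= f (y k) i \<and> f (z k) i <= z k i"
   by (elim exE)
  have "a i <= f a i"
   using LIMSEQ_le[of "%k. y k i" "a i" "%k. f (y k) i" "f a i"] lim[of y i] yz by simp
  moreover have "f a i <= a i"
   using LIMSEQ_le[of "%k. f (z k) i" "f a i" "%k. z k i" "a i"] lim[of z i] yz by simp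
  ultimately show ?thesis by simp
 qed
 then show ?thesis using a(1) by blast
qed

text \<open>The Schauder projection: a finite \<open>e\<close>-net \<open>y\<^sub>1, \<dots>, y\<^sub>n\<close> of \<open>Z\<close> and the partition of unity
subordinate to it turn \<open>S\<close> into a map of weight vectors, to which \<open>cube_fixed_point\<close> applies.\<close>

lemma schauder_approximate:
 fixes S :: "'a::real_normed_vector => 'a"
 assumes "convex C" "0 \<in> C" "continuous_on C S" "S ` C \<subseteq> Z" "compact Z" "Z \<subseteq> C" "0 < e"
 shows "\<exists>u\<in>C. dist u (S u) <= e"
proof -
 obtain Y where Y: "finite Y" "Y \<subseteq> Z" "Z \<subseteq> (\<Union>y\<in>Y. ball y e)"
  using seq_compact_imp_totally_bounded assms(5,7) compact_imp_seq_compact by metis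
 obtain n and y :: "nat => 'a" where y: "Y = y ` {i. i < n}"
  using finite_imp_nat_seg_image_inj_on[OF Y(1)] by blast
 define K where "K = {x :: nat => real. \<forall>i. 0 <= x i \<and> x i <= 1}"
 (* Dividing by the total weight, or by 1 where that is larger, keeps s t in C for all weights,
    as 0 belongs to C. *)
 define s where "s t = (\<Sum>i<n. t i *\<^sub>R y i) /\<^sub>R max 1 (\<Sum>i<n. t i)" for t :: "nat => real"
 define m where "m x i = max 0 (e - dist x (y i))" for x i
 define f where "f t i = (if i < n then m (S (s t)) i / (\<Sum>j<n. m (S (s t)) j) else 0)" for t i
 have sC: "s t \<in> C" if "t \<in> K" for t
 proof -
  have t: "t i \<ge> 0" for i using that by (simp add: K_def)
  define M where "M = max 1 (\<Sum>i<n. t i)"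
  have M: "M \<ge> 1" "(\<Sum>i<n. t i) <= M" by (auto simp: M_def)
  have "(\<Sum>i\<in>{..<Suc n}. (if i < n then t i / M else 1 - (\<Sum>i<n. t i) / M) *\<^sub>R (if i < n then y i else 0)) \<in> C"
  proof (rule convex_sum[OF _ assms(1)])
   show "(\<Sum>i<Suc n. if i < n then t i / M else 1 - (\<Sum>i<n. t i) / M) = 1"
    by (simp add: sum_divide_distrib)
   show "0 <= (if i < n then t i / M else 1 - sum t {..<n} / M)" for i
    using t M by auto
   show "(if i < n then y i else 0) \<in> C" if "i \<in> {..<Suc n}" for i
    using y Y(2) assms(2,6) by auto
  qed auto
  then show ?thesis
   by (simp add: s_def M_def scaleR_right.sum divide_inverse mult.commute)
 qed
 have pos: "(\<Sum>j<n. m x j) > 0" if xZ: "x \<in> Z" for x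
 proof -
  obtain i where "i < n" "x \<in> ball (y i) e" using Y(3) xZ y by blast
  then have "0 < m x i" by (simp add: m_def dist_commute)
  then show ?thesis
   using \<open>i < n\<close> by (intro sum_pos2[of _ i]) (auto simp: m_def)
 qed
 have m0: "m x i \<ge> 0" for x i by (simp add: m_def)
 have SZ: "S (s t) \<in> Z" if "t \<in> K" for t using sC[OF that] assms(4) by blast
 have conts: "continuous_on K s"
  unfolding s_def by (intro continuous_intros continuous_on_subset[OF continuous_on_product_coordinates]) auto
 have contm: "continuous_on K (%t. m (S (s t)) i)" for i
  unfolding m_def using sC
  by (intro continuous_intros continuous_on_compose2[OF assms(3) conts]) auto
 have "continuous_on K f"
 proof (intro continuous_on_coordinatewise_then_product)
  fix i show "continuous_on K (%t. f t i)"
   unfolding f_def using pos[OF SZ] by (cases "i < n") (auto intro!: continuous_intros contm less_imp_neq[THEN not_sym])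
 qed
 moreover have "f ` K \<subseteq> K"
 proof -
  have "0 <= f t i \<and> f t i <= 1" if "t \<in> K" for t i
   using pos[OF SZ[OF that]] m0 member_le_sum[of i "{..<n}" "m (S (s t))"]
   by (auto simp: f_def)
  then show ?thesis by (auto simp: K_def)
 qed
 ultimately obtain t where t: "t \<in> K" "\<forall>i<n. f t i = t i"
  using cube_fixed_point[of f n] unfolding K_def by blast
 define x where "x = S (s t)"
 have xZ: "x \<in> Z" using SZ[OF t(1)] by (simp add: x_def)
 define D where "D = (\<Sum>j<n. m x j)"
 have D: "D > 0" using pos[OF xZ] by (simp add: D_def)
 have ti: "t i = m x i / D" if "i < n" for i
  using t(2) that by (auto simp: f_def x_def D_def)
 have sum1: "(\<Sum>i<n. t i) = 1"
  using D by (simp add: ti sum_divide_distrib[symmetric] D_def)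
 have "s t - x = (\<Sum>i<n. t i *\<^sub>R (y i - x))"
  using sum1 by (simp add: s_def scaleR_right_diff_distrib sum_subtractf scaleR_left.sum[symmetric])
 also have "norm ... <= (\<Sum>i<n. t i * e)"
 proof (intro sum_norm_le)
  fix i assume "i \<in> {..<n}"
  then have i: "i < n" by simp
  have "norm (t i *\<^sub>R (y i - x)) = t i * dist x (y i)"
   using m0[of x i] D by (simp add: ti[OF i] dist_norm norm_minus_commute)
  also have "... <= t i * e"
   using D by (cases "dist x (y i) <= e") (auto simp: ti[OF i] m_def intro!: mult_left_mono divide_right_mono)
  finally show "norm (t i *\<^sub>R (y i - x)) <= t i * e" .
 qed
 also have "... = e" using sum1 by (simp add: sum_distrib_right[symmetric])
 finally show ?thesis
  using sC[OF t(1)] by (auto simp: dist_norm x_def intro!: bexI[of _ "s t"])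
qed

lemma schauder_fixed_point:
 fixes S :: "'a::real_normed_vector => 'a"
 assumes "convex C" "0 \<in> C" "continuous_on C S" "S ` C \<subseteq> Z" "compact Z" "Z \<subseteq> C"
 shows "\<exists>u\<in>C. S u = u"
proof -
 have "\<exists>u\<in>C. dist u (S u) <= 1 / real (Suc k)" for k
  by (rule schauder_approximate[OF assms]) simp
 then obtain u where u: "!!k. u k \<in> C" "!!k. dist (u k) (S (u k)) <= 1 / real (Suc k)" by metis
 have "seq_compact Z" using assms(5) by (rule compact_imp_seq_compact)
 moreover have "\<forall>k. S (u k) \<in> Z" using u(1) assms(4) by blast
 ultimately obtain a r where a: "a \<in> Z" "strict_mono r" "((%k. S (u k)) \<circ> r) \<longlonglongrightarrow> a"
  unfolding seq_compact_def by metis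
 then have Sa: "(%k. S (u (r k))) \<longlonglongrightarrow> a" by (simp add: o_def)
 have "(%k. 1 / real (Suc (r k))) \<longlonglongrightarrow> 0"
  using LIMSEQ_subseq_LIMSEQ[OF lim_1_over_n[THEN LIMSEQ_Suc] a(2)] by (simp add: o_def)
 then have "(%k. u (r k) - S (u (r k))) \<longlonglongrightarrow> 0"
  by (rule Lim_null_comparison[rotated]) (use u(2) in \<open>auto simp: dist_norm\<close>)
 from tendsto_add[OF this Sa] have ua: "(%k. u (r k)) \<longlonglongrightarrow> a" by simp
 have "(%k. S (u (r k))) \<longlonglongrightarrow> S a"
  by (rule continuous_on_tendsto_compose[OF assms(3) ua]) (use a(1) assms(6) u(1) in auto)
 then have "S a = a" using Sa LIMSEQ_unique by blast
 then show ?thesis using a(1) assms(6) by blast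
qed

section \<open>Variational inequalities in Hilbert space\<close>

text \<open>A minimising sequence of the distance is Cauchy by the parallelogram law.\<close>

lemma projection_exists:
 fixes K :: "'a::{real_inner,complete_space} set"
 assumes "closed K" "convex K" "K ~= {}"
 shows "\<exists>p\<in>K. \<forall>v\<in>K. (x - p) \<bullet> (v - p) <= 0"
proof -
 define d where "d = infdist x K"
 have d: "d <= dist x v" if "v \<in> K" for v
  using infdist_le[OF that] by (simp add: d_def)
 have d0: "0 <= d" by (simp add: d_def infdist_nonneg)
 have "\<exists>v\<in>K. (dist x v)\<^sup>2 < d\<^sup>2 + 1 / real (Suc n)" for n
 proof -
  have "d < sqrt (d\<^sup>2 + 1 / real (Suc n))"
   by (rule real_less_rsqrt) simp
  then have "\<exists>v\<in>K. dist x v < sqrt (d\<^sup>2 + 1 / real (Suc n))"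
   using assms(3) by (simp add: d_def infdist_notempty cINF_less_iff)
  then obtain v where v: "v \<in> K" "dist x v < sqrt (d\<^sup>2 + 1 / real (Suc n))" by blast
  have "(dist x v)\<^sup>2 < (sqrt (d\<^sup>2 + 1 / real (Suc n)))\<^sup>2"
   by (rule power_strict_mono) (use v in auto)
  then show ?thesis using v(1) by auto
 qed
 then obtain v where v: "!!n. v n \<in> K" "!!n. (dist x (v n))\<^sup>2 < d\<^sup>2 + 1 / real (Suc n)"
  by metis
 have est: "(dist (v n) (v m))\<^sup>2 <= 2 / real (Suc n) + 2 / real (Suc m)" for n m
 proof -
  define w where "w = (1/2) *\<^sub>R v n + (1/2) *\<^sub>R v m"
  have "w \<in> K" unfolding w_def using assms(2) v(1) by (simp add: convexD)
  then have "d\<^sup>2 <= (norm (x - w))\<^sup>2"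
   using d d0 by (intro power_mono) (auto simp: dist_norm)
  moreover have "(dist (v n) (v m))\<^sup>2 = 2 * (norm (x - v n))\<^sup>2 + 2 * (norm (x - v m))\<^sup>2 - 4 * (norm (x - w))\<^sup>2"
   by (simp add: w_def dist_norm power2_norm_eq_inner inner_diff_left inner_diff_right inner_add_left
     inner_add_right inner_commute algebra_simps)
  ultimately show ?thesis using v(2)[of n] v(2)[of m] by (simp add: dist_norm)
 qed
 have "Cauchy v"
 proof (rule metric_CauchyI)
  fix e :: real assume e: "0 < e"
  obtain N :: nat where N: "4 / e\<^sup>2 < real N" using reals_Archimedean2 by blast
  have N': "4 / real (Suc k) < e\<^sup>2" if "k \<ge> N" for k
  proof -
   have "4 / e\<^sup>2 < real (Suc k)" using N that by linarith
   then show ?thesis using e by (simp add: field_simps)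
  qed
  have "dist (v m) (v n) < e" if "m \<ge> N" "n \<ge> N" for m n
  proof -
   have "(dist (v m) (v n))\<^sup>2 < e\<^sup>2"
    using est[of m n] N'[OF that(1)] N'[OF that(2)] by simp
   then show ?thesis using e by (simp add: power_less_imp_less_base)
  qed
  then show "\<exists>M. \<forall>m\<ge>M. \<forall>n\<ge>M. dist (v m) (v n) < e" by blast
 qed
 then obtain p where p: "v \<longlonglongrightarrow> p" using Cauchy_convergent convergent_def by blast
 have pK: "p \<in> K" using closed_sequentially[OF assms(1)] v(1) p by blast
 have "(%n. (dist x (v n))\<^sup>2) \<longlonglongrightarrow> (dist x p)\<^sup>2" by (intro tendsto_intros p)
 moreover have "(%n. d\<^sup>2 + 1 / real (Suc n)) \<longlonglongrightarrow> d\<^sup>2 + 0"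
  by (intro tendsto_intros lim_1_over_n[THEN LIMSEQ_Suc])
 ultimately have "(dist x p)\<^sup>2 <= d\<^sup>2"
  using LIMSEQ_le v(2) less_imp_le by (metis (no_types, lifting) add.right_neutral)
 then have dp: "dist x p <= d" using d0 by (rule power2_le_imp_le)
 have "(x - p) \<bullet> (u - p) <= 0" if u: "u \<in> K" for u
  by (rule any_closest_point_dot[OF assms(2,1) pK u]) (use dp d in force)
 then show ?thesis using pK by blast
qed

text \<open>The theorem of Lions and Stampacchia for bilinear forms that need not be symmetric. For small \<open>r\<close> the
map that sends \<open>u\<close> to the projection of \<open>u - r (T u - l)\<close> onto \<open>K\<close> is a contraction, because \<open>T\<close> is
coercive and bounded; its fixed point is the solution.\<close>

lemma variational_inequality_solvable:
 fixes K :: "'a::{real_inner,complete_space} set" and T :: "'a => 'a"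
 assumes K: "closed K" "convex K" "K ~= {}" and T: "bounded_linear T"
  and a: "0 < a" "!!u. a * (norm u)\<^sup>2 <= T u \<bullet> u"
 shows "\<exists>u\<in>K. \<forall>v\<in>K. (T u - l) \<bullet> (v - u) \<ge> 0"
proof -
 interpret T: bounded_linear T by (rule T)
 obtain M where M: "M > 0" "!!u. norm (T u) <= norm u * M" using T.pos_bounded by blast
 define P where "P x = (SOME p. p \<in> K \<and> (\<forall>v\<in>K. (x - p) \<bullet> (v - p) <= 0))" for x
 have P: "P x \<in> K" "!!v. v \<in> K ==> (x - P x) \<bullet> (v - P x) <= 0" for x
  using someI_ex[of "%p. p \<in> K \<and> (\<forall>v\<in>K. (x - p) \<bullet> (v - p) <= 0)"] projection_exists[OF K, of x]
  unfolding P_def by auto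
 have nonexp: "norm (P x - P y) <= norm (x - y)" for x y
 proof -
  have "(norm (P x - P y))\<^sup>2 <= (x - y) \<bullet> (P x - P y)"
   using P(2)[OF P(1), of x y] P(2)[OF P(1), of y x]
   by (simp add: power2_norm_eq_inner inner_diff_left inner_diff_right inner_commute)
  also have "... <= norm (x - y) * norm (P x - P y)" by (rule norm_cauchy_schwarz)
  finally show ?thesis by (cases "P x = P y") (auto simp: power2_eq_square)
 qed
 define \<rho> where "\<rho> = a / M\<^sup>2"
 have rho: "\<rho> > 0" using a M by (simp add: \<rho>_def)
 define q where "q = sqrt (max 0 (1 - a\<^sup>2 / M\<^sup>2))"
 have q: "0 <= q" "q < 1" using a M by (auto simp: q_def)
 define F where "F u = P (u - \<rho> *\<^sub>R (T u - l))" for u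
 have "dist (F u) (F w) <= q * dist u w" for u w
 proof -
  define z where "z = u - w"
  have "dist (F u) (F w) <= norm ((u - \<rho> *\<^sub>R (T u - l)) - (w - \<rho> *\<^sub>R (T w - l)))"
   unfolding F_def dist_norm by (rule nonexp)
  also have "... = norm (z - \<rho> *\<^sub>R T z)"
   by (simp add: z_def T.diff algebra_simps)
  also have "... <= q * norm z"
  proof (rule power2_le_imp_le)
   have "(norm (z - \<rho> *\<^sub>R T z))\<^sup>2 = (norm z)\<^sup>2 - 2 * \<rho> * (T z \<bullet> z) + \<rho>\<^sup>2 * (norm (T z))\<^sup>2"
    unfolding power2_norm_eq_inner
    by (simp add: inner_diff_left inner_diff_right inner_commute algebra_simps power2_eq_square)
   also have "... <= (norm z)\<^sup>2 - 2 * \<rho> * (a * (norm z)\<^sup>2) + \<rho>\<^sup>2 * (M\<^sup>2 * (norm z)\<^sup>2)"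
   proof -
    have "(norm (T z))\<^sup>2 <= M\<^sup>2 * (norm z)\<^sup>2"
     using power_mono[OF M(2), of z 2] by (simp add: power_mult_distrib mult.commute)
    then show ?thesis using a(2)[of z] rho by (intro add_mono diff_mono mult_left_mono) auto
   qed
   also have "... = (1 - a\<^sup>2 / M\<^sup>2) * (norm z)\<^sup>2"
    using M(1) by (simp add: \<rho>_def field_simps power2_eq_square)
   also have "... <= (q * norm z)\<^sup>2"
    by (simp add: q_def power_mult_distrib mult_right_mono)
   finally show "(norm (z - \<rho> *\<^sub>R T z))\<^sup>2 <= (q * norm z)\<^sup>2" .
  qed (use q in simp)
  finally show ?thesis by (simp add: z_def dist_norm)
 qed
 then obtain u where u: "F u = u" using banach_fix_type[OF q, of F] by blast
 have "u \<in> K" using P(1) u unfolding F_def by metis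
 moreover have "(T u - l) \<bullet> (v - u) \<ge> 0" if "v \<in> K" for v
 proof -
  have "(u - \<rho> *\<^sub>R (T u - l) - u) \<bullet> (v - u) <= 0"
   using P(2)[OF that, of "u - \<rho> *\<^sub>R (T u - l)"] u unfolding F_def by simp
  then show ?thesis using rho by (simp add: zero_le_mult_iff)
 qed
 ultimately show ?thesis by blast
qed

text \<open>The representing vector is a multiple of the element of least norm in the hyperplane \<open>F = 1\<close>.\<close>

lemma riesz_representation:
 fixes V :: "'a::{real_inner,complete_space} set" and F :: "'a => real"
 assumes V: "closed V" "subspace V"
  and lin: "!!x y a b. x \<in> V ==> y \<in> V ==> F (a *\<^sub>R x + b *\<^sub>R y) = a * F x + b * F y"
  and bd: "!!x. x \<in> V ==> \<bar>F x\<bar> <= C * norm x"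
 shows "\<exists>z\<in>V. \<forall>x\<in>V. F x = z \<bullet> x"
proof (cases "\<forall>x\<in>V. F x = 0")
 case True
 then show ?thesis using subspace_0[OF V(2)] by (intro bexI[of _ 0]) auto
next
 case False
 then obtain e where e: "e \<in> V" "F e ~= 0" by blast
 define K where "K = {x \<in> V. F x = 1}"
 have Fs: "F (a *\<^sub>R x) = a * F x" if "x \<in> V" for a x
  using lin[OF that that, of a 0] by simp
 have Fa: "F (x + y) = F x + F y" "F (x - y) = F x - F y" if "x \<in> V" "y \<in> V" for x y
  using lin[OF that, of 1 1] lin[OF that, of 1 "-1"] by simp_all
 have "K ~= {}"
  using e Fs[OF e(1), of "1 / F e"] subspace_scale[OF V(2) e(1), of "1 / F e"] by (auto simp: K_def)
 moreover have "convex K"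
  unfolding K_def convex_def using lin V(2) by (auto simp: subspace_add subspace_scale)
 moreover have "closed K"
 proof (subst closed_sequential_limits, intro allI impI, elim conjE)
  fix x l assume x: "\<forall>n. x n \<in> K" "x \<longlonglongrightarrow> l"
  have l: "l \<in> V" using closed_sequentially[OF V(1)] x by (auto simp: K_def)
  have "\<bar>F l - 1\<bar> <= \<bar>C\<bar> * norm (l - x n)" for n
  proof -
   have xn: "x n \<in> V" "F (x n) = 1" using x(1) by (auto simp: K_def)
   have "\<bar>F (l - x n)\<bar> <= C * norm (l - x n)" by (rule bd) (use V(2) l xn in \<open>auto simp: subspace_diff\<close>)
   also have "... <= \<bar>C\<bar> * norm (l - x n)" by (simp add: mult_right_mono)
   finally show ?thesis using Fa(2)[OF l xn(1)] xn(2) by simp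
  qed
  moreover have "(%n. \<bar>C\<bar> * norm (l - x n)) \<longlonglongrightarrow> \<bar>C\<bar> * norm (l - l)" by (intro tendsto_intros x)
  ultimately have "\<bar>F l - 1\<bar> <= 0" by (intro LIMSEQ_le_const[of "%n. \<bar>C\<bar> * norm (l - x n)"]) auto
  then show "l \<in> K" using l by (simp add: K_def)
 qed
 ultimately obtain p where p: "p \<in> K" "!!v. v \<in> K ==> (0 - p) \<bullet> (v - p) <= 0"
  using projection_exists[of K 0] by blast
 have pV: "p \<in> V" "F p = 1" using p(1) by (auto simp: K_def)
 have orth: "p \<bullet> w = 0" if w: "w \<in> V" "F w = 0" for w
 proof -
  have "p + w \<in> K" "p - w \<in> K"
   using w pV Fa V(2) by (auto simp: K_def subspace_add subspace_diff)
  from p(2)[OF this(1)] p(2)[OF this(2)] show ?thesis by (simp add: inner_diff_right)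
 qed
 have p0: "p \<bullet> p ~= 0"
 proof
  assume "p \<bullet> p = 0"
  then have "p = 0" by simp
  then show False using Fs[OF pV(1), of 0] pV(2) by simp
 qed
 show ?thesis
 proof (intro bexI ballI)
  show "p /\<^sub>R (p \<bullet> p) \<in> V" using V(2) pV by (simp add: subspace_scale)
  fix x assume x: "x \<in> V"
  have "p \<bullet> (x - F x *\<^sub>R p) = 0"
   using x pV V(2) by (intro orth) (auto simp: subspace_diff subspace_scale Fa Fs)
  then show "F x = (p /\<^sub>R (p \<bullet> p)) \<bullet> x" using p0 by (simp add: inner_diff_right field_simps)
 qed
qed

lemma subspace_closure:
 fixes S :: "'a::real_normed_vector set"
 assumes "subspace S"
 shows "subspace (closure S)"
 unfolding subspace_def
proof (intro conjI ballI allI)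
 show "0 \<in> closure S" using subspace_0[OF assms] closure_subset by blast
 fix x y c assume x: "x \<in> closure S" and y: "y \<in> closure S"
 obtain f where f: "!!n. f n \<in> S" "f \<longlonglongrightarrow> x" using x unfolding closure_sequential by blast
 obtain g where g: "!!n. g n \<in> S" "g \<longlonglongrightarrow> y" using y unfolding closure_sequential by blast
 show "x + y \<in> closure S" unfolding closure_sequential
  using f g assms by (intro exI[of _ "%n. f n + g n"]) (auto simp: subspace_add intro!: tendsto_intros)
 show "c *\<^sub>R x \<in> closure S" unfolding closure_sequential
  using f assms by (intro exI[of _ "%n. c *\<^sub>R f n"]) (auto simp: subspace_scale intro!: tendsto_intros)
qed

definition weakly_tendsto :: "(nat => 'a::real_inner) => 'a => bool" where
 "weakly_tendsto x l \<longleftrightarrow> (\<forall>y. (%n. x n \<bullet> y) \<longlonglongrightarrow> l \<bullet> y)"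

text \<open>A diagonal sequence makes the inner products with all members of the sequence converge, hence those
with the closed subspace that they span; its orthogonal complement does not see the sequence. The
weak limit comes from the Riesz representation of the limit functional.\<close>

lemma bounded_has_weak_subsequence:
 fixes x :: "nat => 'a::{real_inner,complete_space}"
 assumes V: "closed V" "subspace V" and xV: "!!n. x n \<in> V" and bd: "!!n. norm (x n) <= R"
 shows "\<exists>r l. strict_mono r \<and> l \<in> V \<and> weakly_tendsto (x \<circ> r) l"
proof -
 define conv where "conv k s \<longleftrightarrow> convergent (%n. x (s n) \<bullet> x k)" for k and s :: "nat => nat"
 have R: "R \<ge> 0" using bd[of 0] norm_ge_zero order_trans by blast
 interpret subseqs conv
 proof
  fix k s assume "strict_mono (s :: nat => nat)"
  have "\<bar>x (s n) \<bullet> x k\<bar> <= R * R" for n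
   using Cauchy_Schwarz_ineq2[of "x (s n)" "x k"] bd[of "s n"] bd[of k] R
   by (meson mult_mono norm_ge_zero order_trans)
  then have "bounded (range (%n. x (s n) \<bullet> x k))" by (auto simp: bounded_iff intro!: exI[of _ "R * R"])
  then obtain l r where "strict_mono r" "((%n. x (s n) \<bullet> x k) \<circ> r) \<longlonglongrightarrow> l"
   using bounded_imp_convergent_subsequence by blast
  then show "\<exists>r'. strict_mono r' \<and> conv k (s \<circ> r')"
   by (auto simp: conv_def o_def convergent_def)
 qed
 define r where "r = diagseq"
 have r: "strict_mono r" by (simp add: r_def subseq_diagseq)
 have "conv k (r \<circ> (+) (Suc k))" for k
  unfolding r_def by (rule diagseq_holds) (auto simp: conv_def o_def intro: convergent_subseq_convergent[unfolded o_def])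
 then have "convergent (%n. x (r (n + Suc k)) \<bullet> x k)" for k
  by (simp add: conv_def o_def add.commute[of _ k])
 then have conv0: "convergent (%n. x (r n) \<bullet> x k)" for k
  using convergent_ignore_initial_segment[of "%n. x (r n) \<bullet> x k" "Suc k"] by simp
 define W where "W = closure (span (range x))"
 have W: "closed W" "subspace W"
  using closed_closure subspace_closure[OF subspace_span] by (auto simp: W_def)
 have WV: "W \<subseteq> V" unfolding W_def using V xV by (intro closure_minimal span_minimal) auto
 have xW: "x n \<in> W" for n unfolding W_def by (intro subsetD[OF closure_subset] span_base) simp
 define S where "S = {y. convergent (%n. x (r n) \<bullet> y)}"
 have subS: "subspace S"
  unfolding S_def subspace_def
  by (auto simp: inner_add_right intro: convergent_add convergent_const convergent_mult)
 have "closed S"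
 proof (subst closed_sequential_limits, intro allI impI, elim conjE)
  fix y l assume y: "\<forall>n. y n \<in> S" "y \<longlonglongrightarrow> l"
  have "Cauchy (%n. x (r n) \<bullet> l)"
  proof (rule metric_CauchyI)
   fix e :: real assume e: "0 < e"
   have "e / (3 * (R + 1)) > 0" using e R by simp
   then obtain k where k: "dist (y k) l < e / (3 * (R + 1))"
    using y(2) unfolding lim_sequentially by blast
   have close: "\<bar>x n \<bullet> l - x n \<bullet> y k\<bar> < e / 3" for n
   proof -
    have "\<bar>x n \<bullet> (l - y k)\<bar> <= norm (x n) * norm (l - y k)" by (rule Cauchy_Schwarz_ineq2)
    also have "... <= (R + 1) * norm (l - y k)" using bd[of n] by (intro mult_right_mono) auto
    also have "... < (R + 1) * (e / (3 * (R + 1)))"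
     using k R by (intro mult_strict_left_mono) (auto simp: dist_norm norm_minus_commute)
    also have "... = e / 3" using R by (simp add: field_simps)
    finally show ?thesis by (simp add: inner_diff_right)
   qed
   have "Cauchy (%n. x (r n) \<bullet> y k)" using y(1) by (simp add: S_def convergent_eq_Cauchy Cauchy_convergent_iff)
   then obtain M where M: "!!m n. m \<ge> M ==> n \<ge> M ==> dist (x (r m) \<bullet> y k) (x (r n) \<bullet> y k) < e / 3"
    using e by (metis metric_CauchyD zero_less_divide_iff zero_less_numeral)
   have "dist (x (r m) \<bullet> l) (x (r n) \<bullet> l) < e" if "m \<ge> M" "n \<ge> M" for m n
    using M[OF that] close[of "r m"] close[of "r n"] unfolding dist_real_def by linarith
   then show "\<exists>M. \<forall>m\<ge>M. \<forall>n\<ge>M. dist (x (r m) \<bullet> l) (x (r n) \<bullet> l) < e" by blast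
  qed
  then show "l \<in> S" by (simp add: S_def Cauchy_convergent_iff)
 qed
 then have WS: "W \<subseteq> S"
  unfolding W_def using subS conv0 by (intro closure_minimal span_minimal) (auto simp: S_def)
 define F where "F y = lim (%n. x (r n) \<bullet> y)" for y
 have limF: "(%n. x (r n) \<bullet> y) \<longlonglongrightarrow> F y" if "y \<in> W" for y
  using WS that by (auto simp: S_def F_def convergent_LIMSEQ_iff)
 have "\<exists>z\<in>W. \<forall>y\<in>W. F y = z \<bullet> y"
 proof (rule riesz_representation[OF W, where C = R])
  fix y z a b assume yz: "y \<in> W" "z \<in> W"
  have "(%n. x (r n) \<bullet> (a *\<^sub>R y + b *\<^sub>R z)) \<longlonglongrightarrow> a * F y + b * F z"
   unfolding inner_add_right inner_scaleR_right by (intro tendsto_intros limF yz)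
  moreover have "a *\<^sub>R y + b *\<^sub>R z \<in> W" using W(2) yz by (simp add: subspace_add subspace_scale)
  ultimately show "F (a *\<^sub>R y + b *\<^sub>R z) = a * F y + b * F z" using limF LIMSEQ_unique by blast
 next
  fix y assume y: "y \<in> W"
  have "\<bar>x (r n) \<bullet> y\<bar> <= R * norm y" for n
   using Cauchy_Schwarz_ineq2[of "x (r n)" y] bd[of "r n"] by (meson mult_right_mono norm_ge_zero order_trans)
  then show "\<bar>F y\<bar> <= R * norm y"
   by (intro LIMSEQ_le_const2[OF tendsto_rabs[OF limF[OF y]]]) auto
 qed
 then obtain l where l: "l \<in> W" "!!y. y \<in> W ==> F y = l \<bullet> y" by blast
 have "(%n. x (r n) \<bullet> y) \<longlonglongrightarrow> l \<bullet> y" for y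
 proof -
  obtain p where p: "p \<in> W" "!!v. v \<in> W ==> (y - p) \<bullet> (v - p) <= 0"
   using projection_exists[OF W(1) subspace_imp_convex[OF W(2)], of y] l(1) by blast
  have orth: "(y - p) \<bullet> v = 0" if v: "v \<in> W" for v
  proof -
   have "p + v \<in> W" "p - v \<in> W" using W(2) v p by (auto simp: subspace_add subspace_diff)
   from p(2)[OF this(1)] p(2)[OF this(2)] show ?thesis by simp
  qed
  have eq: "v \<bullet> y = v \<bullet> p" if "v \<in> W" for v
   using orth[OF that] by (simp add: inner_diff_left inner_diff_right inner_commute)
  show ?thesis using limF[OF p(1)] l(2)[OF p(1)] eq[OF xW] eq[OF l(1)] by simp
 qed
 then show ?thesis using r l(1) WV unfolding weakly_tendsto_def o_def by blast
qed

section \<open>Quasi-variational inequalities in Hilbert space\<close>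

text \<open>The assumption on \<open>K\<close> is what uniform convergence of positive thresholds amounts to: up to factors
that tend to \<open>1\<close>, the constraint sets of a weakly convergent sequence and of its limit are contained
in each other.\<close>

lemma quasi_variational_inequality_solvable:
 fixes V :: "'a::{real_inner,complete_space} set" and T :: "'a => 'a" and K :: "'a => 'a set"
 assumes V: "closed V" "subspace V" and T: "bounded_linear T"
  and a: "0 < a" "!!u. a * (norm u)\<^sup>2 <= T u \<bullet> u"
  and K: "!!u. u \<in> V ==> closed (K u)" "!!u. u \<in> V ==> convex (K u)"
   "!!u. u \<in> V ==> K u \<subseteq> V" "!!u. u \<in> V ==> 0 \<in> K u"
  and K_weak: "!!us u. (!!n. us n \<in> V) ==> u \<in> V ==> weakly_tendsto us u ==>
   \<exists>c. (\<forall>n. 0 <= c n \<and> c n <= (1::real)) \<and> c \<longlonglongrightarrow> 1 \<and>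
     (\<forall>n. \<forall>w\<in>K u. c n *\<^sub>R w \<in> K (us n)) \<and> (\<forall>n. \<forall>w\<in>K (us n). c n *\<^sub>R w \<in> K u)"
 shows "\<exists>u\<in>V. u \<in> K u \<and> (\<forall>v\<in>K u. (T u - l) \<bullet> (v - u) \<ge> 0)"
proof -
 interpret T: bounded_linear T by (rule T)
 obtain M where M: "M > 0" "!!u. norm (T u) <= norm u * M" using T.pos_bounded by blast
 define S where "S u = (SOME w. w \<in> K u \<and> (\<forall>v\<in>K u. (T w - l) \<bullet> (v - w) \<ge> 0))" for u
 have S: "S u \<in> K u \<and> (\<forall>v\<in>K u. (T (S u) - l) \<bullet> (v - S u) \<ge> 0)" if "u \<in> V" for u
  unfolding S_def
 proof (rule someI_ex)
  have "K u ~= {}" using K(4)[OF that] by blast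
  from variational_inequality_solvable[OF K(1)[OF that] K(2)[OF that] this T a, of l]
  show "\<exists>w. w \<in> K u \<and> (\<forall>v\<in>K u. 0 <= (T w - l) \<bullet> (v - w))" by blast
 qed
 define R where "R = norm l / a"
 have SV: "S u \<in> V" if "u \<in> V" for u using S K(3) that by blast
 have R0: "R \<ge> 0" using a by (simp add: R_def)
 have SR: "norm (S u) <= R" if "u \<in> V" for u
 proof -
  have "(T (S u) - l) \<bullet> (0 - S u) \<ge> 0" using S[OF that] K(4)[OF that] by blast
  then have "T (S u) \<bullet> S u <= l \<bullet> S u" by (simp add: inner_diff_left)
  then have "a * (norm (S u))\<^sup>2 <= norm l * norm (S u)"
   using a(2)[of "S u"] norm_cauchy_schwarz[of l "S u"] by linarith
  then have "a * norm (S u) <= norm l"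
   by (cases "S u = 0") (auto simp: power2_eq_square mult.assoc[symmetric])
  then show ?thesis using a(1) by (simp add: R_def field_simps)
 qed
 have stable: "(%n. S (us n)) \<longlonglongrightarrow> S u" if us: "!!n. us n \<in> V" "u \<in> V" "weakly_tendsto us u" for us u
 proof -
  obtain c where c: "!!n. 0 <= c n" "!!n. c n <= (1::real)" "c \<longlonglongrightarrow> 1"
   "!!n w. w \<in> K u ==> c n *\<^sub>R w \<in> K (us n)" "!!n w. w \<in> K (us n) ==> c n *\<^sub>R w \<in> K u"
   using K_weak[OF us] by blast
  define C where "C = 2 * norm l * R + 2 * R * (R * M)"
  (* The rescaled solutions are admissible competitors in each other's inequalities. *)
  have est: "(norm (S (us n) - S u))\<^sup>2 <= (1 - c n) * (C / a)" for n
  proof -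
   define w where "w = S u"
   define v where "v = S (us n)"
   have w: "w \<in> K u" "norm w <= R" and v: "v \<in> K (us n)" "norm v <= R"
    using S SR us by (auto simp: w_def v_def)
   have 1: "(T w - l) \<bullet> (c n *\<^sub>R v - w) \<ge> 0" using S[OF us(2)] c(5)[OF v(1)] by (auto simp: w_def)
   have 2: "(T v - l) \<bullet> (c n *\<^sub>R w - v) \<ge> 0" using S[OF us(1)] c(4)[OF w(1)] by (auto simp: v_def)
   have "a * (norm (v - w))\<^sup>2 <= T (v - w) \<bullet> (v - w)" by (rule a(2))
   also have "... <= (1 - c n) * (l \<bullet> w + l \<bullet> v - T w \<bullet> v - T v \<bullet> w)"
    using 1 2 by (simp add: T.diff inner_diff_left inner_diff_right algebra_simps)
   also have "... <= (1 - c n) * C"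
   proof (rule mult_left_mono)
    have b: "\<bar>l \<bullet> x\<bar> <= norm l * R" if "norm x <= R" for x
     using Cauchy_Schwarz_ineq2[of l x] that by (meson mult_left_mono norm_ge_zero order_trans)
    have t: "\<bar>T x \<bullet> y\<bar> <= (R * M) * R" if "norm x <= R" "norm y <= R" for x y
    proof -
     have "norm (T x) <= R * M" using M that(1) by (meson mult_right_mono less_imp_le order_trans)
     then have "norm (T x) * norm y <= (R * M) * R" using that R0 M(1) by (intro mult_mono) auto
     then show ?thesis using Cauchy_Schwarz_ineq2[of "T x" y] by linarith
    qed
    show "l \<bullet> w + l \<bullet> v - T w \<bullet> v - T v \<bullet> w <= C"
     using b[OF w(2)] b[OF v(2)] t[OF w(2) v(2)] t[OF v(2) w(2)] unfolding C_def
     by (simp add: algebra_simps)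
   qed (use c in simp)
   finally show ?thesis using a(1) by (simp add: w_def v_def field_simps)
  qed
  have "(%n. (1 - c n) * (C / a)) \<longlonglongrightarrow> (1 - 1) * (C / a)"
   by (intro tendsto_mult tendsto_diff tendsto_const c(3))
  then have lim0: "(%n. (1 - c n) * (C / a)) \<longlonglongrightarrow> 0" by simp
  have "(%n. (norm (S (us n) - S u))\<^sup>2) \<longlonglongrightarrow> 0"
   by (rule Lim_null_comparison[OF always_eventually lim0]) (use est in simp)
  then have "(%n. norm (S (us n) - S u)) \<longlonglongrightarrow> 0"
   using tendsto_real_sqrt[of "%n. (norm (S (us n) - S u))\<^sup>2" 0] by simp
  then show ?thesis using Lim_null tendsto_norm_zero_iff by blast
 qed
 define C where "C = V \<inter> cball 0 R"
 have C: "closed C" "convex C" "0 \<in> C" "C \<subseteq> V"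
  using V R0 by (auto simp: C_def subspace_0 subspace_imp_convex intro: closed_Int convex_Int)
 define Z where "Z = closure (S ` C)"
 have SC: "S ` C \<subseteq> C" using SV SR by (auto simp: C_def)
 have ZC: "Z \<subseteq> C" unfolding Z_def by (rule closure_minimal[OF SC C(1)])
 have subseq: "\<exists>r w. strict_mono r \<and> (%n. S (us (r n))) \<longlonglongrightarrow> w" if "!!n. us n \<in> C" for us :: "nat => 'a"
 proof -
  have us: "us n \<in> V" "norm (us n) <= R" for n using that[of n] by (auto simp: C_def)
  obtain r u where r: "strict_mono r" "u \<in> V" "weakly_tendsto (us \<circ> r) u"
   using bounded_has_weak_subsequence[of V us R] V us by blast
  have "(%n. S ((us \<circ> r) n)) \<longlonglongrightarrow> S u" by (rule stable) (use r us in \<open>auto simp: o_def\<close>)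
  then show ?thesis using r(1) by auto
 qed
 have "seq_compact Z"
  unfolding seq_compact_def
 proof (intro allI impI)
  fix z :: "nat => 'a" assume z: "\<forall>n. z n \<in> Z"
  have "\<exists>u\<in>C. dist (S u) (z n) < 1 / real (Suc n)" for n
   using z unfolding Z_def closure_approachable by (metis (no_types, lifting) image_iff of_nat_0_less_iff zero_less_Suc zero_less_divide_1_iff)
  then obtain us where us: "!!n. us n \<in> C" "!!n. dist (S (us n)) (z n) < 1 / real (Suc n)" by metis
  obtain r w where r: "strict_mono r" "(%n. S (us (r n))) \<longlonglongrightarrow> w" using subseq[of us] us(1) by blast
  have "(%k. 1 / real (Suc (r k))) \<longlonglongrightarrow> 0"
   using LIMSEQ_subseq_LIMSEQ[OF lim_1_over_n[THEN LIMSEQ_Suc] r(1)] by (simp add: o_def)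
  then have "(%n. z (r n) - S (us (r n))) \<longlonglongrightarrow> 0"
   by (rule Lim_null_comparison[rotated])
    (rule always_eventually, use us(2) in \<open>simp add: dist_norm norm_minus_commute less_imp_le\<close>)
  from tendsto_add[OF this r(2)] have zw: "(%n. z (r n)) \<longlonglongrightarrow> w" by simp
  have "w \<in> Z" by (rule closed_sequentially[OF _ _ zw]) (use z in \<open>auto simp: Z_def\<close>)
  then show "\<exists>l\<in>Z. \<exists>r. strict_mono r \<and> (z \<circ> r) \<longlonglongrightarrow> l"
   using zw r(1) by (auto simp: o_def)
 qed
 then have Zc: "compact Z" by (simp add: compact_eq_seq_compact_metric)
 have "continuous_on C S"
  unfolding continuous_on_sequentially
 proof (intro allI ballI impI)
  fix us u assume "u \<in> C" "(\<forall>n. us n \<in> C) \<and> us \<longlonglongrightarrow> u"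
  then show "(S \<circ> us) \<longlonglongrightarrow> S u"
   unfolding o_def using C(4) by (intro stable) (auto simp: weakly_tendsto_def intro!: tendsto_intros)
 qed
 from schauder_fixed_point[OF C(2,3) this _ Zc ZC]
 obtain u where "u \<in> C" "S u = u" using closure_subset[of "S ` C"] unfolding Z_def by blast
 then show ?thesis using S[of u] C(4) by auto
qed

section \<open>The Hilbert space of square integrable vector fields\<close>

lemma nn_integral_le_of_AE_tendsto:
 fixes h :: "nat => 'a => ennreal"
 assumes "!!k. h k \<in> borel_measurable M" "AE x in M. (%k. h k x) \<longlonglongrightarrow> g x"
  and "\<forall>\<^sub>F k in sequentially. (\<integral>\<^sup>+x. h k x \<partial>M) <= c"
 shows "(\<integral>\<^sup>+x. g x \<partial>M) <= c"
proof -
 have "(\<integral>\<^sup>+x. g x \<partial>M) = (\<integral>\<^sup>+x. liminf (%k. h k x) \<partial>M)"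
  by (rule nn_integral_cong_AE) (use assms(2) in \<open>auto elim!: eventually_mono simp: lim_imp_Liminf\<close>)
 also have "... <= liminf (%k. \<integral>\<^sup>+x. h k x \<partial>M)"
  by (rule nn_integral_liminf) (rule assms)
 also have "... <= liminf (%k::nat. c)"
  by (rule Liminf_mono) (rule assms)
 also have "... = c" by (simp add: Liminf_const)
 finally show ?thesis .
qed

text \<open>Allows to work with real bounds for sequences of extended nonnegative numbers.\<close>

lemma tendsto_0_iff_eventually_le_ennreal:
 fixes f :: "nat => ennreal"
 shows "f \<longlonglongrightarrow> 0 \<longleftrightarrow> (\<forall>e>0. \<forall>\<^sub>F n in sequentially. f n <= ennreal e)"
proof
 assume f: "f \<longlonglongrightarrow> 0"
 show "\<forall>e>0. \<forall>\<^sub>F n in sequentially. f n <= ennreal e"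
 proof (intro allI impI)
  fix e :: real assume "0 < e"
  then have "\<forall>\<^sub>F n in sequentially. f n < ennreal e" by (intro order_tendstoD(2)[OF f]) simp
  then show "\<forall>\<^sub>F n in sequentially. f n <= ennreal e" by (rule eventually_mono) simp
 qed
next
 assume *: "\<forall>e>0. \<forall>\<^sub>F n in sequentially. f n <= ennreal e"
 show "f \<longlonglongrightarrow> 0"
 proof (rule order_tendstoI)
  fix a :: ennreal assume "0 < a"
  then obtain b where b: "0 < b" "b < a" using dense by blast
  define e where "e = enn2real b"
  have "b < \<infinity>" using b(2) order.strict_trans2[of b a \<infinity>] by simp
  then have e: "0 < e" "ennreal e < a" using b by (auto simp: e_def enn2real_positive_iff less_top)
  show "\<forall>\<^sub>F n in sequentially. f n < a"
   using *[rule_format, OF e(1)] by (rule eventually_mono) (use e in auto)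
 qed simp
qed

text \<open>Completeness of the space of square integrable functions in terms of functions. The subsequence that
converges almost everywhere is part of the conclusion, because it is needed for Fatou arguments with
other functionals than the norm.\<close>

lemma square_integral_Cauchy_limit:
 fixes f :: "nat => 'a => 'b::{banach,second_countable_topology}"
 assumes meas: "!!n. f n \<in> borel_measurable M"
  and Cauchy: "!!e. 0 < e ==> \<exists>N. \<forall>m\<ge>N. \<forall>n\<ge>N. (\<integral>\<^sup>+x. ennreal ((norm (f m x - f n x))\<^sup>2) \<partial>M) <= ennreal e"
 obtains g r where "g \<in> borel_measurable M" "strict_mono r"
  "AE x in M. (%k. f (r k) x) \<longlonglongrightarrow> g x"
  "(%n. \<integral>\<^sup>+x. ennreal ((norm (f n x - g x))\<^sup>2) \<partial>M) \<longlonglongrightarrow> 0"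
proof -
 have [measurable]: "f n \<in> borel_measurable M" for n by (rule meas)
 have "\<exists>N. \<forall>m\<ge>N. \<forall>n\<ge>N. (\<integral>\<^sup>+x. ennreal ((norm (f m x - f n x))\<^sup>2) \<partial>M) <= ennreal ((1/4)^k)" for k
  by (rule Cauchy) simp
 then obtain N where N: "!!k m n. m \<ge> N k ==> n \<ge> N k ==>
   (\<integral>\<^sup>+x. ennreal ((norm (f m x - f n x))\<^sup>2) \<partial>M) <= ennreal ((1/4)^k)" by metis
 define r where "r k = k + (\<Sum>i\<le>k. N i)" for k
 have rN: "r k \<ge> N k" for k
 proof -
  have "N k <= (\<Sum>i\<le>k. N i)" by (rule member_le_sum) auto
  then show ?thesis by (simp add: r_def)
 qed
 have r: "strict_mono r" by (rule strict_monoI_Suc) (simp add: r_def)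
 define D where "D k x = norm (f (r (Suc k)) x - f (r k) x)" for k x
 have [measurable]: "D k \<in> borel_measurable M" for k unfolding D_def by measurable
 have "(\<integral>\<^sup>+x. (\<Sum>k. ennreal (2^k * (D k x)\<^sup>2)) \<partial>M) = (\<Sum>k. \<integral>\<^sup>+x. ennreal (2^k * (D k x)\<^sup>2) \<partial>M)"
  by (rule nn_integral_suminf) measurable
 also have "... <= (\<Sum>k. ennreal ((1/2)^k))"
 proof (rule suminf_le)
  fix k
  have "(\<integral>\<^sup>+x. ennreal (2^k * (D k x)\<^sup>2) \<partial>M) = ennreal (2^k) * (\<integral>\<^sup>+x. ennreal ((D k x)\<^sup>2) \<partial>M)"
   by (simp add: ennreal_mult nn_integral_cmult)
  also have "... <= ennreal (2^k) * ennreal ((1/4)^k)"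
   unfolding D_def using rN[of k] strict_mono_less_eq[OF r, of k "Suc k"]
   by (intro mult_left_mono N) auto
  also have "... = ennreal ((1/2)^k)"
   by (simp add: ennreal_mult[symmetric] power_mult_distrib[symmetric])
  finally show "(\<integral>\<^sup>+x. ennreal (2^k * (D k x)\<^sup>2) \<partial>M) <= ennreal ((1/2)^k)" .
 qed auto
 also have "... = ennreal (\<Sum>k. (1/2)^k)"
  by (rule suminf_ennreal2) (auto intro: summable_geometric)
 also have "... < \<infinity>" by simp
 finally have "AE x in M. (\<Sum>k. ennreal (2^k * (D k x)\<^sup>2)) ~= \<infinity>"
  by (intro nn_integral_noteq_infinite) (auto simp: less_top)
 then have ae: "AE x in M. convergent (%k. f (r k) x)"
 proof eventually_elim
  case (elim x)
  define B where "B = enn2real (\<Sum>k. ennreal (2^k * (D k x)\<^sup>2))"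
  have B: "ennreal B = (\<Sum>k. ennreal (2^k * (D k x)\<^sup>2))" "B \<ge> 0"
   using elim by (auto simp: B_def less_top)
  have "D k x <= sqrt B * (sqrt (1/2))^k" for k
  proof -
   have "ennreal (2^k * (D k x)\<^sup>2) <= ennreal B"
   proof -
    have "(\<Sum>i\<in>{k}. ennreal (2^i * (D i x)\<^sup>2)) <= (\<Sum>i. ennreal (2^i * (D i x)\<^sup>2))"
     by (rule sum_le_suminf) (auto intro: summableI)
    then show ?thesis by (simp only: B(1) sum.insert sum.empty finite.emptyI empty_iff simp_thms add_0_right)
   qed
   then have "2^k * (D k x)\<^sup>2 <= B" using B(2) by (simp only: ennreal_le_iff)
   then have "(D k x)\<^sup>2 <= B * (1/2)^k" by (simp add: field_simps)
   then have "D k x <= sqrt (B * (1/2)^k)" by (rule real_le_rsqrt)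
   then show ?thesis by (simp add: real_sqrt_mult real_sqrt_power)
  qed
  then have Dk: "norm (f (r (Suc k)) x - f (r k) x) <= sqrt B * (sqrt (1/2))^k" for k
   by (simp add: D_def)
  have "norm (sqrt (1/2) :: real) < 1" by simp
  then have "summable (%k. sqrt B * (sqrt (1/2))^k)" by (intro summable_mult summable_geometric)
  then have "summable (%k. f (r (Suc k)) x - f (r k) x)"
   by (rule summable_comparison_test') (rule Dk)
  then have "convergent (%n. \<Sum>k<n. f (r (Suc k)) x - f (r k) x)"
   by (simp add: summable_iff_convergent)
  then have "convergent (%n. f (r n) x - f (r 0) x)"
   by (simp add: sum_lessThan_telescope[of "%k. f (r k) x"])
  then have "convergent (%n. (f (r n) x - f (r 0) x) + f (r 0) x)"
   by (intro convergent_add convergent_const)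
  then show ?case by simp
 qed
 define g where "g x = lim (%k. f (r k) x)" for x
 have g[measurable]: "g \<in> borel_measurable M"
  unfolding g_def by (rule borel_measurable_lim_metric) measurable
 have lim: "AE x in M. (%k. f (r k) x) \<longlonglongrightarrow> g x"
  using ae by eventually_elim (simp add: g_def convergent_LIMSEQ_iff)
 have "(%n. \<integral>\<^sup>+x. ennreal ((norm (f n x - g x))\<^sup>2) \<partial>M) \<longlonglongrightarrow> 0"
  unfolding tendsto_0_iff_eventually_le_ennreal
 proof (intro allI impI)
  fix e :: real assume e: "0 < e"
  obtain N where N: "!!m n. m \<ge> N ==> n \<ge> N ==>
    (\<integral>\<^sup>+x. ennreal ((norm (f m x - f n x))\<^sup>2) \<partial>M) <= ennreal e"
   using Cauchy[OF e] by blast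
  have "(\<integral>\<^sup>+x. ennreal ((norm (f n x - g x))\<^sup>2) \<partial>M) <= ennreal e" if n: "n \<ge> N" for n
  proof (rule nn_integral_le_of_AE_tendsto[where h = "%k x. ennreal ((norm (f n x - f (r k) x))\<^sup>2)"])
   show "AE x in M. (%k. ennreal ((norm (f n x - f (r k) x))\<^sup>2)) \<longlonglongrightarrow> ennreal ((norm (f n x - g x))\<^sup>2)"
    using lim by eventually_elim (intro tendsto_ennrealI tendsto_intros)
   have "r k \<ge> N" if "k \<ge> N" for k using seq_suble[OF r, of k] that by linarith
   then show "\<forall>\<^sub>F k in sequentially. (\<integral>\<^sup>+x. ennreal ((norm (f n x - f (r k) x))\<^sup>2) \<partial>M) <= ennreal e"
    by (intro eventually_sequentiallyI[of N] N n) auto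
  qed measurable
  then show "\<forall>\<^sub>F n in sequentially. (\<integral>\<^sup>+x. ennreal ((norm (f n x - g x))\<^sup>2) \<partial>M) <= ennreal e"
   by (intro eventually_sequentiallyI[of N])
 qed
 then show ?thesis using that g r lim by blast
qed

text \<open>Fields themselves instead of classes, since the fractional gradient is a function.\<close>

definition L2 :: "(real^'n => real^'n) set" where
 "L2 = {f \<in> \<L>. integrable lebesgue (%x. (norm (f x))\<^sup>2)}"

lemma L2_iff_nn: "f \<in> L2 \<longleftrightarrow> f \<in> \<L> \<and> (NL x. ennreal ((norm (f x))\<^sup>2)) < \<infinity>"
 unfolding L2_def by (auto simp: integrable_iff_bounded)

lemma L2_measurable[measurable_dest]: "f \<in> L2 ==> f \<in> \<L>"
 by (simp add: L2_def)

lemma L2_0: "(%_. 0) \<in> L2" by (simp add: L2_def)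

lemma L2_add: assumes "f \<in> L2" "g \<in> L2" shows "(%x. f x + g x) \<in> L2"
proof -
 have [measurable]: "f \<in> \<L>" "g \<in> \<L>"
  using assms by (auto simp: L2_def)
 have "integrable lebesgue (%x. 2 * (norm (f x))\<^sup>2 + 2 * (norm (g x))\<^sup>2)"
  using assms by (auto simp: L2_def)
 then have "integrable lebesgue (%x. (norm (f x + g x))\<^sup>2)"
 proof (rule Bochner_Integration.integrable_bound)
  show "AE x in lebesgue. norm ((norm (f x + g x))\<^sup>2) <= norm (2 * (norm (f x))\<^sup>2 + 2 * (norm (g x))\<^sup>2)"
  proof (rule AE_I2)
   fix x
   have "(norm (f x + g x))\<^sup>2 + (norm (f x - g x))\<^sup>2 = 2 * (norm (f x))\<^sup>2 + 2 * (norm (g x))\<^sup>2"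
    unfolding power2_norm_eq_inner by (simp add: inner_add_left inner_add_right inner_diff_left inner_diff_right inner_commute)
   then show "norm ((norm (f x + g x))\<^sup>2) <= norm (2 * (norm (f x))\<^sup>2 + 2 * (norm (g x))\<^sup>2)"
    using zero_le_power2[of "norm (f x - g x)"] zero_le_power2[of "norm (f x + g x)"]
    unfolding real_norm_def by linarith
  qed
 qed measurable
 then show ?thesis by (simp add: L2_def)
qed

lemma L2_scaleR: "f \<in> L2 ==> (%x. c *\<^sub>R f x) \<in> L2"
 by (auto simp: L2_def power_mult_distrib)

lemma L2_minus: "f \<in> L2 ==> (%x. - f x) \<in> L2"
 by (auto simp: L2_def)

lemma L2_diff: "f \<in> L2 ==> g \<in> L2 ==> (%x. f x - g x) \<in> L2"
 using L2_add[OF _ L2_minus, of f g] by simp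

lemma L2_inner_integrable: assumes "f \<in> L2" "g \<in> L2" shows "integrable lebesgue (%x. f x \<bullet> g x)"
proof -
 have "integrable lebesgue (%x. ((norm (f x + g x))\<^sup>2 - (norm (f x))\<^sup>2 - (norm (g x))\<^sup>2) / 2)"
  using assms L2_add[OF assms] by (auto simp: L2_def)
 moreover have "((norm (f x + g x))\<^sup>2 - (norm (f x))\<^sup>2 - (norm (g x))\<^sup>2) / 2 = f x \<bullet> g x" for x
  by (simp add: dot_norm)
 ultimately show ?thesis by simp
qed

text \<open>Identification of fields that agree almost everywhere makes the square integrable fields a type of
classes \<open>real_inner\<close> and \<open>complete_space\<close>, to which the abstract theory applies.\<close>

quotient_type 'n L2_field = "real^'n => real^'n" / partial:
 "%f g. f \<in> L2 \<and> g \<in> L2 \<and> (AE x in lebesgue. f x = (g x :: real^'n))"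
proof (rule part_equivpI)
 show "\<exists>f. f \<in> L2 \<and> f \<in> L2 \<and> (AE x in lebesgue. f x = (f x :: real^'n))"
  using L2_0 by blast
qed (auto intro!: sympI transpI elim: eventually_elim2 eventually_mono)

instantiation L2_field :: (finite) real_inner
begin

lift_definition zero_L2_field :: "'a L2_field" is "%_. 0" by (simp add: L2_0)

lift_definition plus_L2_field :: "'a L2_field => 'a L2_field => 'a L2_field" is "%f g x. f x + g x"
 by (auto intro: L2_add elim: eventually_elim2)

lift_definition uminus_L2_field :: "'a L2_field => 'a L2_field" is "%f x. - f x"
 by (auto intro: L2_minus elim: eventually_mono)

lift_definition minus_L2_field :: "'a L2_field => 'a L2_field => 'a L2_field" is "%f g x. f x - g x"
 by (auto intro: L2_diff elim: eventually_elim2)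

lift_definition scaleR_L2_field :: "real => 'a L2_field => 'a L2_field" is "%c f x. c *\<^sub>R f x"
 by (auto intro: L2_scaleR elim: eventually_mono)

lift_definition inner_L2_field :: "'a L2_field => 'a L2_field => real" is
 "%f g. LINT x|lebesgue. f x \<bullet> g x"
 by (intro integral_cong_AE) (auto simp: L2_def elim: eventually_elim2)

definition norm_L2_field :: "'a L2_field => real" where "norm_L2_field U = sqrt (U \<bullet> U)"
definition sgn_L2_field :: "'a L2_field => 'a L2_field" where "sgn_L2_field U = inverse (norm U) *\<^sub>R U"
definition dist_L2_field :: "'a L2_field => 'a L2_field => real" where "dist_L2_field U W = norm (U - W)"
definition uniformity_L2_field :: "('a L2_field \<times> 'a L2_field) filter" where
 "uniformity_L2_field = (INF e\<in>{0 <..}. principal {(x, y). dist x y < e})"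
definition open_L2_field :: "'a L2_field set => bool" where
 "open_L2_field S \<longleftrightarrow> (\<forall>x\<in>S. \<forall>\<^sub>F (x', y) in uniformity. x' = x --> y \<in> S)"

instance
proof
 fix U W X :: "'a L2_field" and a b c :: real
 show "dist U W = norm (U - W)" by (simp add: dist_L2_field_def)
 show "U + W + X = U + (W + X)" by transfer (simp add: L2_add add.assoc)
 show "U + W = W + U" by transfer (simp add: L2_add add.commute)
 show "0 + U = U" by transfer simp
 show "- U + U = 0" by transfer (simp add: L2_0)
 show "U - W = U + - W" by transfer (simp add: L2_diff L2_add L2_minus)
 show "a *\<^sub>R (U + W) = a *\<^sub>R U + a *\<^sub>R W" by transfer (simp add: L2_add L2_scaleR scaleR_add_right)
 show "(a + b) *\<^sub>R U = a *\<^sub>R U + b *\<^sub>R U" by transfer (simp add: L2_add L2_scaleR scaleR_add_left)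
 show "a *\<^sub>R b *\<^sub>R U = (a * b) *\<^sub>R U" by transfer (simp add: L2_scaleR)
 show "1 *\<^sub>R U = U" by transfer simp
 show "sgn U = inverse (norm U) *\<^sub>R U" by (simp add: sgn_L2_field_def)
 show "uniformity = (INF e\<in>{0 <..}. principal {(x, y :: 'a L2_field). dist x y < e})"
  by (simp add: uniformity_L2_field_def)
 show "open S \<longleftrightarrow> (\<forall>x\<in>S. \<forall>\<^sub>F (x', y) in uniformity. x' = x --> y \<in> S)" for S :: "'a L2_field set"
  by (simp add: open_L2_field_def)
 show "U \<bullet> W = W \<bullet> U" by transfer (simp add: inner_commute)
 show "(U + W) \<bullet> X = U \<bullet> X + W \<bullet> X" by transfer (simp add: inner_add_left L2_inner_integrable)
 show "a *\<^sub>R U \<bullet> W = a * (U \<bullet> W)" by transfer simp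
 show "0 <= U \<bullet> U" by transfer (simp add: integral_nonneg_AE)
 show "U \<bullet> U = 0 \<longleftrightarrow> U = 0"
  by transfer (auto simp: L2_0 power2_norm_eq_inner[symmetric] integral_nonneg_eq_0_iff_AE L2_def)
 show "norm U = sqrt (U \<bullet> U)" by (simp add: norm_L2_field_def)
qed

end

abbreviation L2_class :: "(real^'n => real^'n) => 'n L2_field" where "L2_class \<equiv> abs_L2_field"
abbreviation L2_fun :: "'n L2_field => real^'n => real^'n" where "L2_fun \<equiv> rep_L2_field"

lemma L2_fun_in_L2: "L2_fun U \<in> L2"
 using Quotient3_rel_rep Quotient3_L2_field Quotient3_rep_reflp by fastforce

lemma L2_class_fun [simp]: "L2_class (L2_fun U) = U"
 by (rule Quotient3_abs_rep[OF Quotient3_L2_field])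

lemma L2_class_eq_iff: "f \<in> L2 ==> g \<in> L2 ==> L2_class f = L2_class g \<longleftrightarrow> (AE x in lebesgue. f x = g x)"
 using Quotient3_rel[OF Quotient3_L2_field, of f g] by simp

lemma L2_fun_class: "f \<in> L2 ==> AE x in lebesgue. L2_fun (L2_class f) x = f x"
 using L2_class_eq_iff[OF L2_fun_in_L2, of f "L2_class f"] by simp

lemma L2_class_add: "f \<in> L2 ==> g \<in> L2 ==> L2_class f + L2_class g = L2_class (%x. f x + g x)"
 by (simp add: plus_L2_field.abs_eq)

lemma L2_class_diff: "f \<in> L2 ==> g \<in> L2 ==> L2_class f - L2_class g = L2_class (%x. f x - g x)"
 by (simp add: minus_L2_field.abs_eq)

lemma L2_class_scaleR: "f \<in> L2 ==> c *\<^sub>R L2_class f = L2_class (%x. c *\<^sub>R f x)"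
 by (simp add: scaleR_L2_field.abs_eq)

lemma L2_class_inner: "f \<in> L2 ==> g \<in> L2 ==> L2_class f \<bullet> L2_class g = (LINT x|lebesgue. f x \<bullet> g x)"
 by (simp add: inner_L2_field.abs_eq)

lemma L2_class_norm: "f \<in> L2 ==> (norm (L2_class f))\<^sup>2 = (LINT x|lebesgue. (norm (f x))\<^sup>2)"
 by (simp add: power2_norm_eq_inner L2_class_inner)

lemma L2_class_norm_nn:
 "f \<in> L2 ==> ennreal ((norm (L2_class f))\<^sup>2) = (NL x. ennreal ((norm (f x))\<^sup>2))"
 by (subst nn_integral_eq_integral) (auto simp: L2_class_norm L2_def)

instance L2_field :: (finite) complete_space
proof
 fix X :: "nat => 'a L2_field" assume X: "Cauchy X"
 have nn: "ennreal ((dist U (L2_class g))\<^sup>2) = (NL x. ennreal ((norm (L2_fun U x - g x))\<^sup>2))" if "g \<in> L2" for U :: "'a L2_field" and g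
  using L2_class_norm_nn[OF L2_diff[OF L2_fun_in_L2 that, of U]] L2_class_diff[OF L2_fun_in_L2 that, of U]
  by (simp add: dist_norm)
 obtain g where g: "g \<in> \<L>"
  "(%n. NL x. ennreal ((norm (L2_fun (X n) x - g x))\<^sup>2)) \<longlonglongrightarrow> 0"
 proof (rule square_integral_Cauchy_limit[of "%n. L2_fun (X n)" lebesgue])
  show "L2_fun (X n) \<in> \<L>" for n by (intro L2_measurable L2_fun_in_L2)
  fix e :: real assume "0 < e"
  then obtain N where N: "!!m n. m \<ge> N ==> n \<ge> N ==> dist (X m) (X n) < sqrt e"
   using X unfolding Cauchy_def by (meson real_sqrt_gt_zero)
  have "(NL x. ennreal ((norm (L2_fun (X m) x - L2_fun (X n) x))\<^sup>2)) <= ennreal e" if "m \<ge> N" "n \<ge> N" for m n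
   using real_le_rsqrt N[OF that] nn[OF L2_fun_in_L2, of "X m" "X n"] \<open>0 < e\<close>
   by (metis L2_class_fun ennreal_leI less_imp_le power_mono real_sqrt_pow2 zero_le_dist)
  then show "\<exists>N. \<forall>m\<ge>N. \<forall>n\<ge>N. (NL x. ennreal ((norm (L2_fun (X m) x - L2_fun (X n) x))\<^sup>2)) <= ennreal e"
   by blast
 qed blast
 have "\<forall>\<^sub>F n in sequentially. (NL x. ennreal ((norm (L2_fun (X n) x - g x))\<^sup>2)) < \<infinity>"
  using order_tendstoD(2)[OF g(2), of \<infinity>] by simp
 then obtain n where n: "(NL x. ennreal ((norm (L2_fun (X n) x - g x))\<^sup>2)) < \<infinity>"
  using eventually_happens by force
 have "(%x. L2_fun (X n) x - g x) \<in> L2"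
  unfolding L2_iff_nn using n g(1) L2_measurable[OF L2_fun_in_L2, of "X n"] by simp
 from L2_diff[OF L2_fun_in_L2 this, of "X n"] have gs: "g \<in> L2" by simp
 have "(%n. ennreal ((dist (X n) (L2_class g))\<^sup>2)) \<longlonglongrightarrow> ennreal 0"
  unfolding nn[OF gs] using g(2) by simp
 then have "(%n. (dist (X n) (L2_class g))\<^sup>2) \<longlonglongrightarrow> 0"
  by (subst (asm) tendsto_ennreal_iff) auto
 then have "(%n. dist (X n) (L2_class g)) \<longlonglongrightarrow> 0"
  using tendsto_real_sqrt[of "%n. (dist (X n) (L2_class g))\<^sup>2" 0] by simp
 then show "convergent X" unfolding convergent_def using tendsto_dist_iff by blast
qed

section \<open>Integration by parts\<close>

lemma integrable_continuous_bounded_support: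
 fixes f :: "'a::euclidean_space => 'b::{banach,second_countable_topology}"
 assumes "continuous_on UNIV f" "bounded S" "!!x. x \<notin> S ==> f x = 0"
 shows "integrable lborel f"
proof -
 have "compact (closure S)" using assms(2) by (simp add: compact_closure)
 from borel_integrable_compact[OF this continuous_on_subset[OF assms(1)]]
 have "integrable lborel (%x. indicator (closure S) x *\<^sub>R f x)" by simp
 moreover have "indicator (closure S) x *\<^sub>R f x = f x" for x
  using assms(3)[of x] closure_subset[of S] by (auto simp: indicator_def)
 ultimately show ?thesis by simp
qed

lemma continuous_bounded_support_bounded:
 fixes f :: "'a::euclidean_space => real"
 assumes "continuous_on UNIV f" "bounded S" "!!x. x \<notin> S ==> f x = 0"
 obtains B where "0 <= B" "!!x. \<bar>f x\<bar> <= B"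
proof -
 have "compact (f ` closure S)"
  using assms by (intro compact_continuous_image continuous_on_subset[OF assms(1)]) (auto simp: compact_closure)
 then obtain B where B: "!!y. y \<in> f ` closure S ==> norm y <= B"
  using compact_imp_bounded bounded_iff by metis
 have "\<bar>f x\<bar> <= max 0 B" for x
  using assms(3)[of x] B[of "f x"] closure_subset[of S] by (cases "x \<in> S") auto
 then show thesis by (intro that[of "max 0 B"]) auto
qed

definition C1_fun :: "(real^'n => real) => bool" where
 "C1_fun \<phi> \<longleftrightarrow> (\<forall>x. \<phi> differentiable at x) \<and> (\<forall>j. continuous_on UNIV (partial_deriv j \<phi>))"

lemma C1_fun_continuous: "C1_fun \<phi> ==> continuous_on UNIV \<phi>"
 by (auto simp: C1_fun_def continuous_on_eq_continuous_at intro: differentiable_imp_continuous_within)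

lemma partial_deriv_eqI: "(\<phi> has_derivative D) (at x) ==> partial_deriv j \<phi> x = D (axis j 1)"
 unfolding partial_deriv_def using frechet_derivative_at by metis

lemma partial_deriv_line:
 assumes "\<phi> differentiable at (x + t *\<^sub>R axis j 1)"
 shows "((%t. \<phi> (x + t *\<^sub>R axis j 1)) has_real_derivative partial_deriv j \<phi> (x + t *\<^sub>R axis j 1)) (at t)"
proof -
 let ?e = "axis j 1 :: real^'a"
 have d: "(\<phi> has_derivative frechet_derivative \<phi> (at (x + t *\<^sub>R ?e))) (at (x + t *\<^sub>R ?e))"
  using assms frechet_derivative_works by blast
 have "((%t. x + t *\<^sub>R ?e) has_derivative (%s. s *\<^sub>R ?e)) (at t)"
  by (auto intro!: derivative_eq_intros)
 from diff_chain_at[OF this d]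
 have "((%t. \<phi> (x + t *\<^sub>R ?e)) has_derivative (%s. frechet_derivative \<phi> (at (x + t *\<^sub>R ?e)) (s *\<^sub>R ?e))) (at t)"
  by (simp add: o_def)
 moreover have "frechet_derivative \<phi> (at (x + t *\<^sub>R ?e)) (s *\<^sub>R ?e) = s * partial_deriv j \<phi> (x + t *\<^sub>R ?e)" for s
  using has_derivative_linear[OF d] by (simp add: linear_scale partial_deriv_def)
 ultimately show ?thesis
  by (simp add: has_field_derivative_def mult_commute_abs)
qed

lemma partial_deriv_zero:
 assumes "open U" "x \<in> U" "!!y. y \<in> U ==> \<phi> y = 0"
 shows "partial_deriv j \<phi> x = 0"
proof -
 have "(\<phi> has_derivative (%_. 0)) (at x)"
  by (rule has_derivative_transform_within_open[of "%_. 0" _ x UNIV U]) (use assms in auto)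
 then show ?thesis by (rule partial_deriv_eqI)
qed

text \<open>Translation invariance of the integral: the integrals of the difference quotients in direction \<open>j\<close>
vanish, and they converge to the integral of the derivative by dominated convergence.\<close>

lemma integral_partial_deriv_eq_0:
 fixes \<Phi> :: "real^'n => real"
 assumes "C1_fun \<Phi>" "bounded {x. \<Phi> x ~= 0}"
 shows "(LINT x|lborel. partial_deriv j \<Phi> x) = 0"
proof -
 let ?e = "axis j 1 :: real^'n"
 obtain R where R: "!!x. \<Phi> x ~= 0 ==> norm x <= R" using assms(2) by (auto simp: bounded_iff)
 have diff: "\<Phi> differentiable at x" for x using assms(1) by (simp add: C1_fun_def)
 have cont: "continuous_on UNIV \<Phi>" "continuous_on UNIV (partial_deriv j \<Phi>)"
  using assms(1) C1_fun_continuous by (auto simp: C1_fun_def)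
 have zero: "partial_deriv j \<Phi> x = 0" if "x \<notin> cball 0 R" for x
  by (rule partial_deriv_zero[of "- cball 0 R"]) (use that R in force)+
 obtain B where B: "0 <= B" "!!x. \<bar>partial_deriv j \<Phi> x\<bar> <= B"
  using continuous_bounded_support_bounded[OF cont(2) bounded_cball zero] by blast
 have int: "integrable lborel \<Phi>"
  by (rule integrable_continuous_bounded_support[OF cont(1) bounded_cball[of 0 R]]) (use R in force)
 have [measurable]: "\<Phi> \<in> \<B>" "partial_deriv j \<Phi> \<in> \<B>"
  using cont by (auto intro: borel_measurable_continuous_onI)
 define h where "h n = 1 / real (Suc n)" for n
 define F where "F n x = (\<Phi> (x + h n *\<^sub>R ?e) - \<Phi> x) / h n" for n x
 have [measurable]: "F n \<in> \<B>" for n unfolding F_def by measurable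
 have h: "0 < h n" "h n <= 1" for n by (auto simp: h_def)
 have hlim: "h \<longlonglongrightarrow> 0" unfolding h_def by (rule lim_1_over_n[THEN LIMSEQ_Suc])
 have "(%n. LINT x|lborel. F n x) \<longlonglongrightarrow> (LINT x|lborel. partial_deriv j \<Phi> x)"
 proof (rule integral_dominated_convergence[where w = "%x. B * indicator (cball 0 (R + 1)) x"])
  show "integrable lborel (%x. B * indicator (cball 0 (R + 1)) x :: real)"
   by (auto intro!: integrable_real_indicator emeasure_bounded_finite)
  show "AE x in lborel. (%n. F n x) \<longlonglongrightarrow> partial_deriv j \<Phi> x"
  proof (rule AE_I2)
   fix x
   have "((%t. \<Phi> (x + t *\<^sub>R ?e)) has_real_derivative partial_deriv j \<Phi> x) (at 0)"
    using partial_deriv_line[OF diff, where t = 0 and x = x and j = j] by simp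
   then have "((%s. (\<Phi> (x + s *\<^sub>R ?e) - \<Phi> x) / s) \<longlongrightarrow> partial_deriv j \<Phi> x) (at 0)"
    by (simp add: DERIV_def)
   moreover have "filterlim h (at 0) sequentially"
    using hlim h(1) by (auto simp: filterlim_at intro!: always_eventually less_imp_neq[THEN not_sym])
   ultimately show "(%n. F n x) \<longlonglongrightarrow> partial_deriv j \<Phi> x"
    unfolding F_def by (rule filterlim_compose)
  qed
  show "AE x in lborel. norm (F n x) <= B * indicator (cball 0 (R + 1)) x" for n
  proof (rule AE_I2)
   fix x
   obtain t where t: "0 < t" "t < h n" "\<Phi> (x + h n *\<^sub>R ?e) - \<Phi> (x + 0 *\<^sub>R ?e) = (h n - 0) * partial_deriv j \<Phi> (x + t *\<^sub>R ?e)"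
    using MVT2[OF h(1)[of n], of "%t. \<Phi> (x + t *\<^sub>R ?e)" "%t. partial_deriv j \<Phi> (x + t *\<^sub>R ?e)"]
     partial_deriv_line[OF diff] by blast
   have F: "F n x = partial_deriv j \<Phi> (x + t *\<^sub>R ?e)" using t(3) h(1)[of n] by (simp add: F_def)
   show "norm (F n x) <= B * indicator (cball 0 (R + 1)) x"
   proof (cases "x \<in> cball 0 (R + 1)")
    case False
    then have "norm x > R + 1" by simp
    moreover have "norm x <= norm (x + t *\<^sub>R ?e) + norm (t *\<^sub>R ?e)"
     using norm_triangle_ineq4[of "x + t *\<^sub>R ?e" "t *\<^sub>R ?e"] by simp
    moreover have "norm (t *\<^sub>R ?e) <= 1" using t(1,2) h(2)[of n] by (simp add: norm_axis_1)
    ultimately show ?thesis using zero[of "x + t *\<^sub>R ?e"] by (simp add: F)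
   qed (use B(2) in \<open>simp add: F\<close>)
  qed
 qed measurable
 moreover have "(LINT x|lborel. F n x) = 0" for n
 proof -
  have distr: "distr lborel borel ((+) (h n *\<^sub>R ?e)) = (lborel :: (real^'n) measure)"
   using lborel_distr_plus[of "h n *\<^sub>R ?e"] by simp
  have "integrable lborel (%x. \<Phi> (h n *\<^sub>R ?e + x))"
   using int by (subst (asm) distr[symmetric], subst (asm) integrable_distr_eq) auto
  moreover have "(LINT x|lborel. \<Phi> (h n *\<^sub>R ?e + x)) = (LINT x|lborel. \<Phi> x)"
   by (subst (2) distr[symmetric], subst integral_distr) auto
  ultimately show ?thesis unfolding F_def using int by (simp add: add.commute)
 qed
 ultimately have "(%n. 0 :: real) \<longlonglongrightarrow> (LINT x|lborel. partial_deriv j \<Phi> x)" by simp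
 then show ?thesis by (simp add: LIMSEQ_const_iff)
qed

lemma partial_deriv_mult:
 assumes "\<phi> differentiable at x" "\<psi> differentiable at x"
 shows "partial_deriv j (%x. \<phi> x * \<psi> x) x = partial_deriv j \<phi> x * \<psi> x + \<phi> x * partial_deriv j \<psi> x"
proof -
 have "((%x. \<phi> x * \<psi> x) has_derivative
   (%h. \<phi> x * frechet_derivative \<psi> (at x) h + frechet_derivative \<phi> (at x) h * \<psi> x)) (at x)"
  using assms by (intro has_derivative_mult) (auto simp: frechet_derivative_works)
 from partial_deriv_eqI[OF this, of j] show ?thesis by (simp add: partial_deriv_def)
qed

lemma partial_deriv_lin:
 assumes "\<phi> differentiable at x" "\<psi> differentiable at x"
 shows "partial_deriv j (%x. a * \<phi> x + b * \<psi> x) x = a * partial_deriv j \<phi> x + b * partial_deriv j \<psi> x"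
proof -
 have "((%x. a * \<phi> x + b * \<psi> x) has_derivative
   (%h. a * frechet_derivative \<phi> (at x) h + b * frechet_derivative \<psi> (at x) h)) (at x)"
  using assms by (intro has_derivative_add has_derivative_mult_right) (auto simp: frechet_derivative_works)
 from partial_deriv_eqI[OF this, of j] show ?thesis by (simp add: partial_deriv_def)
qed

lemma C1_fun_mult:
 assumes "C1_fun \<phi>" "C1_fun \<psi>" shows "C1_fun (%x. \<phi> x * \<psi> x)"
proof -
 have "partial_deriv j (%x. \<phi> x * \<psi> x) = (%x. partial_deriv j \<phi> x * \<psi> x + \<phi> x * partial_deriv j \<psi> x)" for j
  using assms by (intro ext partial_deriv_mult) (auto simp: C1_fun_def)
 then show ?thesis
  using assms C1_fun_continuous[OF assms(1)] C1_fun_continuous[OF assms(2)]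
  by (auto simp: C1_fun_def intro!: continuous_intros)
qed

lemma integral_by_parts_partial:
 fixes \<phi> \<psi> :: "real^'n => real"
 assumes "C1_fun \<phi>" "C1_fun \<psi>" "bounded S" "!!x. x \<notin> S ==> \<phi> x = 0"
 shows "(LINT x|lborel. partial_deriv j \<phi> x * \<psi> x) = - (LINT x|lborel. \<phi> x * partial_deriv j \<psi> x)"
proof -
 let ?C = "closure S"
 have bC: "bounded ?C" using assms(3) by (rule bounded_closure)
 have 0: "\<phi> x = 0 \<and> partial_deriv j \<phi> x = 0" if "x \<notin> ?C" for x
  using assms(4) closure_subset[of S] that by (auto intro!: partial_deriv_zero[of "- ?C"])
 have c: "continuous_on UNIV \<phi>" "continuous_on UNIV \<psi>" "continuous_on UNIV (partial_deriv j \<phi>)"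
  "continuous_on UNIV (partial_deriv j \<psi>)"
  using assms C1_fun_continuous by (auto simp: C1_fun_def)
 have "integrable lborel (%x. partial_deriv j \<phi> x * \<psi> x)" "integrable lborel (%x. \<phi> x * partial_deriv j \<psi> x)"
  by (rule integrable_continuous_bounded_support[OF _ bC]; use c 0 in \<open>auto intro!: continuous_intros\<close>)+
 then have "(LINT x|lborel. partial_deriv j \<phi> x * \<psi> x) + (LINT x|lborel. \<phi> x * partial_deriv j \<psi> x)
   = (LINT x|lborel. partial_deriv j \<phi> x * \<psi> x + \<phi> x * partial_deriv j \<psi> x)"
  by simp
 also have "... = (LINT x|lborel. partial_deriv j (%x. \<phi> x * \<psi> x) x)"
  using assms(1,2) by (intro Bochner_Integration.integral_cong) (auto simp: C1_fun_def partial_deriv_mult)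
 also have "... = 0"
 proof (rule integral_partial_deriv_eq_0[OF C1_fun_mult[OF assms(1,2)]])
  show "bounded {x. \<phi> x * \<psi> x ~= 0}" by (rule bounded_subset[OF assms(3)]) (use assms(4) in auto)
 qed
 finally show ?thesis by simp
qed

section \<open>Test functions\<close>

lemma Ck_lin: "Ck k \<phi> ==> Ck k \<psi> ==> Ck k (%x. a * \<phi> x + b * \<psi> x)"
proof (induction k arbitrary: \<phi> \<psi>)
 case 0
 then show ?case by (auto intro!: continuous_intros)
next
 case (Suc k)
 then have "partial_deriv j (%x. a * \<phi> x + b * \<psi> x) = (%x. a * partial_deriv j \<phi> x + b * partial_deriv j \<psi> x)" for j
  by (auto intro!: partial_deriv_lin)
 then show ?case using Suc by auto
qed

lemma test_functions_lin:
 assumes "\<phi> \<in> test_functions \<Omega>" "\<psi> \<in> test_functions \<Omega>"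
 shows "(%x. a * \<phi> x + b * \<psi> x) \<in> test_functions \<Omega>"
proof -
 let ?S = "%\<phi>. closure {x. \<phi> x ~= (0::real)}"
 have sub: "?S (%x. a * \<phi> x + b * \<psi> x) \<subseteq> ?S \<phi> \<union> ?S \<psi>"
  unfolding closure_Un[symmetric] by (rule closure_mono) auto
 have "compact (?S \<phi> \<union> ?S \<psi>)" using assms by (auto simp: test_functions_def)
 then have "compact (?S (%x. a * \<phi> x + b * \<psi> x))"
  using sub bounded_subset closed_closure unfolding compact_eq_bounded_closed by blast
 moreover have "Ck k (%x. a * \<phi> x + b * \<psi> x)" for k
  using assms by (intro Ck_lin) (auto simp: test_functions_def)
 moreover have "?S \<phi> \<union> ?S \<psi> \<subseteq> \<Omega>" using assms by (auto simp: test_functions_def)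
 ultimately show ?thesis using sub by (auto simp: test_functions_def)
qed

lemma test_functions_diff:
 "\<phi> \<in> test_functions \<Omega> ==> \<psi> \<in> test_functions \<Omega> ==> (%x. \<phi> x - \<psi> x) \<in> test_functions \<Omega>"
 using test_functions_lin[of \<phi> \<Omega> \<psi> 1 "-1"] by simp

lemma test_functions_partial_deriv:
 assumes "\<phi> \<in> test_functions \<Omega>" shows "partial_deriv j \<phi> \<in> test_functions \<Omega>"
proof -
 let ?S = "%\<phi>. closure {x. \<phi> x ~= (0::real)}"
 have "partial_deriv j \<phi> x = 0" if "x \<notin> ?S \<phi>" for x
  by (rule partial_deriv_zero[of "- ?S \<phi>"]) (use that closure_subset[of "{x. \<phi> x ~= 0}"] in auto)
 then have sub: "?S (partial_deriv j \<phi>) \<subseteq> ?S \<phi>" by (intro closure_minimal) auto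
 have "compact (?S \<phi>)" using assms by (auto simp: test_functions_def)
 then have "compact (?S (partial_deriv j \<phi>))"
  using sub bounded_subset closed_closure unfolding compact_eq_bounded_closed by blast
 moreover have "Ck k (partial_deriv j \<phi>)" for k
 proof -
  have "Ck (Suc k) \<phi>" using assms unfolding test_functions_def by blast
  then show ?thesis by simp
 qed
 ultimately show ?thesis using assms sub by (auto simp: test_functions_def)
qed

lemma test_functions_mono: "\<Omega> \<subseteq> \<Omega>' ==> test_functions \<Omega> \<subseteq> test_functions \<Omega>'"
 by (auto simp: test_functions_def)

lemma test_functions_C1: "\<phi> \<in> test_functions \<Omega> ==> C1_fun \<phi>"
proof -
 assume "\<phi> \<in> test_functions \<Omega>"
 then have "Ck (Suc 0) \<phi>" unfolding test_functions_def by blast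
 then show ?thesis by (simp add: C1_fun_def)
qed

lemma test_functions_continuous: "\<phi> \<in> test_functions \<Omega> ==> continuous_on UNIV \<phi>"
 by (rule C1_fun_continuous[OF test_functions_C1])

lemma test_functions_borel: "\<phi> \<in> test_functions \<Omega> ==> \<phi> \<in> \<B>"
 by (rule borel_measurable_continuous_onI[OF test_functions_continuous])

lemma test_functions_bounded_support: "\<phi> \<in> test_functions \<Omega> ==> bounded {x. \<phi> x ~= 0}"
 unfolding test_functions_def using compact_imp_bounded bounded_subset[OF _ closure_subset] by blast

lemma test_functions_outside: "\<phi> \<in> test_functions \<Omega> ==> x \<notin> \<Omega> ==> \<phi> x = 0"
 unfolding test_functions_def using closure_subset[of "{x. \<phi> x ~= 0}"] by auto

section \<open>Bump functions and the fundamental lemma\<close>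

text \<open>The functions \<open>P(1/t) exp(-1/t)\<close>, extended by \<open>0\<close> to \<open>t \<le> 0\<close>. Allowing all polynomials \<open>P\<close> makes
the family closed under differentiation, which reduces smoothness to the first derivative.\<close>

definition flat_exp :: "real poly => real => real" where
 "flat_exp p t = (if 0 < t then poly p (1 / t) * exp (- (1 / t)) else 0)"

lemma poly_exp_tendsto_0: "((%y::real. poly p y * exp (- y)) \<longlongrightarrow> 0) at_top"
proof -
 have "((%y. \<Sum>i\<le>degree p. coeff p i * (y ^ i / exp y)) \<longlongrightarrow> (\<Sum>i\<le>degree p. coeff p i * 0)) at_top"
  by (intro tendsto_sum tendsto_mult tendsto_const tendsto_power_div_exp_0)
 moreover have "(\<Sum>i\<le>degree p. coeff p i * (y ^ i / exp y)) = poly p y * exp (- y)" for y :: real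
  by (simp add: poly_altdef exp_minus field_simps sum_distrib_right sum_divide_distrib)
 ultimately show ?thesis by simp
qed

lemma flat_exp_has_derivative:
 "(flat_exp p has_real_derivative flat_exp ([:0,0,1:] * (p - pderiv p)) t) (at t)"
proof (cases "t = 0")
 case True
 have "((%s. poly ([:0,1:] * p) (1 / s) * exp (- (1 / s))) \<longlongrightarrow> 0) (at_right 0)"
  using filterlim_compose[OF poly_exp_tendsto_0[of "[:0,1:] * p"] filterlim_inverse_at_top_right]
  by (simp add: inverse_eq_divide)
 moreover have "\<forall>\<^sub>F s in at_right 0. poly ([:0,1:] * p) (1 / s) * exp (- (1 / s)) = (flat_exp p (0 + s) - flat_exp p 0) / s"
  by (auto simp: eventually_at_filter flat_exp_def)
 ultimately have R: "((%s. (flat_exp p (0 + s) - flat_exp p 0) / s) \<longlongrightarrow> 0) (at_right 0)"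
  by (rule Lim_transform_eventually)
 have "\<forall>\<^sub>F s in at_left (0::real). 0 = (flat_exp p (0 + s) - flat_exp p 0) / s"
  by (auto simp: eventually_at_filter flat_exp_def)
 then have L: "((%s. (flat_exp p (0 + s) - flat_exp p 0) / s) \<longlongrightarrow> 0) (at_left 0)"
  by (rule Lim_transform_eventually[OF tendsto_const])
 have "((%s. (flat_exp p (0 + s) - flat_exp p 0) / s) \<longlongrightarrow> 0) (at 0)"
  using L R by (rule filterlim_split_at)
 then show ?thesis using True by (simp add: DERIV_def flat_exp_def)
next
 case False
 show ?thesis
 proof (cases "t > 0")
  case True
  have "((%t. poly p (1 / t) * exp (- (1 / t))) has_real_derivative
    flat_exp ([:0,0,1:] * (p - pderiv p)) t) (at t)"
   using True
   by (auto intro!: derivative_eq_intros DERIV_chain2[OF poly_DERIV] simp: flat_exp_def field_simps power2_eq_square)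
  then show ?thesis
   by (rule has_field_derivative_transform_within_open[of _ _ _ "{0<..}"]) (use True in \<open>auto simp: flat_exp_def\<close>)
 next
  case F: False
  have "((%t. 0) has_real_derivative 0) (at t)" by simp
  then have "(flat_exp p has_real_derivative 0) (at t)"
   by (rule has_field_derivative_transform_within_open[of _ _ _ "{..<0}"]) (use False F in \<open>auto simp: flat_exp_def\<close>)
  then show ?thesis using F by (simp add: flat_exp_def)
 qed
qed

text \<open>Products of flat exponentials in the distances of \<open>x\<close> to the faces of the box from \<open>a\<close> to \<open>b\<close>. They
live in the box and, for \<open>P = 1\<close> and growing steepness \<open>m\<close>, increase to its indicator function.\<close>

definition box_bump :: "('n => real poly) => ('n => real poly) => real => real^'n => real^'n => real^'n::finite => real" where
 "box_bump p q m a b x = (\<Prod>j\<in>UNIV. flat_exp (p j) (m * (x $ j - a $ j)) * flat_exp (q j) (m * (b $ j - x $ j)))"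

abbreviation flat_exp_deriv :: "real poly => real poly" where
 "flat_exp_deriv p \<equiv> [:0,0,1:] * (p - pderiv p)"

lemma box_bump_has_derivative:
 fixes a b :: "real^'n"
 shows "box_bump p q m a b differentiable at x"
  and "partial_deriv i (box_bump p q m a b) x =
   m * box_bump (p(i := flat_exp_deriv (p i))) q m a b x + (- m) * box_bump p (q(i := flat_exp_deriv (q i))) m a b x"
proof -
 define g where "g j t = flat_exp (p j) (m * (t - a $ j)) * flat_exp (q j) (m * (b $ j - t))" for j t
 define g' where "g' j t = m * (flat_exp (flat_exp_deriv (p j)) (m * (t - a $ j)) * flat_exp (q j) (m * (b $ j - t)))
  - m * (flat_exp (p j) (m * (t - a $ j)) * flat_exp (flat_exp_deriv (q j)) (m * (b $ j - t)))" for j t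
 have g: "(g j has_real_derivative g' j t) (at t)" for j t
  unfolding g_def g'_def
  by (rule derivative_eq_intros DERIV_chain2[OF flat_exp_has_derivative] refl | simp add: algebra_simps)+
 have gx: "((%x. g j (x $ j)) has_derivative (%y. g' j (x $ j) * (y $ j))) (at x)" for j
  by (rule has_derivative_compose[OF bounded_linear_imp_has_derivative[OF bounded_linear_vec_nth] g[unfolded has_field_derivative_def]])
 have "((%x. \<Prod>j\<in>UNIV. g j (x $ j)) has_derivative (%y. \<Sum>j\<in>UNIV. (g' j (x $ j) * (y $ j)) * (\<Prod>k\<in>UNIV - {j}. g k (x $ k)))) (at x)"
  by (rule has_derivative_prod) (rule gx)
 then have D: "(box_bump p q m a b has_derivative (%y. \<Sum>j\<in>UNIV. (g' j (x $ j) * (y $ j)) * (\<Prod>k\<in>UNIV - {j}. g k (x $ k)))) (at x)"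
  by (simp add: box_bump_def[abs_def] g_def)
 then show "box_bump p q m a b differentiable at x" by (auto simp: differentiable_def)
 have "partial_deriv i (box_bump p q m a b) x = (\<Sum>j\<in>UNIV. (if j = i then g' i (x $ i) * (\<Prod>k\<in>UNIV - {i}. g k (x $ k)) else 0))"
  unfolding partial_deriv_eqI[OF D] by (rule sum.cong) (auto simp: axis_def)
 also have "... = g' i (x $ i) * (\<Prod>k\<in>UNIV - {i}. g k (x $ k))" by simp
 also have "... = m * box_bump (p(i := flat_exp_deriv (p i))) q m a b x + (- m) * box_bump p (q(i := flat_exp_deriv (q i))) m a b x"
 proof -
  have 1: "box_bump (p(i := flat_exp_deriv (p i))) q m a b x =
   (flat_exp (flat_exp_deriv (p i)) (m * (x $ i - a $ i)) * flat_exp (q i) (m * (b $ i - x $ i))) * (\<Prod>k\<in>UNIV - {i}. g k (x $ k))"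
   unfolding box_bump_def g_def by (subst prod.remove[of _ i]) (auto intro!: prod.cong arg_cong2[where f = "(*)"])
  have 2: "box_bump p (q(i := flat_exp_deriv (q i))) m a b x =
   (flat_exp (p i) (m * (x $ i - a $ i)) * flat_exp (flat_exp_deriv (q i)) (m * (b $ i - x $ i))) * (\<Prod>k\<in>UNIV - {i}. g k (x $ k))"
   unfolding box_bump_def g_def by (subst prod.remove[of _ i]) (auto intro!: prod.cong arg_cong2[where f = "(*)"])
  show ?thesis unfolding 1 2 g'_def by (simp add: left_diff_distrib mult.assoc)
 qed
 finally show "partial_deriv i (box_bump p q m a b) x =
   m * box_bump (p(i := flat_exp_deriv (p i))) q m a b x + (- m) * box_bump p (q(i := flat_exp_deriv (q i))) m a b x" .
qed

text \<open>A partial derivative of a bump is a sum of two bumps with other polynomials.\<close>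

lemma box_bump_Ck: "Ck k (box_bump p q m a b)"
proof (induction k arbitrary: p q)
 case 0
 show ?case
  by (simp add: continuous_on_eq_continuous_at differentiable_imp_continuous_within box_bump_has_derivative(1))
next
 case (Suc k)
 have "partial_deriv i (box_bump p q m a b) = (%x. m * box_bump (p(i := flat_exp_deriv (p i))) q m a b x
   + (- m) * box_bump p (q(i := flat_exp_deriv (q i))) m a b x)" for i
  by (rule ext) (rule box_bump_has_derivative(2))
 then have "Ck k (partial_deriv i (box_bump p q m a b))" for i
  by (simp only:) (rule Ck_lin[OF Suc Suc])
 then show ?case by (simp add: box_bump_has_derivative(1))
qed

lemma flat_exp_1: "0 <= flat_exp 1 t" "flat_exp 1 t <= 1" "t <= 0 ==> flat_exp 1 t = 0"
 by (auto simp: flat_exp_def)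

lemma flat_exp_1_tendsto: "0 < t ==> (%n. flat_exp 1 (real (Suc n) * t)) \<longlonglongrightarrow> 1"
proof -
 assume t: "0 < t"
 have "(%n. exp (- (1 / real (Suc n) * (1 / t)))) \<longlonglongrightarrow> exp (- (0 * (1 / t)))"
  by (intro tendsto_exp tendsto_minus tendsto_mult tendsto_const lim_1_over_n[THEN LIMSEQ_Suc])
 moreover have "flat_exp 1 (real (Suc n) * t) = exp (- (1 / real (Suc n) * (1 / t)))" for n
  using t by (simp add: flat_exp_def)
 ultimately show ?thesis by (simp del: of_nat_Suc)
qed

lemma box_bump_tendsto_box:
 fixes a b :: "real^'n"
 defines "\<beta> n \<equiv> box_bump (%_. 1) (%_. 1) (real (Suc n)) a b"
 shows "\<beta> n \<in> test_functions UNIV" "\<bar>\<beta> n x\<bar> <= indicator (cbox a b) x" "(%n. \<beta> n x) \<longlonglongrightarrow> indicator (box a b) x"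
proof -
 have out: "\<beta> n x = 0" if "\<not> (\<forall>j. a $ j < x $ j \<and> x $ j < b $ j)" for x n
 proof -
  obtain j where "\<not> (a $ j < x $ j \<and> x $ j < b $ j)" using \<open>\<not> (\<forall>j. _ j)\<close> by blast
  then have "flat_exp 1 (real (Suc n) * (x $ j - a $ j)) * flat_exp 1 (real (Suc n) * (b $ j - x $ j)) = 0"
   using flat_exp_1(3)[of "real (Suc n) * (x $ j - a $ j)"] flat_exp_1(3)[of "real (Suc n) * (b $ j - x $ j)"]
   by (auto simp: mult_le_0_iff not_less)
  then show ?thesis unfolding \<beta>_def box_bump_def by (intro prod_zero) auto
 qed
 have sub: "{x. \<beta> n x ~= 0} \<subseteq> cbox a b"
 proof
  fix x assume "x \<in> {x. \<beta> n x ~= 0}"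
  then have "\<forall>j. a $ j < x $ j \<and> x $ j < b $ j" using out[of x n] by blast
  then show "x \<in> cbox a b" by (auto simp: mem_box_cart less_imp_le)
 qed
 have "compact (closure {x. \<beta> n x ~= 0})"
  using bounded_subset[OF bounded_cbox sub] by (simp add: compact_closure)
 then show "\<beta> n \<in> test_functions UNIV" by (simp add: test_functions_def \<beta>_def box_bump_Ck)
 have "0 <= \<beta> n x" "\<beta> n x <= 1"
  unfolding \<beta>_def box_bump_def
  by (auto intro!: prod_nonneg prod_le_1 mult_nonneg_nonneg mult_le_one simp: flat_exp_1 simp del: of_nat_Suc)
 then show "\<bar>\<beta> n x\<bar> <= indicator (cbox a b) x" using sub by (auto simp: indicator_def)
 show "(%n. \<beta> n x) \<longlonglongrightarrow> indicator (box a b) x"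
 proof (cases "x \<in> box a b")
  case True
  have "(%n. \<beta> n x) \<longlonglongrightarrow> (\<Prod>j\<in>(UNIV :: 'n set). 1 * 1)"
   unfolding \<beta>_def box_bump_def
   by (intro tendsto_prod tendsto_mult flat_exp_1_tendsto) (use True in \<open>auto simp: mem_box_cart\<close>)
  then show ?thesis using True by simp
 next
  case False
  then have "\<beta> n x = 0" for n using out[of x n] by (auto simp: mem_box_cart)
  then show ?thesis using False by simp
 qed
qed

text \<open>Open boxes form an intersection stable generator of the Borel sets.\<close>

lemma AE_zero_if_integral_boxes_zero:
 fixes h :: "'a::euclidean_space => real"
 assumes h: "integrable lborel h" and box: "!!a b. (LINT x|lborel. indicator (box a b) x * h x) = 0"
  and total: "(LINT x|lborel. h x) = 0"
 shows "AE x in lborel. h x = 0"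
proof -
 have [measurable]: "h \<in> \<B>" using h by simp
 have int: "integrable lborel (%x. indicator A x * h x)" if "A \<in> sets borel" for A
  using integrable_mult_indicator[of A lborel h] that h by simp
 have zero: "(LINT x|lborel. indicator A x * h x) = 0" if "A \<in> sets borel" for A :: "'a set"
 proof -
  have Int: "Int_stable (range (%(a, b). box a b :: 'a set))"
   by (auto simp: Int_stable_def box_Int_box)
  have sb: "sets borel = sigma_sets UNIV (range (%(a, b). box a b :: 'a set))"
   by (subst borel_eq_box) simp
  show ?thesis
  proof (rule sigma_sets_induct_disjoint[OF Int _ that[unfolded sb], where P = "%A. (LINT x|lborel. indicator A x * h x) = 0"])
   show "(LINT x|lborel. indicator A x * h x) = 0" if "A \<in> range (%(a, b). box a b)" for A
    using box that by auto
   show "(LINT x|lborel. indicator (UNIV - A) x * h x) = 0"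
    if A: "A \<in> sigma_sets UNIV (range (%(a, b). box a b))" and "(LINT x|lborel. indicator A x * h x) = 0" for A
   proof -
    have "(LINT x|lborel. indicator (UNIV - A) x * h x) = (LINT x|lborel. h x - indicator A x * h x)"
     by (intro Bochner_Integration.integral_cong) (auto simp: indicator_def)
    also have "... = 0" using total h int[OF A[folded sb]] that(2) by simp
    finally show ?thesis .
   qed
   show "(LINT x|lborel. indicator (\<Union> (range A)) x * h x) = 0"
    if A: "disjoint_family A" "range A \<subseteq> sigma_sets UNIV (range (%(a, b). box a b))"
     and 0: "!!i::nat. (LINT x|lborel. indicator (A i) x * h x) = 0" for A
   proof -
    have m: "A i \<in> sets lborel" for i using A(2) sb by auto
    have "(LINT x:(\<Union>i. A i)|lborel. h x) = (\<Sum>i. (LINT x:(A i)|lborel. h x))"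
    proof (rule lebesgue_integral_countable_add[OF m])
     show "A i \<inter> A j = {}" if "i ~= j" for i j using A(1) that by (auto simp: disjoint_family_on_def)
     have "(\<Union>i. A i) \<in> sets borel" using m by auto
     from int[OF this] show "set_integrable lborel (\<Union>i. A i) h"
      by (simp add: set_integrable_def)
    qed
    then show ?thesis using 0 by (simp add: set_lebesgue_integral_def)
   qed
  qed auto
 qed
 have m: "{x. 0 < h x} \<in> sets borel" "{x. h x < 0} \<in> sets borel" by measurable
 have "AE x in lborel. indicator {x. 0 < h x} x * h x = 0"
  using integral_nonneg_eq_0_iff_AE[OF int[OF m(1)]] zero[OF m(1)] by (auto simp: indicator_def)
 moreover have "AE x in lborel. - (indicator {x. h x < 0} x * h x) = 0"
  using integral_nonneg_eq_0_iff_AE[of lborel "%x. - (indicator {x. h x < 0} x * h x)"] int[OF m(2)] zero[OF m(2)]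
  by (auto simp: indicator_def)
 ultimately show ?thesis by eventually_elim (auto simp: indicator_def split: if_splits)
qed

text \<open>Testing with bumps that approximate the indicator function of a box shows that the integral of \<open>h\<close>
over every box vanishes.\<close>

lemma fundamental_lemma_AE:
 fixes h :: "real^'n => real"
 assumes loc: "locally_integrable h"
  and test: "!!\<psi>. \<psi> \<in> test_functions UNIV ==> (LINT x|lebesgue. h x * \<psi> x) = 0"
 shows "AE x in lebesgue. h x = 0"
proof -
 have box0: "(LINT x|lebesgue. indicator (box a b) x * h x) = 0" for a b :: "real^'n"
 proof -
  define \<beta> where "\<beta> n = box_bump (%_. 1) (%_. 1) (real (Suc n)) a b" for n
  have int: "integrable lebesgue (%x. indicator (cbox a b) x * h x)"
   using loc compact_cbox unfolding locally_integrable_def set_integrable_def by (metis (no_types, lifting) real_scaleR_def Bochner_Integration.integrable_cong)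
  have b[measurable]: "\<beta> n \<in> \<L>" for n
   using test_functions_borel[OF box_bump_tendsto_box(1)[of n a b]] by (simp add: \<beta>_def measurable_completion)
  have "(%n. LINT x|lebesgue. \<beta> n x * (indicator (cbox a b) x * h x)) \<longlonglongrightarrow> (LINT x|lebesgue. indicator (box a b) x * (indicator (cbox a b) x * h x))"
  proof (rule integral_dominated_convergence[where w = "%x. \<bar>indicator (cbox a b) x * h x\<bar>"])
   show "integrable lebesgue (%x. \<bar>indicator (cbox a b) x * h x\<bar>)" using int by simp
   show "AE x in lebesgue. (%n. \<beta> n x * (indicator (cbox a b) x * h x)) \<longlonglongrightarrow> indicator (box a b) x * (indicator (cbox a b) x * h x)"
    unfolding \<beta>_def by (intro AE_I2 tendsto_mult box_bump_tendsto_box(3) tendsto_const)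
   show "AE x in lebesgue. norm (\<beta> n x * (indicator (cbox a b) x * h x)) <= \<bar>indicator (cbox a b) x * h x\<bar>" for n
   proof (rule AE_I2)
    fix x
    have "\<bar>\<beta> n x\<bar> <= indicator (cbox a b) x" using box_bump_tendsto_box(2)[of n a b x] by (simp only: \<beta>_def)
    then have "\<bar>\<beta> n x\<bar> <= 1" by (cases "x \<in> cbox a b") simp_all
    then show "norm (\<beta> n x * (indicator (cbox a b) x * h x)) <= \<bar>indicator (cbox a b) x * h x\<bar>"
     by (simp add: abs_mult mult_left_le_one_le)
   qed
   have box_meas: "indicator (box a b) \<in> \<L>"
    by (intro borel_measurable_indicator fmeasurableD lmeasurable_box)
   show "(%x. indicator (box a b) x * (indicator (cbox a b) x * h x)) \<in> \<L>"
    by (rule borel_measurable_times[OF box_meas]) (use int in auto)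
   show "(%x. \<beta> n x * (indicator (cbox a b) x * h x)) \<in> \<L>" for n
    by (rule borel_measurable_times[OF b]) (use int in auto)
  qed
  moreover have "\<beta> n x * (indicator (cbox a b) x * h x) = h x * \<beta> n x" for n x
   using box_bump_tendsto_box(2)[of n a b x, folded \<beta>_def] by (auto simp: indicator_def split: if_splits)
  moreover have "indicator (box a b) x * (indicator (cbox a b) x * h x) = indicator (box a b) x * h x" for x
   using box_subset_cbox[of a b] by (auto simp: indicator_def)
  moreover have "(LINT x|lebesgue. h x * \<beta> n x) = 0" for n
   unfolding \<beta>_def by (intro test box_bump_tendsto_box(1))
  ultimately have "(%n. 0::real) \<longlonglongrightarrow> (LINT x|lebesgue. indicator (box a b) x * h x)" by simp
  then show ?thesis by (simp add: LIMSEQ_const_iff)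
 qed
 have "AE x in lebesgue. x \<in> box (- vec (real k)) (vec (real k)) --> h x = 0" for k
 proof -
  define B where "B = box (- vec (real k)) (vec (real k) :: real^'n)"
  have "h absolutely_integrable_on cbox (- vec (real k)) (vec (real k))"
   using loc compact_cbox unfolding locally_integrable_def by blast
  then have "h absolutely_integrable_on B"
   unfolding B_def by (rule set_integrable_subset) (auto simp: box_subset_cbox)
  then have int: "integrable lebesgue (%x. indicator B x * h x)" by (simp add: set_integrable_def)
  obtain g where g: "g \<in> borel_measurable lborel" "AE x in lborel. indicator B x * h x = g x"
   using completion_ex_borel_measurable_real[of "%x. indicator B x * h x" lborel] int by auto
  have g': "AE x in lebesgue. indicator B x * h x = g x" using g(2) by (rule AE_completion)
  have gl: "g \<in> \<L>" using g(1) by (rule measurable_completion)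
  have "integrable lebesgue g" using integrable_cong_AE_imp[OF int gl] g' by (auto elim: eventually_mono)
  then have ig: "integrable lborel g" using g(1) integrable_completion by blast
  have ib: "(LINT x|lborel. indicator (box a b) x * g x) = 0" for a b
  proof -
   have box_meas: "indicator (box a b) \<in> \<L>"
    by (intro borel_measurable_indicator fmeasurableD lmeasurable_box)
   have "(LINT x|lborel. indicator (box a b) x * g x) = (LINT x|lebesgue. indicator (box a b) x * g x)"
    using g(1) by (subst integral_completion) auto
   also have "... = (LINT x|lebesgue. indicator (box a b \<inter> B) x * h x)"
   proof (rule integral_cong_AE)
    show "(%x. indicator (box a b) x * g x) \<in> \<L>" by (rule borel_measurable_times[OF box_meas gl])
    have "(%x. indicator (box a b) x * (indicator B x * h x)) \<in> \<L>"
     by (rule borel_measurable_times[OF box_meas]) (use int in auto)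
    then show "(%x. indicator (box a b \<inter> B) x * h x) \<in> \<L>"
     by (simp add: indicator_inter_arith mult.assoc)
    show "AE x in lebesgue. indicator (box a b) x * g x = indicator (box a b \<inter> B) x * h x"
     using g' by eventually_elim (auto simp: indicator_def)
   qed
   also have "... = 0" unfolding B_def box_Int_box by (rule box0)
   finally show ?thesis .
  qed
  have "(LINT x|lborel. g x) = (LINT x|lebesgue. g x)" using g(1) by (subst integral_completion) auto
  also have "... = (LINT x|lebesgue. indicator B x * h x)"
   using g' gl int by (intro integral_cong_AE) (auto elim: eventually_mono)
  also have "... = 0" unfolding B_def by (rule box0)
  finally have "AE x in lborel. g x = 0" using AE_zero_if_integral_boxes_zero[OF ig ib] by blast
  then have "AE x in lebesgue. g x = 0" by (rule AE_completion)
  with g' show ?thesis unfolding B_def[symmetric] by eventually_elim (auto simp: indicator_def)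
 qed
 then have "AE x in lebesgue. \<forall>k. x \<in> box (- vec (real k)) (vec (real k)) --> h x = 0" by (subst AE_all_countable) blast
 then show ?thesis
 proof eventually_elim
  case (elim x)
  obtain k :: nat where k: "norm x < real k" using reals_Archimedean2 by blast
  have "x \<in> box (- vec (real k)) (vec (real k))"
   unfolding mem_box_cart
  proof
   fix i show "(- vec (real k)) $ i < x $ i \<and> x $ i < vec (real k) $ i"
    using k component_le_norm_cart[of x i] unfolding abs_le_iff by simp
  qed
  then show ?case using elim by blast
 qed
qed

section \<open>The heat kernel and subordination\<close>

definition heat :: "real => 'a::euclidean_space => real" where
 "heat t x = (4 * pi * t) powr (- real DIM('a) / 2) * exp (- (norm x)\<^sup>2 / (4 * t))"

lemma heat_nonneg [simp]: "0 <= heat t x"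
 by (simp add: heat_def)

lemma heat_minus [simp]: "heat t (- x) = heat t x"
 by (simp add: heat_def)

lemma borel_measurable_heat [measurable (raw)]:
 assumes [measurable]: "f \<in> borel_measurable M" "g \<in> borel_measurable M"
 shows "(%x. heat (f x) (g x :: 'a::euclidean_space)) \<in> borel_measurable M"
 unfolding heat_def by measurable

text \<open>The heat kernel is a product of normal densities with variance \<open>2 t\<close>.\<close>

lemma nn_integral_heat:
 assumes t: "0 < t"
 shows "(NN x. ennreal (heat t (x :: 'a::euclidean_space))) = 1"
proof -
 define \<sigma> where "\<sigma> = sqrt (2 * t)"
 have s: "\<sigma> > 0" "\<sigma>\<^sup>2 = 2 * t" using t by (auto simp: \<sigma>_def)
 have "heat t x = (\<Prod>b\<in>Basis. normal_density 0 \<sigma> (x \<bullet> b))" for x :: 'a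
 proof -
  have "(\<Prod>b\<in>(Basis :: 'a set). normal_density 0 \<sigma> (x \<bullet> b)) =
    (1 / sqrt (4 * pi * t)) ^ DIM('a) * exp (\<Sum>b\<in>Basis. - (x \<bullet> b)\<^sup>2 / (4 * t))"
  proof -
   have "normal_density 0 \<sigma> u = (1 / sqrt (4 * pi * t)) * exp (- u\<^sup>2 / (4 * t))" for u
    by (simp add: normal_density_def s)
   then show ?thesis by (simp only: prod.distrib prod_constant exp_sum finite_Basis)
  qed
  also have "(\<Sum>b\<in>Basis. - (x \<bullet> b)\<^sup>2 / (4 * t)) = - (norm x)\<^sup>2 / (4 * t)"
   by (simp add: sum_divide_distrib[symmetric] sum_negf power2_norm_eq_inner euclidean_inner[of x x] flip: power2_eq_square)
  also have "(1 / sqrt (4 * pi * t)) ^ DIM('a) = (4 * pi * t) powr (- real DIM('a) / 2)"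
  proof -
   have "(1 / sqrt (4 * pi * t)) = (4 * pi * t) powr (- (1/2))"
    using t by (simp add: powr_minus powr_half_sqrt inverse_eq_divide)
   then show ?thesis using t by (simp add: powr_powr flip: powr_realpow)
  qed
  finally show ?thesis by (simp add: heat_def)
 qed
 then have "(NN x. ennreal (heat t (x :: 'a))) = (NN x. (\<Prod>b\<in>Basis. ennreal (normal_density 0 \<sigma> ((x :: 'a) \<bullet> b))))"
  by (simp add: prod_ennreal)
 also have "... = (\<Prod>b\<in>(Basis :: 'a set). (NN x. ennreal (normal_density 0 \<sigma> x)))"
  by (rule nn_integral_lborel_prod) auto
 also have "(NN x. ennreal (normal_density 0 \<sigma> x)) = 1"
  using s(1) by (subst nn_integral_eq_integral) auto
 finally show ?thesis by simp
qed

lemma integrable_heat [simp]: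
 assumes "0 < t" shows "integrable lborel (heat t :: 'a::euclidean_space => real)"
 using nn_integral_heat[OF assms, where 'a='a] by (intro integrableI_bounded) auto

lemma integral_heat:
 assumes "0 < t" shows "(LINT x|lborel. heat t (x :: 'a::euclidean_space)) = 1"
 using nn_integral_heat[OF assms, where 'a='a] integrable_heat[OF assms, where 'a='a]
 by (subst (asm) nn_integral_eq_integral) auto

text \<open>Completing the square in the exponent; this is the semigroup property before integration.\<close>

lemma heat_mult_complete_square:
 fixes x y :: "'a::euclidean_space"
 assumes "0 < s" "0 < t"
 shows "heat s (x - y) * heat t y = heat (s + t) x * heat (s * t / (s + t)) (y - (t / (s + t)) *\<^sub>R x)"
proof -
 define c where "c = - real DIM('a) / 2"
 have "(4 * pi * s) powr c * (4 * pi * t) powr c = (4 * pi * (s + t)) powr c * (4 * pi * (s * t / (s + t))) powr c"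
 proof -
  have m: "x powr c * y powr c = (x * y) powr c" if "0 < x" "0 < y" for x y :: real
   using that by (simp add: powr_mult)
  have "s + t ~= 0" using assms by linarith
  then have "(4 * pi * s) * (4 * pi * t) = (4 * pi * (s + t)) * (4 * pi * (s * t / (s + t)))"
   by (simp add: field_simps)
  then show ?thesis using assms by (simp only: m mult_pos_pos zero_less_numeral pi_gt_zero add_pos_pos divide_pos_pos)
 qed
 moreover have "exp (- (norm (x - y))\<^sup>2 / (4 * s)) * exp (- (norm y)\<^sup>2 / (4 * t)) =
  exp (- (norm x)\<^sup>2 / (4 * (s + t))) * exp (- (norm (y - (t / (s + t)) *\<^sub>R x))\<^sup>2 / (4 * (s * t / (s + t))))"
 proof -
  define X Y Z where "X = x \<bullet> x" and "Y = y \<bullet> y" and "Z = x \<bullet> y"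
  have n: "(norm (x - y))\<^sup>2 = X - 2 * Z + Y" "(norm y)\<^sup>2 = Y" "(norm x)\<^sup>2 = X"
   "(norm (y - (t / (s + t)) *\<^sub>R x))\<^sup>2 = Y - 2 * (t / (s + t)) * Z + (t / (s + t))\<^sup>2 * X"
   unfolding power2_norm_eq_inner X_def Y_def Z_def
   by (auto simp: inner_diff_left inner_diff_right inner_commute power2_eq_square algebra_simps)
  have st: "s + t ~= 0" using assms by linarith
  have "- (X - 2 * Z + Y) / (4 * s) + - Y / (4 * t) =
   - X / (4 * (s + t)) + - (Y - 2 * (t / (s + t)) * Z + (t / (s + t))\<^sup>2 * X) / (4 * (s * t / (s + t)))"
   using assms st by (simp add: divide_simps power2_eq_square) algebra
  then show ?thesis unfolding n exp_add[symmetric] by simp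
 qed
 ultimately show ?thesis unfolding heat_def c_def[symmetric] by (simp add: ac_simps)
qed

lemma nn_integral_lborel_translate:
 assumes [measurable]: "f \<in> \<B>"
 shows "(NN x. f (x + c)) = (NN x. f (x :: 'a::euclidean_space))"
 by (subst (2) lborel_distr_plus[of c, symmetric], subst nn_integral_distr) (auto simp: add.commute)

lemma integral_lborel_translate:
 fixes f :: "'a::euclidean_space => real"
 assumes [measurable]: "f \<in> \<B>"
 shows "(LINT x|lborel. f (x + c)) = (LINT x|lborel. f x)"
 by (subst (2) lborel_distr_plus[of c, symmetric], subst integral_distr) (auto simp: add.commute)

lemma nn_integral_heat_semigroup:
 fixes x y :: "'a::euclidean_space"
 assumes "0 < s" "0 < t"
 shows "(NN z. ennreal (heat s (x - z) * heat t (y - z))) = ennreal (heat (s + t) (x - y))"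
proof -
 have st: "0 < s * t / (s + t)" using assms by simp
 have "(NN z. ennreal (heat s (x - z) * heat t (y - z)))
   = (NN z. ennreal (heat s (x - (z + y)) * heat t (y - (z + y))))"
  by (rule nn_integral_lborel_translate[symmetric]) measurable
 also have "... = (NN z. ennreal (heat (s + t) (x - y) * heat (s * t / (s + t)) (z + (- ((t / (s + t)) *\<^sub>R (x - y))))))"
  using heat_mult_complete_square[OF assms, of "x - y"] by (simp add: algebra_simps)
 also have "... = (NN z. ennreal (heat (s + t) (x - y)) * ennreal (heat (s * t / (s + t)) (z :: 'a)))"
  by (subst nn_integral_lborel_translate) (auto simp: ennreal_mult)
 also have "... = ennreal (heat (s + t) (x - y))"
  by (simp add: nn_integral_cmult nn_integral_heat[OF st])
 finally show ?thesis .
qed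

lemma power_exp_bound:
 fixes y :: real assumes y: "y \<ge> 0" shows "y ^ k * exp (- y) <= fact k"
proof -
 have "(\<Sum>n\<in>{k}. y ^ n /\<^sub>R fact n) <= (\<Sum>n. y ^ n /\<^sub>R fact n)"
  by (rule sum_le_suminf[OF summable_exp_generic]) (use y in auto)
 then have "y ^ k / fact k <= exp y" unfolding exp_def by (simp add: divide_inverse mult.commute)
 then show ?thesis by (simp add: exp_minus field_simps)
qed

lemma nn_integral_powr_01:
 assumes "0 < e"
 shows "(NN x. ennreal (x powr (e - 1)) * indicator {0..1} x) = ennreal (1 / e)"
 using nn_integral_has_integral_lebesgue'[OF _ has_integral_powr_from_0[of "e - 1" 1]] assms by simp

lemma nn_integral_powr_ge:
 assumes "0 < e" "0 < a"
 shows "(NN x. ennreal (x powr (- e - 1)) * indicator {a..} x) = ennreal (a powr (- e) / e)"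
 using nn_integral_has_integral_lebesgue'[OF _ has_integral_powr_to_inf[of "- e - 1" a]] assms by simp

text \<open>The substitution \<open>s = \<bar>x\<bar>\<^sup>2 \<tau>\<close> takes all powers of \<open>\<bar>x\<bar>\<close> out of the integral. For \<open>b > 0\<close> these are
the Riesz kernels, for \<open>b = -\<sigma>\<close> the Gagliardo kernels. Only positivity and finiteness of the
constant matter.\<close>

lemma subordination:
 fixes b :: real
 assumes b: "b < real DIM('a::euclidean_space) / 2"
 shows "\<exists>C>0. \<forall>x::'a. x ~= 0 -->
  (NN s. ennreal (s powr (b - 1) * heat s x) * indicator {0<..} s) = ennreal (C * norm x powr (2 * b - real DIM('a)))"
proof -
 define d where "d = real DIM('a)"
 define g where "g \<tau> = \<tau> powr (b - 1) * ((4 * pi * \<tau>) powr (- d / 2) * exp (- 1 / (4 * \<tau>)))" for \<tau> :: real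
 have [measurable]: "g \<in> \<B>" unfolding g_def by measurable
 define I where "I = (NN \<tau>. ennreal (g \<tau>) * indicator {0<..} \<tau>)"
 define k where "k = nat \<lceil>d / 2 + 1 - b\<rceil>"
 have k: "real k \<ge> d / 2 + 1 - b" unfolding k_def by linarith
 define c where "c = (4 * pi) powr (- d / 2)"
 have c: "c > 0" by (simp add: c_def)
 have g0: "g \<tau> = c * (\<tau> powr (b - 1 - d / 2) * exp (- 1 / (4 * \<tau>)))" if "0 < \<tau>" for \<tau>
 proof -
  have "\<tau> powr (b - 1 - d / 2) = \<tau> powr (b - 1) * \<tau> powr (- d / 2)"
   using that by (simp add: powr_add[symmetric])
  then show ?thesis using that by (simp add: g_def c_def powr_mult)
 qed
 have g1: "g \<tau> <= c * (fact k * 4 ^ k)" if "0 < \<tau>" "\<tau> <= 1" for \<tau>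
 proof -
  have e: "exp (- 1 / (4 * \<tau>)) <= fact k * (4 * \<tau>) ^ k"
   using power_exp_bound[of "1 / (4 * \<tau>)" k] that by (simp add: power_divide field_simps)
  have "g \<tau> = c * (\<tau> powr (b - 1 - d / 2) * exp (- 1 / (4 * \<tau>)))"
   using that(1) by (rule g0)
  also have "... <= c * (\<tau> powr (b - 1 - d / 2) * (fact k * (4 * \<tau>) ^ k))"
   using c e by (intro mult_left_mono) auto
  also have "... = c * (fact k * 4 ^ k) * \<tau> powr (b - 1 - d / 2 + real k)"
   using that by (simp add: powr_add powr_realpow power_mult_distrib)
  also have "... <= c * (fact k * 4 ^ k) * 1"
   using c k that by (intro mult_left_mono powr_le1) auto
  finally show ?thesis by simp
 qed
 have g2: "g \<tau> <= c * \<tau> powr (- (d / 2 - b) - 1)" if "1 <= \<tau>" for \<tau>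
 proof -
  have "g \<tau> = c * \<tau> powr (- (d / 2 - b) - 1) * exp (- 1 / (4 * \<tau>))"
   using g0[of \<tau>] that by (simp add: algebra_simps)
  also have "... <= c * \<tau> powr (- (d / 2 - b) - 1) * 1"
   using c that by (intro mult_left_mono) auto
  finally show ?thesis by simp
 qed
 have "I <= (NN \<tau>. ennreal (c * (fact k * 4 ^ k)) * indicator {0..1} \<tau> +
   ennreal c * (ennreal (\<tau> powr (- (d / 2 - b) - 1)) * indicator {1..} \<tau>))"
  unfolding I_def
 proof (rule nn_integral_mono)
  fix \<tau> :: real
  consider "\<tau> <= 0" | "0 < \<tau>" "\<tau> <= 1" | "1 < \<tau>" by linarith
  then show "ennreal (g \<tau>) * indicator {0<..} \<tau> <= ennreal (c * (fact k * 4 ^ k)) * indicator {0..1} \<tau> +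
   ennreal c * (ennreal (\<tau> powr (- (d / 2 - b) - 1)) * indicator {1..} \<tau>)"
  proof cases
   case 2
   then show ?thesis using g1[of \<tau>] by (intro add_increasing2) (auto intro: ennreal_leI)
  next
   case 3
   then show ?thesis using g2[of \<tau>] c by (intro add_increasing) (auto simp: ennreal_mult[symmetric] intro: ennreal_leI)
  qed auto
 qed
 also have "... = ennreal (c * (fact k * 4 ^ k)) + ennreal c * ennreal (1 powr (- (d / 2 - b)) / (d / 2 - b))"
  using b nn_integral_powr_ge[of "d / 2 - b" 1]
  by (subst nn_integral_add) (auto simp: nn_integral_cmult d_def nn_integral_cmult_indicator)
 also have "... < \<infinity>" by (simp add: ennreal_mult_less_top)
 finally have fin: "I < \<infinity>" .
 have "I ~= 0"
 proof
  assume "I = 0"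
  then have "AE \<tau> in lborel. ennreal (g \<tau>) * indicator {0<..} \<tau> = 0"
   unfolding I_def by (subst (asm) nn_integral_0_iff_AE) auto
  then have "AE \<tau> in lborel. \<tau> \<notin> {0<..<1::real}"
  proof eventually_elim
   case (elim \<tau>)
   have "0 < g \<tau>" if "0 < \<tau>" using that by (simp add: g_def)
   then show ?case using elim by (auto simp: indicator_def ennreal_eq_0_iff not_le[symmetric] split: if_splits)
  qed
  then have "{0<..<1::real} \<in> null_sets lborel"
   by (subst AE_iff_null_sets) auto
  then have "emeasure lborel {0<..<1::real} = 0" by (rule null_setsD1)
  moreover have "emeasure lborel {0<..<1::real} = 1" by simp
  ultimately show False by (metis zero_neq_one)
 qed
 then have C: "0 < enn2real I" "ennreal (enn2real I) = I"
  using fin by (auto simp: enn2real_positive_iff less_top zero_less_iff_neq_zero)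
 show ?thesis
 proof (intro exI conjI allI impI)
  show "0 < enn2real I" by (rule C)
  fix x :: 'a assume x: "x ~= 0"
  define r where "r = norm x"
  have r: "r > 0" using x by (simp add: r_def)
  have scale: "r\<^sup>2 * ((r\<^sup>2 * \<tau>) powr (b - 1) * heat (r\<^sup>2 * \<tau>) x) = r powr (2 * b - d) * g \<tau>" if "0 < \<tau>" for \<tau>
  proof -
   have e: "- (norm x)\<^sup>2 / (4 * (r\<^sup>2 * \<tau>)) = - 1 / (4 * \<tau>)" using r that by (simp add: r_def)
   have r2: "(r\<^sup>2) powr p = r powr (2 * p)" for p
    using r by (simp add: powr_powr flip: powr_numeral)
   have "r\<^sup>2 * ((r\<^sup>2 * \<tau>) powr (b - 1) * heat (r\<^sup>2 * \<tau>) x) =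
    (r\<^sup>2 * (r powr (2 * (b - 1)) * r powr (2 * (- d / 2)))) * g \<tau>"
    using r that unfolding heat_def e g_def d_def
    by (simp add: powr_mult r2 mult.left_commute[of _ "r\<^sup>2"] ac_simps)
   also have "r\<^sup>2 * (r powr (2 * (b - 1)) * r powr (2 * (- d / 2))) = r powr (2 * b - d)"
    using r by (simp add: powr_add[symmetric] flip: powr_numeral)
   finally show ?thesis .
  qed
  have "(NN s. ennreal (s powr (b - 1) * heat s x) * indicator {0<..} s) =
   ennreal \<bar>r\<^sup>2\<bar> * (NN \<tau>. ennreal ((0 + r\<^sup>2 * \<tau>) powr (b - 1) * heat (0 + r\<^sup>2 * \<tau>) x) * indicator {0<..} (0 + r\<^sup>2 * \<tau>))"
   by (rule nn_integral_real_affine) (use r in auto)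
  also have "... = (NN \<tau>. ennreal (r powr (2 * b - d)) * (ennreal (g \<tau>) * indicator {0<..} \<tau>))"
  proof (subst nn_integral_cmult[symmetric], measurable, rule nn_integral_cong)
   fix \<tau> :: real
   show "ennreal \<bar>r\<^sup>2\<bar> * (ennreal ((0 + r\<^sup>2 * \<tau>) powr (b - 1) * heat (0 + r\<^sup>2 * \<tau>) x) * indicator {0<..} (0 + r\<^sup>2 * \<tau>))
    = ennreal (r powr (2 * b - d)) * (ennreal (g \<tau>) * indicator {0<..} \<tau>)"
    using scale[of \<tau>] r by (cases "0 < \<tau>") (auto simp: ennreal_mult'[symmetric] zero_less_mult_iff g_def)
  qed
  also have "... = ennreal (r powr (2 * b - d)) * I"
   unfolding I_def by (rule nn_integral_cmult) measurable
  also have "... = ennreal (enn2real I * norm x powr (2 * b - real DIM('a)))"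
   using C by (subst C(2)[symmetric]) (simp add: ennreal_mult' r_def d_def mult.commute)
  finally show "(NN s. ennreal (s powr (b - 1) * heat s x) * indicator {0<..} s) = ennreal (enn2real I * norm x powr (2 * b - real DIM('a)))" .
 qed
qed

section \<open>Correlations and the heat flow\<close>

lemma abs_integral_le:
 fixes f g :: "'a => real"
 assumes "integrable M g" "!!x. \<bar>f x\<bar> <= g x"
 shows "\<bar>LINT x|M. f x\<bar> <= (LINT x|M. g x)"
 by (rule order_trans[OF integral_abs_bound integral_mono'[OF assms(1)]])
  (use assms(2) order_trans[OF abs_ge_zero assms(2)] in auto)

text \<open>The correlation of \<open>u\<close> and \<open>v\<close>. All quadratic expressions below are integrals of a kernel against the
correlation of a function with itself.\<close>

definition corr :: "('a::euclidean_space => real) => ('a => real) => 'a => real" where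
 "corr u v z = (LINT x|lborel. u x * v (x + z))"

definition heat_flow :: "real => ('a::euclidean_space => real) => 'a => real" where
 "heat_flow t v x = (LINT z|lborel. heat t z * v (x + z))"

text \<open>The form \<open>\<langle>P\<^sub>t v, v\<rangle>\<close> of the heat semigroup, written as an integral against the correlation.\<close>

definition heat_form :: "('a::euclidean_space => real) => real => real" where
 "heat_form v t = (LINT z|lborel. heat t z * corr v v z)"

text \<open>All the regularity that the heat flow needs; in this form it makes sense on every Euclidean space.\<close>

definition Cc_fun :: "('a::euclidean_space => real) => bool" where
 "Cc_fun v \<longleftrightarrow> continuous_on UNIV v \<and> bounded {x. v x ~= 0}"

lemma Cc_fun_test: "\<phi> \<in> test_functions \<Omega> ==> Cc_fun \<phi>"
 by (simp add: Cc_fun_def test_functions_continuous test_functions_bounded_support)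

lemma Cc_fun_bounds:
 assumes "Cc_fun v"
 obtains B R where "0 <= B" "0 <= R" "!!x. \<bar>v x\<bar> <= B" "!!x. \<bar>v x\<bar> <= B * indicator (cball 0 R) x" "!!x. x \<notin> cball 0 R ==> v x = 0"
proof -
 obtain R0 where R0: "!!x. v x ~= 0 ==> norm x <= R0" using assms by (auto simp: Cc_fun_def bounded_iff)
 have v: "continuous_on UNIV v" "bounded {x. v x ~= 0}" using assms by (simp_all add: Cc_fun_def)
 obtain B where B: "0 <= B" "!!x. \<bar>v x\<bar> <= B"
  by (rule continuous_bounded_support_bounded[OF v]) (simp, rule that)
 have z: "v x = 0" if "x \<notin> cball 0 (max 0 R0)" for x using R0[of x] that by fastforce
 have i: "\<bar>v x\<bar> <= B * indicator (cball 0 (max 0 R0)) x" for x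
  using B(2)[of x] z[of x] by (cases "x \<in> cball 0 (max 0 R0)") simp_all
 show thesis by (rule that[OF B(1) max.cobounded1 B(2) i z])
qed

lemma Cc_fun_borel [measurable_dest]: "Cc_fun v ==> v \<in> \<B>"
 by (auto simp: Cc_fun_def intro: borel_measurable_continuous_onI)

lemma Cc_fun_integrable: "Cc_fun v ==> integrable lborel v"
 unfolding Cc_fun_def by (elim conjE) (rule integrable_continuous_bounded_support, auto)

lemma Cc_fun_translate: "Cc_fun v ==> Cc_fun (%x. v (x + z))"
proof -
 assume v: "Cc_fun v"
 have "{x. v (x + z) ~= 0} = (%x. - z + x) ` {x. v x ~= 0}"
  by (auto simp: image_iff intro!: exI[of _ "_ + z"])
 then show ?thesis using v unfolding Cc_fun_def
  using bounded_translation[of "{x. v x ~= 0}" "- z"]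
  by (auto intro!: continuous_on_compose2[of UNIV v] continuous_intros)
qed

lemma integrable_product_mult:
 fixes f :: "'a::euclidean_space => real" and g :: "'b::euclidean_space => real"
 assumes f: "integrable lborel f" and g: "integrable lborel g"
 shows "integrable (lborel \<Otimes>\<^sub>M lborel) (%(x, y). f x * g y)"
proof -
 have [measurable]: "f \<in> borel_measurable lborel" "g \<in> borel_measurable lborel" using assms by auto
 show ?thesis
 proof (rule lborel_pair.Fubini_integrable)
  have "integrable lborel (%x. \<bar>f x\<bar> * (LINT y|lborel. \<bar>g y\<bar>))" using f by (intro integrable_mult_left integrable_abs)
  then show "integrable lborel (%x. LINT y|lborel. norm (case (x, y) of (x, y) => f x * g y))"
   by (simp add: abs_mult)
  show "AE x in lborel. integrable lborel (%y. case (x, y) of (x, y) => f x * g y)"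
   using g by simp
 qed measurable
qed

lemma corr_kernel_Fubini:
 fixes u v K :: "'a::euclidean_space => real"
 assumes u: "Cc_fun u" and v: "Cc_fun v" and K: "K \<in> \<B>"
  and K_loc: "!!R. integrable lborel (%z. indicator (cball 0 R) z * K z)"
 shows "integrable (lborel \<Otimes>\<^sub>M lborel) (%(z, x). K z * (u x * v (x + z)))"
  and "(LINT z|lborel. K z * corr u v z) = (LINT x|lborel. u x * (LINT z|lborel. K z * v (x + z)))"
proof -
 obtain B R where B: "0 <= B" "0 <= R" "!!x. \<bar>u x\<bar> <= B" "!!x. \<bar>u x\<bar> <= B * indicator (cball 0 R) x" "!!x. x \<notin> cball 0 R ==> u x = 0"
  by (rule Cc_fun_bounds[OF u]) (rule that)
 obtain B' R' where B': "0 <= B'" "0 <= R'" "!!x. \<bar>v x\<bar> <= B'"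
  "!!x. \<bar>v x\<bar> <= B' * indicator (cball 0 R') x" "!!x. x \<notin> cball 0 R' ==> v x = 0"
  by (rule Cc_fun_bounds[OF v]) (rule that)
 have [measurable]: "u \<in> \<B>" "v \<in> \<B>" "K \<in> \<B>"
  using u v K by (auto intro: Cc_fun_borel)
 have "integrable lborel (%x. B * B' * indicator (cball 0 R) x :: real)"
  by (auto intro!: integrable_real_indicator emeasure_bounded_finite)
 from integrable_product_mult[OF integrable_abs[OF K_loc[of "R + R'"]] this]
 have I: "integrable (lborel \<Otimes>\<^sub>M lborel) (%(z, x). \<bar>indicator (cball 0 (R + R')) z * K z\<bar> * (B * B' * indicator (cball (0::'a) R) x))" .
 show int: "integrable (lborel \<Otimes>\<^sub>M lborel) (%(z, x). K z * (u x * v (x + z)))"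
 proof (rule Bochner_Integration.integrable_bound[OF I])
  have "norm (K z * (u x * v (x + z))) <= \<bar>indicator (cball 0 (R + R')) z * K z\<bar> * (B * B' * indicator (cball (0::'a) R) x)" for z x
  proof (cases "x \<in> cball 0 R \<and> x + z \<in> cball 0 R'")
   case True
   have "norm z <= norm (x + z) + norm x" using norm_triangle_ineq4[of "x + z" x] by simp
   then have "z \<in> cball 0 (R + R')" using True by simp
   moreover have "\<bar>u x * v (x + z)\<bar> <= B * B'" unfolding abs_mult by (intro mult_mono B B') auto
   ultimately show ?thesis using True by (simp add: abs_mult mult_left_mono)
  next
   case False
   then show ?thesis using B B' by (auto simp: abs_mult)
  qed
  then show "AE p in lborel \<Otimes>\<^sub>M lborel. norm (case p of (z, x) => K z * (u x * v (x + z)))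
   <= norm (case p of (z, x) => \<bar>indicator (cball 0 (R + R')) z * K z\<bar> * (B * B' * indicator (cball (0::'a) R) x))"
   by (intro AE_I2) (auto intro: order_trans[OF _ abs_ge_self])
 qed measurable
 have "(LINT z|lborel. K z * corr u v z) = (LINT z|lborel. LINT x|lborel. K z * (u x * v (x + z)))"
  by (simp add: corr_def)
 also have "... = (LINT x|lborel. LINT z|lborel. K z * (u x * v (x + z)))"
  using lborel_pair.Fubini_integral[OF int] by simp
 also have "... = (LINT x|lborel. u x * (LINT z|lborel. K z * v (x + z)))"
 proof (intro Bochner_Integration.integral_cong refl)
  fix x
  have "(LINT z|lborel. K z * (u x * v (x + z))) = (LINT z|lborel. u x * (K z * v (x + z)))"
   by (simp only: mult.left_commute)
  then show "(LINT z|lborel. K z * (u x * v (x + z))) = u x * (LINT z|lborel. K z * v (x + z))" by simp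
 qed
 finally show "(LINT z|lborel. K z * corr u v z) = (LINT x|lborel. u x * (LINT z|lborel. K z * v (x + z)))" .
qed

lemma continuous_imp_locally_integrable_lborel:
 fixes K :: "'a::euclidean_space => real"
 assumes "continuous_on UNIV K"
 shows "integrable lborel (%z. indicator (cball 0 R) z * K z)"
proof -
 have "integrable lborel (%z. indicator (cball 0 R) z *\<^sub>R K z)"
  by (rule borel_integrable_compact[OF compact_cball continuous_on_subset[OF assms]]) simp
 then show ?thesis by simp
qed

lemma partial_deriv_translate:
 assumes "v differentiable at (x + z)"
 shows "partial_deriv j (%x. v (x + z)) x = partial_deriv j v (x + z)" "(%x. v (x + z)) differentiable at x"
proof -
 have "(v has_derivative frechet_derivative v (at (x + z))) (at (x + z))"
  using assms frechet_derivative_works by blast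
 then have d: "((%x. v (x + z)) has_derivative frechet_derivative v (at (x + z))) (at x)"
 proof -
  have "((%x. x + z) has_derivative (%h. h)) (at x)"
   using has_derivative_add[OF has_derivative_ident has_derivative_const] by simp
  from diff_chain_at[OF this \<open>(v has_derivative _) _\<close>] show ?thesis by (simp add: o_def)
 qed
 show "partial_deriv j (%x. v (x + z)) x = partial_deriv j v (x + z)"
  using partial_deriv_eqI[OF d] by (simp add: partial_deriv_def)
 show "(%x. v (x + z)) differentiable at x" using d by (auto simp: differentiable_def)
qed

lemma C1_fun_translate:
 assumes "C1_fun v"
 shows "C1_fun (%x. v (x + z))" "partial_deriv j (%x. v (x + z)) = (%x. partial_deriv j v (x + z))"
proof -
 have d: "v differentiable at x" for x using assms by (simp add: C1_fun_def)
 show eq: "partial_deriv j (%x. v (x + z)) = (%x. partial_deriv j v (x + z))" for j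
  by (rule ext) (rule partial_deriv_translate(1)[OF d])
 have cv: "continuous_on UNIV (partial_deriv j v)" for j using assms by (simp add: C1_fun_def)
 have ct: "continuous_on UNIV (%x. x + z)" by (intro continuous_intros)
 have c: "continuous_on UNIV (%x. partial_deriv j v (x + z))" for j
  by (rule continuous_on_compose2[OF cv ct subset_UNIV])
 show "C1_fun (%x. v (x + z))"
  unfolding C1_fun_def
 proof (intro conjI allI)
  show "(%x. v (x + z)) differentiable at x" for x by (rule partial_deriv_translate(2)[OF d])
  show "continuous_on UNIV (partial_deriv j (%x. v (x + z)))" for j unfolding eq by (rule c)
 qed
qed

lemma corr_partial_deriv:
 assumes "u \<in> test_functions \<Omega>" "v \<in> test_functions \<Omega>'"
 shows "corr u (partial_deriv j v) z = - corr (partial_deriv j u) v z"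
proof -
 have "(LINT x|lborel. partial_deriv j u x * v (x + z)) = - (LINT x|lborel. u x * partial_deriv j (%x. v (x + z)) x)"
 proof (rule integral_by_parts_partial)
  show "C1_fun u" by (rule test_functions_C1[OF assms(1)])
  show "C1_fun (%x. v (x + z))" by (rule C1_fun_translate(1)[OF test_functions_C1[OF assms(2)]])
  show "bounded {x. u x ~= 0}" by (rule test_functions_bounded_support[OF assms(1)])
 qed simp
 then show ?thesis unfolding corr_def C1_fun_translate(2)[OF test_functions_C1[OF assms(2)]] by simp
qed

lemma kernel_corr_by_parts:
 fixes K :: "real^'n => real"
 assumes K: "C1_fun K" and u: "u \<in> test_functions \<Omega>" and v: "v \<in> test_functions \<Omega>'"
 shows "(LINT z|lborel. partial_deriv j K z * corr u v z) = - (LINT z|lborel. K z * corr u (partial_deriv j v) z)"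
proof -
 have cK: "continuous_on UNIV K" by (rule C1_fun_continuous[OF K])
 have cK': "continuous_on UNIV (partial_deriv j K)" using K by (simp add: C1_fun_def)
 have v': "partial_deriv j v \<in> test_functions \<Omega>'" by (rule test_functions_partial_deriv[OF v])
 note F = corr_kernel_Fubini(2)[OF Cc_fun_test[OF u] Cc_fun_test borel_measurable_continuous_onI continuous_imp_locally_integrable_lborel]
 have "(LINT z|lborel. partial_deriv j K z * v (x + z)) = - (LINT z|lborel. K z * partial_deriv j v (x + z))" for x
 proof -
  have C1: "C1_fun (%z. v (z + x))" by (rule C1_fun_translate(1)[OF test_functions_C1[OF v]])
  have "(LINT z|lborel. partial_deriv j (%z. v (z + x)) z * K z) = - (LINT z|lborel. v (z + x) * partial_deriv j K z)"
  proof (rule integral_by_parts_partial[OF C1 K])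
   show "bounded {z. v (z + x) ~= 0}" using Cc_fun_translate[OF Cc_fun_test[OF v], of x] by (simp add: Cc_fun_def)
  qed auto
  then show ?thesis unfolding C1_fun_translate(2)[OF test_functions_C1[OF v]] by (simp add: mult.commute add.commute)
 qed
 then show ?thesis
  unfolding F[OF v cK' cK'] F[OF v' cK cK] by simp
qed

lemma corr_bound:
 assumes "Cc_fun u" "Cc_fun v"
 obtains M where "0 <= M" "!!z. \<bar>corr u v z\<bar> <= M"
proof -
 obtain B where B: "0 <= B" "!!x. \<bar>v x\<bar> <= B" by (rule Cc_fun_bounds[OF assms(2)]) (rule that)
 note [measurable] = Cc_fun_borel[OF assms(1)] Cc_fun_borel[OF assms(2)]
 have iu: "integrable lborel (%x. \<bar>u x\<bar> * B)" using Cc_fun_integrable[OF assms(1)] by simp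
 have "\<bar>corr u v z\<bar> <= (LINT x|lborel. \<bar>u x\<bar> * B)" for z
  unfolding corr_def
  by (rule abs_integral_le[OF iu]) (simp add: abs_mult mult_left_mono B)
 moreover have "0 <= (LINT x|lborel. \<bar>u x\<bar> * B)" using B by (intro integral_nonneg_AE) auto
 ultimately show thesis using that by blast
qed

lemma corr_borel [measurable]: "Cc_fun u ==> Cc_fun v ==> corr u v \<in> \<B>"
proof -
 assume "Cc_fun u" "Cc_fun v"
 note [measurable] = Cc_fun_borel[OF this(1)] Cc_fun_borel[OF this(2)]
 show ?thesis unfolding corr_def[abs_def] by measurable
qed

lemma corr_continuous:
 assumes "Cc_fun u" "Cc_fun v" shows "continuous_on UNIV (corr u v)"
proof (clarsimp simp: continuous_on_sequentially o_def)
 fix zs :: "nat => 'a" and z assume z: "zs \<longlonglongrightarrow> z"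
 obtain B where B: "0 <= B" "!!x. \<bar>v x\<bar> <= B" by (rule Cc_fun_bounds[OF assms(2)]) (rule that)
 note [measurable] = Cc_fun_borel[OF assms(1)] Cc_fun_borel[OF assms(2)]
 show "(%n. corr u v (zs n)) \<longlonglongrightarrow> corr u v z"
  unfolding corr_def
 proof (rule integral_dominated_convergence[where w = "%x. \<bar>u x\<bar> * B"])
  show "integrable lborel (%x. \<bar>u x\<bar> * B)" using Cc_fun_integrable[OF assms(1)] by simp
  have "isCont v x" for x using assms(2) by (simp add: Cc_fun_def continuous_on_eq_continuous_at)
  then show "AE x in lborel. (%n. u x * v (x + zs n)) \<longlonglongrightarrow> u x * v (x + z)"
   by (intro AE_I2 tendsto_mult tendsto_const isCont_tendsto_compose[of _ v] tendsto_add z)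
  show "AE x in lborel. norm (u x * v (x + zs n)) <= \<bar>u x\<bar> * B" for n
   using B by (intro AE_I2) (auto simp: abs_mult intro!: mult_left_mono)
 qed measurable
qed

lemma heat_continuous: "0 < t ==> continuous_on UNIV (heat t :: 'a::euclidean_space => real)"
 unfolding heat_def[abs_def] by (intro continuous_intros) auto

lemma heat_flow_eq:
 assumes "Cc_fun v"
 shows "heat_flow t v x = (LINT y|lborel. heat t (x - y) * v y)"
proof -
 note [measurable] = Cc_fun_borel[OF assms]
 have "(LINT y|lborel. heat t (y - x) * v y) = (LINT z|lborel. heat t ((z + x) - x) * v (z + x))"
  by (rule integral_lborel_translate[symmetric]) measurable
 moreover have "heat t (y - x) = heat t (x - y)" for y using heat_minus[of t "x - y"] by simp
 ultimately show ?thesis by (simp add: heat_flow_def add.commute)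
qed

lemma heat_flow_borel [measurable (raw)]:
 assumes "Cc_fun v" and [measurable]: "f \<in> borel_measurable M" "g \<in> borel_measurable M"
 shows "(%p. heat_flow (f p) v (g p)) \<in> borel_measurable M"
proof -
 note [measurable] = Cc_fun_borel[OF assms(1)]
 have "case_prod (%t. heat_flow t v) \<in> borel_measurable (borel \<Otimes>\<^sub>M borel)"
  unfolding heat_flow_def[abs_def] by measurable
 then have "(%p. case_prod (%t. heat_flow t v) (f p, g p)) \<in> borel_measurable M" by measurable
 then show ?thesis by simp
qed

lemma heat_form_borel [measurable (raw)]:
 assumes "Cc_fun v" and [measurable]: "f \<in> borel_measurable M"
 shows "(%p. heat_form v (f p)) \<in> borel_measurable M"
proof -
 note [measurable] = corr_borel[OF assms(1) assms(1)]
 have "heat_form v \<in> \<B>" unfolding heat_form_def[abs_def] by measurable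
 then show ?thesis by measurable
qed

lemma heat_flow_bound:
 fixes v :: "'a::euclidean_space => real"
 assumes "Cc_fun v" "0 < t" "!!x. \<bar>v x\<bar> <= B"
 shows "\<bar>heat_flow t v x\<bar> <= B"
proof -
 note [measurable] = Cc_fun_borel[OF assms(1)]
 have "\<bar>heat_flow t v x\<bar> <= (LINT z|lborel. heat t (z :: 'a) * B)"
  unfolding heat_flow_def
  by (rule abs_integral_le) (simp_all add: abs_mult mult_left_mono assms(2,3))
 then show ?thesis using assms(2) by (simp add: integral_heat)
qed

lemma heat_flow_semigroup:
 assumes v: "Cc_fun v" and st: "0 < s" "0 < t"
 shows "(LINT x|lborel. heat s (y - x) * heat_flow t v x) = heat_flow (s + t) v y"
proof -
 note [measurable] = Cc_fun_borel[OF v]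
 obtain B where B: "0 <= B" "!!x. \<bar>v x\<bar> <= B" by (rule Cc_fun_bounds[OF v]) (rule that)
 have int: "integrable (lborel \<Otimes>\<^sub>M lborel) (%(y', x). heat s (y - x) * (heat t (x - y') * v y'))"
 proof (rule integrableI_bounded)
  have "(\<integral>\<^sup>+p. ennreal (norm (case p of (y', x) => heat s (y - x) * (heat t (x - y') * v y'))) \<partial>(lborel \<Otimes>\<^sub>M lborel))
   = (NN y'. (NN x. ennreal (norm (heat s (y - x) * (heat t (x - y') * v y')))))"
   by (subst lborel.nn_integral_fst[symmetric]) auto
  also have "... = (NN y'. (NN x. ennreal \<bar>v y'\<bar> * ennreal (heat s (y - x) * heat t (y' - x))))"
  proof (intro nn_integral_cong)
   fix x y' :: 'a
   have "heat t (x - y') = heat t (y' - x)" using heat_minus[of t "x - y'"] by simp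
   then show "ennreal (norm (heat s (y - x) * (heat t (x - y') * v y'))) = ennreal \<bar>v y'\<bar> * ennreal (heat s (y - x) * heat t (y' - x))"
    by (simp add: abs_mult ennreal_mult[symmetric] ac_simps)
  qed
  also have "... = (NN y'. ennreal \<bar>v y'\<bar> * ennreal (heat (s + t) (y - y')))"
   by (subst nn_integral_cmult) (auto simp: nn_integral_heat_semigroup[OF st])
  also have "... <= (NN y'. ennreal B * ennreal (heat (s + t) (y' - y)))"
  proof (intro nn_integral_mono mult_mono)
   show "ennreal (heat (s + t) (y - y')) <= ennreal (heat (s + t) (y' - y))" for y'
    using heat_minus[of "s + t" "y - y'"] by simp
  qed (use B in \<open>auto intro: ennreal_leI\<close>)
  also have "... = ennreal B * (NN y'. ennreal (heat (s + t) (y' + (- y))))"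
   by (simp add: nn_integral_cmult)
  also have "... = ennreal B" using st by (subst nn_integral_lborel_translate) (auto simp: nn_integral_heat)
  finally show "(\<integral>\<^sup>+p. ennreal (norm (case p of (y', x) => heat s (y - x) * (heat t (x - y') * v y'))) \<partial>(lborel \<Otimes>\<^sub>M lborel)) < \<infinity>"
   using order_le_less_trans by fastforce
 qed measurable
 have "(LINT x|lborel. heat s (y - x) * heat_flow t v x) = (LINT x|lborel. LINT y'|lborel. heat s (y - x) * (heat t (x - y') * v y'))"
  by (simp add: heat_flow_eq[OF v])
 also have "... = (LINT y'|lborel. LINT x|lborel. heat s (y - x) * (heat t (x - y') * v y'))"
  using lborel_pair.Fubini_integral[OF int] by simp
 also have "... = (LINT y'|lborel. heat (s + t) (y - y') * v y')"
 proof (intro Bochner_Integration.integral_cong refl)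
  fix y' :: 'a
  have sym: "heat t (x - y') = heat t (y' - x)" for x :: 'a using heat_minus[of t "x - y'"] by simp
  have "(LINT x|lborel. heat s (y - x) * heat t (y' - x)) = heat (s + t) (y - y')"
   using nn_integral_heat_semigroup[OF st, of y y']
   by (subst integral_eq_nn_integral) auto
  then have "(LINT x|lborel. (heat s (y - x) * heat t (y' - x)) * v y') = heat (s + t) (y - y') * v y'"
   by simp
  then show "(LINT x|lborel. heat s (y - x) * (heat t (x - y') * v y')) = heat (s + t) (y - y') * v y'"
   by (simp add: sym mult.assoc)
 qed
 also have "... = heat_flow (s + t) v y" by (simp add: heat_flow_eq[OF v])
 finally show ?thesis .
qed

lemma heat_form_eq:
 assumes "Cc_fun v" "0 < t"
 shows "heat_form v t = (LINT x|lborel. v x * heat_flow t v x)"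
 unfolding heat_form_def heat_flow_def
 by (rule corr_kernel_Fubini(2)[OF assms(1) assms(1)
    borel_measurable_continuous_onI[OF heat_continuous[OF assms(2)]]
    continuous_imp_locally_integrable_lborel[OF heat_continuous[OF assms(2)]]])

text \<open>Symmetry and semigroup property: \<open>\<langle>P\<^sub>s v, P\<^sub>t v\<rangle> = \<langle>P\<^bsub>s+t\<^esub> v, v\<rangle>\<close>.\<close>

lemma heat_flow_inner:
 fixes v :: "'a::euclidean_space => real"
 assumes v: "Cc_fun v" and st: "0 < s" "0 < t"
 shows "integrable lborel (%x. heat_flow s v x * heat_flow t v x)"
  and "(LINT x|lborel. heat_flow s v x * heat_flow t v x) = heat_form v (s + t)"
proof -
 note [measurable] = Cc_fun_borel[OF v] heat_flow_borel[OF v]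
 obtain B where B: "0 <= B" "!!x. \<bar>v x\<bar> <= B" by (rule Cc_fun_bounds[OF v]) (rule that)
 have int: "integrable (lborel \<Otimes>\<^sub>M lborel) (%(y, x). (heat s (x - y) * v y) * heat_flow t v x)"
 proof (rule integrableI_bounded)
  have "(\<integral>\<^sup>+p. ennreal (norm (case p of (y, x) => (heat s (x - y) * v y) * heat_flow t v x)) \<partial>(lborel \<Otimes>\<^sub>M lborel))
   = (NN y. (NN x. ennreal (norm ((heat s (x - y) * v y) * heat_flow t v x))))"
   by (subst lborel.nn_integral_fst[symmetric]) auto
  also have "... <= (NN y. (NN x. ennreal (B * \<bar>v y\<bar>) * ennreal (heat s (x + (- y)))))"
  proof (intro nn_integral_mono)
   fix x y
   have "\<bar>heat_flow t v x\<bar> <= B" by (rule heat_flow_bound[OF v st(2) B(2)])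
   then have "norm ((heat s (x - y) * v y) * heat_flow t v x) <= (heat s (x - y) * \<bar>v y\<bar>) * B"
    by (simp add: abs_mult mult_left_mono)
   then show "ennreal (norm ((heat s (x - y) * v y) * heat_flow t v x)) <= ennreal (B * \<bar>v y\<bar>) * ennreal (heat s (x + (- y)))"
    using B(1) by (simp add: ennreal_mult[symmetric] ac_simps ennreal_leI)
  qed
  also have "... = (NN y. ennreal (B * \<bar>v y\<bar>))"
   by (subst nn_integral_cmult, measurable, subst nn_integral_lborel_translate) (auto simp: nn_integral_heat[OF st(1)])
  also have "... < \<infinity>"
   using Cc_fun_integrable[OF v] B(1)
   by (simp add: integrable_iff_bounded ennreal_mult nn_integral_cmult ennreal_mult_less_top)
  finally show "(\<integral>\<^sup>+p. ennreal (norm (case p of (y, x) => (heat s (x - y) * v y) * heat_flow t v x)) \<partial>(lborel \<Otimes>\<^sub>M lborel)) < \<infinity>" .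
 qed measurable
 have eq: "heat_flow s v x * heat_flow t v x = (LINT y|lborel. (heat s (x - y) * v y) * heat_flow t v x)" for x
  by (simp add: heat_flow_eq[OF v, of s])
 show "integrable lborel (%x. heat_flow s v x * heat_flow t v x)"
  unfolding eq using lborel_pair.integrable_snd[OF int] by simp
 have "(LINT x|lborel. heat_flow s v x * heat_flow t v x) = (LINT y|lborel. LINT x|lborel. (heat s (x - y) * v y) * heat_flow t v x)"
  unfolding eq using lborel_pair.Fubini_integral[OF int] by simp
 also have "... = (LINT y|lborel. v y * heat_flow (s + t) v y)"
 proof (intro Bochner_Integration.integral_cong refl)
  fix y :: 'a
  have "heat s (x - y) = heat s (y - x)" for x :: 'a using heat_minus[of s "x - y"] by simp
  then show "(LINT x|lborel. (heat s (x - y) * v y) * heat_flow t v x) = v y * heat_flow (s + t) v y"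
   using heat_flow_semigroup[OF v st, of y, symmetric] by (simp add: ac_simps)
 qed
 also have "... = heat_form v (s + t)" using st by (simp add: heat_form_eq[OF v])
 finally show "(LINT x|lborel. heat_flow s v x * heat_flow t v x) = heat_form v (s + t)" .
qed

lemma heat_form_nonneg: "Cc_fun v ==> 0 < t ==> 0 <= heat_form v t"
proof -
 assume "Cc_fun v" "0 < t"
 then have "heat_form v t = (LINT x|lborel. heat_flow (t / 2) v x * heat_flow (t / 2) v x)"
  using heat_flow_inner(2)[of v "t/2" "t/2"] by simp
 also have "... \<ge> 0" by (intro integral_nonneg_AE AE_I2) simp
 finally show ?thesis .
qed

lemma heat_flow_square:
 assumes "Cc_fun v" "0 < s"
 shows "(NN x. ennreal ((heat_flow s v x)\<^sup>2)) = ennreal (heat_form v (2 * s))"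
proof -
 have "(NN x. ennreal (heat_flow s v x * heat_flow s v x)) = ennreal (LINT x|lborel. heat_flow s v x * heat_flow s v x)"
  by (rule nn_integral_eq_integral[OF heat_flow_inner(1)[OF assms(1) assms(2) assms(2)]]) simp
 then show ?thesis
  by (simp only: heat_flow_inner(2)[OF assms(1) assms(2) assms(2)] power2_eq_square mult_2)
qed

section \<open>The heat equation in weak form\<close>

lemma heat_has_derivative:
 fixes x :: "real^'n"
 assumes "0 < t"
 shows "(heat t has_derivative (%h. - (x \<bullet> h) / (2 * t) * heat t x)) (at x)"
proof -
 have "((%x. (4 * pi * t) powr (- real DIM(real^'n) / 2) * exp (- (x \<bullet> x) / (4 * t))) has_derivative
  (%h. (4 * pi * t) powr (- real DIM(real^'n) / 2) * (exp (- (x \<bullet> x) / (4 * t)) * (- (x \<bullet> h + h \<bullet> x) / (4 * t))))) (at x)"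
  using assms by (auto intro!: derivative_eq_intros simp: field_simps)
 then show ?thesis
  unfolding heat_def[abs_def] power2_norm_eq_inner
  by (rule has_derivative_eq_rhs) (auto simp: fun_eq_iff inner_commute field_simps)
qed

lemma heat_C1:
 fixes t :: real and j :: "'n::finite"
 assumes t: "0 < t"
 defines "K \<equiv> %x :: real^'n. - (x $ j) / (2 * t) * heat t x"
 shows "C1_fun (heat t :: real^'n => real)" "partial_deriv j (heat t) = K"
  "C1_fun K" "partial_deriv j K z = ((z $ j)\<^sup>2 / (4 * t\<^sup>2) - 1 / (2 * t)) * heat t z"
proof -
 have pd: "partial_deriv i (heat t) = (%x :: real^'n. - (x $ i) / (2 * t) * heat t x)" for i
  using partial_deriv_eqI[OF heat_has_derivative[OF t]] by (auto simp: inner_axis)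
 have hd: "heat t differentiable at x" for x :: "real^'n"
  using heat_has_derivative[OF t] by (auto simp: differentiable_def)
 have ch: "continuous_on UNIV (heat t :: real^'n => real)" by (rule heat_continuous[OF t])
 show C: "C1_fun (heat t :: real^'n => real)"
  unfolding C1_fun_def pd using hd t by (auto intro!: continuous_intros ch)
 show "partial_deriv j (heat t) = K" by (simp add: pd K_def)
 have ld: "((%x :: real^'n. - (x $ j) / (2 * t)) has_derivative (%h. - (h $ j) / (2 * t))) (at x)" for x
  by (rule bounded_linear_imp_has_derivative)
   (use bounded_linear_compose[OF bounded_linear_mult_right[of "- 1 / (2 * t)"] bounded_linear_vec_nth[of j]] in \<open>simp add: o_def\<close>)
 have pl: "partial_deriv i (%x :: real^'n. - (x $ j) / (2 * t)) = (%x. - (axis i 1 $ j) / (2 * t))" for i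
  by (rule ext) (rule partial_deriv_eqI[OF ld])
 have "C1_fun (%x :: real^'n. - (x $ j) / (2 * t))"
  unfolding C1_fun_def pl using ld by (auto simp: differentiable_def)
 from C1_fun_mult[OF this C] show "C1_fun K" by (simp add: K_def)
 have "partial_deriv j K z = partial_deriv j (%x. - (x $ j) / (2 * t)) z * heat t z + - (z $ j) / (2 * t) * partial_deriv j (heat t) z"
  unfolding K_def by (rule partial_deriv_mult) (use ld hd in \<open>auto simp: differentiable_def\<close>)
 then show "partial_deriv j K z = ((z $ j)\<^sup>2 / (4 * t\<^sup>2) - 1 / (2 * t)) * heat t z"
  unfolding pl pd using t by (simp add: power2_eq_square field_simps)
qed

text \<open>Two integrations by parts move both derivatives onto the heat kernel.\<close>

lemma heat_form_partial_deriv: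
 fixes \<phi> :: "real^'n => real"
 assumes \<phi>: "\<phi> \<in> test_functions \<Omega>" and t: "0 < t"
 shows "heat_form (partial_deriv j \<phi>) t = - (LINT z|lborel. ((z $ j)\<^sup>2 / (4 * t\<^sup>2) - 1 / (2 * t)) * heat t z * corr \<phi> \<phi> z)"
proof -
 let ?d = "partial_deriv j :: (real^'n => real) => _"
 have d1: "?d \<phi> \<in> test_functions \<Omega>" by (rule test_functions_partial_deriv[OF \<phi>])
 have "heat_form (?d \<phi>) t = - (LINT z|lborel. heat t z * corr \<phi> (?d (?d \<phi>)) z)"
  unfolding heat_form_def corr_partial_deriv[OF \<phi> d1] by simp
 also have "... = (LINT z|lborel. ?d (heat t) z * corr \<phi> (?d \<phi>) z)"
  unfolding kernel_corr_by_parts[OF heat_C1(1)[OF t] \<phi> d1] ..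
 also have "... = - (LINT z|lborel. ?d (%x. - (x $ j) / (2 * t) * heat t x) z * corr \<phi> \<phi> z)"
  unfolding kernel_corr_by_parts[OF heat_C1(3)[OF t] \<phi> \<phi>] heat_C1(2)[OF t] by simp
 finally show ?thesis unfolding heat_C1(4)[OF t] .
qed

text \<open>The quadratic factor is absorbed by half of the Gaussian, at the price of doubling the time.\<close>

lemma norm_sq_heat_bound:
 fixes z :: "'a::euclidean_space"
 assumes t: "0 < t"
 shows "(norm z)\<^sup>2 / (4 * t) * heat t z <= 2 * 2 powr (real DIM('a) / 2) * heat (2 * t) z"
proof -
 define y where "y = (norm z)\<^sup>2 / (4 * t)"
 define d where "d = real DIM('a)"
 have y: "0 <= y" using t by (simp add: y_def)
 have "y * exp (- y) = 2 * ((y / 2) ^ 1 * exp (- (y / 2))) * exp (- (y / 2))"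
  by (simp add: exp_add[symmetric])
 also have "... <= 2 * fact 1 * exp (- (y / 2))"
  using power_exp_bound[of "y / 2" 1] y by (intro mult_right_mono mult_left_mono) auto
 finally have e: "y * exp (- y) <= 2 * exp (- (y / 2))" by simp
 have "y * heat t z = (4 * pi * t) powr (- d / 2) * (y * exp (- y))"
  by (simp add: heat_def y_def d_def)
 also have "... <= (4 * pi * t) powr (- d / 2) * (2 * exp (- (y / 2)))"
  by (intro mult_left_mono e) auto
 also have "... = 2 * 2 powr (d / 2) * ((4 * pi * (2 * t)) powr (- d / 2) * exp (- (y / 2)))"
 proof -
  have "(4 * pi * (2 * t)) powr (- d / 2) = ((4 * pi * t) * 2) powr (- d / 2)" by (simp add: ac_simps)
  also have "... = (4 * pi * t) powr (- d / 2) * 2 powr (- d / 2)" using t by (simp only: powr_mult zero_le_mult_iff pi_ge_zero less_imp_le zero_le_numeral simp_thms)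
  finally have "2 powr (d / 2) * (4 * pi * (2 * t)) powr (- d / 2) = (4 * pi * t) powr (- d / 2)"
   by (simp add: powr_minus)
  then show ?thesis by (simp add: ac_simps)
 qed
 also have "... = 2 * 2 powr (d / 2) * heat (2 * t) z"
  by (simp add: heat_def y_def d_def)
 finally show ?thesis by (simp add: y_def d_def)
qed

text \<open>For large times the derivatives are better placed on the heat kernel, for small times on \<open>\<phi>\<close>. The two
bounds make the time integrals in the energy identity converge at both ends.\<close>

lemma heat_form_decay:
 fixes \<phi> :: "real^'n => real"
 assumes \<phi>: "\<phi> \<in> test_functions \<Omega>"
 obtains M where "0 < M" "!!t. 0 < t ==> heat_form (partial_deriv j \<phi>) t <= M"
  "!!t. 0 < t ==> heat_form (partial_deriv j \<phi>) t <= M / t"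
proof -
 let ?v = "partial_deriv j \<phi>"
 have c: "Cc_fun \<phi>" "Cc_fun ?v" using Cc_fun_test test_functions_partial_deriv \<phi> by blast+
 note [measurable] = corr_borel[OF c(1) c(1)] corr_borel[OF c(2) c(2)]
 obtain M1 where M1: "0 <= M1" "!!z. \<bar>corr ?v ?v z\<bar> <= M1" using corr_bound[OF c(2) c(2)] by blast
 obtain M2 where M2: "0 <= M2" "!!z. \<bar>corr \<phi> \<phi> z\<bar> <= M2" using corr_bound[OF c(1) c(1)] by blast
 define k where "k = 2 * 2 powr (real CARD('n) / 2) + 1 / 2"
 have b1: "heat_form ?v t <= M1" if t: "0 < t" for t
 proof -
  have "\<bar>heat_form ?v t\<bar> <= (LINT z|lborel. heat t (z :: real^'n) * M1)"
   unfolding heat_form_def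
   by (rule abs_integral_le) (simp_all add: abs_mult mult_left_mono M1 t)
  then show ?thesis using t by (simp add: integral_heat)
 qed
 have b2: "heat_form ?v t <= M2 * k / t" if t: "0 < t" for t
 proof -
  have "heat_form ?v t <= \<bar>LINT z|lborel. ((z $ j)\<^sup>2 / (4 * t\<^sup>2) - 1 / (2 * t)) * heat t z * corr \<phi> \<phi> z\<bar>"
   unfolding heat_form_partial_deriv[OF \<phi> t] by linarith
  also have "... <= (LINT z|lborel. (2 * 2 powr (real CARD('n) / 2) * heat (2 * t) z + 1 / 2 * heat t (z :: real^'n)) * (M2 / t))"
  proof (rule abs_integral_le)
   fix z :: "real^'n"
   have "(z $ j)\<^sup>2 <= (norm z)\<^sup>2" using component_le_norm_cart[of z j] by (metis abs_ge_zero power2_abs power_mono)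
   then have "(z $ j)\<^sup>2 / (4 * t) <= (norm z)\<^sup>2 / (4 * t)" using t by (simp add: divide_right_mono)
   then have zj: "(z $ j)\<^sup>2 / (4 * t) * heat t z <= 2 * 2 powr (real CARD('n) / 2) * heat (2 * t) z"
    using norm_sq_heat_bound[OF t, of z] mult_right_mono[OF _ heat_nonneg[of t z]] by fastforce
   have "\<bar>(z $ j)\<^sup>2 / (4 * t\<^sup>2) - 1 / (2 * t)\<bar> * heat t z <= ((z $ j)\<^sup>2 / (4 * t\<^sup>2) + 1 / (2 * t)) * heat t z"
    using t by (intro mult_right_mono) (auto simp: abs_le_iff)
   also have "... = ((z $ j)\<^sup>2 / (4 * t) * heat t z + 1 / 2 * heat t z) / t"
    using t by (simp add: field_simps power2_eq_square)
   also have "... <= (2 * 2 powr (real CARD('n) / 2) * heat (2 * t) z + 1 / 2 * heat t z) / t"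
    using t zj by (intro divide_right_mono add_mono) auto
   finally have *: "\<bar>(z $ j)\<^sup>2 / (4 * t\<^sup>2) - 1 / (2 * t)\<bar> * heat t z <= (2 * 2 powr (real CARD('n) / 2) * heat (2 * t) z + 1 / 2 * heat t z) / t" .
   have "\<bar>((z $ j)\<^sup>2 / (4 * t\<^sup>2) - 1 / (2 * t)) * heat t z * corr \<phi> \<phi> z\<bar> =
    (\<bar>(z $ j)\<^sup>2 / (4 * t\<^sup>2) - 1 / (2 * t)\<bar> * heat t z) * \<bar>corr \<phi> \<phi> z\<bar>" by (simp add: abs_mult)
   also have "... <= ((2 * 2 powr (real CARD('n) / 2) * heat (2 * t) z + 1 / 2 * heat t z) / t) * M2"
    using t by (intro mult_mono * M2) auto
   finally show "\<bar>((z $ j)\<^sup>2 / (4 * t\<^sup>2) - 1 / (2 * t)) * heat t z * corr \<phi> \<phi> z\<bar>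
    <= (2 * 2 powr (real CARD('n) / 2) * heat (2 * t) z + 1 / 2 * heat t z) * (M2 / t)" by simp
  next
   show "integrable lborel (%z :: real^'n. (2 * 2 powr (real CARD('n) / 2) * heat (2 * t) z + 1 / 2 * heat t z) * (M2 / t))"
    using t by (intro integrable_mult_left Bochner_Integration.integrable_add integrable_mult_right integrable_heat) auto
  qed
  also have "... = M2 * k / t"
   using t by (simp add: integral_heat k_def Bochner_Integration.integral_add)
  finally show ?thesis .
 qed
 have k: "k > 0" by (simp add: k_def add_pos_pos)
 define M where "M = max M1 (M2 * k) + 1"
 have "M > 0" "M1 <= M" "M2 * k <= M" using M1(1) by (auto simp: M_def)
 then show thesis
  using b1 b2 by (intro that[of M]) (meson order_trans divide_right_mono less_imp_le)+
qed

section \<open>Energy dissipation along the heat flow\<close>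

lemma LIMSEQ_if_eventually_le:
 fixes f :: "nat => real"
 assumes "!!e. 0 < e ==> \<forall>\<^sub>F n in sequentially. \<bar>f n - l\<bar> <= e"
 shows "f \<longlonglongrightarrow> l"
proof (rule tendstoI)
 fix e :: real assume "0 < e"
 then have "\<forall>\<^sub>F n in sequentially. \<bar>f n - l\<bar> <= e / 2" by (intro assms) simp
 then show "\<forall>\<^sub>F n in sequentially. dist (f n) l < e"
  by (rule eventually_mono) (use \<open>0 < e\<close> in \<open>simp add: dist_real_def\<close>)
qed

text \<open>The time derivative of the heat kernel, which by the heat equation equals its Laplacian.\<close>

definition heat_rate :: "real => real^'n => real" where
 "heat_rate r z = ((norm z)\<^sup>2 / (4 * r\<^sup>2) - real CARD('n) / (2 * r)) * heat r z"

lemma heat_rate_borel [measurable (raw)]: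
 assumes [measurable]: "f \<in> borel_measurable M" "g \<in> borel_measurable M"
 shows "(%x. heat_rate (f x) (g x :: real^'n)) \<in> borel_measurable M"
 unfolding heat_rate_def by measurable

lemma heat_time_derivative:
 fixes z :: "real^'n"
 assumes r: "0 < r"
 shows "((%r. heat r z) has_real_derivative heat_rate r z) (at r)"
proof -
 define c where "c = - real DIM(real^'n) / 2"
 have d: "((%r. (4 * pi * r) powr c * exp (- (norm z)\<^sup>2 / (4 * r))) has_real_derivative
   (c * (4 * pi * r) powr (c - 1) * (4 * pi)) * exp (- (norm z)\<^sup>2 / (4 * r)) +
   (4 * pi * r) powr c * (exp (- (norm z)\<^sup>2 / (4 * r)) * ((norm z)\<^sup>2 / (4 * r\<^sup>2)))) (at r)"
  using r by (auto intro!: derivative_eq_intros simp: power2_eq_square field_simps)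
 have c: "(c * (4 * pi * r) powr (c - 1) * (4 * pi)) = (c / r) * (4 * pi * r) powr c"
  using r by (simp add: powr_diff field_simps)
 have id: "c / r * P * E + P * (E * Q) = (Q - real CARD('n) / (2 * r)) * (P * E)" for P E Q
  by (simp add: c_def algebra_simps)
 show ?thesis
  unfolding heat_rate_def heat_def[abs_def] c_def[symmetric]
  by (rule DERIV_cong[OF d[unfolded c] id])
qed

lemma heat_rate_isCont: "0 < r ==> isCont (%r. heat_rate r z) r"
 unfolding heat_rate_def heat_def by (intro continuous_intros) auto

definition grad_heat_form :: "(real^'n => real) => real => real" where
 "grad_heat_form \<phi> r = (\<Sum>j\<in>UNIV. heat_form (partial_deriv j \<phi>) r)"

lemma Cc_fun_partial_deriv: "\<phi> \<in> test_functions \<Omega> ==> Cc_fun (partial_deriv j \<phi>)"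
 by (rule Cc_fun_test[OF test_functions_partial_deriv])

lemma grad_heat_form_nonneg: "\<phi> \<in> test_functions \<Omega> ==> 0 < r ==> 0 <= grad_heat_form \<phi> r"
 unfolding grad_heat_form_def by (intro sum_nonneg heat_form_nonneg Cc_fun_partial_deriv)

lemma grad_heat_form_borel [measurable (raw)]:
 assumes "\<phi> \<in> test_functions \<Omega>" and [measurable]: "f \<in> borel_measurable M"
 shows "(%p. grad_heat_form \<phi> (f p)) \<in> borel_measurable M"
 unfolding grad_heat_form_def by (intro borel_measurable_sum heat_form_borel Cc_fun_partial_deriv[OF assms(1)] assms(2))

lemma corr_support:
 fixes \<phi> :: "'a::euclidean_space => real"
 assumes "Cc_fun \<phi>"
 obtains R where "0 <= R" "!!z. z \<notin> cball 0 R ==> corr \<phi> \<phi> z = 0"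
proof -
 obtain B R where B: "0 <= B" "0 <= R" "!!x. \<bar>\<phi> x\<bar> <= B" "!!x. \<bar>\<phi> x\<bar> <= B * indicator (cball 0 R) x" "!!x. x \<notin> cball 0 R ==> \<phi> x = 0"
  by (rule Cc_fun_bounds[OF assms]) (rule that)
 have "corr \<phi> \<phi> z = 0" if z: "z \<notin> cball 0 (2 * R)" for z
 proof -
  have "\<phi> x * \<phi> (x + z) = 0" for x
  proof (cases "x \<in> cball 0 R")
   case True
   have "norm z <= norm (x + z) + norm x" using norm_triangle_ineq4[of "x + z" x] by simp
   then have "x + z \<notin> cball 0 R" using True z by simp
   then show ?thesis using B(5) by simp
  qed (use B(5) in simp)
  then have "corr \<phi> \<phi> z = (LINT x|(lborel :: 'a measure). 0)"
   unfolding corr_def by (intro Bochner_Integration.integral_cong refl)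
  then show ?thesis by simp
 qed
 then show thesis using B(2) by (intro that[of "2 * R"]) auto
qed

lemma heat_rate_corr_integrable:
 fixes \<phi> :: "real^'n => real"
 assumes \<phi>: "Cc_fun \<phi>" and e: "0 < e"
 shows "integrable (lborel \<Otimes>\<^sub>M lborel) (%(r, z). indicator {e..t} r * heat_rate r z * corr \<phi> \<phi> z)"
proof -
 note [measurable] = corr_borel[OF \<phi> \<phi>]
 obtain R where R: "0 <= R" "!!z. z \<notin> cball 0 R ==> corr \<phi> \<phi> z = 0"
  by (rule corr_support[OF \<phi>]) (rule that)
 obtain M where M: "0 <= M" "!!z. \<bar>corr \<phi> \<phi> z\<bar> <= M" by (rule corr_bound[OF \<phi> \<phi>]) (rule that)
 define k where "k = (R\<^sup>2 / (4 * e\<^sup>2) + real CARD('n) / (2 * e)) * (4 * pi * e) powr (- real DIM(real^'n) / 2)"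
 have bound: "\<bar>heat_rate r z\<bar> <= k" if "e <= r" "z \<in> cball 0 R" for r and z :: "real^'n"
 proof -
  have r: "0 < r" using e that by simp
  have "heat r z <= (4 * pi * r) powr (- real DIM(real^'n) / 2) * 1"
   unfolding heat_def using r by (intro mult_left_mono) auto
  also have "... <= (4 * pi * e) powr (- real DIM(real^'n) / 2)"
   using e that(1) by (simp add: powr_mono2')
  finally have h: "heat r z <= (4 * pi * e) powr (- real DIM(real^'n) / 2)" .
  have "(norm z)\<^sup>2 / (4 * r\<^sup>2) <= R\<^sup>2 / (4 * e\<^sup>2)"
   using that e by (intro frac_le power_mono mult_left_mono) auto
  moreover have "real CARD('n) / (2 * r) <= real CARD('n) / (2 * e)"
   using that e by (intro divide_left_mono) auto
  moreover have "0 <= (norm z)\<^sup>2 / (4 * r\<^sup>2)" "0 <= real CARD('n) / (2 * r)" using r by auto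
  ultimately have "\<bar>(norm z)\<^sup>2 / (4 * r\<^sup>2) - real CARD('n) / (2 * r)\<bar> <= R\<^sup>2 / (4 * e\<^sup>2) + real CARD('n) / (2 * e)"
   by linarith
  then have "\<bar>(norm z)\<^sup>2 / (4 * r\<^sup>2) - real CARD('n) / (2 * r)\<bar> * heat r z <= k"
   unfolding k_def by (intro mult_mono h) (use e in auto)
  then show ?thesis by (simp add: heat_rate_def abs_mult)
 qed
 have k0: "0 <= k" using e by (simp add: k_def)
 have i1: "integrable lborel (indicator {e..t} :: real => real)"
  by (rule integrable_real_indicator) (simp_all add: emeasure_lborel_Icc_eq)
 have i2: "integrable lborel (%z :: real^'n. k * M * indicator (cball 0 R) z)"
  by (auto intro!: integrable_real_indicator emeasure_bounded_finite)
 show ?thesis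
 proof (rule Bochner_Integration.integrable_bound[OF integrable_product_mult[OF i1 i2]])
  have "\<bar>indicator {e..t} r * heat_rate r z * corr \<phi> \<phi> z\<bar> <= \<bar>indicator {e..t} r * (k * M * indicator (cball 0 R) z)\<bar>" for r and z :: "real^'n"
  proof (cases "r \<in> {e..t} \<and> z \<in> cball 0 R")
   case True
   then have "\<bar>heat_rate r z\<bar> * \<bar>corr \<phi> \<phi> z\<bar> <= k * M" using k0 M by (intro mult_mono bound) auto
   then show ?thesis using True k0 M by (simp add: abs_mult)
  next
   case False
   then show ?thesis using R(2)[of z] by auto
  qed
  then show "AE p in lborel \<Otimes>\<^sub>M lborel. norm (case p of (r, z) => indicator {e..t} r * heat_rate r z * corr \<phi> \<phi> z)
    <= norm (case p of (r, z) => indicator {e..t} r * (k * M * indicator (cball 0 R) z))"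
   by (intro AE_I2) (simp add: split_beta)
 qed measurable
qed

lemma Cc_kernel_integrable:
 fixes K :: "'a::euclidean_space => real"
 assumes "continuous_on UNIV K" "Cc_fun \<phi>"
 shows "integrable lborel (%z. K z * corr \<phi> \<phi> z)"
proof -
 obtain R where R: "0 <= R" "!!z. z \<notin> cball 0 R ==> corr \<phi> \<phi> z = 0"
  by (rule corr_support[OF assms(2)]) (rule that)
 show ?thesis
  by (rule integrable_continuous_bounded_support[OF _ bounded_cball[of 0 R]])
   (simp_all add: R(2) continuous_on_mult assms(1) corr_continuous[OF assms(2) assms(2)])
qed

text \<open>The sum over \<open>j\<close> of \<open>heat_form_partial_deriv\<close> is the Laplacian of the heat kernel.\<close>

lemma grad_heat_form_eq:
 fixes \<phi> :: "real^'n => real"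
 assumes \<phi>: "\<phi> \<in> test_functions \<Omega>" and r: "0 < r"
 shows "grad_heat_form \<phi> r = - (LINT z|lborel. heat_rate r z * corr \<phi> \<phi> z)"
proof -
 have c: "Cc_fun \<phi>" by (rule Cc_fun_test[OF \<phi>])
 let ?k = "%j (z :: real^'n). ((z $ j)\<^sup>2 / (4 * r\<^sup>2) - 1 / (2 * r)) * heat r z * corr \<phi> \<phi> z"
 have int: "integrable lborel (?k j)" for j
  by (rule Cc_kernel_integrable[OF _ c]) (use r in \<open>intro continuous_intros heat_continuous, auto\<close>)
 have "grad_heat_form \<phi> r = - (\<Sum>j\<in>UNIV. LINT z|lborel. ?k j z)"
  unfolding grad_heat_form_def heat_form_partial_deriv[OF \<phi> r] by (simp add: sum_negf)
 also have "(\<Sum>j\<in>UNIV. LINT z|lborel. ?k j z) = (LINT z|lborel. (\<Sum>j\<in>UNIV. ?k j z))"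
  by (rule Bochner_Integration.integral_sum[symmetric]) (rule int)
 also have "(%z. \<Sum>j\<in>UNIV. ?k j z) = (%z. heat_rate r z * corr \<phi> \<phi> z)"
 proof
  fix z :: "real^'n"
  have "(norm z)\<^sup>2 = (\<Sum>j\<in>UNIV. (z $ j)\<^sup>2)"
   by (simp add: power2_norm_eq_inner inner_vec_def flip: power2_eq_square)
  then have "(\<Sum>j\<in>UNIV. (z $ j)\<^sup>2 / (4 * r\<^sup>2) - 1 / (2 * r)) = (norm z)\<^sup>2 / (4 * r\<^sup>2) - real CARD('n) / (2 * r)"
   by (simp add: sum_subtractf sum_divide_distrib)
  then show "(\<Sum>j\<in>UNIV. ?k j z) = heat_rate r z * corr \<phi> \<phi> z"
   by (simp add: heat_rate_def sum_distrib_right[symmetric] mult.assoc)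
 qed
 finally show ?thesis .
qed

text \<open>Energy dissipation: the derivative of \<open>\<langle>P\<^sub>t \<phi>, \<phi>\<rangle>\<close> in \<open>t\<close> is \<open>- \<Sum>\<^sub>j \<langle>P\<^sub>t \<partial>\<^sub>j \<phi>, \<partial>\<^sub>j \<phi>\<rangle>\<close>.\<close>

lemma heat_form_FTC:
 fixes \<phi> :: "real^'n => real"
 assumes \<phi>: "\<phi> \<in> test_functions \<Omega>" and e: "0 < e" "e <= t"
 shows "(NN r. ennreal (grad_heat_form \<phi> r) * indicator {e..t} r) = ennreal (heat_form \<phi> e - heat_form \<phi> t)"
proof -
 have c: "Cc_fun \<phi>" by (rule Cc_fun_test[OF \<phi>])
 note int = heat_rate_corr_integrable[OF c e(1), of t]
 have eq: "indicator {e..t} r * grad_heat_form \<phi> r = - (LINT z|lborel. indicator {e..t} r * heat_rate r z * corr \<phi> \<phi> z)" for r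
  using e by (cases "r \<in> {e..t}") (simp_all add: grad_heat_form_eq[OF \<phi>])
 have i1: "integrable lborel (%r. indicator {e..t} r * grad_heat_form \<phi> r)"
  unfolding eq using lborel_pair.integrable_fst[OF int] by simp
 have "(LINT r|lborel. indicator {e..t} r * grad_heat_form \<phi> r)
   = - (LINT r|lborel. LINT z|lborel. indicator {e..t} r * heat_rate r z * corr \<phi> \<phi> z)"
  unfolding eq by simp
 also have "(LINT r|lborel. LINT z|lborel. indicator {e..t} r * heat_rate r z * corr \<phi> \<phi> z)
   = (LINT z|lborel. LINT r|lborel. indicator {e..t} r * heat_rate r z * corr \<phi> \<phi> z)"
  using lborel_pair.Fubini_integral[OF int] by simp
 also have "... = (LINT z|lborel. heat t z * corr \<phi> \<phi> z - heat e z * corr \<phi> \<phi> z)"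
 proof (intro Bochner_Integration.integral_cong refl)
  fix z :: "real^'n"
  have "(LINT r|lborel. heat_rate r z * indicator {e..t} r) = heat t z - heat e z"
   by (rule integral_FTC_Icc_real) (use e in \<open>auto intro: heat_time_derivative heat_rate_isCont\<close>)
  then have "(LINT r|lborel. (indicator {e..t} r * heat_rate r z)) = heat t z - heat e z"
   by (simp only: mult.commute)
  then have "(LINT r|lborel. (indicator {e..t} r * heat_rate r z) * corr \<phi> \<phi> z) = (heat t z - heat e z) * corr \<phi> \<phi> z"
   by (simp only: integral_mult_left_zero)
  then show "(LINT r|lborel. indicator {e..t} r * heat_rate r z * corr \<phi> \<phi> z) = heat t z * corr \<phi> \<phi> z - heat e z * corr \<phi> \<phi> z"
   by (simp only: left_diff_distrib)
 qed
 also have "... = heat_form \<phi> t - heat_form \<phi> e"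
  unfolding heat_form_def using e
  by (intro Bochner_Integration.integral_diff Cc_kernel_integrable[OF heat_continuous c]) auto
 finally have val: "(LINT r|lborel. indicator {e..t} r * grad_heat_form \<phi> r) = heat_form \<phi> e - heat_form \<phi> t" by simp
 have nn: "0 <= indicator {e..t} r * grad_heat_form \<phi> r" for r
  using grad_heat_form_nonneg[OF \<phi>, of r] e by (cases "r \<in> {e..t}") auto
 have "(NN r. ennreal (grad_heat_form \<phi> r) * indicator {e..t} r) = (NN r. ennreal (indicator {e..t} r * grad_heat_form \<phi> r))"
  by (intro nn_integral_cong) (simp add: indicator_def)
 also have "... = ennreal (heat_form \<phi> e - heat_form \<phi> t)"
  by (subst nn_integral_eq_integral[OF i1]) (simp_all add: nn val)
 finally show ?thesis .
qed

lemma heat_form_tendsto_0: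
 fixes \<phi> :: "'a::euclidean_space => real"
 assumes c: "Cc_fun \<phi>" and e: "!!n. 0 < e n" "e \<longlonglongrightarrow> 0"
 shows "(%n. heat_form \<phi> (e n)) \<longlonglongrightarrow> corr \<phi> \<phi> 0"
proof (rule LIMSEQ_if_eventually_le)
 fix \<eta> :: real assume \<eta>: "0 < \<eta>"
 obtain M where M: "0 <= M" "!!z. \<bar>corr \<phi> \<phi> z\<bar> <= M" by (rule corr_bound[OF c c]) (rule that)
 have "isCont (corr \<phi> \<phi>) 0" using corr_continuous[OF c c] by (simp add: continuous_on_eq_continuous_at)
 then obtain \<delta> where \<delta>: "0 < \<delta>" "!!z. dist z 0 < \<delta> ==> dist (corr \<phi> \<phi> z) (corr \<phi> \<phi> 0) < \<eta> / 2"
  using half_gt_zero[OF \<eta>] unfolding continuous_at_eps_delta by metis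
 have pt: "\<bar>corr \<phi> \<phi> z - corr \<phi> \<phi> 0\<bar> <= \<eta> / 2 + 2 * M / \<delta>\<^sup>2 * (norm z)\<^sup>2" for z
 proof (cases "norm z < \<delta>")
  case True
  then have "\<bar>corr \<phi> \<phi> z - corr \<phi> \<phi> 0\<bar> < \<eta> / 2" using \<delta>(2)[of z] by (simp add: dist_real_def)
  moreover have "0 <= 2 * M / \<delta>\<^sup>2 * (norm z)\<^sup>2" using M(1) by simp
  ultimately show ?thesis by linarith
 next
  case False
  have "\<delta>\<^sup>2 <= (norm z)\<^sup>2" using False \<delta>(1) by (intro power_mono) auto
  then have "1 <= (norm z)\<^sup>2 / \<delta>\<^sup>2" using \<delta>(1) by (simp add: le_divide_eq)
  then have "2 * M * 1 <= 2 * M * ((norm z)\<^sup>2 / \<delta>\<^sup>2)" using M(1) by (intro mult_left_mono) auto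
  moreover have "\<bar>corr \<phi> \<phi> z - corr \<phi> \<phi> 0\<bar> <= 2 * M" using M(2)[of z] M(2)[of 0] by linarith
  ultimately show ?thesis using \<eta> by simp
 qed
 define k where "k = 2 * M / \<delta>\<^sup>2 * (8 * 2 powr (real DIM('a) / 2))"
 have est: "\<bar>heat_form \<phi> t - corr \<phi> \<phi> 0\<bar> <= \<eta> / 2 + k * t" if t: "0 < t" for t
 proof -
  have "heat_form \<phi> t - corr \<phi> \<phi> 0 = (LINT z|lborel. heat t z * corr \<phi> \<phi> z) - (LINT z|lborel. heat t (z :: 'a) * corr \<phi> \<phi> 0)"
   using t by (simp add: heat_form_def integral_heat)
  also have "... = (LINT z|lborel. heat t z * corr \<phi> \<phi> z - heat t z * corr \<phi> \<phi> 0)"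
   by (rule Bochner_Integration.integral_diff[symmetric])
    (simp_all add: t Cc_kernel_integrable[OF heat_continuous[OF t] c])
  finally have eq: "heat_form \<phi> t - corr \<phi> \<phi> 0 = (LINT z|lborel. heat t z * corr \<phi> \<phi> z - heat t z * corr \<phi> \<phi> 0)" .
  have "\<bar>heat_form \<phi> t - corr \<phi> \<phi> 0\<bar> <= (LINT z|lborel. \<eta> / 2 * heat t (z :: 'a) + k * t * heat (2 * t) z)"
   unfolding eq
  proof (rule abs_integral_le)
   show "integrable lborel (%z :: 'a. \<eta> / 2 * heat t z + k * t * heat (2 * t) z)"
    using t by (intro Bochner_Integration.integrable_add integrable_mult_right integrable_heat) auto
   fix z :: 'a
   have n: "(norm z)\<^sup>2 * heat t z <= (4 * t) * (2 * 2 powr (real DIM('a) / 2) * heat (2 * t) z)"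
    using norm_sq_heat_bound[OF t, of z] t by (simp add: field_simps)
   have "\<bar>heat t z * corr \<phi> \<phi> z - heat t z * corr \<phi> \<phi> 0\<bar> = heat t z * \<bar>corr \<phi> \<phi> z - corr \<phi> \<phi> 0\<bar>"
    by (simp add: right_diff_distrib[symmetric] abs_mult)
   also have "... <= heat t z * (\<eta> / 2 + 2 * M / \<delta>\<^sup>2 * (norm z)\<^sup>2)"
    by (intro mult_left_mono pt) simp
   also have "... = \<eta> / 2 * heat t z + 2 * M / \<delta>\<^sup>2 * ((norm z)\<^sup>2 * heat t z)"
    by (simp add: algebra_simps)
   also have "... <= \<eta> / 2 * heat t z + 2 * M / \<delta>\<^sup>2 * ((4 * t) * (2 * 2 powr (real DIM('a) / 2) * heat (2 * t) z))"
    using M(1) by (intro add_left_mono mult_left_mono n) auto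
   also have "... = \<eta> / 2 * heat t z + k * t * heat (2 * t) z" by (simp add: k_def)
   finally show "\<bar>heat t z * corr \<phi> \<phi> z - heat t z * corr \<phi> \<phi> 0\<bar> <= \<eta> / 2 * heat t z + k * t * heat (2 * t) z" .
  qed
  also have "... = \<eta> / 2 + k * t"
   using t by (simp add: integral_heat)
  finally show ?thesis .
 qed
 have "(%n. k * e n) \<longlonglongrightarrow> k * 0" by (intro tendsto_mult tendsto_const e(2))
 then have "\<forall>\<^sub>F n in sequentially. k * e n < \<eta> / 2" using \<eta> by (intro order_tendstoD(2)[of _ "k * 0"]) auto
 then show "\<forall>\<^sub>F n in sequentially. \<bar>heat_form \<phi> (e n) - corr \<phi> \<phi> 0\<bar> <= \<eta>"
 proof (rule eventually_mono)
  fix n assume "k * e n < \<eta> / 2"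
  then show "\<bar>heat_form \<phi> (e n) - corr \<phi> \<phi> 0\<bar> <= \<eta>" using est[OF e(1)[of n]] by linarith
 qed
qed

lemma heat_form_defect:
 fixes \<phi> :: "real^'n => real"
 assumes \<phi>: "\<phi> \<in> test_functions \<Omega>" and t: "0 < t"
 shows "(NN r. ennreal (grad_heat_form \<phi> r) * indicator {0<..t} r) = ennreal (corr \<phi> \<phi> 0 - heat_form \<phi> t)"
proof -
 have c: "Cc_fun \<phi>" by (rule Cc_fun_test[OF \<phi>])
 note [measurable] = grad_heat_form_borel[OF \<phi>]
 define e where "e n = t / real (Suc n)" for n
 have e: "0 < e n" "e n <= t" for n using t by (auto simp: e_def field_simps)
 have "(%n. t * (1 / real (Suc n))) \<longlonglongrightarrow> t * 0"
  by (intro tendsto_mult tendsto_const lim_1_over_n[THEN LIMSEQ_Suc])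
 then have e0: "e \<longlonglongrightarrow> 0" by (simp add: e_def[abs_def] del: of_nat_Suc)
 have decr: "e (Suc n) <= e n" for n using t unfolding e_def by (intro divide_left_mono) auto
 have sup: "(SUP n. ennreal (grad_heat_form \<phi> r) * indicator {e n..t} r) = ennreal (grad_heat_form \<phi> r) * indicator {0<..t} r" for r
 proof (rule antisym)
  show "(SUP n. ennreal (grad_heat_form \<phi> r) * indicator {e n..t} r) <= ennreal (grad_heat_form \<phi> r) * indicator {0<..t} r"
   using e(1) by (intro SUP_least mult_left_mono) (auto simp: indicator_def intro: less_le_trans)
  show "ennreal (grad_heat_form \<phi> r) * indicator {0<..t} r <= (SUP n. ennreal (grad_heat_form \<phi> r) * indicator {e n..t} r)"
  proof (cases "r \<in> {0<..t}")
   case True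
   then have "\<forall>\<^sub>F n in sequentially. e n < r" by (intro order_tendstoD(2)[OF e0]) simp
   then obtain n where "e n < r" by (metis eventually_sequentially order_refl)
   then show ?thesis using True by (intro SUP_upper2[of n]) auto
  qed simp
 qed
 have "(NN r. ennreal (grad_heat_form \<phi> r) * indicator {0<..t} r)
   = (SUP n. \<integral>\<^sup>+r. ennreal (grad_heat_form \<phi> r) * indicator {e n..t} r \<partial>lborel)"
  unfolding sup[symmetric]
 proof (rule nn_integral_monotone_convergence_SUP)
  show "incseq (%n r. ennreal (grad_heat_form \<phi> r) * indicator {e n..t} r)"
  proof (rule incseq_SucI, rule le_funI)
   fix n r
   have "(indicator {e n..t} r :: ennreal) <= indicator {e (Suc n)..t} r"
    using decr[of n] by (auto simp: indicator_def)
   then show "ennreal (grad_heat_form \<phi> r) * indicator {e n..t} r <= ennreal (grad_heat_form \<phi> r) * indicator {e (Suc n)..t} r"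
    by (rule mult_left_mono) simp
  qed
 qed measurable
 also have "... = (SUP n. ennreal (heat_form \<phi> (e n) - heat_form \<phi> t))"
  using heat_form_FTC[OF \<phi> e] by simp
 also have "... = ennreal (corr \<phi> \<phi> 0 - heat_form \<phi> t)"
 proof (rule LIMSEQ_unique)
  show "(%n. ennreal (heat_form \<phi> (e n) - heat_form \<phi> t)) \<longlonglongrightarrow> ennreal (corr \<phi> \<phi> 0 - heat_form \<phi> t)"
   by (intro tendsto_ennrealI tendsto_diff tendsto_const heat_form_tendsto_0[OF c e(1) e0])
  show "(%n. ennreal (heat_form \<phi> (e n) - heat_form \<phi> t)) \<longlonglongrightarrow> (SUP n. ennreal (heat_form \<phi> (e n) - heat_form \<phi> t))"
  proof (rule LIMSEQ_SUP, rule incseq_SucI)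
   fix n
   have "ennreal (heat_form \<phi> (e n) - heat_form \<phi> t) = (NN r. ennreal (grad_heat_form \<phi> r) * indicator {e n..t} r)"
    using heat_form_FTC[OF \<phi> e] by simp
   also have "... <= (NN r. ennreal (grad_heat_form \<phi> r) * indicator {e (Suc n)..t} r)"
    using decr[of n] by (intro nn_integral_mono mult_left_mono) (auto simp: indicator_def)
   also have "... = ennreal (heat_form \<phi> (e (Suc n)) - heat_form \<phi> t)"
    using heat_form_FTC[OF \<phi> e] by simp
   finally show "ennreal (heat_form \<phi> (e n) - heat_form \<phi> t) <= ennreal (heat_form \<phi> (e (Suc n)) - heat_form \<phi> t)" .
  qed
 qed
 finally show ?thesis .
qed

section \<open>The Gagliardo seminorm\<close>

lemma corr_difference:
 fixes \<phi> :: "'a::euclidean_space => real"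
 assumes c: "Cc_fun \<phi>"
 shows "(NN x. ennreal ((\<phi> x - \<phi> (x + z))\<^sup>2)) = ennreal (2 * corr \<phi> \<phi> 0 - 2 * corr \<phi> \<phi> z)"
  and "corr \<phi> \<phi> z <= corr \<phi> \<phi> 0"
proof -
 note [measurable] = Cc_fun_borel[OF c]
 have prod: "integrable lborel (%x. u x * v x)" if "Cc_fun u" "Cc_fun v" for u v :: "'a => real"
 proof (rule integrable_continuous_bounded_support)
  show "continuous_on UNIV (%x. u x * v x)" using that by (intro continuous_on_mult) (auto simp: Cc_fun_def)
  show "bounded {x. u x ~= 0}" using that by (simp add: Cc_fun_def)
 qed simp
 note ct = Cc_fun_translate[OF c, of z]
 have s: "(LINT x|lborel. \<phi> (x + z) * \<phi> (x + z)) = corr \<phi> \<phi> 0"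
  unfolding corr_def using integral_lborel_translate[of "%x. \<phi> x * \<phi> x" z] by simp
 have eq: "(\<phi> x - \<phi> (x + z))\<^sup>2 = \<phi> x * \<phi> x + \<phi> (x + z) * \<phi> (x + z) - 2 * (\<phi> x * \<phi> (x + z))" for x
  by (simp add: power2_eq_square algebra_simps)
 have int: "integrable lborel (%x. (\<phi> x - \<phi> (x + z))\<^sup>2)"
  unfolding eq by (intro Bochner_Integration.integrable_diff Bochner_Integration.integrable_add integrable_mult_right prod c ct)
 have "(LINT x|lborel. (\<phi> x - \<phi> (x + z))\<^sup>2) = (LINT x|lborel. \<phi> x * \<phi> x) + (LINT x|lborel. \<phi> (x + z) * \<phi> (x + z)) - 2 * (LINT x|lborel. \<phi> x * \<phi> (x + z))"
  unfolding eq by (simp add: prod c ct)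
 then have val: "(LINT x|lborel. (\<phi> x - \<phi> (x + z))\<^sup>2) = 2 * corr \<phi> \<phi> 0 - 2 * corr \<phi> \<phi> z"
  unfolding s by (simp add: corr_def)
 show "(NN x. ennreal ((\<phi> x - \<phi> (x + z))\<^sup>2)) = ennreal (2 * corr \<phi> \<phi> 0 - 2 * corr \<phi> \<phi> z)"
  by (subst nn_integral_eq_integral[OF int]) (simp_all add: val)
 have "0 <= (LINT x|lborel. (\<phi> x - \<phi> (x + z))\<^sup>2)" by (intro integral_nonneg_AE AE_I2) simp
 then show "corr \<phi> \<phi> z <= corr \<phi> \<phi> 0" unfolding val by simp
qed

definition gagliardo :: "real => (real^'n => real) => ennreal" where
 "gagliardo \<sigma> u = (NN x. (NN y. ennreal ((u x - u y)\<^sup>2 / norm (x - y) powr (real CARD('n) + 2 * \<sigma>))))"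

text \<open>Fubini after the substitution \<open>y = x + z\<close>; the inner integral is \<open>corr_difference\<close>.\<close>

lemma gagliardo_corr:
 fixes \<phi> :: "real^'n => real"
 assumes c: "Cc_fun \<phi>"
 shows "gagliardo \<sigma> \<phi> = (NN z. ennreal (norm z powr (2 * (- \<sigma>) - real DIM(real^'n))) * ennreal (2 * corr \<phi> \<phi> 0 - 2 * corr \<phi> \<phi> z))"
proof -
 note [measurable] = Cc_fun_borel[OF c]
 let ?p = "real CARD('n) + 2 * \<sigma>"
 have "gagliardo \<sigma> \<phi> = (NN x. (NN z. ennreal ((\<phi> x - \<phi> (x + z))\<^sup>2 / norm z powr ?p)))"
  unfolding gagliardo_def
 proof (rule nn_integral_cong)
  fix x :: "real^'n"
  have "(NN y. ennreal ((\<phi> x - \<phi> y)\<^sup>2 / norm (x - y) powr ?p))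
   = (NN z. ennreal ((\<phi> x - \<phi> (z + x))\<^sup>2 / norm (x - (z + x)) powr ?p))"
   by (rule nn_integral_lborel_translate[symmetric]) measurable
  then show "(NN y. ennreal ((\<phi> x - \<phi> y)\<^sup>2 / norm (x - y) powr ?p))
   = (NN z. ennreal ((\<phi> x - \<phi> (x + z))\<^sup>2 / norm z powr ?p))"
   by (simp add: add.commute)
 qed
 also have "... = (NN z. (NN x. ennreal ((\<phi> x - \<phi> (x + z))\<^sup>2 / norm z powr ?p)))"
  by (rule lborel_pair.Fubini') measurable
 also have "... = (NN z. ennreal (norm z powr (2 * (- \<sigma>) - real DIM(real^'n))) * ennreal (2 * corr \<phi> \<phi> 0 - 2 * corr \<phi> \<phi> z))"
 proof (rule nn_integral_cong)
  fix z :: "real^'n"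
  have e: "2 * (- \<sigma>) - real DIM(real^'n) = - ?p" by simp
  have "(NN x. ennreal ((\<phi> x - \<phi> (x + z))\<^sup>2 / norm z powr ?p))
   = (NN x. ennreal (norm z powr (- ?p)) * ennreal ((\<phi> x - \<phi> (x + z))\<^sup>2))"
  proof (rule nn_integral_cong)
   fix x
   define P where "P = norm z powr ?p"
   have "norm z powr (- ?p) = 1 / P" unfolding P_def by (rule powr_minus_divide)
   then show "ennreal ((\<phi> x - \<phi> (x + z))\<^sup>2 / norm z powr ?p) = ennreal (norm z powr (- ?p)) * ennreal ((\<phi> x - \<phi> (x + z))\<^sup>2)"
    unfolding P_def[symmetric] by (simp only:) (simp add: P_def ennreal_mult[symmetric])
  qed
  also have "... = ennreal (norm z powr (- ?p)) * (NN x. ennreal ((\<phi> x - \<phi> (x + z))\<^sup>2))"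
   by (rule nn_integral_cmult) measurable
  finally show "(NN x. ennreal ((\<phi> x - \<phi> (x + z))\<^sup>2 / norm z powr ?p)) =
   ennreal (norm z powr (2 * (- \<sigma>) - real DIM(real^'n))) * ennreal (2 * corr \<phi> \<phi> 0 - 2 * corr \<phi> \<phi> z)"
   unfolding corr_difference(1)[OF c] e .
 qed
 finally show ?thesis .
qed

lemma AE_lborel_neq: "AE x in lborel. x ~= (c :: 'a::euclidean_space)"
 using AE_lborel_singleton[of c] by simp

text \<open>Subordination with exponent \<open>-\<sigma>\<close> writes the Gagliardo seminorm as the integral of
\<open>s\<^sup>-\<^sup>\<sigma>\<^sup>-\<^sup>1 (\<langle>\<phi>, \<phi>\<rangle> - \<langle>P\<^sub>s \<phi>, \<phi>\<rangle>)\<close> over \<open>s\<close>. The defect is the dissipation up to time \<open>s\<close>, and exchanging the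
two time integrals leaves \<open>r\<^sup>-\<^sup>\<sigma> / \<sigma>\<close> as weight of the dissipation at time \<open>r\<close>.\<close>

lemma gagliardo_heat:
 fixes \<sigma> :: real
 assumes \<sigma>: "0 < \<sigma>"
 obtains C :: real where "0 < C"
  "!!\<phi> :: real^'n => real. \<phi> \<in> test_functions UNIV ==>
   ennreal C * gagliardo \<sigma> \<phi> = (NN r. ennreal (grad_heat_form \<phi> r * r powr (- \<sigma>)) * indicator {0<..} r)"
proof -
 have neg: "- \<sigma> < real DIM(real^'n) / 2"
 proof -
  have "- \<sigma> < 0" using \<sigma> by simp
  also have "0 <= real DIM(real^'n) / 2" by simp
  finally show ?thesis .
 qed
 obtain D where "D > 0 \<and> (\<forall>x :: real^'n. x ~= 0 -->
  (NN s. ennreal (s powr (- \<sigma> - 1) * heat s x) * indicator {0<..} s) = ennreal (D * norm x powr (2 * (- \<sigma>) - real DIM(real^'n))))"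
  using subordination[OF neg] by (elim exE)
 note D = conjunct1[OF this] conjunct2[OF this]
 have main: "ennreal D * gagliardo \<sigma> \<phi> = ennreal (2 / \<sigma>) * (NN r. ennreal (grad_heat_form \<phi> r * r powr (- \<sigma>)) * indicator {0<..} r)"
  if \<phi>: "\<phi> \<in> test_functions UNIV" for \<phi> :: "real^'n => real"
 proof -
  have c: "Cc_fun \<phi>" by (rule Cc_fun_test[OF \<phi>])
  note [measurable] = grad_heat_form_borel[OF \<phi>] corr_borel[OF c c]
  let ?w = "%z. ennreal (2 * corr \<phi> \<phi> 0 - 2 * corr \<phi> \<phi> z)"
  have "ennreal D * gagliardo \<sigma> \<phi> = (NN z. ennreal D * (ennreal (norm z powr (2 * (- \<sigma>) - real DIM(real^'n))) * ?w z))"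
   unfolding gagliardo_corr[OF c] by (rule nn_integral_cmult[symmetric]) measurable
  also have "... = (NN z. (NN s. (ennreal (s powr (- \<sigma> - 1) * heat s z) * indicator {0<..} s) * ?w z))"
  proof (rule nn_integral_cong_AE)
   show "AE z in lborel. ennreal D * (ennreal (norm z powr (2 * (- \<sigma>) - real DIM(real^'n))) * ?w z)
    = (NN s. (ennreal (s powr (- \<sigma> - 1) * heat s z) * indicator {0<..} s) * ?w z)"
    using AE_lborel_neq[of "0 :: real^'n"]
   proof (rule AE_mp, intro AE_I2 impI)
    fix z :: "real^'n" assume z: "z ~= 0"
    have "(NN s. (ennreal (s powr (- \<sigma> - 1) * heat s z) * indicator {0<..} s) * ?w z)
     = (NN s. ennreal (s powr (- \<sigma> - 1) * heat s z) * indicator {0<..} s) * ?w z"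
     by (rule nn_integral_multc) measurable
    also have "... = ennreal D * (ennreal (norm z powr (2 * (- \<sigma>) - real DIM(real^'n))) * ?w z)"
     using D(1) z D(2) by (simp add: ennreal_mult mult.assoc)
    finally show "ennreal D * (ennreal (norm z powr (2 * (- \<sigma>) - real DIM(real^'n))) * ?w z)
     = (NN s. (ennreal (s powr (- \<sigma> - 1) * heat s z) * indicator {0<..} s) * ?w z)" by (rule sym)
   qed
  qed
  also have "... = (NN s. (NN z. (ennreal (s powr (- \<sigma> - 1) * heat s z) * indicator {0<..} s) * ?w z))"
   by (rule lborel_pair.Fubini') measurable
  also have "... = (NN s. (NN r. ennreal 2 * ennreal (grad_heat_form \<phi> r) * indicator {0<..} r * (ennreal (s powr (- \<sigma> - 1)) * indicator {r..} s)))"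
  proof (rule nn_integral_cong)
   fix s :: real
   show "(NN z. (ennreal (s powr (- \<sigma> - 1) * heat s z) * indicator {0<..} s) * ?w z)
    = (NN r. ennreal 2 * ennreal (grad_heat_form \<phi> r) * indicator {0<..} r * (ennreal (s powr (- \<sigma> - 1)) * indicator {r..} s))"
   proof (cases "0 < s")
    case False
    have "(%r. ennreal 2 * ennreal (grad_heat_form \<phi> r) * indicator {0<..} r * (ennreal (s powr (- \<sigma> - 1)) * indicator {r..} s)) = (%r. 0)"
     using False by (auto simp: indicator_def)
    then show ?thesis using False by simp
   next
    case True
    have i: "integrable lborel (%z :: real^'n. heat s z * (2 * corr \<phi> \<phi> 0 - 2 * corr \<phi> \<phi> z))"
    proof -
     have "integrable lborel (%z :: real^'n. 2 * corr \<phi> \<phi> 0 * heat s z - 2 * (heat s z * corr \<phi> \<phi> z))"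
      by (intro Bochner_Integration.integrable_diff integrable_mult_right integrable_heat True Cc_kernel_integrable[OF heat_continuous[OF True] c])
     then show ?thesis by (simp add: algebra_simps)
    qed
    have v: "(LINT z|lborel. heat s z * (2 * corr \<phi> \<phi> 0 - 2 * corr \<phi> \<phi> z)) = 2 * (corr \<phi> \<phi> 0 - heat_form \<phi> s)"
    proof -
     have "(LINT z|lborel. heat s z * (2 * corr \<phi> \<phi> 0 - 2 * corr \<phi> \<phi> z)) = (LINT z|lborel. 2 * corr \<phi> \<phi> 0 * heat s (z :: real^'n) - 2 * (heat s z * corr \<phi> \<phi> z))"
      by (intro Bochner_Integration.integral_cong refl) (simp add: algebra_simps)
     also have "... = (LINT z|lborel. 2 * corr \<phi> \<phi> 0 * heat s (z :: real^'n)) - (LINT z|lborel. 2 * (heat s z * corr \<phi> \<phi> z))"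
      by (intro Bochner_Integration.integral_diff integrable_mult_right integrable_heat True Cc_kernel_integrable[OF heat_continuous[OF True] c])
     finally show ?thesis using True by (simp add: integral_heat heat_form_def)
    qed
    have "(NN z. (ennreal (s powr (- \<sigma> - 1) * heat s z) * indicator {0<..} s) * ?w z)
     = (NN z. ennreal (s powr (- \<sigma> - 1)) * ennreal (heat s z * (2 * corr \<phi> \<phi> 0 - 2 * corr \<phi> \<phi> z)))"
     using True by (intro nn_integral_cong) (simp add: ennreal_mult corr_difference(2)[OF c] mult.assoc)
    also have "... = ennreal (s powr (- \<sigma> - 1)) * (NN z. ennreal (heat s z * (2 * corr \<phi> \<phi> 0 - 2 * corr \<phi> \<phi> z)))"
     by (rule nn_integral_cmult) measurable
    also have "(NN z. ennreal (heat s z * (2 * corr \<phi> \<phi> 0 - 2 * corr \<phi> \<phi> z))) = ennreal (2 * (corr \<phi> \<phi> 0 - heat_form \<phi> s))"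
     by (subst nn_integral_eq_integral[OF i]) (simp_all add: corr_difference(2)[OF c] v)
    also have "... = ennreal 2 * (NN r. ennreal (grad_heat_form \<phi> r) * indicator {0<..s} r)"
     unfolding heat_form_defect[OF \<phi> True] by (rule ennreal_mult') simp
    also have "ennreal (s powr (- \<sigma> - 1)) * (ennreal 2 * (NN r. ennreal (grad_heat_form \<phi> r) * indicator {0<..s} r))
     = (NN r. (ennreal (s powr (- \<sigma> - 1)) * ennreal 2) * (ennreal (grad_heat_form \<phi> r) * indicator {0<..s} r))"
     unfolding mult.assoc[symmetric, of "ennreal (s powr (- \<sigma> - 1))"] by (rule nn_integral_cmult[symmetric]) measurable
    also have "... = (NN r. ennreal 2 * ennreal (grad_heat_form \<phi> r) * indicator {0<..} r * (ennreal (s powr (- \<sigma> - 1)) * indicator {r..} s))"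
     by (intro nn_integral_cong) (auto simp: indicator_def ac_simps)
    finally show ?thesis .
   qed
  qed
  also have "... = (NN r. (NN s. ennreal 2 * ennreal (grad_heat_form \<phi> r) * indicator {0<..} r * (ennreal (s powr (- \<sigma> - 1)) * indicator {r..} s)))"
  proof (rule lborel_pair.Fubini')
   have "(%p :: real \<times> real. indicator {fst p..} (snd p) :: ennreal) = indicator {p. fst p <= snd p}"
    by (auto simp: indicator_def)
   then have [measurable]: "(%p :: real \<times> real. indicator {fst p..} (snd p) :: ennreal) \<in> borel_measurable (lborel \<Otimes>\<^sub>M lborel)"
    by simp
   show "(%(r, s). ennreal 2 * ennreal (grad_heat_form \<phi> r) * indicator {0<..} r * (ennreal (s powr (- \<sigma> - 1)) * indicator {r..} s)) \<in> borel_measurable (lborel \<Otimes>\<^sub>M lborel)"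
    unfolding split_beta' by measurable
  qed
  also have "... = (NN r. ennreal (2 / \<sigma>) * (ennreal (grad_heat_form \<phi> r * r powr (- \<sigma>)) * indicator {0<..} r))"
  proof (rule nn_integral_cong)
   fix r :: real
   have "(NN s. ennreal 2 * ennreal (grad_heat_form \<phi> r) * indicator {0<..} r * (ennreal (s powr (- \<sigma> - 1)) * indicator {r..} s))
    = ennreal 2 * ennreal (grad_heat_form \<phi> r) * indicator {0<..} r * (NN s. ennreal (s powr (- \<sigma> - 1)) * indicator {r..} s)"
    by (rule nn_integral_cmult) measurable
   also have "... = ennreal (2 / \<sigma>) * (ennreal (grad_heat_form \<phi> r * r powr (- \<sigma>)) * indicator {0<..} r)"
   proof (cases "0 < r")
    case True
    have g: "0 <= grad_heat_form \<phi> r" by (rule grad_heat_form_nonneg[OF \<phi> True])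
    define P where "P = r powr (- \<sigma>)"
    have P: "0 <= P" by (simp add: P_def)
    have "ennreal 2 * ennreal (grad_heat_form \<phi> r) * ennreal (P / \<sigma>) = ennreal (2 * grad_heat_form \<phi> r * (P / \<sigma>))"
     using g P \<sigma> by (simp only: ennreal_mult[symmetric] zero_le_numeral mult_nonneg_nonneg divide_nonneg_nonneg less_imp_le)
    also have "... = ennreal (2 / \<sigma> * (grad_heat_form \<phi> r * P))" by (simp add: ac_simps)
    also have "... = ennreal (2 / \<sigma>) * ennreal (grad_heat_form \<phi> r * P)"
     using g P \<sigma> by (intro ennreal_mult) auto
    finally show ?thesis unfolding nn_integral_powr_ge[OF \<sigma> True] P_def[symmetric]
     using True by simp
   qed simp
   finally show "(NN s. ennreal 2 * ennreal (grad_heat_form \<phi> r) * indicator {0<..} r * (ennreal (s powr (- \<sigma> - 1)) * indicator {r..} s))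
    = ennreal (2 / \<sigma>) * (ennreal (grad_heat_form \<phi> r * r powr (- \<sigma>)) * indicator {0<..} r)" .
  qed
  also have "... = ennreal (2 / \<sigma>) * (NN r. ennreal (grad_heat_form \<phi> r * r powr (- \<sigma>)) * indicator {0<..} r)"
   by (rule nn_integral_cmult) measurable
  finally show ?thesis .
 qed
 show thesis
 proof (rule that[of "\<sigma> / 2 * D"])
  show "0 < \<sigma> / 2 * D" using \<sigma> D by simp
  fix \<phi> :: "real^'n => real" assume \<phi>: "\<phi> \<in> test_functions UNIV"
  have "ennreal (\<sigma> / 2 * D) * gagliardo \<sigma> \<phi> = ennreal (\<sigma> / 2) * (ennreal D * gagliardo \<sigma> \<phi>)"
  proof -
   have "ennreal (\<sigma> / 2 * D) = ennreal (\<sigma> / 2) * ennreal D"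
    by (rule ennreal_mult) (use \<sigma> D(1) in auto)
   then show ?thesis by (simp only: mult.assoc)
  qed
  also have "... = (ennreal (\<sigma> / 2) * ennreal (2 / \<sigma>)) * (NN r. ennreal (grad_heat_form \<phi> r * r powr (- \<sigma>)) * indicator {0<..} r)"
   unfolding main[OF \<phi>] by (simp only: mult.assoc)
  also have "ennreal (\<sigma> / 2) * ennreal (2 / \<sigma>) = 1" using \<sigma> by (simp add: ennreal_mult[symmetric])
  finally show "ennreal (\<sigma> / 2 * D) * gagliardo \<sigma> \<phi> = (NN r. ennreal (grad_heat_form \<phi> r * r powr (- \<sigma>)) * indicator {0<..} r)"
   by simp
 qed
qed

section \<open>The energy identity for the Riesz fractional gradient\<close>

lemma nn_integral_heat_translate:
 fixes x :: "'a::euclidean_space"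
 assumes "0 < s"
 shows "(NN y. ennreal (heat s (x - y))) = 1"
proof -
 have "(NN y. ennreal (heat s (x - y))) = (NN y. ennreal (heat s (y + (- x))))"
 proof (rule nn_integral_cong)
  fix y
  have "heat s (x - y) = heat s (- (x - y))" by (rule heat_minus[symmetric])
  then show "ennreal (heat s (x - y)) = ennreal (heat s (y + (- x)))" by simp
 qed
 also have "... = (NN y. ennreal (heat s (y :: 'a)))"
  by (rule nn_integral_lborel_translate) measurable
 finally show ?thesis by (simp add: nn_integral_heat[OF assms])
qed

lemma heat_le:
 assumes "0 < s" shows "heat s (x :: 'a::euclidean_space) <= s powr (- real DIM('a) / 2)"
proof -
 have "heat s x <= (4 * pi * s) powr (- real DIM('a) / 2) * 1"
  unfolding heat_def using assms by (intro mult_left_mono) auto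
 also have "... <= s powr (- real DIM('a) / 2)"
 proof -
  have "1 * s <= (4 * pi) * s" using pi_gt3 assms by (intro mult_right_mono) linarith+
  then show ?thesis using assms by (simp add: powr_mono2')
 qed
 finally show ?thesis .
qed

text \<open>Subordination again: heat at times below \<open>1\<close> is paired with the bound \<open>B\<close> of \<open>w\<close>, heat at later times,
where the kernel is small, with its integral \<open>L\<close>.\<close>

lemma riesz_kernel_bound:
 fixes \<alpha> :: real
 assumes \<alpha>: "0 < \<alpha>" "\<alpha> < real DIM('a::euclidean_space)"
 obtains k where "0 <= k"
  "!!w B L (x :: 'a). w \<in> \<B> ==> 0 <= B ==> 0 <= L ==> (!!y. \<bar>w y\<bar> <= B) ==>
   (NN y. ennreal \<bar>w y\<bar>) <= ennreal L ==>
   (NN y. ennreal (\<bar>w y\<bar> * norm (x - y) powr (\<alpha> - real DIM('a)))) <= ennreal (k * (B + L))"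
proof -
 define a where "a = \<alpha> / 2"
 define d where "d = real DIM('a)"
 have a: "0 < a" "a < d / 2" using \<alpha> by (auto simp: a_def d_def)
 have sub: "a < real DIM('a) / 2" using a by (simp add: d_def)
 obtain C where "0 < C \<and> (\<forall>x :: 'a. x ~= 0 -->
  (NN s. ennreal (s powr (a - 1) * heat s x) * indicator {0<..} s) = ennreal (C * norm x powr (2 * a - real DIM('a))))"
  using subordination[OF sub] by (elim exE)
 note C = conjunct1[OF this] conjunct2[OF this]
 have e: "2 * a - real DIM('a) = \<alpha> - real DIM('a)" by (simp add: a_def)
 define k where "k = (1 / a + 1 / (d / 2 - a)) / C"
 have k: "0 <= k" using a C(1) by (simp add: k_def)
 show thesis
 proof (rule that[OF k])
  fix w :: "'a => real" and B L :: real and x :: 'a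
  assume [measurable]: "w \<in> \<B>" and B: "0 <= B" "!!y. \<bar>w y\<bar> <= B"
   and L: "0 <= L" "(NN y. ennreal \<bar>w y\<bar>) <= ennreal L"
  have "ennreal C * (NN y. ennreal (\<bar>w y\<bar> * norm (x - y) powr (\<alpha> - real DIM('a))))
   = (NN y. ennreal C * ennreal (\<bar>w y\<bar> * norm (x - y) powr (\<alpha> - real DIM('a))))"
   by (rule nn_integral_cmult[symmetric]) measurable
  also have "... = (NN y. (NN s. ennreal \<bar>w y\<bar> * (ennreal (s powr (a - 1) * heat s (x - y)) * indicator {0<..} s)))"
  proof (rule nn_integral_cong_AE)
   have "AE y in lborel. y ~= x" using AE_lborel_singleton[of x] by simp
   then show "AE y in lborel. ennreal C * ennreal (\<bar>w y\<bar> * norm (x - y) powr (\<alpha> - real DIM('a)))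
    = (NN s. ennreal \<bar>w y\<bar> * (ennreal (s powr (a - 1) * heat s (x - y)) * indicator {0<..} s))"
   proof (rule AE_mp, intro AE_I2 impI)
    fix y assume "y ~= x"
    then have v: "(NN s. ennreal (s powr (a - 1) * heat s (x - y)) * indicator {0<..} s) = ennreal (C * norm (x - y) powr (\<alpha> - real DIM('a)))"
     using C(2) unfolding e by simp
    have "(NN s. ennreal \<bar>w y\<bar> * (ennreal (s powr (a - 1) * heat s (x - y)) * indicator {0<..} s))
     = ennreal \<bar>w y\<bar> * (NN s. ennreal (s powr (a - 1) * heat s (x - y)) * indicator {0<..} s)"
     by (rule nn_integral_cmult) measurable
    then show "ennreal C * ennreal (\<bar>w y\<bar> * norm (x - y) powr (\<alpha> - real DIM('a)))
     = (NN s. ennreal \<bar>w y\<bar> * (ennreal (s powr (a - 1) * heat s (x - y)) * indicator {0<..} s))"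
     unfolding v using C(1) by (simp add: ennreal_mult[symmetric] mult.left_commute)
   qed
  qed
  also have "... = (NN s. (NN y. ennreal \<bar>w y\<bar> * (ennreal (s powr (a - 1) * heat s (x - y)) * indicator {0<..} s)))"
   by (rule lborel_pair.Fubini') measurable
  also have "... <= (NN s. ennreal B * (ennreal (s powr (a - 1)) * indicator {0..1} s) + ennreal L * (ennreal (s powr (- (d / 2 - a) - 1)) * indicator {1..} s))"
  proof (rule nn_integral_mono)
   fix s :: real
   let ?I = "NN y. ennreal \<bar>w y\<bar> * (ennreal (s powr (a - 1) * heat s (x - y)) * indicator {0<..} s)"
   consider "s <= 0" | "0 < s" "s <= 1" | "1 < s" by linarith
   then show "?I <= ennreal B * (ennreal (s powr (a - 1)) * indicator {0..1} s) + ennreal L * (ennreal (s powr (- (d / 2 - a) - 1)) * indicator {1..} s)"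
   proof cases
    case 1
    then show ?thesis by simp
   next
    case 2
    have "?I <= (NN y. ennreal (B * s powr (a - 1)) * ennreal (heat s (x - y)))"
    proof (rule nn_integral_mono)
     fix y
     have "\<bar>w y\<bar> * (s powr (a - 1) * heat s (x - y)) <= B * (s powr (a - 1) * heat s (x - y))"
      by (intro mult_right_mono B(2)) simp
     then show "ennreal \<bar>w y\<bar> * (ennreal (s powr (a - 1) * heat s (x - y)) * indicator {0<..} s) <= ennreal (B * s powr (a - 1)) * ennreal (heat s (x - y))"
      using 2 B(1) by (simp add: ennreal_mult[symmetric] mult.assoc ennreal_leI)
    qed
    also have "... = ennreal (B * s powr (a - 1)) * (NN y. ennreal (heat s (x - y)))"
     by (rule nn_integral_cmult) measurable
    also have "... = ennreal B * (ennreal (s powr (a - 1)) * indicator {0..1} s)"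
     unfolding nn_integral_heat_translate[OF 2(1)] using 2 B(1) by (simp add: ennreal_mult)
    finally show ?thesis by (rule order_trans) simp
   next
    case 3
    have "?I <= (NN y. ennreal (s powr (- (d / 2 - a) - 1)) * ennreal \<bar>w y\<bar>)"
    proof (rule nn_integral_mono)
     fix y
     have "s powr (a - 1) * heat s (x - y) <= s powr (a - 1) * s powr (- d / 2)"
      unfolding d_def using 3 by (intro mult_left_mono heat_le) auto
     also have "... = s powr (- (d / 2 - a) - 1)" using 3 by (simp add: powr_add[symmetric] algebra_simps)
     finally have "\<bar>w y\<bar> * (s powr (a - 1) * heat s (x - y)) <= \<bar>w y\<bar> * s powr (- (d / 2 - a) - 1)"
      by (intro mult_left_mono) auto
     then show "ennreal \<bar>w y\<bar> * (ennreal (s powr (a - 1) * heat s (x - y)) * indicator {0<..} s) <= ennreal (s powr (- (d / 2 - a) - 1)) * ennreal \<bar>w y\<bar>"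
      using 3 by (simp add: ennreal_mult[symmetric] mult.commute ennreal_leI)
    qed
    also have "... = ennreal (s powr (- (d / 2 - a) - 1)) * (NN y. ennreal \<bar>w y\<bar>)"
     by (rule nn_integral_cmult) measurable
    also have "... <= ennreal (s powr (- (d / 2 - a) - 1)) * ennreal L" by (intro mult_left_mono L(2)) simp
    also have "... = ennreal L * (ennreal (s powr (- (d / 2 - a) - 1)) * indicator {1..} s)"
     using 3 by (simp add: mult.commute)
    finally show ?thesis by (rule order_trans) simp
   qed
  qed
  also have "... = ennreal B * (NN s. ennreal (s powr (a - 1)) * indicator {0..1} s) + ennreal L * (NN s. ennreal (s powr (- (d / 2 - a) - 1)) * indicator {1..} s)"
   by (simp add: nn_integral_add nn_integral_cmult)
  also have "... = ennreal B * ennreal (1 / a) + ennreal L * ennreal (1 powr (- (d / 2 - a)) / (d / 2 - a))"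
   using a by (subst nn_integral_powr_01, simp, subst nn_integral_powr_ge) auto
  also have "... = ennreal (B * (1 / a) + L * (1 / (d / 2 - a)))"
   using a B L by (simp add: ennreal_mult[symmetric] ennreal_plus[symmetric] del: ennreal_plus)
  also have "... <= ennreal ((B + L) * (1 / a + 1 / (d / 2 - a)))"
  proof (rule ennreal_leI)
   have "0 <= L * (1 / a)" "0 <= B * (1 / (d / 2 - a))" using a B(1) L(1) by auto
   then show "B * (1 / a) + L * (1 / (d / 2 - a)) <= (B + L) * (1 / a + 1 / (d / 2 - a))"
    unfolding ring_distribs by linarith
  qed
  finally have "ennreal C * (NN y. ennreal (\<bar>w y\<bar> * norm (x - y) powr (\<alpha> - real DIM('a)))) <= ennreal ((B + L) * (1 / a + 1 / (d / 2 - a)))" .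
  then have "ennreal (1 / C) * (ennreal C * (NN y. ennreal (\<bar>w y\<bar> * norm (x - y) powr (\<alpha> - real DIM('a))))) <= ennreal (1 / C) * ennreal ((B + L) * (1 / a + 1 / (d / 2 - a)))"
   by (rule mult_left_mono) simp
  moreover have "ennreal (1 / C) * ennreal C = 1" using C(1) by (simp add: ennreal_mult[symmetric])
  moreover have "ennreal (1 / C) * ennreal ((B + L) * (1 / a + 1 / (d / 2 - a))) = ennreal (k * (B + L))"
   using C(1) a B L by (simp add: ennreal_mult[symmetric] k_def mult.commute)
  ultimately show "(NN y. ennreal (\<bar>w y\<bar> * norm (x - y) powr (\<alpha> - real DIM('a)))) <= ennreal (k * (B + L))"
   by (simp add: mult.assoc[symmetric])
 qed
qed

lemma nn_integral_Cauchy_Schwarz_le: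
 assumes [measurable]: "f \<in> borel_measurable M" "g \<in> borel_measurable M"
  and f: "(\<integral>\<^sup>+x. ennreal ((f x)\<^sup>2) \<partial>M) <= ennreal (A\<^sup>2)" and g: "(\<integral>\<^sup>+x. ennreal ((g x)\<^sup>2) \<partial>M) <= ennreal (B\<^sup>2)"
  and AB: "0 <= A" "0 <= B"
 shows "(\<integral>\<^sup>+x. ennreal \<bar>f x * g x\<bar> \<partial>M) <= ennreal (A * B)"
proof -
 have "(\<integral>\<^sup>+x. ennreal \<bar>f x\<bar> * ennreal \<bar>g x\<bar> \<partial>M)\<^sup>2 <= (\<integral>\<^sup>+x. (ennreal \<bar>f x\<bar>)\<^sup>2 \<partial>M) * (\<integral>\<^sup>+x. (ennreal \<bar>g x\<bar>)\<^sup>2 \<partial>M)"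
  by (rule Cauchy_Schwarz_nn_integral) measurable
 also have "... <= ennreal (A\<^sup>2) * ennreal (B\<^sup>2)"
  using f g by (intro mult_mono) (simp_all add: ennreal_power)
 also have "... = (ennreal (A * B))\<^sup>2"
  using AB by (simp add: ennreal_power ennreal_mult[symmetric] power_mult_distrib)
 finally have "(\<integral>\<^sup>+x. ennreal \<bar>f x\<bar> * ennreal \<bar>g x\<bar> \<partial>M) <= ennreal (A * B)"
  using AB
 proof (cases "\<integral>\<^sup>+x. ennreal \<bar>f x\<bar> * ennreal \<bar>g x\<bar> \<partial>M")
  case (real r)
  assume le: "(\<integral>\<^sup>+x. ennreal \<bar>f x\<bar> * ennreal \<bar>g x\<bar> \<partial>M)\<^sup>2 <= (ennreal (A * B))\<^sup>2"
  then have "r\<^sup>2 <= (A * B)\<^sup>2" using real AB by (simp add: ennreal_power)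
  then have "r <= A * B" using AB by (intro power2_le_imp_le[of r "A * B"]) auto
  then show ?thesis using real by (simp add: ennreal_leI)
 qed (simp add: ennreal_power top_power_ennreal top_unique)
 then show ?thesis by (simp add: abs_mult ennreal_mult)
qed

lemma Beta_scaled:
 fixes a r :: real
 assumes a: "0 < a" and r: "0 < r"
 shows "(NN s. ennreal (s powr (a - 1) * (r - s) powr (a - 1)) * indicator {0<..<r} s) = ennreal (r powr (2 * a - 1) * Beta a a)"
proof -
 let ?b = "%\<theta>::real. \<theta> powr (a - 1) * (1 - \<theta>) powr (a - 1)"
 have "(NN s. ennreal (s powr (a - 1) * (r - s) powr (a - 1)) * indicator {0<..<r} s)
  = ennreal \<bar>r\<bar> * (NN \<theta>. ennreal ((0 + r * \<theta>) powr (a - 1) * (r - (0 + r * \<theta>)) powr (a - 1)) * indicator {0<..<r} (0 + r * \<theta>))"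
  by (rule nn_integral_real_affine) (use r in auto)
 also have "... = (NN \<theta>. ennreal \<bar>r\<bar> * (ennreal ((0 + r * \<theta>) powr (a - 1) * (r - (0 + r * \<theta>)) powr (a - 1)) * indicator {0<..<r} (0 + r * \<theta>)))"
  by (rule nn_integral_cmult[symmetric]) measurable
 also have "... = (NN \<theta>. ennreal (r powr (2 * a - 1)) * (ennreal (?b \<theta>) * indicator {0..1} \<theta>))"
 proof (rule nn_integral_cong)
  fix \<theta> :: real
  consider "\<theta> <= 0" | "1 <= \<theta>" | "0 < \<theta>" "\<theta> < 1" by linarith
  then show "ennreal \<bar>r\<bar> * (ennreal ((0 + r * \<theta>) powr (a - 1) * (r - (0 + r * \<theta>)) powr (a - 1)) * indicator {0<..<r} (0 + r * \<theta>))
   = ennreal (r powr (2 * a - 1)) * (ennreal (?b \<theta>) * indicator {0..1} \<theta>)"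
  proof cases
   case 1
   have "0 + r * \<theta> \<notin> {0<..<r}" using 1 r by (simp add: mult_nonneg_nonpos not_less)
   moreover have "ennreal (?b \<theta>) * indicator {0..1} \<theta> = 0" using 1 by (cases "\<theta> = 0") auto
   ultimately show ?thesis by simp
  next
   case 2
   have "0 + r * \<theta> \<notin> {0<..<r}" using 2 r by (simp add: not_less)
   moreover have "ennreal (?b \<theta>) * indicator {0..1} \<theta> = 0" using 2 by (cases "\<theta> = 1") auto
   ultimately show ?thesis by simp
  next
   case 3
   have i: "0 + r * \<theta> \<in> {0<..<r}" using 3 r by simp
   have f: "r - (0 + r * \<theta>) = r * (1 - \<theta>)" by (simp add: algebra_simps)
   have p: "r powr (2 * a - 1) = r * (r powr (a - 1) * r powr (a - 1))"
   proof -
    have "r powr (2 * a - 1) = r powr (1 + ((a - 1) + (a - 1)))" by (simp add: algebra_simps)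
    also have "... = r powr 1 * (r powr (a - 1) * r powr (a - 1))" by (simp only: powr_add)
    finally show ?thesis using r by simp
   qed
   have "r * ((0 + r * \<theta>) powr (a - 1) * (r - (0 + r * \<theta>)) powr (a - 1)) = r powr (2 * a - 1) * ?b \<theta>"
    unfolding f p using 3 r by (simp add: powr_mult ac_simps)
   then have "ennreal \<bar>r\<bar> * ennreal ((0 + r * \<theta>) powr (a - 1) * (r - (0 + r * \<theta>)) powr (a - 1)) = ennreal (r powr (2 * a - 1)) * ennreal (?b \<theta>)"
    using r by (simp only: ennreal_mult[symmetric] abs_of_pos powr_ge_zero mult_nonneg_nonneg less_imp_le)
   then show ?thesis using i 3 by simp
  qed
 qed
 also have "... = ennreal (r powr (2 * a - 1)) * (NN \<theta>. ennreal (?b \<theta>) * indicator {0..1} \<theta>)"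
  by (rule nn_integral_cmult) measurable
 also have "(NN \<theta>. ennreal (?b \<theta>) * indicator {0..1} \<theta>) = ennreal (Beta a a)"
  by (rule nn_integral_has_integral_lebesgue'[OF _ has_integral_Beta_real[OF a a]]) simp
 also have "ennreal (r powr (2 * a - 1)) * ennreal (Beta a a) = ennreal (r powr (2 * a - 1) * Beta a a)"
  by (rule ennreal_mult'[symmetric]) simp
 finally show ?thesis .
qed

text \<open>The weights \<open>s\<^sup>a\<^sup>-\<^sup>1\<close> convolve to a multiple of \<open>r\<^sup>2\<^sup>a\<^sup>-\<^sup>1\<close>, with a Beta function as constant.\<close>

lemma nn_integral_time_convolution:
 fixes F :: "real => real"
 assumes [measurable]: "F \<in> \<B>" and F: "!!r. 0 < r ==> 0 <= F r" and a: "0 < a"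
 shows "(NN s. (NN t. ennreal (indicator {0<..} s * s powr (a - 1) * (indicator {0<..} t * t powr (a - 1)) * F (s + t))))
  = ennreal (Beta a a) * (NN r. ennreal (F r * r powr (2 * a - 1)) * indicator {0<..} r)"
proof -
 have B: "0 <= Beta a a" using a by (simp add: Beta_def Gamma_real_nonneg)
 have "(NN s. (NN t. ennreal (indicator {0<..} s * s powr (a - 1) * (indicator {0<..} t * t powr (a - 1)) * F (s + t))))
  = (NN s. (NN r. ennreal (F r) * (ennreal (s powr (a - 1) * (r - s) powr (a - 1)) * indicator {p. 0 < snd p \<and> snd p < fst p} (r, s))))"
 proof (rule nn_integral_cong)
  fix s :: real
  have "(NN t. ennreal (indicator {0<..} s * s powr (a - 1) * (indicator {0<..} t * t powr (a - 1)) * F (s + t)))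
   = (NN r. ennreal (indicator {0<..} s * s powr (a - 1) * (indicator {0<..} (r + - s) * (r + - s) powr (a - 1)) * F (s + (r + - s))))"
   by (rule nn_integral_lborel_translate[symmetric]) measurable
  also have "... = (NN r. ennreal (F r) * (ennreal (s powr (a - 1) * (r - s) powr (a - 1)) * indicator {p. 0 < snd p \<and> snd p < fst p} (r, s)))"
  proof (rule nn_integral_cong)
   fix r :: real
   show "ennreal (indicator {0<..} s * s powr (a - 1) * (indicator {0<..} (r + - s) * (r + - s) powr (a - 1)) * F (s + (r + - s)))
    = ennreal (F r) * (ennreal (s powr (a - 1) * (r - s) powr (a - 1)) * indicator {p. 0 < snd p \<and> snd p < fst p} (r, s))"
   proof (cases "0 < s \<and> s < r")
    case True
    then have "0 <= F r" by (intro F) auto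
    then show ?thesis using True by (simp add: ennreal_mult[symmetric] ac_simps)
   next
    case False
    then show ?thesis by (auto simp: indicator_def)
   qed
  qed
  finally show "(NN t. ennreal (indicator {0<..} s * s powr (a - 1) * (indicator {0<..} t * t powr (a - 1)) * F (s + t)))
   = (NN r. ennreal (F r) * (ennreal (s powr (a - 1) * (r - s) powr (a - 1)) * indicator {p. 0 < snd p \<and> snd p < fst p} (r, s)))" .
 qed
 also have "... = (NN r. (NN s. ennreal (F r) * (ennreal (s powr (a - 1) * (r - s) powr (a - 1)) * indicator {p. 0 < snd p \<and> snd p < fst p} (r, s))))"
  by (rule lborel_pair.Fubini') measurable
 also have "... = (NN r. ennreal (Beta a a) * (ennreal (F r * r powr (2 * a - 1)) * indicator {0<..} r))"
 proof (rule nn_integral_cong)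
  fix r :: real
  have "(NN s. ennreal (F r) * (ennreal (s powr (a - 1) * (r - s) powr (a - 1)) * indicator {p. 0 < snd p \<and> snd p < fst p} (r, s)))
   = (NN s. ennreal (F r) * (ennreal (s powr (a - 1) * (r - s) powr (a - 1)) * indicator {0<..<r} s))"
   by (intro nn_integral_cong) (auto simp: indicator_def)
  also have "... = ennreal (F r) * (NN s. ennreal (s powr (a - 1) * (r - s) powr (a - 1)) * indicator {0<..<r} s)"
   by (rule nn_integral_cmult) measurable
  also have "... = ennreal (Beta a a) * (ennreal (F r * r powr (2 * a - 1)) * indicator {0<..} r)"
  proof (cases "0 < r")
   case True
   then show ?thesis unfolding Beta_scaled[OF a True] using F[OF True] B
    by (simp add: ennreal_mult[symmetric] ac_simps)
  next
   case False
   then have "{0<..<r} = {}" by auto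
   then show ?thesis using False by simp
  qed
  finally show "(NN s. ennreal (F r) * (ennreal (s powr (a - 1) * (r - s) powr (a - 1)) * indicator {p. 0 < snd p \<and> snd p < fst p} (r, s)))
   = ennreal (Beta a a) * (ennreal (F r * r powr (2 * a - 1)) * indicator {0<..} r)" .
 qed
 also have "... = ennreal (Beta a a) * (NN r. ennreal (F r * r powr (2 * a - 1)) * indicator {0<..} r)"
  by (rule nn_integral_cmult) measurable
 finally show ?thesis .
qed

text \<open>The Riesz potential without its normalising constant.\<close>

definition riesz_conv :: "real => ('a::euclidean_space => real) => 'a => real" where
 "riesz_conv \<alpha> v x = (LINT y|lborel. v y * norm (x - y) powr (\<alpha> - real DIM('a)))"

lemma Cc_fun_riesz_finite:
 fixes v :: "'a::euclidean_space => real"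
 assumes "0 < \<alpha>" "\<alpha> < real DIM('a)" "Cc_fun v"
 obtains K where "0 <= K" "!!x. (NN y. ennreal (\<bar>v y\<bar> * norm (x - y) powr (\<alpha> - real DIM('a)))) <= ennreal K"
proof -
 obtain B R where B: "0 <= B" "0 <= R" "!!x. \<bar>v x\<bar> <= B" "!!x. \<bar>v x\<bar> <= B * indicator (cball 0 R) x" "!!x. x \<notin> cball 0 R ==> v x = 0"
  by (rule Cc_fun_bounds[OF assms(3)]) (rule that)
 define L where "L = (LINT y|lborel. \<bar>v y\<bar>)"
 have L: "0 <= L" "(NN y. ennreal \<bar>v y\<bar>) = ennreal L"
  unfolding L_def using integrable_abs[OF Cc_fun_integrable[OF assms(3)]] by (auto simp: nn_integral_eq_integral)
 show thesis
 proof (rule riesz_kernel_bound[OF assms(1,2)])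
  fix k assume k: "0 <= k" "!!w B L (x :: 'a). w \<in> \<B> ==> 0 <= B ==> 0 <= L ==> (!!y. \<bar>w y\<bar> <= B) ==>
   (NN y. ennreal \<bar>w y\<bar>) <= ennreal L ==>
   (NN y. ennreal (\<bar>w y\<bar> * norm (x - y) powr (\<alpha> - real DIM('a)))) <= ennreal (k * (B + L))"
  show thesis
  proof (rule that)
   show "0 <= k * (B + L)" using k(1) B(1) L(1) by simp
   show "(NN y. ennreal (\<bar>v y\<bar> * norm (x - y) powr (\<alpha> - real DIM('a)))) <= ennreal (k * (B + L))" for x
    by (rule k(2)[OF Cc_fun_borel[OF assms(3)] B(1) L(1) B(3)]) (simp add: L(2))
  qed
 qed
qed

text \<open>\<open>C I\<^sub>\<alpha> = \<integral> s\<^bsup>\<alpha>/2-1\<^esup> P\<^sub>s ds\<close>, the subordination of Riesz potentials to the heat semigroup.\<close>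

lemma riesz_conv_heat:
 fixes v :: "'a::euclidean_space => real" and C :: real
 assumes \<alpha>: "0 < \<alpha>" "\<alpha> < real DIM('a)" and v: "Cc_fun v"
  and C: "0 < C" "\<forall>x :: 'a. x ~= 0 -->
  (NN s. ennreal (s powr (\<alpha> / 2 - 1) * heat s x) * indicator {0<..} s) = ennreal (C * norm x powr (\<alpha> - real DIM('a)))"
 shows "integrable lborel (%s. indicator {0<..} s * s powr (\<alpha> / 2 - 1) * heat_flow s v x)"
  and "(LINT s|lborel. indicator {0<..} s * s powr (\<alpha> / 2 - 1) * heat_flow s v x) = C * riesz_conv \<alpha> v x"
proof -
 note [measurable] = Cc_fun_borel[OF v]
 define h where "h y s = indicator {0<..} s * s powr (\<alpha> / 2 - 1) * heat s (x - y) * v y" for y s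
 have [measurable]: "case_prod h \<in> borel_measurable (lborel \<Otimes>\<^sub>M lborel)" unfolding h_def split_beta' by measurable
 have sub: "(NN s. ennreal (indicator {0<..} s * s powr (\<alpha> / 2 - 1) * heat s z)) = ennreal (C * norm z powr (\<alpha> - real DIM('a)))" if "z ~= 0" for z :: 'a
 proof -
  have "(NN s. ennreal (indicator {0<..} s * s powr (\<alpha> / 2 - 1) * heat s z)) = (NN s. ennreal (s powr (\<alpha> / 2 - 1) * heat s z) * indicator {0<..} s)"
   by (intro nn_integral_cong) (auto simp: indicator_def)
  then show ?thesis using C(2) that by simp
 qed
 have ae: "AE y in lborel. y ~= x" using AE_lborel_singleton[of x] by simp
 obtain K where K: "0 <= K" "!!x. (NN y. ennreal (\<bar>v y\<bar> * norm (x - y) powr (\<alpha> - real DIM('a)))) <= ennreal K"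
  by (rule Cc_fun_riesz_finite[OF \<alpha> v]) (rule that)
 have int: "integrable (lborel \<Otimes>\<^sub>M lborel) (case_prod h)"
 proof (rule integrableI_bounded)
  have "(\<integral>\<^sup>+p. ennreal (norm (case_prod h p)) \<partial>(lborel \<Otimes>\<^sub>M lborel)) = (NN y. (NN s. ennreal (norm (h y s))))"
   by (subst lborel.nn_integral_fst[symmetric]) auto
  also have "... = (NN y. ennreal C * ennreal (\<bar>v y\<bar> * norm (x - y) powr (\<alpha> - real DIM('a))))"
  proof (rule nn_integral_cong_AE, rule AE_mp[OF ae], intro AE_I2 impI)
   fix y assume y: "y ~= x"
   have "(NN s. ennreal (norm (h y s))) = (NN s. ennreal \<bar>v y\<bar> * ennreal (indicator {0<..} s * s powr (\<alpha> / 2 - 1) * heat s (x - y)))"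
    by (intro nn_integral_cong) (simp add: h_def abs_mult ennreal_mult[symmetric] mult.commute)
   also have "... = ennreal \<bar>v y\<bar> * (NN s. ennreal (indicator {0<..} s * s powr (\<alpha> / 2 - 1) * heat s (x - y)))"
    by (rule nn_integral_cmult) measurable
   also have "... = ennreal C * ennreal (\<bar>v y\<bar> * norm (x - y) powr (\<alpha> - real DIM('a)))"
    using y C(1) by (subst sub) (simp_all add: ennreal_mult[symmetric] ac_simps)
   finally show "(NN s. ennreal (norm (h y s))) = ennreal C * ennreal (\<bar>v y\<bar> * norm (x - y) powr (\<alpha> - real DIM('a)))" .
  qed
  also have "... = ennreal C * (NN y. ennreal (\<bar>v y\<bar> * norm (x - y) powr (\<alpha> - real DIM('a))))"
   by (rule nn_integral_cmult) measurable
  also have "... <= ennreal C * ennreal K" by (intro mult_left_mono K(2)) simp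
  also have "... < \<infinity>" by (simp add: ennreal_mult_less_top)
  finally show "(\<integral>\<^sup>+p. ennreal (norm (case_prod h p)) \<partial>(lborel \<Otimes>\<^sub>M lborel)) < \<infinity>" .
 qed measurable
 have hs: "(LINT y|lborel. h y s) = indicator {0<..} s * s powr (\<alpha> / 2 - 1) * heat_flow s v x" for s
  unfolding h_def heat_flow_eq[OF v] by (simp add: mult.assoc)
 show "integrable lborel (%s. indicator {0<..} s * s powr (\<alpha> / 2 - 1) * heat_flow s v x)"
  unfolding hs[symmetric] using lborel_pair.integrable_snd[OF int] by simp
 have "(LINT s|lborel. indicator {0<..} s * s powr (\<alpha> / 2 - 1) * heat_flow s v x) = (LINT y|lborel. LINT s|lborel. h y s)"
  unfolding hs[symmetric] by (rule lborel_pair.Fubini_integral[OF int])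
 also have "... = (LINT y|lborel. C * (v y * norm (x - y) powr (\<alpha> - real DIM('a))))"
 proof (rule integral_cong_AE)
  show "(%y. LINT s|lborel. h y s) \<in> borel_measurable lborel" by measurable
  show "(%y. C * (v y * norm (x - y) powr (\<alpha> - real DIM('a)))) \<in> borel_measurable lborel" by measurable
  show "AE y in lborel. (LINT s|lborel. h y s) = C * (v y * norm (x - y) powr (\<alpha> - real DIM('a)))"
  proof (rule AE_mp[OF ae], intro AE_I2 impI)
   fix y assume y: "y ~= x"
   have "(LINT s|lborel. indicator {0<..} s * s powr (\<alpha> / 2 - 1) * heat s (x - y)) = C * norm (x - y) powr (\<alpha> - real DIM('a))"
    using sub[of "x - y"] y C(1) by (subst integral_eq_nn_integral) auto
   then have "(LINT s|lborel. (indicator {0<..} s * s powr (\<alpha> / 2 - 1) * heat s (x - y)) * v y) = (C * norm (x - y) powr (\<alpha> - real DIM('a))) * v y"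
    by (simp only: integral_mult_left_zero)
   then show "(LINT s|lborel. h y s) = C * (v y * norm (x - y) powr (\<alpha> - real DIM('a)))"
    unfolding h_def by (simp only: ac_simps)
  qed
 qed
 also have "... = C * riesz_conv \<alpha> v x" unfolding riesz_conv_def by (rule integral_mult_right_zero)
 finally show "(LINT s|lborel. indicator {0<..} s * s powr (\<alpha> / 2 - 1) * heat_flow s v x) = C * riesz_conv \<alpha> v x" .
qed

lemma heat_weight_finite:
 fixes a M :: real
 assumes a: "0 < a" "a < 1 / 2"
 defines "m \<equiv> %s. sqrt M * (if s <= 1 then 1 else s powr (- (1/2)))"
 assumes M: "0 < M"
 shows "(NN s. ennreal (indicator {0<..} s * s powr (a - 1) * m s)) < \<infinity>"
proof -
 have "(NN s. ennreal (indicator {0<..} s * s powr (a - 1) * m s))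
  <= (NN s. ennreal (sqrt M) * (ennreal (s powr (a - 1)) * indicator {0..1} s) + ennreal (sqrt M) * (ennreal (s powr (- (1 / 2 - a) - 1)) * indicator {1..} s))"
 proof (rule nn_integral_mono)
  fix s :: real
  consider "s <= 0" | "0 < s" "s <= 1" | "1 < s" by linarith
  then show "ennreal (indicator {0<..} s * s powr (a - 1) * m s) <= ennreal (sqrt M) * (ennreal (s powr (a - 1)) * indicator {0..1} s) + ennreal (sqrt M) * (ennreal (s powr (- (1 / 2 - a) - 1)) * indicator {1..} s)"
  proof cases
   case 2
   then have "ennreal (indicator {0<..} s * s powr (a - 1) * m s) = ennreal (sqrt M) * (ennreal (s powr (a - 1)) * indicator {0..1} s)"
    using M by (simp add: m_def ennreal_mult[symmetric] mult.commute)
   then show ?thesis by simp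
  next
   case 3
   have "s powr (a - 1) * s powr (- (1/2)) = s powr (- (1 / 2 - a) - 1)" unfolding powr_add[symmetric] by (simp add: algebra_simps)
   then have "ennreal (indicator {0<..} s * s powr (a - 1) * m s) = ennreal (sqrt M) * (ennreal (s powr (- (1 / 2 - a) - 1)) * indicator {1..} s)"
    using 3 M by (simp add: m_def ennreal_mult[symmetric] mult.left_commute)
   then show ?thesis by simp
  qed simp
 qed
 also have "... = ennreal (sqrt M) * (NN s. ennreal (s powr (a - 1)) * indicator {0..1} s) + ennreal (sqrt M) * (NN s. ennreal (s powr (- (1 / 2 - a) - 1)) * indicator {1..} s)"
  by (simp add: nn_integral_add nn_integral_cmult)
 also have "... = ennreal (sqrt M) * ennreal (1 / a) + ennreal (sqrt M) * ennreal (1 powr (- (1 / 2 - a)) / (1 / 2 - a))"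
  using nn_integral_powr_01[OF a(1)] nn_integral_powr_ge[of "1 / 2 - a" 1] a(2) by simp
 also have "... < \<infinity>" by (simp add: ennreal_mult_less_top)
 finally show ?thesis .
qed

text \<open>Expanding the square of the time integral in \<open>riesz_conv_heat\<close> produces the inner products
\<open>\<langle>P\<^sub>s v, P\<^sub>t v\<rangle>\<close>, which depend on \<open>s + t\<close> only, so that the double time integral collapses to a simple
one. The decay of \<open>\<langle>P\<^sub>t v, v\<rangle>\<close> justifies Fubini.\<close>

lemma riesz_conv_square:
 fixes v :: "'a::euclidean_space => real" and C :: real
 assumes \<alpha>: "0 < \<alpha>" "\<alpha> < 1" and v: "Cc_fun v"
  and C: "0 < C" "\<forall>x :: 'a. x ~= 0 -->
  (NN s. ennreal (s powr (\<alpha> / 2 - 1) * heat s x) * indicator {0<..} s) = ennreal (C * norm x powr (\<alpha> - real DIM('a)))"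
  and M: "0 < M" "!!t. 0 < t ==> heat_form v t <= M" "!!t. 0 < t ==> heat_form v t <= M / t"
 shows "ennreal (C\<^sup>2) * (NN x. ennreal ((riesz_conv \<alpha> v x)\<^sup>2))
  = ennreal (Beta (\<alpha> / 2) (\<alpha> / 2)) * (NN r. ennreal (heat_form v r * r powr (\<alpha> - 1)) * indicator {0<..} r)"
proof -
 note [measurable] = Cc_fun_borel[OF v] heat_flow_borel[OF v] heat_form_borel[OF v]
 define a where "a = \<alpha> / 2"
 have a: "0 < a" "a < 1 / 2" using \<alpha> by (auto simp: a_def)
 have \<alpha>d: "\<alpha> < real DIM('a)"
 proof -
  have "1 <= real DIM('a)" using DIM_positive[where 'a='a] by linarith
  then show ?thesis using \<alpha> by linarith
 qed
 define W where "W s x = indicator {0<..} s * s powr (a - 1) * heat_flow s v x" for s x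
 have W_meas[measurable]: "(%p. W (f p) (g p)) \<in> borel_measurable N" if [measurable]: "f \<in> borel_measurable N" "g \<in> borel_measurable N" for f g and N :: "'c measure"
  unfolding W_def by measurable
 have W: "integrable lborel (%s. W s x)" "(LINT s|lborel. W s x) = C * riesz_conv \<alpha> v x" for x
  using riesz_conv_heat[OF \<alpha>(1) \<alpha>d v C, of x] by (simp_all add: W_def a_def)
 define m where "m s = sqrt M * (if s <= 1 then 1 else s powr (- (1/2)))" for s
 have [measurable]: "m \<in> \<B>" unfolding m_def by measurable
 have m0: "0 <= m s" for s using M(1) by (simp add: m_def)
 have m2: "(NN x. ennreal ((heat_flow s v x)\<^sup>2)) <= ennreal ((m s)\<^sup>2)" if s: "0 < s" for s
 proof -
  have "heat_form v (2 * s) <= (m s)\<^sup>2"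
  proof (cases "s <= 1")
   case True
   then show ?thesis using M(2)[of "2 * s"] s M(1) by (simp add: m_def)
  next
   case False
   have "(s powr (- (1/2)))\<^sup>2 = s powr (- (1/2) + - (1/2))" by (simp only: powr_add power2_eq_square)
   also have "... = 1 / s" using s by (simp add: powr_minus_divide)
   finally have "(m s)\<^sup>2 = M / s" using False M(1) by (simp add: m_def power_mult_distrib)
   moreover have "M / (2 * s) <= M / s" using M(1) s by (intro divide_left_mono) auto
   ultimately show ?thesis using M(3)[of "2 * s"] s by simp
  qed
  then show ?thesis unfolding heat_flow_square[OF v s] by (rule ennreal_leI)
 qed
 define w where "w s = indicator {0<..} s * s powr (a - 1) * m s" for s
 have [measurable]: "w \<in> \<B>" unfolding w_def by measurable
 have w0: "0 <= w s" for s using m0 by (simp add: w_def)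
 have wfin: "(NN s. ennreal (w s)) < \<infinity>"
  using heat_weight_finite[OF a M(1)] unfolding w_def m_def .
 have WW: "(NN x. ennreal \<bar>W s x * W t x\<bar>) <= ennreal (w s * w t)" for s t
 proof (cases "0 < s \<and> 0 < t")
  case True
  define q where "q = s powr (a - 1) * t powr (a - 1)"
  have q: "0 <= q" by (simp add: q_def)
  have "(NN x. ennreal \<bar>W s x * W t x\<bar>) = (NN x. ennreal q * ennreal \<bar>heat_flow s v x * heat_flow t v x\<bar>)"
   using True by (intro nn_integral_cong) (simp add: W_def q_def abs_mult ennreal_mult[symmetric] ac_simps)
  also have "... = ennreal q * (NN x. ennreal \<bar>heat_flow s v x * heat_flow t v x\<bar>)"
   by (rule nn_integral_cmult) measurable
  also have "... <= ennreal q * ennreal (m s * m t)"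
   using True by (intro mult_left_mono nn_integral_Cauchy_Schwarz_le m2 m0) auto
  also have "... = ennreal (w s * w t)"
   using True q m0 by (simp add: ennreal_mult[symmetric] w_def q_def ac_simps)
  finally show ?thesis .
 qed (auto simp: W_def)
 define G where "G p x = W (fst p) x * W (snd p) x" for p :: "real \<times> real" and x
 have [measurable]: "case_prod G \<in> borel_measurable (lborel \<Otimes>\<^sub>M lborel)"
 proof -
  have f: "(fst :: real \<times> real => real) \<in> borel_measurable lborel" "(snd :: real \<times> real => real) \<in> borel_measurable lborel"
   using borel_measurable_continuous_onI[OF continuous_on_fst[OF continuous_on_id]]
    borel_measurable_continuous_onI[OF continuous_on_snd[OF continuous_on_id]] by simp_all
  have "(%z :: (real \<times> real) \<times> 'a. fst (fst z)) \<in> borel_measurable (lborel \<Otimes>\<^sub>M lborel)"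
   "(%z :: (real \<times> real) \<times> 'a. snd (fst z)) \<in> borel_measurable (lborel \<Otimes>\<^sub>M lborel)"
   by (rule measurable_compose[OF measurable_fst], rule f)+
  moreover have "(snd :: (real \<times> real) \<times> 'a => 'a) \<in> borel_measurable (lborel \<Otimes>\<^sub>M lborel)"
   using measurable_snd[of "lborel :: (real \<times> real) measure" "lborel :: 'a measure"] by simp
  ultimately show ?thesis
   unfolding G_def split_beta' by (intro borel_measurable_times W_meas)
 qed
 have int: "integrable (lborel \<Otimes>\<^sub>M lborel) (case_prod G)"
 proof (rule integrableI_bounded)
  have "(\<integral>\<^sup>+z. ennreal (norm (case_prod G z)) \<partial>(lborel \<Otimes>\<^sub>M lborel)) = (NN p. (NN x. ennreal \<bar>G p x\<bar>))"
   by (subst lborel.nn_integral_fst[symmetric]) auto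
  also have "... <= (NN p. ennreal (w (fst p) * w (snd p)))"
   unfolding G_def by (intro nn_integral_mono WW)
  also have "... = (\<integral>\<^sup>+p. ennreal (w (fst p) * w (snd p)) \<partial>(lborel \<Otimes>\<^sub>M lborel))" by (simp add: lborel_prod)
  also have "... = (NN s. (NN t. ennreal (w s) * ennreal (w t)))"
   by (subst lborel.nn_integral_fst[symmetric]) (auto simp: ennreal_mult w0)
  also have "... = (NN s. ennreal (w s)) * (NN t. ennreal (w t))"
   by (simp add: nn_integral_cmult nn_integral_multc)
  also have "... < \<infinity>" using wfin by (simp add: ennreal_mult_less_top)
  finally show "(\<integral>\<^sup>+z. ennreal (norm (case_prod G z)) \<partial>(lborel \<Otimes>\<^sub>M lborel)) < \<infinity>" .
 qed measurable
 define H where "H s t = indicator {0<..} s * s powr (a - 1) * (indicator {0<..} t * t powr (a - 1)) * heat_form v (s + t)" for s t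
 have Gx: "(LINT p|lborel. G p x) = (C * riesz_conv \<alpha> v x)\<^sup>2" for x
 proof -
  have "(LINT p|lborel. G p x) = integral\<^sup>L (lborel \<Otimes>\<^sub>M lborel) (%(s, t). W s x * W t x)"
   by (simp add: lborel_prod G_def split_beta')
  also have "... = (LINT s|lborel. LINT t|lborel. W s x * W t x)"
   by (rule lborel_pair.integral_fst[symmetric]) (rule integrable_product_mult[OF W(1) W(1)])
  also have "... = (LINT s|lborel. W s x) * (LINT t|lborel. W t x)" by simp
  finally show ?thesis unfolding W(2) by (simp add: power2_eq_square)
 qed
 have Gp: "(LINT x|lborel. G p x) = H (fst p) (snd p)" for p
 proof (cases "0 < fst p \<and> 0 < snd p")
  case True
  have "(LINT x|lborel. G p x) = (LINT x|lborel. (fst p powr (a - 1) * snd p powr (a - 1)) * (heat_flow (fst p) v x * heat_flow (snd p) v x))"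
   using True by (intro Bochner_Integration.integral_cong refl) (simp add: G_def W_def ac_simps)
  also have "... = (fst p powr (a - 1) * snd p powr (a - 1)) * heat_form v (fst p + snd p)"
   using True by (simp only: integral_mult_right_zero heat_flow_inner(2)[OF v])
  finally show ?thesis using True by (simp add: H_def)
 next
  case False
  then show ?thesis by (auto simp: G_def W_def H_def)
 qed
 have H0: "0 <= H s t" for s t
  using heat_form_nonneg[OF v, of "s + t"] by (auto simp: H_def indicator_def)
 have [measurable]: "(%p. H (fst p) (snd p)) \<in> borel_measurable (lborel \<Otimes>\<^sub>M lborel)" unfolding H_def by measurable
 have "ennreal (C\<^sup>2) * (NN x. ennreal ((riesz_conv \<alpha> v x)\<^sup>2)) = (NN x. ennreal (C\<^sup>2) * ennreal ((riesz_conv \<alpha> v x)\<^sup>2))"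
  unfolding riesz_conv_def by (rule nn_integral_cmult[symmetric]) measurable
 also have "... = (NN x. ennreal (LINT p|lborel. G p x))"
  unfolding Gx by (intro nn_integral_cong) (simp add: ennreal_mult[symmetric] power_mult_distrib)
 also have "... = ennreal (LINT x|lborel. LINT p|lborel. G p x)"
  by (rule nn_integral_eq_integral[OF lborel_pair.integrable_snd[OF int]]) (simp add: Gx)
 also have "(LINT x|lborel. LINT p|lborel. G p x) = (LINT p|lborel. LINT x|lborel. G p x)"
  by (rule lborel_pair.Fubini_integral[OF int])
 also have "... = (LINT p|lborel. H (fst p) (snd p))" unfolding Gp ..
 also have "ennreal ... = (NN p. ennreal (H (fst p) (snd p)))"
 proof (rule nn_integral_eq_integral[symmetric])
  show "integrable lborel (%p. H (fst p) (snd p))"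
   using lborel_pair.integrable_fst[OF int] unfolding Gp .
 qed (simp add: H0)
 also have "... = (\<integral>\<^sup>+p. ennreal (H (fst p) (snd p)) \<partial>(lborel \<Otimes>\<^sub>M lborel))" by (simp add: lborel_prod)
 also have "... = (NN s. (NN t. ennreal (H s t)))"
  by (subst lborel.nn_integral_fst[symmetric]) auto
 also have "... = ennreal (Beta a a) * (NN r. ennreal (heat_form v r * r powr (2 * a - 1)) * indicator {0<..} r)"
  unfolding H_def by (rule nn_integral_time_convolution) (use a heat_form_nonneg[OF v] in \<open>auto intro: heat_form_borel[OF v]\<close>)
 finally show ?thesis by (simp add: a_def)
qed

text \<open>Both sides are multiples of the integral of \<open>grad_heat_form \<phi> r\<close> with the weight \<open>r\<^sup>-\<^sup>\<sigma>\<close>: the left-hand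
side by \<open>riesz_conv_square\<close> with \<open>\<alpha> - 1 = - \<sigma>\<close>, the right-hand side by \<open>gagliardo_heat\<close>.\<close>

theorem riesz_gradient_energy:
 fixes \<sigma> :: real
 assumes \<sigma>: "0 < \<sigma>" "\<sigma> < 1"
 obtains \<kappa> :: real where "0 < \<kappa>"
  "!!\<phi> :: real^'n => real. \<phi> \<in> test_functions UNIV ==>
   (\<Sum>j\<in>UNIV. \<integral>\<^sup>+x. ennreal ((riesz_conv (1 - \<sigma>) (partial_deriv j \<phi>) x)\<^sup>2) \<partial>lborel) = ennreal \<kappa> * gagliardo \<sigma> \<phi>"
proof -
 define \<alpha> where "\<alpha> = 1 - \<sigma>"
 have \<alpha>: "0 < \<alpha>" "\<alpha> < 1" using \<sigma> by (auto simp: \<alpha>_def)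
 have b: "\<alpha> / 2 < real DIM(real^'n) / 2"
 proof -
  have "1 <= real DIM(real^'n)" using DIM_positive[where 'a="real^'n"] by linarith
  then show ?thesis using \<alpha> by linarith
 qed
 obtain C where "0 < C \<and> (\<forall>x :: real^'n. x ~= 0 -->
  (NN s. ennreal (s powr (\<alpha> / 2 - 1) * heat s x) * indicator {0<..} s) = ennreal (C * norm x powr (2 * (\<alpha> / 2) - real DIM(real^'n))))"
  using subordination[OF b] by (elim exE)
 then have C: "0 < C" "\<forall>x :: real^'n. x ~= 0 -->
  (NN s. ennreal (s powr (\<alpha> / 2 - 1) * heat s x) * indicator {0<..} s) = ennreal (C * norm x powr (\<alpha> - real DIM(real^'n)))"
  by simp_all
 define B where "B = Beta (\<alpha> / 2) (\<alpha> / 2)"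
 have B: "0 < B" using \<alpha> by (simp add: B_def Beta_def Gamma_real_pos)
 show thesis
 proof (rule gagliardo_heat[OF \<sigma>(1), where 'n = 'n])
  fix D assume D: "0 < D" "!!\<phi> :: real^'n => real. \<phi> \<in> test_functions UNIV ==>
   ennreal D * gagliardo \<sigma> \<phi> = (NN r. ennreal (grad_heat_form \<phi> r * r powr (- \<sigma>)) * indicator {0<..} r)"
  show thesis
  proof (rule that[of "B * D / C\<^sup>2"])
   show "0 < B * D / C\<^sup>2" using B C(1) D(1) by simp
   fix \<phi> :: "real^'n => real" assume \<phi>: "\<phi> \<in> test_functions UNIV"
   note [measurable] = heat_form_borel[OF Cc_fun_partial_deriv[OF \<phi>]]
   have each: "ennreal (C\<^sup>2) * (NN x. ennreal ((riesz_conv \<alpha> (partial_deriv j \<phi>) x)\<^sup>2))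
    = ennreal B * (NN r. ennreal (heat_form (partial_deriv j \<phi>) r * r powr (\<alpha> - 1)) * indicator {0<..} r)" for j
   proof (rule heat_form_decay[OF \<phi>, of j])
    fix M assume M: "0 < M" "!!t. 0 < t ==> heat_form (partial_deriv j \<phi>) t <= M" "!!t. 0 < t ==> heat_form (partial_deriv j \<phi>) t <= M / t"
    show ?thesis unfolding B_def by (rule riesz_conv_square[OF \<alpha> Cc_fun_partial_deriv[OF \<phi>] C M])
   qed
   have "ennreal (C\<^sup>2) * (\<Sum>j\<in>UNIV. \<integral>\<^sup>+x. ennreal ((riesz_conv \<alpha> (partial_deriv j \<phi>) x)\<^sup>2) \<partial>lborel)
    = ennreal B * (\<Sum>j\<in>UNIV. \<integral>\<^sup>+r. ennreal (heat_form (partial_deriv j \<phi>) r * r powr (\<alpha> - 1)) * indicator {0<..} r \<partial>lborel)"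
    unfolding sum_distrib_left each ..
   also have "(\<Sum>j\<in>UNIV. \<integral>\<^sup>+r. ennreal (heat_form (partial_deriv j \<phi>) r * r powr (\<alpha> - 1)) * indicator {0<..} r \<partial>lborel)
    = (NN r. (\<Sum>j\<in>UNIV. ennreal (heat_form (partial_deriv j \<phi>) r * r powr (\<alpha> - 1)) * indicator {0<..} r))"
    by (rule nn_integral_sum[symmetric]) measurable
   also have "... = (NN r. ennreal (grad_heat_form \<phi> r * r powr (- \<sigma>)) * indicator {0<..} r)"
   proof (rule nn_integral_cong)
    fix r :: real
    show "(\<Sum>j\<in>UNIV. ennreal (heat_form (partial_deriv j \<phi>) r * r powr (\<alpha> - 1)) * indicator {0<..} r) = ennreal (grad_heat_form \<phi> r * r powr (- \<sigma>)) * indicator {0<..} r"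
    proof (cases "0 < r")
     case True
     have "(\<Sum>j\<in>UNIV. ennreal (heat_form (partial_deriv j \<phi>) r * r powr (- \<sigma>))) = ennreal (\<Sum>j\<in>UNIV. heat_form (partial_deriv j \<phi>) r * r powr (- \<sigma>))"
      by (rule sum_ennreal) (simp add: heat_form_nonneg[OF Cc_fun_partial_deriv[OF \<phi>] True])
     then show ?thesis using True by (simp add: \<alpha>_def grad_heat_form_def sum_distrib_right)
    qed simp
   qed
   also have "... = ennreal D * gagliardo \<sigma> \<phi>" by (rule D(2)[OF \<phi>, symmetric])
   finally have main: "ennreal (C\<^sup>2) * (\<Sum>j\<in>UNIV. \<integral>\<^sup>+x. ennreal ((riesz_conv \<alpha> (partial_deriv j \<phi>) x)\<^sup>2) \<partial>lborel) = ennreal B * (ennreal D * gagliardo \<sigma> \<phi>)" .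
   let ?S = "\<Sum>j\<in>UNIV. \<integral>\<^sup>+x. ennreal ((riesz_conv \<alpha> (partial_deriv j \<phi>) x)\<^sup>2) \<partial>lborel"
   have one: "ennreal (1 / C\<^sup>2) * ennreal (C\<^sup>2) = 1" using C(1) by (simp add: ennreal_mult[symmetric])
   have "?S = (ennreal (1 / C\<^sup>2) * ennreal (C\<^sup>2)) * ?S" unfolding one by simp
   also have "... = (ennreal (1 / C\<^sup>2) * (ennreal B * ennreal D)) * gagliardo \<sigma> \<phi>" using main by (simp only: mult.assoc)
   also have "ennreal (1 / C\<^sup>2) * (ennreal B * ennreal D) = ennreal (B * D / C\<^sup>2)"
    using B D(1) C(1) by (simp add: ennreal_mult[symmetric])
   finally show "(\<Sum>j\<in>UNIV. \<integral>\<^sup>+x. ennreal ((riesz_conv (1 - \<sigma>) (partial_deriv j \<phi>) x)\<^sup>2) \<partial>lborel) = ennreal (B * D / C\<^sup>2) * gagliardo \<sigma> \<phi>"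
    unfolding \<alpha>_def .
  qed
 qed
qed

section \<open>Symmetry of the Riesz potential\<close>

lemma riesz_pair_integrable:
 fixes u w :: "'a::euclidean_space => real"
 assumes \<alpha>: "0 < \<alpha>" "\<alpha> < real DIM('a)"
  and u: "integrable lborel u"
  and w: "w \<in> \<B>" "0 <= B" "!!y. \<bar>w y\<bar> <= B" "integrable lborel w"
 shows "integrable (lborel \<Otimes>\<^sub>M lborel) (%(x, y). u y * norm (x - y) powr (\<alpha> - real DIM('a)) * w x)"
proof (rule riesz_kernel_bound[OF \<alpha>])
 fix k assume k: "0 <= k" "!!w B L (x :: 'a). w \<in> \<B> ==> 0 <= B ==> 0 <= L ==> (!!y. \<bar>w y\<bar> <= B) ==>
   (NN y. ennreal \<bar>w y\<bar>) <= ennreal L ==>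
   (NN y. ennreal (\<bar>w y\<bar> * norm (x - y) powr (\<alpha> - real DIM('a)))) <= ennreal (k * (B + L))"
 have [measurable]: "u \<in> \<B>" "w \<in> \<B>" using u w(1) by auto
 define L where "L = (LINT y|lborel. \<bar>w y\<bar>)"
 have L: "0 <= L" "(NN y. ennreal \<bar>w y\<bar>) = ennreal L"
  unfolding L_def using integrable_abs[OF w(4)] by (auto simp: nn_integral_eq_integral)
 show ?thesis
 proof (rule integrableI_bounded)
  have "(\<integral>\<^sup>+p. ennreal (norm (case p of (x, y) => u y * norm (x - y) powr (\<alpha> - real DIM('a)) * w x)) \<partial>(lborel \<Otimes>\<^sub>M lborel))
   = (NN y. (NN x. ennreal (norm (u y * norm (x - y) powr (\<alpha> - real DIM('a)) * w x))))"
   by (subst lborel_pair.nn_integral_snd[symmetric]) auto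
  also have "... <= (NN y. ennreal \<bar>u y\<bar> * ennreal (k * (B + L)))"
  proof (rule nn_integral_mono)
   fix y
   have "(NN x. ennreal (norm (u y * norm (x - y) powr (\<alpha> - real DIM('a)) * w x)))
    = (NN x. ennreal \<bar>u y\<bar> * ennreal (\<bar>w x\<bar> * norm (y - x) powr (\<alpha> - real DIM('a))))"
    by (intro nn_integral_cong) (simp add: abs_mult ennreal_mult[symmetric] norm_minus_commute ac_simps)
   also have "... = ennreal \<bar>u y\<bar> * (NN x. ennreal (\<bar>w x\<bar> * norm (y - x) powr (\<alpha> - real DIM('a))))"
    by (rule nn_integral_cmult) measurable
   also have "... <= ennreal \<bar>u y\<bar> * ennreal (k * (B + L))"
    by (intro mult_left_mono k(2) w L) (simp_all add: L(2))
   finally show "(NN x. ennreal (norm (u y * norm (x - y) powr (\<alpha> - real DIM('a)) * w x))) <= ennreal \<bar>u y\<bar> * ennreal (k * (B + L))" .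
  qed
  also have "... = (NN y. ennreal \<bar>u y\<bar>) * ennreal (k * (B + L))"
   by (rule nn_integral_multc) measurable
  also have "... < \<infinity>" using u by (simp add: integrable_iff_bounded ennreal_mult_less_top)
  finally show "(\<integral>\<^sup>+p. ennreal (norm (case p of (x, y) => u y * norm (x - y) powr (\<alpha> - real DIM('a)) * w x)) \<partial>(lborel \<Otimes>\<^sub>M lborel)) < \<infinity>" .
 qed measurable
qed

lemma riesz_conv_pair:
 fixes u w :: "'a::euclidean_space => real"
 assumes \<alpha>: "0 < \<alpha>" "\<alpha> < real DIM('a)"
  and u: "integrable lborel u"
  and w: "w \<in> \<B>" "0 <= B" "!!y. \<bar>w y\<bar> <= B" "integrable lborel w"
 shows "integrable lborel (%x. riesz_conv \<alpha> u x * w x)"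
  and "(LINT x|lborel. riesz_conv \<alpha> u x * w x) = (LINT y|lborel. u y * riesz_conv \<alpha> w y)"
proof -
 note int = riesz_pair_integrable[OF \<alpha> u w]
 have 1: "(LINT y|lborel. u y * norm (x - y) powr (\<alpha> - real DIM('a)) * w x) = riesz_conv \<alpha> u x * w x" for x
  by (simp add: riesz_conv_def)
 have 2: "(LINT x|lborel. u y * norm (x - y) powr (\<alpha> - real DIM('a)) * w x) = u y * riesz_conv \<alpha> w y" for y
 proof -
  have "(LINT x|lborel. u y * norm (x - y) powr (\<alpha> - real DIM('a)) * w x) = (LINT x|lborel. u y * (w x * norm (y - x) powr (\<alpha> - real DIM('a))))"
   by (intro Bochner_Integration.integral_cong refl) (simp add: norm_minus_commute ac_simps)
  then show ?thesis by (simp add: riesz_conv_def)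
 qed
 show "integrable lborel (%x. riesz_conv \<alpha> u x * w x)"
  using lborel_pair.integrable_fst[OF int] unfolding 1 by simp
 show "(LINT x|lborel. riesz_conv \<alpha> u x * w x) = (LINT y|lborel. u y * riesz_conv \<alpha> w y)"
  using lborel_pair.Fubini_integral[OF int] unfolding 1 2 by simp
qed

lemma riesz_conv_borel [measurable (raw)]:
 fixes u :: "'a::euclidean_space => real"
 assumes [measurable]: "u \<in> \<B>"
 shows "riesz_conv \<alpha> u \<in> \<B>"
 unfolding riesz_conv_def[abs_def] by measurable

lemma riesz_conv_bounded:
 fixes v :: "'a::euclidean_space => real"
 assumes "0 < \<alpha>" "\<alpha> < real DIM('a)" "Cc_fun v"
 obtains K where "0 <= K" "!!x. \<bar>riesz_conv \<alpha> v x\<bar> <= K"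
proof (rule Cc_fun_riesz_finite[OF assms])
 fix K assume K: "0 <= K" "!!x. (NN y. ennreal (\<bar>v y\<bar> * norm (x - y) powr (\<alpha> - real DIM('a)))) <= ennreal K"
 note [measurable] = Cc_fun_borel[OF assms(3)]
 show thesis
 proof (rule that[OF K(1)])
  fix x
  have "ennreal \<bar>riesz_conv \<alpha> v x\<bar> <= (NN y. ennreal (norm (v y * norm (x - y) powr (\<alpha> - real DIM('a)))))"
   using integral_norm_bound_ennreal[of lborel "%y. v y * norm (x - y) powr (\<alpha> - real DIM('a))"]
    not_integrable_integral_eq[of lborel "%y. v y * norm (x - y) powr (\<alpha> - real DIM('a))"]
   unfolding riesz_conv_def by (cases "integrable lborel (%y. v y * norm (x - y) powr (\<alpha> - real DIM('a)))") simp_all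
  also have "... <= ennreal K" using K(2)[of x] by (simp add: abs_mult)
  finally show "\<bar>riesz_conv \<alpha> v x\<bar> <= K" using K(1) by simp
 qed
qed

text \<open>Both sides are the integral of the Riesz kernel against correlations, for which the statement is
\<open>corr_partial_deriv\<close>.\<close>

lemma riesz_conv_by_parts:
 fixes \<phi> \<psi> :: "real^'n => real"
 assumes \<alpha>: "0 < \<alpha>" "\<alpha> < real CARD('n)"
  and \<phi>: "\<phi> \<in> test_functions \<Omega>" and \<psi>: "\<psi> \<in> test_functions \<Omega>'"
 shows "(LINT x|lborel. \<phi> x * riesz_conv \<alpha> (partial_deriv j \<psi>) x) = - (LINT x|lborel. partial_deriv j \<phi> x * riesz_conv \<alpha> \<psi> x)"
proof -
 define K where "K z = norm z powr (\<alpha> - real DIM(real^'n))" for z :: "real^'n"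
 have \<alpha>': "\<alpha> < real DIM(real^'n)" using \<alpha>(2) by simp
 have K[measurable]: "K \<in> \<B>" unfolding K_def by measurable
 have loc: "integrable lborel (%z. indicator (cball 0 R) z * K z)" for R
 proof (rule riesz_kernel_bound[OF \<alpha>(1) \<alpha>'])
  fix k assume k: "0 <= k" "!!w B L (x :: real^'n). w \<in> \<B> ==> 0 <= B ==> 0 <= L ==> (!!y. \<bar>w y\<bar> <= B) ==>
   (NN y. ennreal \<bar>w y\<bar>) <= ennreal L ==>
   (NN y. ennreal (\<bar>w y\<bar> * norm (x - y) powr (\<alpha> - real DIM(real^'n)))) <= ennreal (k * (B + L))"
  define L where "L = measure lborel (cball (0 :: real^'n) R)"
  have "emeasure lborel (cball (0 :: real^'n) R) = ennreal L"
   unfolding L_def by (rule emeasure_eq_ennreal_measure) (use emeasure_bounded_finite[OF bounded_cball, of "0 :: real^'n" R] in simp)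
  moreover have "(NN y. ennreal \<bar>indicator (cball (0 :: real^'n) R) y\<bar>) = emeasure lborel (cball (0 :: real^'n) R)"
   by (simp add: ennreal_indicator nn_integral_indicator)
  ultimately have L: "(NN y. ennreal \<bar>indicator (cball (0 :: real^'n) R) y\<bar>) <= ennreal L" by simp
  have "(NN y. ennreal (\<bar>indicator (cball (0 :: real^'n) R) y\<bar> * norm (0 - y) powr (\<alpha> - real DIM(real^'n)))) <= ennreal (k * (1 + L))"
   by (rule k(2)[OF _ _ _ _ L]) (simp_all add: L_def indicator_def)
  then have fin: "(NN z. ennreal (norm (indicator (cball 0 R) z * K z))) < \<infinity>"
   by (auto simp: K_def abs_mult intro: order_le_less_trans)
  have "(%z. indicator (cball 0 R) z * K z) \<in> borel_measurable lborel"
   by (intro borel_measurable_times borel_measurable_indicator) (use K in auto)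
  then show "integrable lborel (%z. indicator (cball 0 R) z * K z)"
   by (rule integrableI_bounded[OF _ fin])
 qed
 have conv: "(LINT z|lborel. K z * v (x + z)) = riesz_conv \<alpha> v x" if "Cc_fun v" for v :: "real^'n => real" and x
 proof -
  note [measurable] = Cc_fun_borel[OF that]
  have "riesz_conv \<alpha> v x = (LINT z|lborel. v (z + x) * norm (x - (z + x)) powr (\<alpha> - real DIM(real^'n)))"
   unfolding riesz_conv_def by (rule integral_lborel_translate[symmetric]) measurable
  then show ?thesis by (simp add: K_def mult.commute add.commute)
 qed
 have d\<psi>: "partial_deriv j \<psi> \<in> test_functions \<Omega>'" and d\<phi>: "partial_deriv j \<phi> \<in> test_functions \<Omega>"
  by (rule test_functions_partial_deriv[OF \<psi>], rule test_functions_partial_deriv[OF \<phi>])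
 have "(LINT x|lborel. \<phi> x * riesz_conv \<alpha> (partial_deriv j \<psi>) x) = (LINT z|lborel. K z * corr \<phi> (partial_deriv j \<psi>) z)"
  unfolding corr_kernel_Fubini(2)[OF Cc_fun_test[OF \<phi>] Cc_fun_test[OF d\<psi>] K loc] conv[OF Cc_fun_test[OF d\<psi>]] ..
 also have "... = - (LINT z|lborel. K z * corr (partial_deriv j \<phi>) \<psi> z)"
  unfolding corr_partial_deriv[OF \<phi> \<psi>] by simp
 also have "(LINT z|lborel. K z * corr (partial_deriv j \<phi>) \<psi> z) = (LINT x|lborel. partial_deriv j \<phi> x * riesz_conv \<alpha> \<psi> x)"
  unfolding corr_kernel_Fubini(2)[OF Cc_fun_test[OF d\<phi>] Cc_fun_test[OF \<psi>] K loc] conv[OF Cc_fun_test[OF \<psi>]] ..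
 finally show ?thesis .
qed

section \<open>The fractional gradient in terms of test functions\<close>

lemma lebesgue_borel_representative:
 fixes u :: "'a::euclidean_space => real"
 assumes "u \<in> \<L>"
 obtains u' where "u' \<in> \<B>" "AE x in lebesgue. u x = u' x" "AE x in lborel. u x = u' x"
proof -
 have "\<exists>u'\<in>borel_measurable lborel. AE x in lborel. u x = u' x"
  by (rule completion_ex_borel_measurable_real[OF assms])
 then obtain u' where u': "u' \<in> borel_measurable lborel" "AE x in lborel. u x = u' x" by (elim bexE)
 show thesis by (rule that[of u']) (use u' AE_completion[OF u'(2)] in auto)
qed

lemma riesz_potential_eq:
 fixes u u' :: "real^'n => real"
 assumes u: "u \<in> \<L>" and u'[measurable]: "u' \<in> \<B>" and ae: "AE x in lebesgue. u x = u' x"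
 shows "riesz_potential \<alpha> u x = riesz_const CARD('n) \<alpha> * riesz_conv \<alpha> u' x"
proof -
 have k: "(%y. norm (x - y) powr (\<alpha> - real CARD('n))) \<in> \<B>" by measurable
 have e: "t / norm (x - y) powr (real CARD('n) - \<alpha>) = t * norm (x - y) powr (\<alpha> - real CARD('n))" for t y
  using powr_minus_divide[of "norm (x - y)" "real CARD('n) - \<alpha>"] by simp
 have "(LINT y|lebesgue. u y / norm (x - y) powr (real CARD('n) - \<alpha>)) = (LINT y|lebesgue. u' y * norm (x - y) powr (\<alpha> - real CARD('n)))"
  unfolding e
 proof (rule integral_cong_AE)
  show "(%y. u y * norm (x - y) powr (\<alpha> - real CARD('n))) \<in> \<L>"
   by (intro borel_measurable_times u measurable_completion) (use k in simp)
  show "(%y. u' y * norm (x - y) powr (\<alpha> - real CARD('n))) \<in> \<L>"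
   by (intro measurable_completion) (use k u' in simp)
  show "AE y in lebesgue. u y * norm (x - y) powr (\<alpha> - real CARD('n)) = u' y * norm (x - y) powr (\<alpha> - real CARD('n))"
   using ae by (rule AE_mp) (intro AE_I2, simp)
 qed
 also have "... = (LINT y|lborel. u' y * norm (x - y) powr (\<alpha> - real CARD('n)))"
  by (rule integral_completion) (use k u' in simp)
 finally show ?thesis by (simp add: riesz_potential_def riesz_conv_def)
qed

lemma integrable_lebesgue_representative:
 fixes u u' :: "'a::euclidean_space => real"
 assumes u: "integrable lebesgue u" and u': "u' \<in> \<B>" and ae: "AE x in lebesgue. u x = u' x"
 shows "integrable lborel u'"
proof -
 have m: "u' \<in> \<L>" using u' by (intro measurable_completion) simp
 have "integrable lebesgue u'"
  using integrable_cong_AE[of u lebesgue u'] u m ae by auto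
 then show ?thesis using integrable_completion[of u' lborel] u' by simp
qed

lemma riesz_potential_locally_integrable:
 fixes u :: "real^'n => real"
 assumes \<alpha>: "0 < \<alpha>" "\<alpha> < real CARD('n)" and u: "integrable lebesgue u"
 shows "locally_integrable (riesz_potential \<alpha> u)"
 unfolding locally_integrable_def
proof (intro allI impI)
 fix K :: "(real^'n) set" assume K: "compact K"
 have um: "u \<in> \<L>" using u by simp
 obtain u' where u': "u' \<in> \<B>" "AE x in lebesgue. u x = u' x" "AE x in lborel. u x = u' x"
  by (rule lebesgue_borel_representative[OF um]) (rule that)
 have i: "integrable lborel u'" by (rule integrable_lebesgue_representative[OF u u'(1,2)])
 have Kb: "K \<in> sets borel" using K by (simp add: borel_compact)
 have "integrable lborel (%x. riesz_conv \<alpha> u' x * indicator K x)"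
 proof (rule riesz_conv_pair(1)[where B = 1])
  show "integrable lborel (indicator K :: real^'n => real)"
   using Kb emeasure_bounded_finite[OF compact_imp_bounded[OF K]] by (intro integrable_real_indicator) auto
 qed (use \<alpha> i Kb in \<open>auto simp: indicator_def\<close>)
 then have "integrable lborel (%x. riesz_const CARD('n) \<alpha> * (riesz_conv \<alpha> u' x * indicator K x))" by (rule integrable_mult_right)
 then have "integrable lebesgue (%x. riesz_const CARD('n) \<alpha> * (riesz_conv \<alpha> u' x * indicator K x))"
  by (subst integrable_completion) auto
 then show "riesz_potential \<alpha> u absolutely_integrable_on K"
  unfolding set_integrable_def riesz_potential_eq[OF um u'(1,2)] by (simp add: ac_simps)
qed

lemma riesz_potential_test_pairing:
 fixes u :: "real^'n => real"
 assumes \<alpha>: "0 < \<alpha>" "\<alpha> < real CARD('n)" and u: "integrable lebesgue u" and w: "Cc_fun w"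
 shows "(LINT x|lebesgue. riesz_potential \<alpha> u x * w x) = (LINT x|lebesgue. u x * (riesz_const CARD('n) \<alpha> * riesz_conv \<alpha> w x))"
proof -
 have um: "u \<in> \<L>" using u by simp
 obtain u' where u': "u' \<in> \<B>" "AE x in lebesgue. u x = u' x" "AE x in lborel. u x = u' x"
  by (rule lebesgue_borel_representative[OF um]) (rule that)
 have i: "integrable lborel u'" by (rule integrable_lebesgue_representative[OF u u'(1,2)])
 obtain B R where B: "0 <= B" "0 <= R" "!!x. \<bar>w x\<bar> <= B" "!!x. \<bar>w x\<bar> <= B * indicator (cball 0 R) x" "!!x. x \<notin> cball 0 R ==> w x = 0"
  by (rule Cc_fun_bounds[OF w]) (rule that)
 note [measurable] = u'(1) Cc_fun_borel[OF w]
 define \<gamma> where "\<gamma> = riesz_const CARD('n) \<alpha>"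
 have wr: "(%x. \<gamma> * riesz_conv \<alpha> w x) \<in> \<B>" by measurable
 have "(LINT x|lebesgue. riesz_potential \<alpha> u x * w x) = (LINT x|lebesgue. \<gamma> * (riesz_conv \<alpha> u' x * w x))"
  unfolding riesz_potential_eq[OF um u'(1,2)] \<gamma>_def by (simp add: mult.assoc)
 also have "... = (LINT x|lborel. \<gamma> * (riesz_conv \<alpha> u' x * w x))" by (rule integral_completion) measurable
 also have "... = \<gamma> * (LINT x|lborel. u' x * riesz_conv \<alpha> w x)"
  using riesz_conv_pair(2)[of \<alpha> u' w B] \<alpha> i B Cc_fun_borel[OF w] Cc_fun_integrable[OF w] by simp
 also have "... = (LINT x|lborel. u' x * (\<gamma> * riesz_conv \<alpha> w x))"
  by (subst integral_mult_right_zero[symmetric]) (simp add: ac_simps)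
 also have "... = (LINT x|lebesgue. u' x * (\<gamma> * riesz_conv \<alpha> w x))" by (rule integral_completion[symmetric]) measurable
 also have "... = (LINT x|lebesgue. u x * (\<gamma> * riesz_conv \<alpha> w x))"
 proof (rule integral_cong_AE)
  show "(%x. u' x * (\<gamma> * riesz_conv \<alpha> w x)) \<in> \<L>" by (intro measurable_completion) measurable
  show "(%x. u x * (\<gamma> * riesz_conv \<alpha> w x)) \<in> \<L>"
   by (rule borel_measurable_times[OF um measurable_completion]) (use wr in simp)
  show "AE x in lebesgue. u' x * (\<gamma> * riesz_conv \<alpha> w x) = u x * (\<gamma> * riesz_conv \<alpha> w x)"
   using u'(2) by (rule AE_mp) (intro AE_I2, simp)
 qed
 finally show ?thesis unfolding \<gamma>_def .
qed

text \<open>Moves the Riesz potential from \<open>u\<close> to the test function, where it is a bounded function. In this form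
the fractional gradient passes to limits in \<open>L\<^sup>1\<close>.\<close>

lemma distr_partial_deriv_riesz_iff:
 fixes u h :: "real^'n => real"
 assumes \<alpha>: "0 < \<alpha>" "\<alpha> < real CARD('n)" and u: "integrable lebesgue u"
 shows "distr_partial_deriv j (riesz_potential \<alpha> u) h \<longleftrightarrow> locally_integrable h \<and>
  (\<forall>\<psi>\<in>test_functions UNIV. (LINT x|lebesgue. u x * (riesz_const CARD('n) \<alpha> * riesz_conv \<alpha> (partial_deriv j \<psi>) x)) = - (LINT x|lebesgue. h x * \<psi> x))"
 unfolding distr_partial_deriv_def
 using riesz_potential_locally_integrable[OF \<alpha> u] riesz_potential_test_pairing[OF \<alpha> u Cc_fun_test[OF test_functions_partial_deriv]]
 by auto

text \<open>The classical formula \<open>I\<^bsub>1-\<sigma>\<^esub> (\<nabla>\<phi>)\<close>.\<close>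

definition test_frac_grad :: "real => (real^'n => real) => real^'n => real^'n" where
 "test_frac_grad \<sigma> \<phi> x = (\<chi> j. riesz_const CARD('n) (1 - \<sigma>) * riesz_conv (1 - \<sigma>) (partial_deriv j \<phi>) x)"

lemma Cc_fun_integrable_lebesgue: "Cc_fun v ==> integrable lebesgue v"
 using Cc_fun_integrable[of v] Cc_fun_borel[of v] integrable_completion[of v lborel] by simp

lemma test_frac_grad_is_frac_grad:
 fixes \<phi> :: "real^'n => real"
 assumes \<sigma>: "0 < \<sigma>" "\<sigma> < 1" and \<phi>: "\<phi> \<in> test_functions UNIV"
 shows "is_frac_grad \<sigma> \<phi> (test_frac_grad \<sigma> \<phi>)"
 unfolding is_frac_grad_def
proof
 fix j :: 'n
 have \<alpha>: "0 < 1 - \<sigma>" "1 - \<sigma> < real CARD('n)"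
 proof -
  have "1 <= real CARD('n)" using zero_less_card_finite[where 'a='n] by linarith
  then show "0 < 1 - \<sigma>" "1 - \<sigma> < real CARD('n)" using \<sigma> by linarith+
 qed
 have d\<phi>: "partial_deriv j \<phi> \<in> test_functions UNIV" by (rule test_functions_partial_deriv[OF \<phi>])
 have c: "Cc_fun \<phi>" "Cc_fun (partial_deriv j \<phi>)" by (rule Cc_fun_test[OF \<phi>], rule Cc_fun_test[OF d\<phi>])
 define \<gamma> where "\<gamma> = riesz_const CARD('n) (1 - \<sigma>)"
 have eq: "(%x. test_frac_grad \<sigma> \<phi> x $ j) = riesz_potential (1 - \<sigma>) (partial_deriv j \<phi>)"
 proof
  fix x
  have "partial_deriv j \<phi> \<in> \<L>" using Cc_fun_integrable_lebesgue[OF c(2)] by simp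
  then show "test_frac_grad \<sigma> \<phi> x $ j = riesz_potential (1 - \<sigma>) (partial_deriv j \<phi>) x"
   by (simp add: test_frac_grad_def riesz_potential_eq[OF _ Cc_fun_borel[OF c(2)]])
 qed
 show "distr_partial_deriv j (riesz_potential (1 - \<sigma>) \<phi>) (%x. test_frac_grad \<sigma> \<phi> x $ j)"
  unfolding distr_partial_deriv_riesz_iff[OF \<alpha> Cc_fun_integrable_lebesgue[OF c(1)]] eq
 proof (intro conjI ballI)
  show "locally_integrable (riesz_potential (1 - \<sigma>) (partial_deriv j \<phi>))"
   by (rule riesz_potential_locally_integrable[OF \<alpha> Cc_fun_integrable_lebesgue[OF c(2)]])
  fix \<psi> :: "real^'n => real" assume \<psi>: "\<psi> \<in> test_functions UNIV"
  have leb: "(LINT x|lebesgue. v x * (\<gamma> * riesz_conv (1 - \<sigma>) w x)) = \<gamma> * (LINT x|lborel. v x * riesz_conv (1 - \<sigma>) w x)"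
   if "Cc_fun v" "Cc_fun w" for v w :: "real^'n => real"
  proof -
   note [measurable] = Cc_fun_borel[OF that(1)] Cc_fun_borel[OF that(2)]
   have "(LINT x|lebesgue. v x * (\<gamma> * riesz_conv (1 - \<sigma>) w x)) = (LINT x|lborel. v x * (\<gamma> * riesz_conv (1 - \<sigma>) w x))"
    by (rule integral_completion) measurable
   also have "... = (LINT x|lborel. \<gamma> * (v x * riesz_conv (1 - \<sigma>) w x))" by (simp only: ac_simps)
   finally show ?thesis by simp
  qed
  have cd\<psi>: "Cc_fun (partial_deriv j \<psi>)" by (rule Cc_fun_test[OF test_functions_partial_deriv[OF \<psi>]])
  have "(LINT x|lebesgue. \<phi> x * (\<gamma> * riesz_conv (1 - \<sigma>) (partial_deriv j \<psi>) x)) = \<gamma> * (LINT x|lborel. \<phi> x * riesz_conv (1 - \<sigma>) (partial_deriv j \<psi>) x)"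
   by (rule leb[OF c(1) cd\<psi>])
  also have "... = - (\<gamma> * (LINT x|lborel. partial_deriv j \<phi> x * riesz_conv (1 - \<sigma>) \<psi> x))"
   unfolding riesz_conv_by_parts[OF \<alpha> \<phi> \<psi>] by simp
  also have "\<gamma> * (LINT x|lborel. partial_deriv j \<phi> x * riesz_conv (1 - \<sigma>) \<psi> x) = (LINT x|lebesgue. partial_deriv j \<phi> x * (\<gamma> * riesz_conv (1 - \<sigma>) \<psi> x))"
   by (rule leb[OF c(2) Cc_fun_test[OF \<psi>], symmetric])
  also have "... = (LINT x|lebesgue. riesz_potential (1 - \<sigma>) (partial_deriv j \<phi>) x * \<psi> x)"
   unfolding \<gamma>_def by (rule riesz_potential_test_pairing[OF \<alpha> Cc_fun_integrable_lebesgue[OF c(2)] Cc_fun_test[OF \<psi>], symmetric])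
  finally show "(LINT x|lebesgue. \<phi> x * (riesz_const CARD('n) (1 - \<sigma>) * riesz_conv (1 - \<sigma>) (partial_deriv j \<psi>) x)) = - (LINT x|lebesgue. riesz_potential (1 - \<sigma>) (partial_deriv j \<phi>) x * \<psi> x)"
   unfolding \<gamma>_def .
 qed
qed

lemma riesz_const_pos: "0 < \<alpha> ==> \<alpha> < real N ==> 0 < riesz_const N \<alpha>"
 by (simp add: riesz_const_def Gamma_real_pos)

lemma partial_deriv_test_diff:
 assumes "\<phi> \<in> test_functions \<Omega>" "\<psi> \<in> test_functions \<Omega>"
 shows "partial_deriv j (%x. \<phi> x - \<psi> x) x = partial_deriv j \<phi> x - partial_deriv j \<psi> x"
 using partial_deriv_lin[of \<phi> x \<psi> j 1 "-1"] test_functions_C1[OF assms(1)] test_functions_C1[OF assms(2)]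
 by (simp add: C1_fun_def)

lemma test_frac_grad_diff:
 fixes \<phi> \<psi> :: "real^'n => real"
 assumes \<sigma>: "0 < \<sigma>" "\<sigma> < 1" and \<phi>: "\<phi> \<in> test_functions \<Omega>" and \<psi>: "\<psi> \<in> test_functions \<Omega>"
 shows "test_frac_grad \<sigma> (%x. \<phi> x - \<psi> x) x = test_frac_grad \<sigma> \<phi> x - test_frac_grad \<sigma> \<psi> x"
proof -
 have \<alpha>: "0 < 1 - \<sigma>" "1 - \<sigma> < real DIM(real^'n)"
 proof -
  have "1 <= real DIM(real^'n)" using DIM_positive[where 'a="real^'n"] by linarith
  then show "0 < 1 - \<sigma>" "1 - \<sigma> < real DIM(real^'n)" using \<sigma> by linarith+
 qed
 have int: "integrable lborel (%y. v y * norm (x - y) powr (1 - \<sigma> - real DIM(real^'n)))" if "Cc_fun v" for v :: "real^'n => real"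
 proof (rule Cc_fun_riesz_finite[OF \<alpha> that])
  fix K assume K: "0 <= K" "!!x. (NN y. ennreal (\<bar>v y\<bar> * norm (x - y) powr (1 - \<sigma> - real DIM(real^'n)))) <= ennreal K"
  note [measurable] = Cc_fun_borel[OF that]
  show ?thesis
   by (rule integrableI_bounded) (use K(2)[of x] in \<open>auto simp: abs_mult intro: order_le_less_trans\<close>)
 qed
 have "riesz_conv (1 - \<sigma>) (partial_deriv j (%x. \<phi> x - \<psi> x)) x = riesz_conv (1 - \<sigma>) (partial_deriv j \<phi>) x - riesz_conv (1 - \<sigma>) (partial_deriv j \<psi>) x" for j
  unfolding riesz_conv_def partial_deriv_test_diff[OF \<phi> \<psi>] left_diff_distrib
  by (rule Bochner_Integration.integral_diff; rule int; rule Cc_fun_test[OF test_functions_partial_deriv]; rule \<phi> \<psi>)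
 then show ?thesis by (simp add: test_frac_grad_def vec_eq_iff right_diff_distrib)
qed

section \<open>Fractional Poincare and Sobolev inequalities\<close>

text \<open>The inner integral of the Gagliardo seminorm, to be bounded from below pointwise.\<close>

definition gagliardo_density :: "real => (real^'n => real) => real^'n => ennreal" where
 "gagliardo_density \<sigma> u x = (NN y. ennreal ((u x - u y)\<^sup>2 / norm (x - y) powr (real CARD('n) + 2 * \<sigma>)))"

lemma gagliardo_eq_density: "gagliardo \<sigma> u = (NN x. gagliardo_density \<sigma> u x)"
 by (simp add: gagliardo_def gagliardo_density_def)

lemma gagliardo_density_borel [measurable]:
 assumes [measurable]: "u \<in> \<B>"
 shows "gagliardo_density \<sigma> u \<in> \<B>"
 unfolding gagliardo_density_def[abs_def] by measurable

text \<open>A ball around \<open>x\<close> of twice the measure of \<open>B\<close> contains a set of measure \<open>m\<close> outside \<open>B\<close>, on which the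
kernel is at least its value at the boundary of the ball.\<close>

lemma kernel_mass_outside_small_set:
 fixes \<sigma> :: real
 assumes \<sigma>: "0 < \<sigma>"
 obtains c where "0 < c"
  "!!B m (x :: real^'n). B \<in> sets borel ==> 0 < m ==> emeasure lborel B <= ennreal m ==>
   ennreal (c * m powr (- (2 * \<sigma> / real CARD('n)))) <=
   (NN y. ennreal (1 / norm (x - y) powr (real CARD('n) + 2 * \<sigma>)) * indicator (- B) y)"
proof -
 define N where "N = real CARD('n)"
 have N: "0 < N" by (simp add: N_def)
 define \<omega> where "\<omega> = unit_ball_vol N"
 have \<omega>: "0 < \<omega>" using N by (simp add: \<omega>_def)
 define \<beta> where "\<beta> = 2 * \<sigma> / N"
 define p where "p = N + 2 * \<sigma>"
 have p: "0 < p" using N \<sigma> by (simp add: p_def)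
 define c where "c = (2 / \<omega>) powr (- (1 + \<beta>))"
 show thesis
 proof (rule that[of c])
  show "0 < c" using \<omega> by (simp add: c_def)
  fix B :: "(real^'n) set" and m :: real and x :: "real^'n"
  assume B[measurable]: "B \<in> sets borel" and m: "0 < m" "emeasure lborel B <= ennreal m"
  (* The radius of a ball of volume 2 m. *)
  define r where "r = (2 * m / \<omega>) powr (1 / N)"
  have r: "0 < r" using m \<omega> by (simp add: r_def)
  have rN: "\<omega> * r ^ CARD('n) = 2 * m"
  proof -
   have "r ^ CARD('n) = r powr N" using r by (simp add: N_def powr_realpow)
   also have "... = 2 * m / \<omega>" using m \<omega> N by (simp add: r_def powr_powr)
   finally show ?thesis using \<omega> by simp
  qed
  have ball: "emeasure lborel (ball x r) = ennreal (2 * m)"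
   using emeasure_ball[of r x] r rN by (simp add: \<omega>_def N_def)
  define A where "A = ball x r - B - {x}"
  have A[measurable]: "A \<in> sets borel" by (simp add: A_def)
  have mA: "ennreal m <= emeasure lborel A"
  proof -
   have "ennreal (2 * m) <= emeasure lborel (A \<union> B \<union> {x})"
    unfolding ball[symmetric] by (rule emeasure_mono) (auto simp: A_def)
   also have "... <= emeasure lborel (A \<union> B) + emeasure lborel {x}"
    by (rule emeasure_subadditive) auto
   also have "... <= emeasure lborel A + emeasure lborel B"
    using emeasure_subadditive[of A lborel B] by simp
   also have "... <= emeasure lborel A + ennreal m" by (intro add_left_mono m(2))
   finally have "ennreal m + ennreal m <= emeasure lborel A + ennreal m"
    using m(1) by (simp flip: ennreal_plus)
   then show ?thesis
    by (simp add: ennreal_add_left_cancel_le add.commute[of "emeasure lborel A"])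
  qed
  have "ennreal (c * m powr (- \<beta>)) = ennreal (1 / r powr p) * ennreal m"
  proof -
   have "r powr p = (2 * m / \<omega>) powr (1 + \<beta>)"
    using N by (simp add: r_def powr_powr p_def \<beta>_def field_simps)
   also have "... = (2 / \<omega>) powr (1 + \<beta>) * m powr (1 + \<beta>)"
    by (simp add: powr_mult[symmetric])
   finally have rp: "r powr p = (2 / \<omega>) powr (1 + \<beta>) * m powr (1 + \<beta>)" .
   have "1 / r powr p * m = (1 / (2 / \<omega>) powr (1 + \<beta>)) * ((1 / m powr (1 + \<beta>)) * m)"
    unfolding rp by simp
   also have "... = (2 / \<omega>) powr (- (1 + \<beta>)) * (m powr (- (1 + \<beta>)) * m powr 1)"
    using m(1) by (simp only: powr_minus_divide powr_one less_imp_le)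
   also have "... = c * m powr (- \<beta>)" unfolding powr_add[symmetric] by (simp add: c_def)
   finally show ?thesis using m(1) by (simp add: ennreal_mult[symmetric])
  qed
  also have "... <= ennreal (1 / r powr p) * emeasure lborel A" by (intro mult_left_mono mA) simp
  also have "... = (NN y. ennreal (1 / r powr p) * indicator A y)"
   by (rule nn_integral_cmult_indicator[symmetric]) simp
  also have "... <= (NN y. ennreal (1 / norm (x - y) powr p) * indicator (- B) y)"
  proof (rule nn_integral_mono)
   fix y
   show "ennreal (1 / r powr p) * indicator A y <= ennreal (1 / norm (x - y) powr p) * indicator (- B) y"
   proof (cases "y \<in> A")
    case True
    then have y: "0 < norm (x - y)" "norm (x - y) <= r" "y \<in> - B" by (auto simp: A_def dist_norm)
    have "norm (x - y) powr p <= r powr p" using y p by (intro powr_mono2) auto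
    then have "1 / r powr p <= 1 / norm (x - y) powr p" using y r by (intro divide_left_mono) auto
    then show ?thesis using y(3) True by (simp add: ennreal_leI)
   qed simp
  qed
  finally show "ennreal (c * m powr (- (2 * \<sigma> / real CARD('n)))) <=
   (NN y. ennreal (1 / norm (x - y) powr (real CARD('n) + 2 * \<sigma>)) * indicator (- B) y)"
   by (simp add: \<beta>_def p_def N_def)
 qed
qed

text \<open>Outside the superlevel set \<open>\<bar>u\<bar> > l\<close> the difference \<open>u x - u y\<close> is at least \<open>\<bar>u x\<bar> - l\<close>. All embeddings
below are obtained by choosing the level \<open>l\<close>.\<close>

lemma gagliardo_density_lower_bound:
 fixes \<sigma> :: real
 assumes \<sigma>: "0 < \<sigma>"
 obtains c where "0 < c"
  "!!u m l (x :: real^'n). u \<in> \<B> ==> 0 < m ==> 0 <= l ==>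
   emeasure lborel {y. l < \<bar>u y\<bar>} <= ennreal m ==> l <= \<bar>u x\<bar> ==>
   ennreal ((\<bar>u x\<bar> - l)\<^sup>2 * (c * m powr (- (2 * \<sigma> / real CARD('n))))) <= gagliardo_density \<sigma> u x"
proof (rule kernel_mass_outside_small_set[OF \<sigma>, where 'n = 'n])
 fix c :: real assume c: "0 < c" "!!B m (x :: real^'n). B \<in> sets borel ==> 0 < m ==> emeasure lborel B <= ennreal m ==>
   ennreal (c * m powr (- (2 * \<sigma> / real CARD('n)))) <=
   (NN y. ennreal (1 / norm (x - y) powr (real CARD('n) + 2 * \<sigma>)) * indicator (- B) y)"
 show thesis
 proof (rule that[OF c(1)])
  fix u :: "real^'n => real" and m l :: real and x :: "real^'n"
  assume [measurable]: "u \<in> \<B>" and m: "0 < m" and l: "0 <= l"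
   and B: "emeasure lborel {y. l < \<bar>u y\<bar>} <= ennreal m" and x: "l <= \<bar>u x\<bar>"
  let ?B = "{y. l < \<bar>u y\<bar>}" and ?p = "real CARD('n) + 2 * \<sigma>"
  have [measurable]: "?B \<in> sets borel" by measurable
  have "ennreal ((\<bar>u x\<bar> - l)\<^sup>2 * (c * m powr (- (2 * \<sigma> / real CARD('n))))) = ennreal ((\<bar>u x\<bar> - l)\<^sup>2) * ennreal (c * m powr (- (2 * \<sigma> / real CARD('n))))"
   using c(1) by (intro ennreal_mult) auto
  also have "... <= ennreal ((\<bar>u x\<bar> - l)\<^sup>2) * (NN y. ennreal (1 / norm (x - y) powr ?p) * indicator (- ?B) y)"
   by (intro mult_left_mono c(2) m B) auto
  also have "... = (NN y. ennreal ((\<bar>u x\<bar> - l)\<^sup>2) * (ennreal (1 / norm (x - y) powr ?p) * indicator (- ?B) y))"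
   by (rule nn_integral_cmult[symmetric]) measurable
  also have "... <= gagliardo_density \<sigma> u x"
   unfolding gagliardo_density_def
  proof (rule nn_integral_mono)
   fix y
   show "ennreal ((\<bar>u x\<bar> - l)\<^sup>2) * (ennreal (1 / norm (x - y) powr ?p) * indicator (- ?B) y) <= ennreal ((u x - u y)\<^sup>2 / norm (x - y) powr ?p)"
   proof (cases "y \<in> ?B")
    case False
    then have "\<bar>u x\<bar> - l <= \<bar>u x - u y\<bar>" by auto
    then have "(\<bar>u x\<bar> - l)\<^sup>2 <= \<bar>u x - u y\<bar>\<^sup>2" using x by (intro power_mono) auto
    then have "(\<bar>u x\<bar> - l)\<^sup>2 * (1 / norm (x - y) powr ?p) <= (u x - u y)\<^sup>2 * (1 / norm (x - y) powr ?p)"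
     by (intro mult_right_mono) auto
    then have le: "ennreal ((\<bar>u x\<bar> - l)\<^sup>2 * (1 / norm (x - y) powr ?p)) <= ennreal ((u x - u y)\<^sup>2 / norm (x - y) powr ?p)"
     by (intro ennreal_leI) simp
    have eq: "ennreal ((\<bar>u x\<bar> - l)\<^sup>2 * (1 / norm (x - y) powr ?p)) = ennreal ((\<bar>u x\<bar> - l)\<^sup>2) * ennreal (1 / norm (x - y) powr ?p)"
     by (rule ennreal_mult) auto
    have i: "(indicator (- ?B) y :: ennreal) = 1" using False by simp
    show ?thesis unfolding i mult_1_right eq[symmetric] by (rule le)
   qed simp
  qed
  finally show "ennreal ((\<bar>u x\<bar> - l)\<^sup>2 * (c * m powr (- (2 * \<sigma> / real CARD('n))))) <= gagliardo_density \<sigma> u x" .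
 qed
qed

text \<open>The level \<open>l = 0\<close>.\<close>

lemma fractional_poincare:
 fixes \<sigma> :: real
 assumes \<sigma>: "0 < \<sigma>" and m: "0 < m"
 obtains C where "0 < C"
  "!!u :: real^'n => real. u \<in> \<B> ==> emeasure lborel {y. u y ~= 0} <= ennreal m ==>
   (NN x. ennreal ((u x)\<^sup>2)) <= ennreal C * gagliardo \<sigma> u"
proof (rule gagliardo_density_lower_bound[OF \<sigma>, where 'n = 'n])
 fix c :: real assume c: "0 < c" "!!u m l (x :: real^'n). u \<in> \<B> ==> 0 < m ==> 0 <= l ==>
   emeasure lborel {y. l < \<bar>u y\<bar>} <= ennreal m ==> l <= \<bar>u x\<bar> ==>
   ennreal ((\<bar>u x\<bar> - l)\<^sup>2 * (c * m powr (- (2 * \<sigma> / real CARD('n))))) <= gagliardo_density \<sigma> u x"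
 define k where "k = c * m powr (- (2 * \<sigma> / real CARD('n)))"
 have k: "0 < k" using c(1) m by (simp add: k_def)
 show thesis
 proof (rule that[of "1 / k"])
  show "0 < 1 / k" using k by simp
  fix u :: "real^'n => real"
  assume u[measurable]: "u \<in> \<B>" and z: "emeasure lborel {y. u y ~= 0} <= ennreal m"
  have e: "{y. 0 < \<bar>u y\<bar>} = {y. u y ~= 0}" by auto
  have "(NN x. ennreal ((u x)\<^sup>2)) <= (NN x. ennreal (1 / k) * gagliardo_density \<sigma> u x)"
  proof (rule nn_integral_mono)
   fix x
   have "ennreal ((\<bar>u x\<bar> - 0)\<^sup>2 * k) <= gagliardo_density \<sigma> u x"
    unfolding k_def by (rule c(2)[OF u m]) (simp_all add: e z)
   then have "ennreal (1 / k) * ennreal ((u x)\<^sup>2 * k) <= ennreal (1 / k) * gagliardo_density \<sigma> u x"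
    by (intro mult_left_mono) auto
   moreover have "ennreal (1 / k) * ennreal ((u x)\<^sup>2 * k) = ennreal ((u x)\<^sup>2)"
    using k by (simp add: ennreal_mult[symmetric])
   ultimately show "ennreal ((u x)\<^sup>2) <= ennreal (1 / k) * gagliardo_density \<sigma> u x" by simp
  qed
  also have "... = ennreal (1 / k) * gagliardo \<sigma> u"
   unfolding gagliardo_eq_density by (rule nn_integral_cmult) measurable
  finally show "(NN x. ennreal ((u x)\<^sup>2)) <= ennreal (1 / k) * gagliardo \<sigma> u" .
 qed
qed

lemma superlevel_measure_le:
 fixes u :: "'a => real"
 assumes [measurable]: "u \<in> borel_measurable M" and X: "(\<integral>\<^sup>+x. ennreal (\<bar>u x\<bar> powr p) \<partial>M) <= ennreal X"
  and l: "0 < l" and p: "0 < p" and X0: "0 <= X"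
 shows "emeasure M {x \<in> space M. l < \<bar>u x\<bar>} <= ennreal (X / l powr p)"
proof -
 have "ennreal (l powr p) * emeasure M {x \<in> space M. l < \<bar>u x\<bar>} = (\<integral>\<^sup>+x. ennreal (l powr p) * indicator {x \<in> space M. l < \<bar>u x\<bar>} x \<partial>M)"
  by (rule nn_integral_cmult_indicator[symmetric]) measurable
 also have "... <= (\<integral>\<^sup>+x. ennreal (\<bar>u x\<bar> powr p) \<partial>M)"
  using l p by (intro nn_integral_mono) (auto simp: indicator_def intro!: ennreal_leI powr_mono2)
 also note X
 finally have "ennreal (1 / l powr p) * (ennreal (l powr p) * emeasure M {x \<in> space M. l < \<bar>u x\<bar>}) <= ennreal (1 / l powr p) * ennreal X"
  by (intro mult_left_mono) auto
 moreover have "ennreal (1 / l powr p) * ennreal (l powr p) = 1" using l by (simp add: ennreal_mult[symmetric])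
 moreover have "ennreal (1 / l powr p) * ennreal X = ennreal (X / l powr p)" using X0 by (simp add: ennreal_mult[symmetric])
 ultimately show ?thesis by (simp add: mult.assoc[symmetric])
qed

text \<open>The level \<open>l = \<bar>u x\<bar> / 2\<close>: Chebyshev's inequality bounds its superlevel set by the integral of \<open>\<bar>u\<bar>\<^sup>p\<close>,
and the lower bound for the density becomes a gain of integrability.\<close>

lemma fractional_sobolev_step:
 fixes \<sigma> p :: real
 assumes \<sigma>: "0 < \<sigma>" and p: "0 < p"
 obtains C where "0 < C"
  "!!(u :: real^'n => real) X. u \<in> \<B> ==> 0 < X ==> (NN x. ennreal (\<bar>u x\<bar> powr p)) <= ennreal X ==>
   (NN x. ennreal (\<bar>u x\<bar> powr (2 + p * (2 * \<sigma> / real CARD('n))))) <= ennreal (C * X powr (2 * \<sigma> / real CARD('n))) * gagliardo \<sigma> u"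
proof (rule gagliardo_density_lower_bound[OF \<sigma>, where 'n = 'n])
 fix c :: real assume c: "0 < c" "!!u m l (x :: real^'n). u \<in> \<B> ==> 0 < m ==> 0 <= l ==>
   emeasure lborel {y. l < \<bar>u y\<bar>} <= ennreal m ==> l <= \<bar>u x\<bar> ==>
   ennreal ((\<bar>u x\<bar> - l)\<^sup>2 * (c * m powr (- (2 * \<sigma> / real CARD('n))))) <= gagliardo_density \<sigma> u x"
 define \<beta> where "\<beta> = 2 * \<sigma> / real CARD('n)"
 define C where "C = 4 / c * (1 / 2) powr (- (p * \<beta>))"
 have C: "0 < C" using c(1) by (simp add: C_def)
 show thesis
 proof (rule that[OF C])
  fix u :: "real^'n => real" and X :: real
  assume u[measurable]: "u \<in> \<B>" and X: "0 < X" "(NN x. ennreal (\<bar>u x\<bar> powr p)) <= ennreal X"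
  have "(NN x. ennreal (\<bar>u x\<bar> powr (2 + p * \<beta>))) <= (NN x. ennreal (C * X powr \<beta>) * gagliardo_density \<sigma> u x)"
  proof (rule nn_integral_mono)
   fix x
   show "ennreal (\<bar>u x\<bar> powr (2 + p * \<beta>)) <= ennreal (C * X powr \<beta>) * gagliardo_density \<sigma> u x"
   proof (cases "u x = 0")
    case False
    define t where "t = \<bar>u x\<bar>"
    have t: "0 < t" using False by (simp add: t_def)
    define m where "m = X / (t / 2) powr p"
    have m: "0 < m" using X(1) t by (simp add: m_def)
    have "emeasure lborel {y. t / 2 < \<bar>u y\<bar>} <= ennreal m"
     unfolding m_def using superlevel_measure_le[of u lborel p X "t / 2"] X t p by simp
    then have "ennreal ((\<bar>u x\<bar> - t / 2)\<^sup>2 * (c * m powr (- \<beta>))) <= gagliardo_density \<sigma> u x"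
     unfolding \<beta>_def using t by (intro c(2)[OF u m]) (auto simp: t_def)
    then have "ennreal (C * X powr \<beta>) * ennreal ((\<bar>u x\<bar> - t / 2)\<^sup>2 * (c * m powr (- \<beta>))) <= ennreal (C * X powr \<beta>) * gagliardo_density \<sigma> u x"
     by (intro mult_left_mono) auto
    moreover have "C * X powr \<beta> * ((\<bar>u x\<bar> - t / 2)\<^sup>2 * (c * m powr (- \<beta>))) = t powr (2 + p * \<beta>)"
    proof -
     have m1: "m powr (- \<beta>) = X powr (- \<beta>) * ((t * (1/2)) powr p) powr \<beta>"
      using X(1) t by (simp add: m_def powr_divide powr_minus powr_mult field_simps)
     have m2: "((t * (1/2)) powr p) powr \<beta> = t powr (p * \<beta>) * (1 / 2) powr (p * \<beta>)"
      by (simp only: powr_powr powr_mult)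
     have m3: "(1 / 2) powr (- (p * \<beta>)) * (1 / 2 :: real) powr (p * \<beta>) = 1" unfolding powr_add[symmetric] by simp
     have m4: "X powr \<beta> * X powr (- \<beta>) = 1" using X(1) unfolding powr_add[symmetric] by simp
     have m5: "(\<bar>u x\<bar> - t / 2)\<^sup>2 = t powr 2 / 4" using t by (simp add: t_def power2_eq_square)
     have "C * X powr \<beta> * ((\<bar>u x\<bar> - t / 2)\<^sup>2 * (c * m powr (- \<beta>)))
      = ((4 / c) * c / 4) * ((1 / 2) powr (- (p * \<beta>)) * (1 / 2) powr (p * \<beta>)) * (X powr \<beta> * X powr (- \<beta>)) * (t powr 2 * t powr (p * \<beta>))"
      unfolding C_def m1 m2 m5 by (simp only: ac_simps times_divide_eq_right times_divide_eq_left)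
     also have "... = t powr 2 * t powr (p * \<beta>)" unfolding m3 m4 using c(1) by simp
     finally show ?thesis by (simp only: powr_add)
    qed
    ultimately show ?thesis using C c(1) unfolding t_def
     by (simp only: ennreal_mult[symmetric] mult_nonneg_nonneg powr_ge_zero less_imp_le zero_le_power2)
   qed simp
  qed
  also have "... = ennreal (C * X powr \<beta>) * gagliardo \<sigma> u"
   unfolding gagliardo_eq_density by (rule nn_integral_cmult) measurable
  finally show "(NN x. ennreal (\<bar>u x\<bar> powr (2 + p * (2 * \<sigma> / real CARD('n))))) <= ennreal (C * X powr (2 * \<sigma> / real CARD('n))) * gagliardo \<sigma> u"
   unfolding \<beta>_def .
 qed
qed

lemma gagliardo_contraction:
 assumes "!!x y. \<bar>T x - T y\<bar> <= \<bar>x - y\<bar>"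
 shows "gagliardo \<sigma> (%x. T (u x)) <= gagliardo \<sigma> u"
 unfolding gagliardo_def
proof (intro nn_integral_mono ennreal_leI divide_right_mono)
 fix x y
 show "(T (u x) - T (u y))\<^sup>2 <= (u x - u y)\<^sup>2" using power_mono[OF assms[of "u x" "u y"], of 2] by simp
qed simp

text \<open>The Sobolev exponent is the fixed point of \<open>p \<mapsto> 2 + 2 \<sigma> p / N\<close>. For truncations of \<open>u\<close> the integral
of \<open>\<bar>u\<bar>\<^sup>q\<close> is finite, and \<open>fractional_sobolev_step\<close> bounds it by a power less than \<open>1\<close> of itself.\<close>

lemma fractional_sobolev_subcritical:
 fixes \<sigma> :: real
 assumes \<sigma>: "0 < \<sigma>" "\<sigma> < real CARD('n) / 2"
 defines "q \<equiv> 2 * real CARD('n) / (real CARD('n) - 2 * \<sigma>)"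
 obtains K where "0 <= K"
  "!!(u :: real^'n => real) m. u \<in> \<B> ==> emeasure lborel {y. u y ~= 0} <= ennreal m ==>
   gagliardo \<sigma> u <= 1 ==> (NN x. ennreal (\<bar>u x\<bar> powr q)) <= ennreal K"
proof -
 define \<beta> where "\<beta> = 2 * \<sigma> / real CARD('n)"
 have \<beta>: "0 < \<beta>" "\<beta> < 1" using \<sigma> by (auto simp: \<beta>_def field_simps)
 have q: "0 < q" using \<sigma> by (simp add: q_def)
 have qe: "2 + q * (2 * \<sigma> / real CARD('n)) = q" using \<sigma> by (simp add: q_def field_simps)
 show thesis
 proof (rule fractional_sobolev_step[OF \<sigma>(1) q, where 'n = 'n])
  fix C assume C: "0 < C" "!!(u :: real^'n => real) X. u \<in> \<B> ==> 0 < X ==> (NN x. ennreal (\<bar>u x\<bar> powr q)) <= ennreal X ==>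
   (NN x. ennreal (\<bar>u x\<bar> powr (2 + q * (2 * \<sigma> / real CARD('n))))) <= ennreal (C * X powr (2 * \<sigma> / real CARD('n))) * gagliardo \<sigma> u"
  define K where "K = C powr (1 / (1 - \<beta>))"
  show thesis
  proof (rule that[of K])
   show "0 <= K" by (simp add: K_def)
   fix u :: "real^'n => real" and m :: real
   assume u[measurable]: "u \<in> \<B>" and z: "emeasure lborel {y. u y ~= 0} <= ennreal m" and E: "gagliardo \<sigma> u <= 1"
   have m: "emeasure lborel {y. u y ~= 0} < \<infinity>" using z order_le_less_trans by fastforce
   (* Truncation at height k does not increase the seminorm. *)
   define T where "T k t = max (- real k) (min (real k) t)" for k :: nat and t :: real
   have T1: "\<bar>T k s - T k t\<bar> <= \<bar>s - t\<bar>" for k s t by (auto simp: T_def max_def min_def)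
   have [measurable]: "(%x. T k (u x)) \<in> \<B>" for k unfolding T_def by measurable
   have Tu: "(NN x. ennreal (\<bar>T k (u x)\<bar> powr q)) <= ennreal K" for k
   proof -
    define X where "X = (NN x. ennreal (\<bar>T k (u x)\<bar> powr q))"
    have "X <= (NN x. ennreal (real k powr q) * indicator {y. u y ~= 0} x)"
     unfolding X_def
    proof (rule nn_integral_mono)
     fix x
     have "\<bar>T k (u x)\<bar> <= real k" by (auto simp: T_def)
     then have "\<bar>T k (u x)\<bar> powr q <= real k powr q" using q by (intro powr_mono2) auto
     moreover have "T k (u x) = 0" if "u x = 0" using that by (simp add: T_def)
     ultimately show "ennreal (\<bar>T k (u x)\<bar> powr q) <= ennreal (real k powr q) * indicator {y. u y ~= 0} x"
      by (cases "u x = 0") (auto intro: ennreal_leI)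
    qed
    also have "... = ennreal (real k powr q) * emeasure lborel {y. u y ~= 0}"
     by (rule nn_integral_cmult_indicator) measurable
    also have "... < \<infinity>" using m by (simp add: ennreal_mult_less_top)
    finally obtain x where x: "X = ennreal x" "0 <= x" by (cases X rule: ennreal_cases) auto
    have "x <= K"
    proof (cases "x = 0")
     case False
     then have x0: "0 < x" using x(2) by simp
     have "X <= ennreal (C * x powr \<beta>) * gagliardo \<sigma> (%x. T k (u x))"
      using C(2)[of "%x. T k (u x)" x] x0 x(1) unfolding qe by (simp add: X_def \<beta>_def)
     also have "... <= ennreal (C * x powr \<beta>) * 1"
      using order_trans[OF gagliardo_contraction[OF T1] E] by (intro mult_left_mono) auto
     finally have "x <= C * x powr \<beta>" unfolding x(1) using C(1) by simp
     then have "x * x powr (- \<beta>) <= C * x powr \<beta> * x powr (- \<beta>)" by (intro mult_right_mono) auto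
     moreover have "x * x powr (- \<beta>) = x powr (1 - \<beta>)"
      using x0 powr_add[of x 1 "- \<beta>"] by simp
     moreover have "x powr \<beta> * x powr (- \<beta>) = 1" unfolding powr_add[symmetric] using x0 by simp
     ultimately have "x powr (1 - \<beta>) <= C" by (simp add: mult.assoc)
     then have "(x powr (1 - \<beta>)) powr (1 / (1 - \<beta>)) <= K" unfolding K_def using \<beta> by (intro powr_mono2) auto
     then show ?thesis using \<beta> x0 by (simp add: powr_powr)
    qed (simp add: K_def)
    then show ?thesis unfolding X_def[symmetric] x(1) by (rule ennreal_leI)
   qed
   have "(NN x. ennreal (\<bar>u x\<bar> powr q)) <= (NN x. liminf (%k. ennreal (\<bar>T k (u x)\<bar> powr q)))"
   proof (rule nn_integral_mono)
    fix x
    obtain k0 :: nat where k0: "\<bar>u x\<bar> < real k0" using reals_Archimedean2 by blast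
    have "\<forall>\<^sub>F k in sequentially. ennreal (\<bar>u x\<bar> powr q) <= ennreal (\<bar>T k (u x)\<bar> powr q)"
    proof (rule eventually_sequentiallyI[of k0])
     fix k assume "k0 <= k"
     then have "\<bar>u x\<bar> <= real k" using k0 by linarith
     then have "T k (u x) = u x" by (auto simp: T_def max_def min_def abs_le_iff)
     then show "ennreal (\<bar>u x\<bar> powr q) <= ennreal (\<bar>T k (u x)\<bar> powr q)" by simp
    qed
    then show "ennreal (\<bar>u x\<bar> powr q) <= liminf (%k. ennreal (\<bar>T k (u x)\<bar> powr q))" by (rule Liminf_bounded)
   qed
   also have "... <= liminf (%k. NN x. ennreal (\<bar>T k (u x)\<bar> powr q))"
    by (rule nn_integral_liminf) measurable
   also have "... <= liminf (%k::nat. ennreal K)" by (intro Liminf_mono always_eventually allI Tu)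
   also have "... = ennreal K" by (simp add: Liminf_const)
   finally show "(NN x. ennreal (\<bar>u x\<bar> powr q)) <= ennreal K" .
  qed
 qed
qed

text \<open>For \<open>\<sigma> = N / 2\<close> every step of \<open>fractional_sobolev_step\<close> raises the exponent by \<open>2\<close>, starting from the
Poincare inequality.\<close>

lemma fractional_sobolev_critical:
 fixes \<sigma> m :: real and k :: nat
 assumes \<sigma>: "0 < \<sigma>" "\<sigma> = real CARD('n) / 2" and m: "0 < m"
 shows "\<exists>K\<ge>0. \<forall>u :: real^'n => real. u \<in> \<B> --> emeasure lborel {y. u y ~= 0} <= ennreal m -->
   gagliardo \<sigma> u <= 1 --> (NN x. ennreal (\<bar>u x\<bar> powr (2 + 2 * real k))) <= ennreal K"
proof (induction k)
 case 0
 show ?case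
 proof (rule fractional_poincare[OF \<sigma>(1) m, where 'n = 'n])
  fix C assume C: "0 < C" "!!u :: real^'n => real. u \<in> \<B> ==> emeasure lborel {y. u y ~= 0} <= ennreal m ==>
   (NN x. ennreal ((u x)\<^sup>2)) <= ennreal C * gagliardo \<sigma> u"
  show ?case
  proof (intro exI[of _ C] conjI allI impI)
   fix u :: "real^'n => real"
   assume u: "u \<in> \<B>" "emeasure lborel {y. u y ~= 0} <= ennreal m" "gagliardo \<sigma> u <= 1"
   have "\<bar>t\<bar> powr 2 = t\<^sup>2" for t :: real by (cases "t = 0") auto
   then have "(NN x. ennreal (\<bar>u x\<bar> powr (2 + 2 * real 0))) = (NN x. ennreal ((u x)\<^sup>2))" by simp
   also have "... <= ennreal C * gagliardo \<sigma> u" by (rule C(2)[OF u(1,2)])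
   also have "... <= ennreal C * 1" by (intro mult_left_mono u(3)) simp
   finally show "(NN x. ennreal (\<bar>u x\<bar> powr (2 + 2 * real 0))) <= ennreal C" by simp
  qed (use C(1) in simp)
 qed
next
 case (Suc k)
 then obtain K where K: "K \<ge> 0" "\<forall>u :: real^'n => real. u \<in> \<B> --> emeasure lborel {y. u y ~= 0} <= ennreal m -->
   gagliardo \<sigma> u <= 1 --> (NN x. ennreal (\<bar>u x\<bar> powr (2 + 2 * real k))) <= ennreal K"
  by (elim exE conjE)
 have p: "0 < 2 + 2 * real k" by simp
 show ?case
 proof (rule fractional_sobolev_step[OF \<sigma>(1) p, where 'n = 'n])
  fix C assume C: "0 < C" "!!(u :: real^'n => real) X. u \<in> \<B> ==> 0 < X ==> (NN x. ennreal (\<bar>u x\<bar> powr (2 + 2 * real k))) <= ennreal X ==>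
   (NN x. ennreal (\<bar>u x\<bar> powr (2 + (2 + 2 * real k) * (2 * \<sigma> / real CARD('n))))) <= ennreal (C * X powr (2 * \<sigma> / real CARD('n))) * gagliardo \<sigma> u"
  have e: "2 + (2 + 2 * real k) * (2 * \<sigma> / real CARD('n)) = 2 + 2 * real (Suc k)"
  proof -
   have "2 * \<sigma> / real CARD('n) = 1" using \<sigma>(2) by simp
   then show ?thesis by (simp only:) simp
  qed
  show ?case
  proof (intro exI[of _ "C * (K + 1) powr (2 * \<sigma> / real CARD('n))"] conjI allI impI)
   show "0 <= C * (K + 1) powr (2 * \<sigma> / real CARD('n))" using C(1) by simp
   fix u :: "real^'n => real"
   assume u: "u \<in> \<B>" "emeasure lborel {y. u y ~= 0} <= ennreal m" "gagliardo \<sigma> u <= 1"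
   have "(NN x. ennreal (\<bar>u x\<bar> powr (2 + 2 * real k))) <= ennreal K" using K(2) u by blast
   also have "... <= ennreal (K + 1)" by (intro ennreal_leI) simp
   finally have "(NN x. ennreal (\<bar>u x\<bar> powr (2 + 2 * real (Suc k)))) <= ennreal (C * (K + 1) powr (2 * \<sigma> / real CARD('n))) * gagliardo \<sigma> u"
    using C(2)[OF u(1), of "K + 1"] K(1) unfolding e by simp
   also have "... <= ennreal (C * (K + 1) powr (2 * \<sigma> / real CARD('n))) * 1" by (intro mult_left_mono u(3)) simp
   finally show "(NN x. ennreal (\<bar>u x\<bar> powr (2 + 2 * real (Suc k)))) <= ennreal (C * (K + 1) powr (2 * \<sigma> / real CARD('n)))" by simp
  qed
 qed
qed

text \<open>Stampacchia's iteration over an increasing sequence of levels: \<open>gagliardo_density_lower_bound\<close> bounds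
the measure of a superlevel set by a power greater than \<open>1\<close> of the previous one.\<close>

lemma fractional_sobolev_supercritical:
 fixes \<sigma> m :: real
 assumes \<sigma>: "real CARD('n) / 2 < \<sigma>" and m: "0 < m"
 obtains D where "0 <= D"
  "!!u :: real^'n => real. u \<in> \<B> ==> emeasure lborel {y. u y ~= 0} <= ennreal m ==>
   gagliardo \<sigma> u <= 1 ==> (AE x in lborel. \<bar>u x\<bar> <= D)"
proof -
 have \<sigma>0: "0 < \<sigma>" using \<sigma> by (rule order.strict_trans1[rotated]) simp
 define \<beta> where "\<beta> = 2 * \<sigma> / real CARD('n)"
 have \<beta>: "1 < \<beta>" using \<sigma> by (simp add: \<beta>_def field_simps)
 show thesis
 proof (rule gagliardo_density_lower_bound[OF \<sigma>0, where 'n = 'n])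
  fix c :: real assume c: "0 < c" "!!u m l (x :: real^'n). u \<in> \<B> ==> 0 < m ==> 0 <= l ==>
   emeasure lborel {y. l < \<bar>u y\<bar>} <= ennreal m ==> l <= \<bar>u x\<bar> ==>
   ennreal ((\<bar>u x\<bar> - l)\<^sup>2 * (c * m powr (- (2 * \<sigma> / real CARD('n))))) <= gagliardo_density \<sigma> u x"
  (* The superlevel sets of the levels D (1 - 2^-k) shall have measure at most m \<rho>^k. The step from k
     to k + 1 requires \<rho>^(\<beta> - 1) = 1 / 4 and D^2 = 4 m^(\<beta> - 1) / (c \<rho>). *)
  define \<rho> where "\<rho> = (1 / 4) powr (1 / (\<beta> - 1) :: real)"
  have \<rho>: "0 < \<rho>" "\<rho> < 1" using \<beta> powr_less_mono'[of "1/4" 0 "1 / (\<beta> - 1)"] by (auto simp: \<rho>_def)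
  have \<rho>\<beta>: "\<rho> powr \<beta> = \<rho> * (1 / 4)"
  proof -
   have "\<rho> powr (\<beta> - 1) = 1 / 4" using \<beta> by (simp add: \<rho>_def powr_powr)
   then show ?thesis using powr_add[of \<rho> 1 "\<beta> - 1"] \<rho>(1) by simp
  qed
  define D where "D = sqrt (4 * m powr (\<beta> - 1) / (c * \<rho>))"
  have D: "0 < D" using c(1) m \<rho>(1) by (simp add: D_def)
  have D2: "D\<^sup>2 = 4 * m powr (\<beta> - 1) / (c * \<rho>)" using c(1) m \<rho>(1) by (simp add: D_def)
  show thesis
  proof (rule that[of D])
   show "0 <= D" using D by simp
   fix u :: "real^'n => real"
   assume u[measurable]: "u \<in> \<B>" and z: "emeasure lborel {y. u y ~= 0} <= ennreal m" and E: "gagliardo \<sigma> u <= 1"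
   define L where "L k = D * (1 - (1/2)^k)" for k :: nat
   have L0: "0 <= L k" for k using D by (simp add: L_def power_le_one)
   have level: "emeasure lborel {y. L k < \<bar>u y\<bar>} <= ennreal (m * \<rho> ^ k)" for k
   proof (induction k)
    case 0
    have "{y. L 0 < \<bar>u y\<bar>} = {y. u y ~= 0}" by (auto simp: L_def)
    then show ?case using z by simp
   next
    case (Suc k)
    define mk where "mk = m * \<rho> ^ k"
    have mk: "0 < mk" using m \<rho>(1) by (simp add: mk_def)
    define A where "A = {y. L (Suc k) < \<bar>u y\<bar>}"
    have [measurable]: "A \<in> sets borel" unfolding A_def by measurable
    define h where "h = (D * (1/2) ^ Suc k)\<^sup>2 * (c * mk powr (- \<beta>))"
    have dL: "L (Suc k) - L k = D * (1/2) ^ Suc k" by (simp add: L_def algebra_simps)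
    have h: "0 < h" using D c(1) mk by (simp add: h_def)
    have "ennreal h * emeasure lborel A = (NN x. ennreal h * indicator A x)"
     by (rule nn_integral_cmult_indicator[symmetric]) simp
    also have "... <= (NN x. gagliardo_density \<sigma> u x)"
    proof (rule nn_integral_mono)
     fix x
     show "ennreal h * indicator A x <= gagliardo_density \<sigma> u x"
     proof (cases "x \<in> A")
      case True
      then have x: "L (Suc k) < \<bar>u x\<bar>" by (simp add: A_def)
      have d0: "0 <= D * (1/2) ^ Suc k" using D by simp
      have "h <= (\<bar>u x\<bar> - L k)\<^sup>2 * (c * mk powr (- \<beta>))"
       unfolding h_def using x dL d0 c(1) by (intro mult_right_mono power_mono) auto
      then have "ennreal h <= ennreal ((\<bar>u x\<bar> - L k)\<^sup>2 * (c * mk powr (- \<beta>)))" by (rule ennreal_leI)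
      also have "... <= gagliardo_density \<sigma> u x"
       unfolding \<beta>_def using x dL d0 Suc by (intro c(2)[OF u mk L0]) (auto simp: mk_def)
      finally show ?thesis using True by simp
     qed simp
    qed
    also have "... <= 1" using E by (simp add: gagliardo_eq_density)
    finally have "ennreal (1 / h) * (ennreal h * emeasure lborel A) <= ennreal (1 / h) * 1" by (intro mult_left_mono) auto
    moreover have "ennreal (1 / h) * ennreal h = 1" using h by (simp add: ennreal_mult[symmetric])
    ultimately have "emeasure lborel A <= ennreal (1 / h)" by (simp add: mult.assoc[symmetric])
    also have "1 / h = m * \<rho> ^ Suc k"
    proof -
     have p1: "mk powr \<beta> = m * m powr (\<beta> - 1) * (\<rho> ^ k * (1/4)^k)"
     proof -
      have "mk powr \<beta> = m powr \<beta> * (\<rho> powr real k) powr \<beta>"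
       using m \<rho>(1) by (simp add: mk_def powr_mult powr_realpow)
      also have "(\<rho> powr real k) powr \<beta> = (\<rho> powr \<beta>) powr real k" by (simp add: powr_powr mult.commute)
      also have "... = (\<rho> * (1/4)) ^ k" unfolding \<rho>\<beta> using \<rho>(1) by (simp add: powr_realpow)
      also have "m powr \<beta> = m * m powr (\<beta> - 1)" using powr_add[of m 1 "\<beta> - 1"] m by simp
      finally show ?thesis by (simp only: power_mult_distrib mult.assoc)
     qed
     have p2: "mk powr (- \<beta>) = 1 / mk powr \<beta>" by (rule powr_minus_divide)
     have p3: "((1/2 :: real) ^ Suc k)\<^sup>2 = (1/4) * (1/4)^k"
      by (simp add: power2_eq_square power_mult_distrib[symmetric])
     have h_eq: "h = D\<^sup>2 * ((1/4) * (1/4)^k) * c / (m * m powr (\<beta> - 1) * (\<rho> ^ k * (1/4)^k))"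
      unfolding h_def p2 p1 power_mult_distrib p3 by simp
     define P where "P = m powr (\<beta> - 1)"
     define Q :: real where "Q = (1/4)^k"
     have PQ: "0 < P" "0 < Q" using m by (auto simp: P_def Q_def)
     have "h = (4 * P / (c * \<rho>)) * ((1/4) * Q) * c / (m * P * (\<rho> ^ k * Q))"
      unfolding h_eq D2 P_def Q_def ..
     also have "... = 1 / (m * \<rho> ^ Suc k)" using PQ m c(1) \<rho>(1) by (simp add: field_simps)
     finally show ?thesis by simp
    qed
    finally show ?case unfolding A_def .
   qed
   define A where "A = {y. D < \<bar>u y\<bar>}"
   have [measurable]: "A \<in> sets borel" unfolding A_def by measurable
   have le: "emeasure lborel A <= ennreal (m * \<rho> ^ k)" for k
   proof -
    have "L k <= D" using D by (simp add: L_def algebra_simps)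
    then have "emeasure lborel A <= emeasure lborel {y. L k < \<bar>u y\<bar>}"
     by (intro emeasure_mono) (auto simp: A_def)
    then show ?thesis using level[of k] by (rule order_trans)
   qed
   have "(%k. m * \<rho> ^ k) \<longlonglongrightarrow> m * 0" using \<rho> by (intro tendsto_mult tendsto_const LIMSEQ_power_zero) auto
   then have "(%k. ennreal (m * \<rho> ^ k)) \<longlonglongrightarrow> ennreal (m * 0)" by (rule tendsto_ennrealI)
   then have "emeasure lborel A <= ennreal (m * 0)" by (rule LIMSEQ_le_const) (use le in blast)
   then have "A \<in> null_sets lborel" by (simp add: null_sets_def)
   then have "AE x in lborel. x \<notin> A" by (rule AE_not_in)
   then show "AE x in lborel. \<bar>u x\<bar> <= D" by (rule AE_mp) (auto simp: A_def not_less)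
  qed
 qed
qed

section \<open>The Sobolev--Slobodeckij norm\<close>

lemma Hs_norm_sq_eq: "Hs_norm_sq \<sigma> u = (NN x. ennreal ((u x)\<^sup>2)) + gagliardo \<sigma> u"
 unfolding Hs_norm_sq_def gagliardo_def nn_integral_completion ..

lemma gagliardo_cong_AE:
 fixes u v :: "real^'n => real"
 assumes "AE x in lebesgue. u x = v x"
 shows "gagliardo \<sigma> u = gagliardo \<sigma> v"
proof -
 have ae: "AE x in lborel. u x = v x" using assms by (simp add: AE_completion_iff)
 show ?thesis
  unfolding gagliardo_def
 proof (rule nn_integral_cong_AE, use ae in eventually_elim)
  fix x assume x: "u x = v x"
  show "(NN y. ennreal ((u x - u y)\<^sup>2 / norm (x - y) powr (real CARD('n) + 2 * \<sigma>)))
    = (NN y. ennreal ((v x - v y)\<^sup>2 / norm (x - y) powr (real CARD('n) + 2 * \<sigma>)))"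
   by (rule nn_integral_cong_AE, use ae in eventually_elim) (simp add: x)
 qed
qed

lemma Hs_norm_sq_cong_AE:
 assumes "AE x in lebesgue. u x = v x"
 shows "Hs_norm_sq \<sigma> u = Hs_norm_sq \<sigma> v"
proof -
 have "AE x in lborel. u x = v x" using assms by (simp add: AE_completion_iff)
 then have "(NN x. ennreal ((u x)\<^sup>2)) = (NN x. ennreal ((v x)\<^sup>2))"
  by (intro nn_integral_cong_AE) auto
 then show ?thesis by (simp add: Hs_norm_sq_eq gagliardo_cong_AE[OF assms])
qed

lemma square_lin_le: "(a * s + b * t)\<^sup>2 <= 2 * a\<^sup>2 * s\<^sup>2 + 2 * b\<^sup>2 * (t::real)\<^sup>2"
 using zero_le_power2[of "a * s - b * t"] by (simp add: power2_sum power2_diff power_mult_distrib)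

text \<open>The factor \<open>2\<close> avoids the triangle inequality; the estimate is only used for convergence to \<open>0\<close> and
for bounds up to constants.\<close>

lemma gagliardo_lin_le:
 fixes u v :: "real^'n => real"
 assumes [measurable]: "u \<in> \<B>" "v \<in> \<B>"
 shows "gagliardo \<sigma> (%x. a * u x + b * v x) <= ennreal (2 * a\<^sup>2) * gagliardo \<sigma> u + ennreal (2 * b\<^sup>2) * gagliardo \<sigma> v"
proof -
 let ?k = "%w x y. ennreal ((w x - w y)\<^sup>2 / norm (x - y :: real^'n) powr (real CARD('n) + 2 * \<sigma>))"
 have le: "?k (%x. a * u x + b * v x) x y <= ennreal (2 * a\<^sup>2) * ?k u x y + ennreal (2 * b\<^sup>2) * ?k v x y" for x y
 proof -
  have "(a * u x + b * v x - (a * u y + b * v y))\<^sup>2 <= 2 * a\<^sup>2 * (u x - u y)\<^sup>2 + 2 * b\<^sup>2 * (v x - v y)\<^sup>2"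
   using square_lin_le[of a "u x - u y" b "v x - v y"] by (simp add: algebra_simps)
  then have "(a * u x + b * v x - (a * u y + b * v y))\<^sup>2 / norm (x - y) powr (real CARD('n) + 2 * \<sigma>)
   <= (2 * a\<^sup>2 * (u x - u y)\<^sup>2 + 2 * b\<^sup>2 * (v x - v y)\<^sup>2) / norm (x - y) powr (real CARD('n) + 2 * \<sigma>)"
   by (rule divide_right_mono) simp
  also have "... = 2 * a\<^sup>2 * ((u x - u y)\<^sup>2 / norm (x - y) powr (real CARD('n) + 2 * \<sigma>)) + 2 * b\<^sup>2 * ((v x - v y)\<^sup>2 / norm (x - y) powr (real CARD('n) + 2 * \<sigma>))"
   by (simp add: add_divide_distrib)
  finally have "?k (%x. a * u x + b * v x) x y <= ennreal (2 * a\<^sup>2 * ((u x - u y)\<^sup>2 / norm (x - y) powr (real CARD('n) + 2 * \<sigma>)) + 2 * b\<^sup>2 * ((v x - v y)\<^sup>2 / norm (x - y) powr (real CARD('n) + 2 * \<sigma>)))"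
   by (rule ennreal_leI)
  then show ?thesis by (simp add: ennreal_plus[symmetric] ennreal_mult[symmetric] del: ennreal_plus)
 qed
 have "gagliardo \<sigma> (%x. a * u x + b * v x) <= (NN x. NN y. ennreal (2 * a\<^sup>2) * ?k u x y + ennreal (2 * b\<^sup>2) * ?k v x y)"
  unfolding gagliardo_def by (intro nn_integral_mono le)
 also have "... = ennreal (2 * a\<^sup>2) * gagliardo \<sigma> u + ennreal (2 * b\<^sup>2) * gagliardo \<sigma> v"
  unfolding gagliardo_def by (simp add: nn_integral_add nn_integral_cmult)
 finally show ?thesis .
qed

lemma Hs_norm_sq_lin_le:
 fixes u v :: "real^'n => real"
 assumes u: "u \<in> \<L>" and v: "v \<in> \<L>"
 shows "Hs_norm_sq \<sigma> (%x. a * u x + b * v x) <= ennreal (2 * a\<^sup>2) * Hs_norm_sq \<sigma> u + ennreal (2 * b\<^sup>2) * Hs_norm_sq \<sigma> v"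
proof -
 obtain u' where u': "u' \<in> \<B>" "AE x in lebesgue. u x = u' x" "AE x in lborel. u x = u' x"
  by (rule lebesgue_borel_representative[OF u]) (rule that)
 obtain v' where v': "v' \<in> \<B>" "AE x in lebesgue. v x = v' x" "AE x in lborel. v x = v' x"
  by (rule lebesgue_borel_representative[OF v]) (rule that)
 note [measurable] = u'(1) v'(1)
 have "AE x in lebesgue. a * u x + b * v x = a * u' x + b * v' x" using u'(2) v'(2) by eventually_elim simp
 note e = Hs_norm_sq_cong_AE[OF this] Hs_norm_sq_cong_AE[OF u'(2)] Hs_norm_sq_cong_AE[OF v'(2)]
 have "(NN x. ennreal ((a * u' x + b * v' x)\<^sup>2)) <= (NN x. ennreal (2 * a\<^sup>2) * ennreal ((u' x)\<^sup>2) + ennreal (2 * b\<^sup>2) * ennreal ((v' x)\<^sup>2))"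
 proof (rule nn_integral_mono)
  fix x
  have "ennreal ((a * u' x + b * v' x)\<^sup>2) <= ennreal (2 * a\<^sup>2 * (u' x)\<^sup>2 + 2 * b\<^sup>2 * (v' x)\<^sup>2)"
   by (rule ennreal_leI) (rule square_lin_le)
  then show "ennreal ((a * u' x + b * v' x)\<^sup>2) <= ennreal (2 * a\<^sup>2) * ennreal ((u' x)\<^sup>2) + ennreal (2 * b\<^sup>2) * ennreal ((v' x)\<^sup>2)"
   by (simp add: ennreal_plus[symmetric] ennreal_mult[symmetric] del: ennreal_plus)
 qed
 also have "... = ennreal (2 * a\<^sup>2) * (NN x. ennreal ((u' x)\<^sup>2)) + ennreal (2 * b\<^sup>2) * (NN x. ennreal ((v' x)\<^sup>2))"
  by (simp add: nn_integral_add nn_integral_cmult)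
 finally have "(NN x. ennreal ((a * u' x + b * v' x)\<^sup>2)) + gagliardo \<sigma> (%x. a * u' x + b * v' x) <=
  ennreal (2 * a\<^sup>2) * (NN x. ennreal ((u' x)\<^sup>2)) + ennreal (2 * b\<^sup>2) * (NN x. ennreal ((v' x)\<^sup>2)) +
  (ennreal (2 * a\<^sup>2) * gagliardo \<sigma> u' + ennreal (2 * b\<^sup>2) * gagliardo \<sigma> v')"
  by (rule add_mono) (rule gagliardo_lin_le[OF u'(1) v'(1)])
 then show ?thesis unfolding e unfolding Hs_norm_sq_eq by (simp add: distrib_left ac_simps)
qed

lemma tendsto_0_lin_le_ennreal:
 fixes f g h :: "nat => ennreal"
 assumes "f \<longlonglongrightarrow> 0" "g \<longlonglongrightarrow> 0" "!!n. h n <= ennreal a * f n + ennreal b * g n"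
 shows "h \<longlonglongrightarrow> 0"
proof (rule tendsto_sandwich[of "%_. 0"])
 have "(%n. ennreal a * f n + ennreal b * g n) \<longlonglongrightarrow> ennreal a * 0 + ennreal b * 0"
  by (intro tendsto_add ennreal_tendsto_cmult assms) simp_all
 then show "(%n. ennreal a * f n + ennreal b * g n) \<longlonglongrightarrow> 0" by simp
qed (use assms(3) in auto)

section \<open>Square integrable fields and uniqueness of the fractional gradient\<close>

lemma L2_component_measurable: "f \<in> L2 ==> (%x. f x $ j) \<in> \<L>"
proof -
 assume "f \<in> L2"
 then have "(%x. f x \<bullet> axis j 1) \<in> \<L>"
  by (intro borel_measurable_inner borel_measurable_const) (rule L2_measurable)
 then show ?thesis by (simp add: inner_axis)
qed

lemma locally_integrable_alt: "locally_integrable w \<longleftrightarrow> (\<forall>K. compact K --> integrable lebesgue (%x. indicator K x * w x))"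
 by (simp add: locally_integrable_def set_integrable_def)

lemma L2_locally_integrable:
 assumes g: "g \<in> L2"
 shows "locally_integrable (%x. g x $ j)"
 unfolding locally_integrable_alt
proof (intro allI impI)
 fix K :: "(real^'a) set" assume K: "compact K"
 have K': "K \<in> sets lebesgue" using K by (simp add: compact_imp_closed)
 have "integrable lborel (indicator K :: _ => real)"
  using emeasure_bounded_finite[OF compact_imp_bounded[OF K]] K by (simp add: integrable_indicator_iff compact_imp_closed)
 then have i: "integrable lebesgue (indicator K :: _ => real)"
  by (subst integrable_completion) (use K in \<open>auto simp: compact_imp_closed\<close>)
 have "integrable lebesgue (%x. indicator K x + (norm (g x))\<^sup>2)"
  using i g by (intro Bochner_Integration.integrable_add) (auto simp: L2_def)
 then show "integrable lebesgue (%x. indicator K x * g x $ j)"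
 proof (rule Bochner_Integration.integrable_bound)
  show "(%x. indicator K x * g x $ j) \<in> \<L>"
   using K' L2_component_measurable[OF g] by (intro borel_measurable_times) auto
  show "AE x in lebesgue. norm (indicator K x * g x $ j) <= norm (indicator K x + (norm (g x))\<^sup>2)"
  proof (rule AE_I2)
   fix x
   have "\<bar>g x $ j\<bar> <= norm (g x)" by (rule component_le_norm_cart)
   also have "... <= 1 + (norm (g x))\<^sup>2"
   proof -
    have "t <= 1 + t\<^sup>2" if "0 <= t" for t :: real
     using zero_le_power2[of "t - 1"] that by (simp add: power2_diff)
    then show ?thesis by simp
   qed
   finally show "norm (indicator K x * g x $ j) <= norm (indicator K x + (norm (g x))\<^sup>2)"
    by (simp add: indicator_def)
  qed
 qed
qed

lemma locally_integrable_mult_Cc: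
 assumes h: "locally_integrable h" and c: "Cc_fun \<psi>"
 shows "integrable lebesgue (%x. h x * \<psi> x)"
proof -
 obtain B R where B: "0 <= B" "0 <= R" "!!x. \<bar>\<psi> x\<bar> <= B" "!!x. \<bar>\<psi> x\<bar> <= B * indicator (cball 0 R) x" "!!x. x \<notin> cball 0 R ==> \<psi> x = 0"
  by (rule Cc_fun_bounds[OF c]) (rule that)
 have i: "integrable lebesgue (%x. indicator (cball 0 R) x * h x)" using h by (simp add: locally_integrable_alt)
 then have i': "integrable lebesgue (%x. B * (indicator (cball 0 R) x * h x))" by (rule integrable_mult_right)
 have eq: "h x * \<psi> x = indicator (cball 0 R) x * h x * \<psi> x" for x
  using B(5)[of x] by (cases "x \<in> cball 0 R") (auto simp: indicator_def)
 show ?thesis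
 proof (rule Bochner_Integration.integrable_bound[OF i'])
  show "(%x. h x * \<psi> x) \<in> \<L>"
   unfolding eq by (intro borel_measurable_times borel_measurable_integrable[OF i] borel_measurable_integrable[OF Cc_fun_integrable_lebesgue[OF c]])
  show "AE x in lebesgue. norm (h x * \<psi> x) <= norm (B * (indicator (cball 0 R) x * h x))"
  proof (rule AE_I2)
   fix x
   have "\<bar>h x * \<psi> x\<bar> = \<bar>indicator (cball 0 R) x * h x\<bar> * \<bar>\<psi> x\<bar>" unfolding eq by (simp only: abs_mult)
   also have "... <= \<bar>indicator (cball 0 R) x * h x\<bar> * B" by (intro mult_left_mono B(3)) simp
   finally show "norm (h x * \<psi> x) <= norm (B * (indicator (cball 0 R) x * h x))"
    using B(1) by (simp only: real_norm_def abs_mult) (simp add: ac_simps)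
  qed
 qed
qed

lemma locally_integrable_diff:
 assumes "locally_integrable h" "locally_integrable k"
 shows "locally_integrable (%x. h x - k x)"
 using assms by (simp add: locally_integrable_alt right_diff_distrib)

text \<open>Justifies working with the representative that \<open>frac_grad\<close> chooses.\<close>

lemma is_frac_grad_unique:
 assumes g: "is_frac_grad \<sigma> u g" and h: "is_frac_grad \<sigma> u h"
 shows "AE x in lebesgue. g x = h x"
proof -
 have "AE x in lebesgue. g x $ j - h x $ j = 0" for j
 proof (rule fundamental_lemma_AE)
  have l: "locally_integrable (%x. g x $ j)" "locally_integrable (%x. h x $ j)"
   using g h unfolding is_frac_grad_def distr_partial_deriv_def by auto
  then show "locally_integrable (%x. g x $ j - h x $ j)" by (rule locally_integrable_diff)
  fix \<psi> :: "real^'a => real" assume \<psi>: "\<psi> \<in> test_functions UNIV"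
  have "(LINT x|lebesgue. g x $ j * \<psi> x) = (LINT x|lebesgue. h x $ j * \<psi> x)"
  proof -
   have "(LINT x|lebesgue. riesz_potential (1 - \<sigma>) u x * partial_deriv j \<psi> x) = - (LINT x|lebesgue. g' x $ j * \<psi> x)"
    if g': "is_frac_grad \<sigma> u g'" for g'
    using g'[unfolded is_frac_grad_def distr_partial_deriv_def, rule_format, of j] \<psi> by simp
   from this[OF g] this[OF h] show ?thesis by simp
  qed
  then show "(LINT x|lebesgue. (g x $ j - h x $ j) * \<psi> x) = 0"
   unfolding left_diff_distrib
   by (subst Bochner_Integration.integral_diff) (simp_all add: locally_integrable_mult_Cc[OF l(1) Cc_fun_test[OF \<psi>]] locally_integrable_mult_Cc[OF l(2) Cc_fun_test[OF \<psi>]])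
 qed
 then have "AE x in lebesgue. \<forall>j\<in>UNIV. g x $ j - h x $ j = 0" by (subst AE_finite_all) auto
 then show ?thesis by eventually_elim (simp add: vec_eq_iff)
qed

lemma is_frac_grad_some: "is_frac_grad \<sigma> u g ==> is_frac_grad \<sigma> u (frac_grad \<sigma> u)"
 unfolding frac_grad_def by (rule someI[where P = "is_frac_grad \<sigma> u"])

lemma L2_cong_AE:
 assumes f: "f \<in> L2" and ae: "AE x in lebesgue. f x = g x"
 shows "g \<in> L2"
proof -
 have "(NL x. ennreal ((norm (g x))\<^sup>2)) = (NL x. ennreal ((norm (f x))\<^sup>2))"
  by (rule nn_integral_cong_AE) (use ae in eventually_elim, simp)
 then show ?thesis using f borel_measurable_AE[OF _ ae] by (simp add: L2_iff_nn)
qed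

lemma frac_grad_eq:
 assumes "is_frac_grad \<sigma> u g" "g \<in> L2"
 shows "frac_grad \<sigma> u \<in> L2" "AE x in lebesgue. g x = frac_grad \<sigma> u x"
proof -
 show ae: "AE x in lebesgue. g x = frac_grad \<sigma> u x"
  by (rule is_frac_grad_unique[OF assms(1) is_frac_grad_some[OF assms(1)]])
 show "frac_grad \<sigma> u \<in> L2" by (rule L2_cong_AE[OF assms(2) ae])
qed

lemma riesz_conv_bounded_lebesgue:
 fixes \<psi> :: "real^'n => real"
 assumes \<alpha>: "0 < \<alpha>" "\<alpha> < real CARD('n)" and \<psi>: "\<psi> \<in> test_functions \<Omega>"
 obtains K where "0 <= K" "!!x. \<bar>c * riesz_conv \<alpha> (partial_deriv j \<psi>) x\<bar> <= K"
  "(%x. c * riesz_conv \<alpha> (partial_deriv j \<psi>) x) \<in> \<L>"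
proof -
 have c: "Cc_fun (partial_deriv j \<psi>)" by (rule Cc_fun_test[OF test_functions_partial_deriv[OF \<psi>]])
 note [measurable] = Cc_fun_borel[OF c]
 have \<alpha>': "\<alpha> < real DIM(real^'n)" using \<alpha> by simp
 obtain K where K: "0 <= K" "!!x. \<bar>riesz_conv \<alpha> (partial_deriv j \<psi>) x\<bar> <= K"
  by (rule riesz_conv_bounded[OF \<alpha>(1) \<alpha>' c]) (rule that)
 show thesis
 proof (rule that[of "\<bar>c\<bar> * K"])
  show "\<bar>c * riesz_conv \<alpha> (partial_deriv j \<psi>) x\<bar> <= \<bar>c\<bar> * K" for x
   unfolding abs_mult by (intro mult_left_mono K(2)) simp
  show "(%x. c * riesz_conv \<alpha> (partial_deriv j \<psi>) x) \<in> \<L>"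
   by (rule measurable_completion) measurable
 qed (use K in simp)
qed

lemma integrable_bounded_mult:
 fixes u w :: "'a => real"
 assumes "integrable M u" "w \<in> borel_measurable M" "!!x. \<bar>w x\<bar> <= K"
 shows "integrable M (%x. u x * w x)"
proof (rule Bochner_Integration.integrable_bound)
 show "integrable M (%x. K * u x)" using assms(1) by simp
 show "(%x. u x * w x) \<in> borel_measurable M" using assms by (intro borel_measurable_times) auto
 show "AE x in M. norm (u x * w x) <= norm (K * u x)"
 proof (rule AE_I2)
  fix x
  have "\<bar>u x\<bar> * \<bar>w x\<bar> <= \<bar>u x\<bar> * \<bar>K\<bar>" using assms(3)[of x] by (intro mult_left_mono) auto
  then show "norm (u x * w x) <= norm (K * u x)" by (simp add: abs_mult ac_simps)
 qed
qed

lemma is_frac_grad_lin: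
 fixes u v :: "real^'n => real"
 assumes \<sigma>: "0 < \<sigma>" "\<sigma> < 1" and u: "integrable lebesgue u" and v: "integrable lebesgue v"
  and g: "is_frac_grad \<sigma> u g" and h: "is_frac_grad \<sigma> v h"
 shows "is_frac_grad \<sigma> (%x. a * u x + b * v x) (%x. a *\<^sub>R g x + b *\<^sub>R h x)"
 unfolding is_frac_grad_def
proof
 fix j :: 'n
 have \<alpha>: "0 < 1 - \<sigma>" "1 - \<sigma> < real CARD('n)"
 proof -
  have "1 <= real CARD('n)" using zero_less_card_finite[where 'a='n] by linarith
  then show "0 < 1 - \<sigma>" "1 - \<sigma> < real CARD('n)" using \<sigma> by linarith+
 qed
 have uv: "integrable lebesgue (%x. a * u x + b * v x)" using u v by simp
 have G: "locally_integrable (%x. g x $ j)"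
   "!!\<psi>. \<psi> \<in> test_functions UNIV ==> (LINT x|lebesgue. u x * (riesz_const CARD('n) (1 - \<sigma>) * riesz_conv (1 - \<sigma>) (partial_deriv j \<psi>) x)) = - (LINT x|lebesgue. g x $ j * \<psi> x)"
  using g unfolding is_frac_grad_def distr_partial_deriv_riesz_iff[OF \<alpha> u] by auto
 have H: "locally_integrable (%x. h x $ j)"
   "!!\<psi>. \<psi> \<in> test_functions UNIV ==> (LINT x|lebesgue. v x * (riesz_const CARD('n) (1 - \<sigma>) * riesz_conv (1 - \<sigma>) (partial_deriv j \<psi>) x)) = - (LINT x|lebesgue. h x $ j * \<psi> x)"
  using h unfolding is_frac_grad_def distr_partial_deriv_riesz_iff[OF \<alpha> v] by auto
 have lin: "integral\<^sup>L lebesgue (%x. (a * p x + b * r x) * w x) = a * (LINT x|lebesgue. p x * w x) + b * (LINT x|lebesgue. r x * w x)"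
  if "integrable lebesgue (%x. p x * w x)" "integrable lebesgue (%x. r x * w x)" for p r w :: "real^'n => real"
 proof -
  have "(%x. (a * p x + b * r x) * w x) = (%x. a * (p x * w x) + b * (r x * w x))" by (simp add: algebra_simps)
  then show ?thesis using that by simp
 qed
 show "distr_partial_deriv j (riesz_potential (1 - \<sigma>) (%x. a * u x + b * v x)) (%x. (a *\<^sub>R g x + b *\<^sub>R h x) $ j)"
  unfolding distr_partial_deriv_riesz_iff[OF \<alpha> uv]
 proof (intro conjI ballI)
  show "locally_integrable (%x. (a *\<^sub>R g x + b *\<^sub>R h x) $ j)"
   unfolding locally_integrable_alt
  proof (intro allI impI)
   fix K :: "(real^'n) set" assume "compact K"
   then have "integrable lebesgue (%x. a * (indicator K x * g x $ j) + b * (indicator K x * h x $ j))"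
    using G(1) H(1) by (simp add: locally_integrable_alt)
   then show "integrable lebesgue (%x. indicator K x * (a *\<^sub>R g x + b *\<^sub>R h x) $ j)"
    by (simp add: algebra_simps)
  qed
  fix \<psi> :: "real^'n => real" assume \<psi>: "\<psi> \<in> test_functions UNIV"
  obtain K where K: "0 <= K" "!!x. \<bar>riesz_const CARD('n) (1 - \<sigma>) * riesz_conv (1 - \<sigma>) (partial_deriv j \<psi>) x\<bar> <= K"
   "(%x. riesz_const CARD('n) (1 - \<sigma>) * riesz_conv (1 - \<sigma>) (partial_deriv j \<psi>) x) \<in> \<L>"
   by (rule riesz_conv_bounded_lebesgue[OF \<alpha> \<psi>]) (rule that)
  show "(LINT x|lebesgue. (a * u x + b * v x) * (riesz_const CARD('n) (1 - \<sigma>) * riesz_conv (1 - \<sigma>) (partial_deriv j \<psi>) x)) = - (LINT x|lebesgue. (a *\<^sub>R g x + b *\<^sub>R h x) $ j * \<psi> x)"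
   using lin[OF integrable_bounded_mult[OF u K(3,2)] integrable_bounded_mult[OF v K(3,2)]]
    lin[OF locally_integrable_mult_Cc[OF G(1) Cc_fun_test[OF \<psi>]] locally_integrable_mult_Cc[OF H(1) Cc_fun_test[OF \<psi>]]]
   by (simp add: G(2)[OF \<psi>] H(2)[OF \<psi>])
 qed
qed

section \<open>Fractional gradients of test functions\<close>

text \<open>Finiteness is read off from the time integral in \<open>gagliardo_heat\<close>.\<close>

lemma gagliardo_test_finite:
 fixes \<phi> :: "real^'n => real"
 assumes \<sigma>: "0 < \<sigma>" "\<sigma> < 1" and \<phi>: "\<phi> \<in> test_functions \<Omega>"
 shows "gagliardo \<sigma> \<phi> < \<infinity>"
proof -
 have \<phi>U: "\<phi> \<in> test_functions UNIV" using \<phi> test_functions_mono[of \<Omega> UNIV] by auto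
 obtain C where C: "0 < C" "!!\<phi> :: real^'n => real. \<phi> \<in> test_functions UNIV ==>
   ennreal C * gagliardo \<sigma> \<phi> = (NN r. ennreal (grad_heat_form \<phi> r * r powr (- \<sigma>)) * indicator {0<..} r)"
  by (rule gagliardo_heat[OF \<sigma>(1)]) (rule that)
 have "\<exists>M. 0 < M \<and> (\<forall>t. 0 < t --> heat_form (partial_deriv j \<phi>) t <= M \<and> heat_form (partial_deriv j \<phi>) t <= M / t)" for j
  by (rule heat_form_decay[OF \<phi>, of j]) auto
 then obtain M where M: "!!j. 0 < M j \<and> (\<forall>t. 0 < t --> heat_form (partial_deriv j \<phi>) t <= M j \<and> heat_form (partial_deriv j \<phi>) t <= M j / t)"
  by metis
 define L where "L = (\<Sum>j\<in>UNIV. M j)"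
 have L: "0 <= L" unfolding L_def by (intro sum_nonneg) (use M in \<open>auto intro: less_imp_le\<close>)
 have b: "grad_heat_form \<phi> r <= L" "grad_heat_form \<phi> r <= L / r" if "0 < r" for r
  unfolding grad_heat_form_def L_def sum_divide_distrib by (intro sum_mono, use M that in blast)+
 have "ennreal C * gagliardo \<sigma> \<phi> <= (NN r. ennreal L * (ennreal (r powr ((1 - \<sigma>) - 1)) * indicator {0..1} r) + ennreal L * (ennreal (r powr (- \<sigma> - 1)) * indicator {1..} r))"
  unfolding C(2)[OF \<phi>U]
 proof (rule nn_integral_mono)
  fix r :: real
  consider "r <= 0" | "0 < r" "r <= 1" | "1 < r" by linarith
  then show "ennreal (grad_heat_form \<phi> r * r powr (- \<sigma>)) * indicator {0<..} r <= ennreal L * (ennreal (r powr ((1 - \<sigma>) - 1)) * indicator {0..1} r) + ennreal L * (ennreal (r powr (- \<sigma> - 1)) * indicator {1..} r)"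
  proof cases
   case 2
   have "ennreal (grad_heat_form \<phi> r * r powr (- \<sigma>)) <= ennreal (L * r powr (- \<sigma>))"
    by (rule ennreal_leI) (rule mult_right_mono[OF b(1)[OF 2(1)]], simp)
   also have "... = ennreal L * (ennreal (r powr ((1 - \<sigma>) - 1)) * indicator {0..1} r)"
    using 2 L by (simp add: ennreal_mult)
   finally show ?thesis using 2 by (simp add: add_increasing2)
  next
   case 3
   have "ennreal (grad_heat_form \<phi> r * r powr (- \<sigma>)) <= ennreal (L / r * r powr (- \<sigma>))"
    by (rule ennreal_leI) (rule mult_right_mono[OF b(2)], use 3 in simp_all)
   also have "L / r * r powr (- \<sigma>) = L * r powr (- \<sigma> - 1)" using 3 by (simp add: powr_diff)
   also have "ennreal ... = ennreal L * (ennreal (r powr (- \<sigma> - 1)) * indicator {1..} r)"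
    using 3 L by (simp add: ennreal_mult)
   finally show ?thesis using 3 by (simp add: add_increasing)
  qed simp
 qed
 also have "... = ennreal L * ennreal (1 / (1 - \<sigma>)) + ennreal L * ennreal (1 powr (- \<sigma>) / \<sigma>)"
  using nn_integral_powr_01[of "1 - \<sigma>"] nn_integral_powr_ge[of \<sigma> 1] \<sigma> by (simp add: nn_integral_add nn_integral_cmult)
 also have "... < \<infinity>" by (simp add: ennreal_mult_less_top)
 finally have fin: "ennreal C * gagliardo \<sigma> \<phi> < \<infinity>" .
 show ?thesis
 proof (rule ccontr)
  assume "\<not> gagliardo \<sigma> \<phi> < \<infinity>"
  then have "gagliardo \<sigma> \<phi> = top" by (metis infinity_ennreal_def top.not_eq_extremum)
  then have "ennreal C * gagliardo \<sigma> \<phi> = top" using C(1) by (simp add: ennreal_mult_eq_top_iff)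
  then show False using fin by simp
 qed
qed

lemma test_frac_grad_borel:
 fixes \<phi> :: "real^'n => real"
 assumes \<phi>: "\<phi> \<in> test_functions \<Omega>"
 shows "test_frac_grad \<sigma> \<phi> \<in> \<B>"
proof (subst borel_measurable_euclidean_space, rule ballI)
 fix i :: "real^'n" assume "i \<in> Basis"
 then have "\<exists>j. i = axis j 1" by (simp add: Basis_vec_def)
 then obtain j where j: "i = axis j 1" by (rule exE)
 note [measurable] = Cc_fun_borel[OF Cc_fun_partial_deriv[OF \<phi>]]
 have "(%x. test_frac_grad \<sigma> \<phi> x \<bullet> i) = (%x. riesz_const CARD('n) (1 - \<sigma>) * riesz_conv (1 - \<sigma>) (partial_deriv j \<phi>) x)"
  unfolding j by (simp add: inner_axis test_frac_grad_def)
 moreover have "(%x. riesz_const CARD('n) (1 - \<sigma>) * riesz_conv (1 - \<sigma>) (partial_deriv j \<phi>) x) \<in> \<B>"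
  by measurable
 ultimately show "(%x. test_frac_grad \<sigma> \<phi> x \<bullet> i) \<in> \<B>" by (simp only:)
qed

lemma one_minus_order:
 assumes "0 < \<sigma>" "\<sigma> < 1" shows "0 < 1 - \<sigma>" "1 - \<sigma> < real CARD('n::finite)"
proof -
 have "1 <= real CARD('n)" using zero_less_card_finite[where 'a='n] by linarith
 then show "0 < 1 - \<sigma>" "1 - \<sigma> < real CARD('n)" using assms by linarith+
qed

lemma test_frac_grad_energy:
 fixes \<sigma> :: real
 assumes \<sigma>: "0 < \<sigma>" "\<sigma> < 1"
 obtains E :: real where "0 < E"
  "!!(\<phi> :: real^'n => real) \<Omega>. \<phi> \<in> test_functions \<Omega> ==>
   (NL x. ennreal ((norm (test_frac_grad \<sigma> \<phi> x))\<^sup>2)) = ennreal E * gagliardo \<sigma> \<phi>"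
proof -
 obtain \<kappa> where \<kappa>: "0 < \<kappa>" "!!\<phi> :: real^'n => real. \<phi> \<in> test_functions UNIV ==>
   (\<Sum>j\<in>UNIV. \<integral>\<^sup>+x. ennreal ((riesz_conv (1 - \<sigma>) (partial_deriv j \<phi>) x)\<^sup>2) \<partial>lborel) = ennreal \<kappa> * gagliardo \<sigma> \<phi>"
  by (rule riesz_gradient_energy[OF \<sigma>]) (rule that)
 define \<gamma> where "\<gamma> = riesz_const CARD('n) (1 - \<sigma>)"
 have \<gamma>: "0 < \<gamma>" unfolding \<gamma>_def by (rule riesz_const_pos[OF one_minus_order[OF \<sigma>]])
 show thesis
 proof (rule that[of "\<gamma>\<^sup>2 * \<kappa>"])
  show "0 < \<gamma>\<^sup>2 * \<kappa>" using \<gamma> \<kappa>(1) by simp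
  fix \<phi> :: "real^'n => real" and \<Omega> assume \<phi>: "\<phi> \<in> test_functions \<Omega>"
  then have \<phi>U: "\<phi> \<in> test_functions UNIV" using test_functions_mono[of \<Omega> UNIV] by auto
  note [measurable] = Cc_fun_borel[OF Cc_fun_partial_deriv[OF \<phi>]]
  have "(NL x. ennreal ((norm (test_frac_grad \<sigma> \<phi> x))\<^sup>2)) = (NN x. (\<Sum>j\<in>UNIV. ennreal (\<gamma>\<^sup>2) * ennreal ((riesz_conv (1 - \<sigma>) (partial_deriv j \<phi>) x)\<^sup>2)))"
   unfolding nn_integral_completion
  proof (rule nn_integral_cong)
   fix x
   have "(norm (test_frac_grad \<sigma> \<phi> x))\<^sup>2 = (\<Sum>j\<in>UNIV. \<gamma>\<^sup>2 * (riesz_conv (1 - \<sigma>) (partial_deriv j \<phi>) x)\<^sup>2)"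
    unfolding power2_norm_eq_inner inner_vec_def by (simp add: test_frac_grad_def \<gamma>_def power2_eq_square ac_simps)
   also have "ennreal ... = (\<Sum>j\<in>UNIV. ennreal (\<gamma>\<^sup>2 * (riesz_conv (1 - \<sigma>) (partial_deriv j \<phi>) x)\<^sup>2))"
    by (subst sum_ennreal) auto
   finally show "ennreal ((norm (test_frac_grad \<sigma> \<phi> x))\<^sup>2) = (\<Sum>j\<in>UNIV. ennreal (\<gamma>\<^sup>2) * ennreal ((riesz_conv (1 - \<sigma>) (partial_deriv j \<phi>) x)\<^sup>2))"
    by (simp add: ennreal_mult)
  qed
  also have "... = ennreal (\<gamma>\<^sup>2) * (\<Sum>j\<in>UNIV. \<integral>\<^sup>+x. ennreal ((riesz_conv (1 - \<sigma>) (partial_deriv j \<phi>) x)\<^sup>2) \<partial>lborel)"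
   by (subst nn_integral_sum) (simp_all add: nn_integral_cmult sum_distrib_left)
  also have "... = ennreal (\<gamma>\<^sup>2 * \<kappa>) * gagliardo \<sigma> \<phi>"
   unfolding \<kappa>(2)[OF \<phi>U] using \<kappa>(1) by (simp add: ennreal_mult mult.assoc)
  finally show "(NL x. ennreal ((norm (test_frac_grad \<sigma> \<phi> x))\<^sup>2)) = ennreal (\<gamma>\<^sup>2 * \<kappa>) * gagliardo \<sigma> \<phi>" .
 qed
qed

lemma test_frac_grad_L2:
 fixes \<phi> :: "real^'n => real"
 assumes \<sigma>: "0 < \<sigma>" "\<sigma> < 1" and \<phi>: "\<phi> \<in> test_functions \<Omega>"
 shows "test_frac_grad \<sigma> \<phi> \<in> L2"
proof -
 obtain E where E: "0 < E" "!!(\<phi> :: real^'n => real) \<Omega>. \<phi> \<in> test_functions \<Omega> ==>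
   (NL x. ennreal ((norm (test_frac_grad \<sigma> \<phi> x))\<^sup>2)) = ennreal E * gagliardo \<sigma> \<phi>"
  by (rule test_frac_grad_energy[OF \<sigma>]) (rule that)
 have "(NL x. ennreal ((norm (test_frac_grad \<sigma> \<phi> x))\<^sup>2)) < \<infinity>"
  unfolding E(2)[OF \<phi>] using gagliardo_test_finite[OF \<sigma> \<phi>] by (simp add: ennreal_mult_less_top)
 then show ?thesis
  unfolding L2_iff_nn by (intro conjI measurable_completion) (use test_frac_grad_borel[OF \<phi>] in auto)
qed

lemma Hs_norm_sq_test_finite:
 fixes \<phi> :: "real^'n => real"
 assumes \<sigma>: "0 < \<sigma>" "\<sigma> < 1" and \<phi>: "\<phi> \<in> test_functions \<Omega>"
 shows "Hs_norm_sq \<sigma> \<phi> < \<infinity>"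
proof -
 have c: "Cc_fun \<phi>" by (rule Cc_fun_test[OF \<phi>])
 obtain B R where B: "0 <= B" "0 <= R" "!!x. \<bar>\<phi> x\<bar> <= B" "!!x. \<bar>\<phi> x\<bar> <= B * indicator (cball 0 R) x" "!!x. x \<notin> cball 0 R ==> \<phi> x = 0"
  by (rule Cc_fun_bounds[OF c]) (rule that)
 have "integrable lborel (%x. \<phi> x * \<phi> x)"
  by (rule integrable_bounded_mult[OF Cc_fun_integrable[OF c] _ B(3)]) (use Cc_fun_borel[OF c] in simp)
 then have "(NN x. ennreal ((\<phi> x)\<^sup>2)) < \<infinity>"
  by (simp add: integrable_iff_bounded power2_eq_square)
 then show ?thesis unfolding Hs_norm_sq_eq using gagliardo_test_finite[OF \<sigma> \<phi>] by simp
qed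

section \<open>Limits of test functions\<close>

locale fractional_domain =
 fixes \<Omega> :: "(real^'n) set" and \<sigma> :: real
 assumes \<sigma>: "0 < \<sigma>" "\<sigma> < 1" and \<Omega>: "open \<Omega>" "bounded \<Omega>"
begin

lemma volume_finite: obtains m where "0 < m" "emeasure lborel \<Omega> <= ennreal m" "emeasure lebesgue \<Omega> <= ennreal m"
proof (rule that[of "measure lborel \<Omega> + 1"])
 have e: "emeasure lborel \<Omega> = ennreal (measure lborel \<Omega>)"
  by (rule emeasure_eq_ennreal_measure) (use emeasure_bounded_finite[OF \<Omega>(2)] in simp)
 show b: "emeasure lborel \<Omega> <= ennreal (measure lborel \<Omega> + 1)"
  unfolding e by (rule ennreal_leI) simp
 then show "emeasure lebesgue \<Omega> <= ennreal (measure lborel \<Omega> + 1)" using \<Omega>(1) by simp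
 show "0 < measure lborel \<Omega> + 1" using measure_nonneg[of lborel \<Omega>] by linarith
qed

lemma \<Omega>_lebesgue [measurable]: "\<Omega> \<in> sets lebesgue" using \<Omega>(1) by simp

lemma test_lebesgue: "\<phi> \<in> test_functions \<Omega> ==> \<phi> \<in> \<L>"
 by (rule borel_measurable_integrable[OF Cc_fun_integrable_lebesgue[OF Cc_fun_test]])

text \<open>Test functions that converge to \<open>u\<close> in \<open>H\<^sup>\<sigma>\<close>; finiteness of the norm of \<open>u\<close> is then automatic.\<close>

definition approx :: "(nat => real^'n => real) => (real^'n => real) => bool" where
 "approx \<phi> u \<longleftrightarrow> u \<in> \<L> \<and> (\<forall>n. \<phi> n \<in> test_functions \<Omega>) \<and> (%n. Hs_norm_sq \<sigma> (%x. \<phi> n x - u x)) \<longlonglongrightarrow> 0"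

lemma approxD:
 assumes "approx \<phi> u"
 shows "u \<in> \<L>" "!!n. \<phi> n \<in> test_functions \<Omega>" "(%n. Hs_norm_sq \<sigma> (%x. \<phi> n x - u x)) \<longlonglongrightarrow> 0"
  "(%n. NL x. ennreal ((\<phi> n x - u x)\<^sup>2)) \<longlonglongrightarrow> 0"
proof -
 show 1: "u \<in> \<L>" "!!n. \<phi> n \<in> test_functions \<Omega>" "(%n. Hs_norm_sq \<sigma> (%x. \<phi> n x - u x)) \<longlonglongrightarrow> 0"
  using assms by (auto simp: approx_def)
 show "(%n. NL x. ennreal ((\<phi> n x - u x)\<^sup>2)) \<longlonglongrightarrow> 0"
  by (rule tendsto_sandwich[OF _ _ tendsto_const 1(3)]) (simp_all add: Hs_norm_sq_eq nn_integral_completion)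
qed

lemma approx_H0: "approx \<phi> u ==> u \<in> H0 \<sigma> \<Omega>"
proof -
 assume a: "approx \<phi> u"
 note D = approxD[OF a]
 have "eventually (%n. Hs_norm_sq \<sigma> (%x. \<phi> n x - u x) < \<infinity>) sequentially"
  by (rule order_tendstoD(2)[OF D(3)]) simp
 then obtain n where n: "Hs_norm_sq \<sigma> (%x. \<phi> n x - u x) < \<infinity>" by (auto simp: eventually_sequentially)
 have "Hs_norm_sq \<sigma> (%x. 1 * \<phi> n x + (-1) * (\<phi> n x - u x)) <= ennreal (2 * 1\<^sup>2) * Hs_norm_sq \<sigma> (\<phi> n) + ennreal (2 * (-1)\<^sup>2) * Hs_norm_sq \<sigma> (%x. \<phi> n x - u x)"
  by (rule Hs_norm_sq_lin_le) (use test_lebesgue[OF D(2)] D(1) in auto)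
 also have "... < \<infinity>" using n Hs_norm_sq_test_finite[OF \<sigma> D(2)] by (simp add: ennreal_mult_less_top del: ennreal_numeral)
 finally show ?thesis using D by (auto simp: H0_def Hs_def)
qed

lemma H0_approx: assumes "u \<in> H0 \<sigma> \<Omega>" obtains \<phi> where "approx \<phi> u"
 using assms unfolding H0_def Hs_def approx_def by blast

text \<open>Functions in \<open>H0\<close> vanish outside the domain, as limits of functions that do.\<close>

lemma approx_vanishes:
 assumes "approx \<phi> u" shows "AE x in lebesgue. x \<notin> \<Omega> --> u x = 0"
proof -
 note D = approxD[OF assms]
 have m: "(%x. ennreal ((u x)\<^sup>2) * indicator (- \<Omega>) x) \<in> \<L>"
  using D(1) \<Omega>_lebesgue by measurable
 have "(NL x. ennreal ((u x)\<^sup>2) * indicator (- \<Omega>) x) <= (NL x. ennreal ((\<phi> n x - u x)\<^sup>2))" for n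
  by (intro nn_integral_mono) (use test_functions_outside[OF D(2)] in \<open>auto simp: indicator_def\<close>)
 then have "(NL x. ennreal ((u x)\<^sup>2) * indicator (- \<Omega>) x) <= 0"
  by (intro LIMSEQ_le_const[OF D(4)]) auto
 then have "AE x in lebesgue. ennreal ((u x)\<^sup>2) * indicator (- \<Omega>) x = 0"
  by (simp add: nn_integral_0_iff_AE[OF m])
 then show ?thesis by eventually_elim (auto simp: indicator_def)
qed

text \<open>Since everything vanishes outside the bounded set \<open>\<Omega>\<close>, convergence in the mean square implies
convergence in the mean.\<close>

lemma approx_L1:
 assumes "approx \<phi> u"
 shows "integrable lebesgue u" "(%n. NL x. ennreal (norm (\<phi> n x - u x))) \<longlonglongrightarrow> 0"
proof -
 note D = approxD[OF assms]
 obtain m where m: "0 < m" "emeasure lborel \<Omega> <= ennreal m" "emeasure lebesgue \<Omega> <= ennreal m" by (rule volume_finite) (rule that)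
 note [measurable] = D(1) test_lebesgue[OF D(2)]
 have ae: "AE x in lebesgue. norm (\<phi> n x - u x) = \<bar>(\<phi> n x - u x) * indicator \<Omega> x\<bar>" for n
  using approx_vanishes[OF assms] by eventually_elim (use test_functions_outside[OF D(2)] in \<open>auto simp: indicator_def\<close>)
 have le: "(NL x. ennreal (norm (\<phi> n x - u x))) <= ennreal (e * sqrt m)"
  if e: "0 <= e" "(NL x. ennreal ((\<phi> n x - u x)\<^sup>2)) <= ennreal (e\<^sup>2)" for n e
 proof -
  have "(NL x. ennreal (norm (\<phi> n x - u x))) = (NL x. ennreal \<bar>(\<phi> n x - u x) * indicator \<Omega> x\<bar>)"
   by (rule nn_integral_cong_AE) (use ae in eventually_elim, simp)
  also have "... <= ennreal (e * sqrt m)"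
  proof (rule nn_integral_Cauchy_Schwarz_le)
   have "(NL x. ennreal ((indicator \<Omega> x)\<^sup>2)) = (NL x. indicator \<Omega> x)"
    by (intro nn_integral_cong) (simp add: indicator_def)
   then show "(NL x. ennreal ((indicator \<Omega> x)\<^sup>2)) <= ennreal ((sqrt m)\<^sup>2)"
    using m by simp
  qed (use e m in auto)
  finally show ?thesis .
 qed
 show lim: "(%n. NL x. ennreal (norm (\<phi> n x - u x))) \<longlonglongrightarrow> 0"
  unfolding tendsto_0_iff_eventually_le_ennreal
 proof (intro allI impI)
  fix e :: real assume e: "0 < e"
  have "\<forall>\<^sub>F n in sequentially. (NL x. ennreal ((\<phi> n x - u x)\<^sup>2)) <= ennreal ((e / sqrt m)\<^sup>2)"
   by (rule D(4)[unfolded tendsto_0_iff_eventually_le_ennreal, rule_format]) (use e m in simp)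
  then show "\<forall>\<^sub>F n in sequentially. (NL x. ennreal (norm (\<phi> n x - u x))) <= ennreal e"
  proof eventually_elim
   case (elim n)
   show ?case using le[OF _ elim] e m(1) by simp
  qed
 qed
 have "\<forall>\<^sub>F n in sequentially. (NL x. ennreal (norm (\<phi> n x - u x))) < \<infinity>"
  by (rule order_tendstoD(2)[OF lim]) simp
 then obtain n where n: "(NL x. ennreal (norm (\<phi> n x - u x))) < \<infinity>" by (auto simp: eventually_sequentially)
 have "(%x. \<phi> n x - u x) \<in> \<L>" by measurable
 then have "integrable lebesgue (%x. \<phi> n x - u x)" by (rule integrableI_bounded[OF _ n])
 from Bochner_Integration.integrable_diff[OF Cc_fun_integrable_lebesgue[OF Cc_fun_test[OF D(2)[of n]]] this]
 show "integrable lebesgue u" by simp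
qed

end

text \<open>Fatou's lemma, applied to both integrals.\<close>

lemma gagliardo_le_of_AE_tendsto:
 fixes v :: "nat => real^'n => real"
 assumes v: "!!k. v k \<in> \<B>" and lim: "AE x in lebesgue. (%k. v k x) \<longlonglongrightarrow> w x"
  and le: "\<forall>\<^sub>F k in sequentially. gagliardo \<sigma> (v k) <= c"
 shows "gagliardo \<sigma> w <= c"
proof -
 note [measurable] = v
 have lim': "AE x in lborel. (%k. v k x) \<longlonglongrightarrow> w x" using lim by (simp add: AE_completion_iff)
 let ?k = "%v x y. ennreal ((v x - v y)\<^sup>2 / norm (x - y :: real^'n) powr (real CARD('n) + 2 * \<sigma>))"
 have "gagliardo \<sigma> w <= (NN x. liminf (%k. NN y. ?k (v k) x y))"
  unfolding gagliardo_def
 proof (rule nn_integral_mono_AE, use lim' in eventually_elim)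
  fix x assume x: "(%k. v k x) \<longlonglongrightarrow> w x"
  have "(NN y. ?k w x y) = (NN y. liminf (%k. ?k (v k) x y))"
  proof (rule nn_integral_cong_AE, use lim' in eventually_elim)
   fix y assume y: "(%k. v k y) \<longlonglongrightarrow> w y"
   have "(%k. ?k (v k) x y) \<longlonglongrightarrow> ?k w x y"
    unfolding divide_inverse by (intro tendsto_ennrealI tendsto_mult tendsto_const tendsto_power tendsto_diff x y)
   then show "?k w x y = liminf (%k. ?k (v k) x y)" by (intro lim_imp_Liminf[symmetric]) simp_all
  qed
  also have "... <= liminf (%k. NN y. ?k (v k) x y)"
   by (rule nn_integral_liminf) measurable
  finally show "(NN y. ?k w x y) <= liminf (%k. NN y. ?k (v k) x y)" .
 qed
 also have "... <= liminf (%k. NN x. NN y. ?k (v k) x y)"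
  by (rule nn_integral_liminf) measurable
 also have "... <= liminf (%k::nat. c)"
  by (rule Liminf_mono) (use le in \<open>simp add: gagliardo_def\<close>)
 also have "... = c" by (simp add: Liminf_const)
 finally show ?thesis .
qed

context fractional_domain
begin

text \<open>By the energy identity the fractional gradients of the approximating test functions form a Cauchy
sequence. Its limit is the distributional gradient of \<open>u\<close>, because the Riesz potential of the derivative
of a test function is bounded and \<open>\<phi> n\<close> converges in the mean.\<close>

lemma approx_gradient:
 assumes a: "approx \<phi> u"
 obtains g where "g \<in> L2" "is_frac_grad \<sigma> u g" "(%n. L2_class (test_frac_grad \<sigma> (\<phi> n))) \<longlonglongrightarrow> L2_class g"
proof -
 note D = approxD[OF a] and L1 = approx_L1[OF a]
 have \<alpha>: "0 < 1 - \<sigma>" "1 - \<sigma> < real CARD('n)" by (rule one_minus_order[OF \<sigma>])+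
 note s = test_frac_grad_L2[OF \<sigma> D(2)]
 obtain E where E: "0 < E" "!!(\<phi> :: real^'n => real) \<Omega>. \<phi> \<in> test_functions \<Omega> ==>
   (NL x. ennreal ((norm (test_frac_grad \<sigma> \<phi> x))\<^sup>2)) = ennreal E * gagliardo \<sigma> \<phi>"
  by (rule test_frac_grad_energy[OF \<sigma>]) (rule that)
 have m[measurable]: "u \<in> \<L>" "!!n. \<phi> n \<in> \<L>"
  using D(1) test_lebesgue[OF D(2)] by auto
 define X where "X n = L2_class (test_frac_grad \<sigma> (\<phi> n))" for n
 have "Cauchy X"
 proof (rule metric_CauchyI)
  fix e :: real assume e: "0 < e"
  have "\<forall>\<^sub>F n in sequentially. Hs_norm_sq \<sigma> (%x. \<phi> n x - u x) <= ennreal (e\<^sup>2 / (8 * E))"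
   by (rule D(3)[unfolded tendsto_0_iff_eventually_le_ennreal, rule_format]) (use e E in simp)
  then obtain N where N: "!!n. N <= n ==> Hs_norm_sq \<sigma> (%x. \<phi> n x - u x) <= ennreal (e\<^sup>2 / (8 * E))"
   by (auto simp: eventually_sequentially)
  have "dist (X m) (X n) < e" if mn: "N <= m" "N <= n" for m n
  proof -
   have "gagliardo \<sigma> (%x. \<phi> m x - \<phi> n x) <= Hs_norm_sq \<sigma> (%x. 1 * (\<phi> m x - u x) + (-1) * (\<phi> n x - u x))"
    by (simp add: Hs_norm_sq_eq)
   also have "... <= ennreal (2 * 1\<^sup>2) * Hs_norm_sq \<sigma> (%x. \<phi> m x - u x) + ennreal (2 * (-1)\<^sup>2) * Hs_norm_sq \<sigma> (%x. \<phi> n x - u x)"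
    by (rule Hs_norm_sq_lin_le) measurable
   also have "... <= ennreal (2 * 1\<^sup>2) * ennreal (e\<^sup>2 / (8 * E)) + ennreal (2 * (-1)\<^sup>2) * ennreal (e\<^sup>2 / (8 * E))"
    by (intro add_mono mult_left_mono N mn) simp_all
   also have "... = ennreal (2 * 1\<^sup>2 * (e\<^sup>2 / (8 * E)) + 2 * (-1)\<^sup>2 * (e\<^sup>2 / (8 * E)))"
    by (subst (1 2) ennreal_mult[symmetric], (use e E in \<open>simp_all only: zero_le_divide_iff\<close>)?) (use e E in \<open>auto simp: ennreal_plus[symmetric] simp del: ennreal_plus\<close>)
   also have "2 * 1\<^sup>2 * (e\<^sup>2 / (8 * E)) + 2 * (-1)\<^sup>2 * (e\<^sup>2 / (8 * E)) = e\<^sup>2 / 2 / E" using E by (simp add: field_simps)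
   finally have "ennreal E * gagliardo \<sigma> (%x. \<phi> m x - \<phi> n x) <= ennreal E * ennreal (e\<^sup>2 / 2 / E)" by (rule mult_left_mono) simp
   also have "... = ennreal (e\<^sup>2 / 2)" using E e by (simp add: ennreal_mult[symmetric])
   finally have "ennreal ((norm (X m - X n))\<^sup>2) <= ennreal (e\<^sup>2 / 2)"
    unfolding X_def L2_class_diff[OF s s] L2_class_norm_nn[OF L2_diff[OF s s]]
    using E(2)[OF test_functions_diff[OF D(2) D(2)], of m n] by (simp add: test_frac_grad_diff[OF \<sigma> D(2) D(2)])
   then have "(norm (X m - X n))\<^sup>2 <= e\<^sup>2 / 2" by (subst (asm) ennreal_le_iff) simp_all
   also have "... < e\<^sup>2" using e by simp
   finally show ?thesis unfolding dist_norm by (rule power2_less_imp_less) (use e in simp)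
  qed
  then show "\<exists>N. \<forall>m\<ge>N. \<forall>n\<ge>N. dist (X m) (X n) < e" by blast
 qed
 then obtain W where W: "X \<longlonglongrightarrow> W" using Cauchy_convergent convergent_def by blast
 define g where "g = L2_fun W"
 have g: "g \<in> L2" unfolding g_def by (rule L2_fun_in_L2)
 have lim: "X \<longlonglongrightarrow> L2_class g" using W by (simp add: g_def)
 have "is_frac_grad \<sigma> u g"
  unfolding is_frac_grad_def
 proof
  fix j :: 'n
  show "distr_partial_deriv j (riesz_potential (1 - \<sigma>) u) (%x. g x $ j)"
   unfolding distr_partial_deriv_riesz_iff[OF \<alpha> L1(1)]
  proof (intro conjI ballI)
   show "locally_integrable (%x. g x $ j)" by (rule L2_locally_integrable[OF g])
   fix \<psi> :: "real^'n => real" assume \<psi>: "\<psi> \<in> test_functions UNIV"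
   define w where "w x = riesz_const CARD('n) (1 - \<sigma>) * riesz_conv (1 - \<sigma>) (partial_deriv j \<psi>) x" for x
   obtain K where K: "0 <= K" "!!x. \<bar>w x\<bar> <= K" "w \<in> \<L>"
    by (rule riesz_conv_bounded_lebesgue[OF \<alpha> \<psi>, where j = j and c = "riesz_const CARD('n) (1 - \<sigma>)", folded w_def]) (rule that)
   have \<phi>i: "integrable lebesgue (\<phi> n)" for n by (rule Cc_fun_integrable_lebesgue[OF Cc_fun_test[OF D(2)]])
   have eq: "(LINT x|lebesgue. \<phi> n x * w x) = - (LINT x|lebesgue. test_frac_grad \<sigma> (\<phi> n) x $ j * \<psi> x)" for n
   proof -
    have "\<phi> n \<in> test_functions UNIV" using D(2) test_functions_mono[of \<Omega> UNIV] by blast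
    from test_frac_grad_is_frac_grad[OF \<sigma> this] have "distr_partial_deriv j (riesz_potential (1 - \<sigma>) (\<phi> n)) (%x. test_frac_grad \<sigma> (\<phi> n) x $ j)"
     by (simp add: is_frac_grad_def)
    then show ?thesis unfolding distr_partial_deriv_riesz_iff[OF \<alpha> \<phi>i] w_def using \<psi> by blast
   qed
   have A: "(%n. LINT x|lebesgue. \<phi> n x * w x) \<longlonglongrightarrow> (LINT x|lebesgue. u x * w x)"
   proof (rule tendsto_L1_int)
    show "integrable lebesgue (%x. \<phi> n x * w x)" for n by (rule integrable_bounded_mult[OF \<phi>i K(3,2)])
    show "integrable lebesgue (%x. u x * w x)" by (rule integrable_bounded_mult[OF L1(1) K(3,2)])
    show "(%n. NL x. ennreal (norm (\<phi> n x * w x - u x * w x))) \<longlonglongrightarrow> 0"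
    proof (rule tendsto_0_lin_le_ennreal[OF L1(2) L1(2)])
     fix n
     have "(NL x. ennreal (norm (\<phi> n x * w x - u x * w x))) <= (NL x. ennreal K * ennreal (norm (\<phi> n x - u x)))"
     proof (rule nn_integral_mono)
      fix x
      have "norm (\<phi> n x * w x - u x * w x) = \<bar>w x\<bar> * norm (\<phi> n x - u x)"
       unfolding left_diff_distrib[symmetric] by (simp add: abs_mult)
      also have "... <= K * norm (\<phi> n x - u x)" by (intro mult_right_mono K(2)) simp
      finally show "ennreal (norm (\<phi> n x * w x - u x * w x)) <= ennreal K * ennreal (norm (\<phi> n x - u x))"
       using K(1) by (subst ennreal_mult[symmetric]) (auto intro: ennreal_leI)
     qed
     also have "... = ennreal K * (NL x. ennreal (norm (\<phi> n x - u x)))"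
      by (rule nn_integral_cmult) measurable
     finally show "(NL x. ennreal (norm (\<phi> n x * w x - u x * w x))) <= ennreal K * (NL x. ennreal (norm (\<phi> n x - u x))) + ennreal 0 * (NL x. ennreal (norm (\<phi> n x - u x)))"
      by simp
    qed
   qed
   define p where "p x = \<psi> x *\<^sub>R axis j (1 :: real)" for x
   have "(NL x. ennreal ((norm (p x))\<^sup>2)) < \<infinity>"
    using Hs_norm_sq_test_finite[OF \<sigma> \<psi>] by (simp add: p_def Hs_norm_sq_eq nn_integral_completion)
   moreover have "p \<in> \<L>" unfolding p_def[abs_def]
    by (intro borel_measurable_scaleR borel_measurable_const borel_measurable_integrable[OF Cc_fun_integrable_lebesgue[OF Cc_fun_test[OF \<psi>]]])
   ultimately have p: "p \<in> L2" by (simp add: L2_iff_nn)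
   have ip: "L2_class h \<bullet> L2_class p = (LINT x|lebesgue. h x $ j * \<psi> x)" if "h \<in> L2" for h
    unfolding L2_class_inner[OF that p] by (simp add: p_def inner_axis mult.commute)
   have "(%n. X n \<bullet> L2_class p) \<longlonglongrightarrow> L2_class g \<bullet> L2_class p" by (intro tendsto_inner lim tendsto_const)
   then have B: "(%n. LINT x|lebesgue. test_frac_grad \<sigma> (\<phi> n) x $ j * \<psi> x) \<longlonglongrightarrow> (LINT x|lebesgue. g x $ j * \<psi> x)"
    unfolding X_def ip[OF s] ip[OF g] .
   show "(LINT x|lebesgue. u x * (riesz_const CARD('n) (1 - \<sigma>) * riesz_conv (1 - \<sigma>) (partial_deriv j \<psi>) x)) = - (LINT x|lebesgue. g x $ j * \<psi> x)"
    by (rule LIMSEQ_unique[OF A[unfolded eq, unfolded w_def] tendsto_minus[OF B]])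
  qed
 qed
 then show thesis by (rule that[OF g _ lim[unfolded X_def[abs_def]]])
qed

section \<open>The space of fractional gradients\<close>

text \<open>The embedding of \<open>H0 \<sigma> \<Omega>\<close> into the Hilbert space of fields.\<close>

definition grad_class :: "(real^'n => real) => 'n L2_field" where
 "grad_class u = L2_class (frac_grad \<sigma> u)"

lemma H0_frac_grad:
 assumes "u \<in> H0 \<sigma> \<Omega>"
 shows "is_frac_grad \<sigma> u (frac_grad \<sigma> u)" "frac_grad \<sigma> u \<in> L2" "integrable lebesgue u"
proof -
 obtain \<phi> where a: "approx \<phi> u" by (rule H0_approx[OF assms]) (rule that)
 obtain g where g: "g \<in> L2" "is_frac_grad \<sigma> u g"
  "(%n. L2_class (test_frac_grad \<sigma> (\<phi> n))) \<longlonglongrightarrow> L2_class g"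
  by (rule approx_gradient[OF a]) (rule that)
 show "is_frac_grad \<sigma> u (frac_grad \<sigma> u)" by (rule is_frac_grad_some[OF g(2)])
 show "frac_grad \<sigma> u \<in> L2" by (rule frac_grad_eq(1)[OF g(2,1)])
 show "integrable lebesgue u" by (rule approx_L1(1)[OF a])
qed

lemma grad_class_eq:
 assumes "is_frac_grad \<sigma> u g" "g \<in> L2"
 shows "grad_class u = L2_class g"
 unfolding grad_class_def
 by (subst L2_class_eq_iff) (use frac_grad_eq[OF assms] assms(2) in \<open>auto elim: eventually_mono\<close>)

lemma test_grad_class:
 assumes "\<phi> \<in> test_functions \<Omega>"
 shows "grad_class \<phi> = L2_class (test_frac_grad \<sigma> \<phi>)"
proof (rule grad_class_eq[OF test_frac_grad_is_frac_grad[OF \<sigma>] test_frac_grad_L2[OF \<sigma> assms]])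
 show "\<phi> \<in> test_functions UNIV" using assms test_functions_mono[of \<Omega> UNIV] by blast
qed

lemma test_H0: assumes "\<phi> \<in> test_functions \<Omega>" shows "\<phi> \<in> H0 \<sigma> \<Omega>"
 by (rule approx_H0[of "%_. \<phi>"]) (use assms test_lebesgue in \<open>auto simp: approx_def Hs_norm_sq_def\<close>)

lemma approx_grad_class:
 assumes a: "approx \<phi> u"
 shows "(%n. grad_class (\<phi> n)) \<longlonglongrightarrow> grad_class u"
proof -
 note D = approxD[OF a]
 obtain g where g: "g \<in> L2" "is_frac_grad \<sigma> u g"
  "(%n. L2_class (test_frac_grad \<sigma> (\<phi> n))) \<longlonglongrightarrow> L2_class g"
  by (rule approx_gradient[OF a]) (rule that)
 show ?thesis unfolding grad_class_eq[OF g(2,1)] test_grad_class[OF D(2)] by (rule g(3))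
qed

lemma H0_norm_eq:
 assumes "u \<in> H0 \<sigma> \<Omega>" shows "H0_norm \<sigma> u = norm (grad_class u)"
 unfolding H0_norm_def grad_class_def L2_class_norm[OF H0_frac_grad(2)[OF assms], symmetric] by simp

lemma H0_lin:
 assumes u: "u \<in> H0 \<sigma> \<Omega>" and v: "v \<in> H0 \<sigma> \<Omega>"
 shows "(%x. a * u x + b * v x) \<in> H0 \<sigma> \<Omega>"
  and "AE x in lebesgue. frac_grad \<sigma> (%x. a * u x + b * v x) x = a *\<^sub>R frac_grad \<sigma> u x + b *\<^sub>R frac_grad \<sigma> v x"
  and "grad_class (%x. a * u x + b * v x) = a *\<^sub>R grad_class u + b *\<^sub>R grad_class v"
proof -
 obtain \<phi> where \<phi>: "approx \<phi> u" by (rule H0_approx[OF u]) (rule that)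
 obtain \<psi> where \<psi>: "approx \<psi> v" by (rule H0_approx[OF v]) (rule that)
 note U = approxD[OF \<phi>] and V = approxD[OF \<psi>]
 have [measurable]: "u \<in> \<L>" "v \<in> \<L>"
   "!!n. \<phi> n \<in> \<L>" "!!n. \<psi> n \<in> \<L>"
  using U(1) V(1) test_lebesgue[OF U(2)] test_lebesgue[OF V(2)] by auto
 have "approx (%n x. a * \<phi> n x + b * \<psi> n x) (%x. a * u x + b * v x)"
  unfolding approx_def
 proof (intro conjI allI)
  show "(%x. a * \<phi> n x + b * \<psi> n x) \<in> test_functions \<Omega>" for n by (rule test_functions_lin[OF U(2) V(2)])
  show "(%n. Hs_norm_sq \<sigma> (%x. a * \<phi> n x + b * \<psi> n x - (a * u x + b * v x))) \<longlonglongrightarrow> 0"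
  proof (rule tendsto_0_lin_le_ennreal[OF U(3) V(3)])
   fix n
   have "Hs_norm_sq \<sigma> (%x. a * (\<phi> n x - u x) + b * (\<psi> n x - v x)) <= ennreal (2 * a\<^sup>2) * Hs_norm_sq \<sigma> (%x. \<phi> n x - u x) + ennreal (2 * b\<^sup>2) * Hs_norm_sq \<sigma> (%x. \<psi> n x - v x)"
    by (rule Hs_norm_sq_lin_le) measurable
   then show "Hs_norm_sq \<sigma> (%x. a * \<phi> n x + b * \<psi> n x - (a * u x + b * v x)) <= ennreal (2 * a\<^sup>2) * Hs_norm_sq \<sigma> (%x. \<phi> n x - u x) + ennreal (2 * b\<^sup>2) * Hs_norm_sq \<sigma> (%x. \<psi> n x - v x)"
    by (simp add: algebra_simps)
  qed
 qed measurable
 then show "(%x. a * u x + b * v x) \<in> H0 \<sigma> \<Omega>" by (rule approx_H0)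
 note fu = H0_frac_grad[OF u] and fv = H0_frac_grad[OF v]
 have s: "(%x. a *\<^sub>R frac_grad \<sigma> u x + b *\<^sub>R frac_grad \<sigma> v x) \<in> L2"
  by (intro L2_add L2_scaleR fu(2) fv(2))
 have i: "is_frac_grad \<sigma> (%x. a * u x + b * v x) (%x. a *\<^sub>R frac_grad \<sigma> u x + b *\<^sub>R frac_grad \<sigma> v x)"
  by (rule is_frac_grad_lin[OF \<sigma> fu(3) fv(3) fu(1) fv(1)])
 show "AE x in lebesgue. frac_grad \<sigma> (%x. a * u x + b * v x) x = a *\<^sub>R frac_grad \<sigma> u x + b *\<^sub>R frac_grad \<sigma> v x"
  using frac_grad_eq(2)[OF i s] by eventually_elim simp
 show "grad_class (%x. a * u x + b * v x) = a *\<^sub>R grad_class u + b *\<^sub>R grad_class v"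
  unfolding grad_class_eq[OF i s] unfolding grad_class_def
  by (simp add: L2_class_scaleR fu(2) fv(2) L2_class_add L2_scaleR)
qed

lemma H0_diff:
 assumes "u \<in> H0 \<sigma> \<Omega>" "v \<in> H0 \<sigma> \<Omega>"
 shows "(%x. u x - v x) \<in> H0 \<sigma> \<Omega>" "grad_class (%x. u x - v x) = grad_class u - grad_class v"
  "AE x in lebesgue. frac_grad \<sigma> (%x. u x - v x) x = frac_grad \<sigma> u x - frac_grad \<sigma> v x"
 using H0_lin[OF assms, of 1 "-1"] by simp_all

text \<open>Poincare inequality and energy identity.\<close>

lemma test_norm_bound:
 obtains C where "0 < C" "!!\<phi>. \<phi> \<in> test_functions \<Omega> ==> Hs_norm_sq \<sigma> \<phi> <= ennreal (C * (norm (grad_class \<phi>))\<^sup>2)"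
proof -
 obtain m where m: "0 < m" "emeasure lborel \<Omega> <= ennreal m" "emeasure lebesgue \<Omega> <= ennreal m" by (rule volume_finite) (rule that)
 obtain P where P: "0 < P" "!!u :: real^'n => real. u \<in> \<B> ==> emeasure lborel {y. u y ~= 0} <= ennreal m ==>
   (NN x. ennreal ((u x)\<^sup>2)) <= ennreal P * gagliardo \<sigma> u"
  by (rule fractional_poincare[OF \<sigma>(1) m(1)]) (rule that)
 obtain E where E: "0 < E" "!!(\<phi> :: real^'n => real) \<Omega>. \<phi> \<in> test_functions \<Omega> ==>
   (NL x. ennreal ((norm (test_frac_grad \<sigma> \<phi> x))\<^sup>2)) = ennreal E * gagliardo \<sigma> \<phi>"
  by (rule test_frac_grad_energy[OF \<sigma>]) (rule that)
 show thesis
 proof (rule that[of "(P + 1) / E"])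
  show "0 < (P + 1) / E" using P(1) E(1) by simp
  fix \<phi> assume \<phi>: "\<phi> \<in> test_functions \<Omega>"
  have "{y. \<phi> y ~= 0} \<subseteq> \<Omega>" using test_functions_outside[OF \<phi>] by blast
  then have "emeasure lborel {y. \<phi> y ~= 0} <= emeasure lborel \<Omega>" by (rule emeasure_mono) (use \<Omega> in simp)
  also note m(2)
  finally have "(NN x. ennreal ((\<phi> x)\<^sup>2)) <= ennreal P * gagliardo \<sigma> \<phi>"
   by (rule P(2)[OF Cc_fun_borel[OF Cc_fun_test[OF \<phi>]]])
  then have "Hs_norm_sq \<sigma> \<phi> <= ennreal P * gagliardo \<sigma> \<phi> + gagliardo \<sigma> \<phi>"
   unfolding Hs_norm_sq_eq by (rule add_right_mono)
  also have "... = ennreal (P + 1) * gagliardo \<sigma> \<phi>" using P(1) by (simp add: distrib_right)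
  also have "ennreal (P + 1) = ennreal ((P + 1) / E) * ennreal E" using P(1) E(1) by (subst ennreal_mult[symmetric]) simp_all
  also have "... * gagliardo \<sigma> \<phi> = ennreal ((P + 1) / E) * ennreal ((norm (grad_class \<phi>))\<^sup>2)"
   unfolding mult.assoc E(2)[OF \<phi>, symmetric] test_grad_class[OF \<phi>] L2_class_norm_nn[OF test_frac_grad_L2[OF \<sigma> \<phi>]] ..
  also have "... = ennreal ((P + 1) / E * (norm (grad_class \<phi>))\<^sup>2)" using P(1) E(1) by (subst ennreal_mult[symmetric]) simp_all
  finally show "Hs_norm_sq \<sigma> \<phi> <= ennreal ((P + 1) / E * (norm (grad_class \<phi>))\<^sup>2)" .
 qed
qed

lemma H0_norm_bound:
 obtains C where "0 < C" "!!u. u \<in> H0 \<sigma> \<Omega> ==> Hs_norm_sq \<sigma> u <= ennreal (C * (norm (grad_class u))\<^sup>2)"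
proof -
 obtain C where C: "0 < C" "!!\<phi>. \<phi> \<in> test_functions \<Omega> ==> Hs_norm_sq \<sigma> \<phi> <= ennreal (C * (norm (grad_class \<phi>))\<^sup>2)"
  by (rule test_norm_bound) (rule that)
 show thesis
 proof (rule that[of "2 * C"])
  fix u assume "u \<in> H0 \<sigma> \<Omega>"
  then obtain \<phi> where a: "approx \<phi> u" by (rule H0_approx) (rule that)
  note D = approxD[OF a]
  have le: "Hs_norm_sq \<sigma> u <= ennreal (2 * C * (norm (grad_class (\<phi> n)))\<^sup>2) + ennreal 2 * Hs_norm_sq \<sigma> (%x. \<phi> n x - u x)" for n
  proof -
   have "Hs_norm_sq \<sigma> (%x. 1 * \<phi> n x + (-1) * (\<phi> n x - u x)) <= ennreal (2 * 1\<^sup>2) * Hs_norm_sq \<sigma> (\<phi> n) + ennreal (2 * (-1)\<^sup>2) * Hs_norm_sq \<sigma> (%x. \<phi> n x - u x)"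
    by (rule Hs_norm_sq_lin_le) (use test_lebesgue[OF D(2)] D(1) in auto)
   then have "Hs_norm_sq \<sigma> u <= ennreal 2 * Hs_norm_sq \<sigma> (\<phi> n) + ennreal 2 * Hs_norm_sq \<sigma> (%x. \<phi> n x - u x)" by simp
   also have "... <= ennreal 2 * ennreal (C * (norm (grad_class (\<phi> n)))\<^sup>2) + ennreal 2 * Hs_norm_sq \<sigma> (%x. \<phi> n x - u x)"
    by (intro add_right_mono mult_left_mono C(2) D(2)) simp
   also have "ennreal 2 * ennreal (C * (norm (grad_class (\<phi> n)))\<^sup>2) = ennreal (2 * C * (norm (grad_class (\<phi> n)))\<^sup>2)"
    using C(1) by (subst ennreal_mult[symmetric]) (simp_all add: mult.assoc)
   finally show ?thesis .
  qed
  have "(%n. ennreal (2 * C * (norm (grad_class (\<phi> n)))\<^sup>2) + ennreal 2 * Hs_norm_sq \<sigma> (%x. \<phi> n x - u x)) \<longlonglongrightarrow> ennreal (2 * C * (norm (grad_class u))\<^sup>2) + ennreal 2 * 0"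
   by (intro tendsto_add ennreal_tendsto_cmult D(3) tendsto_ennrealI tendsto_mult tendsto_const tendsto_power tendsto_norm approx_grad_class[OF a]) simp
  from LIMSEQ_le_const[OF this] le show "Hs_norm_sq \<sigma> u <= ennreal (2 * C * (norm (grad_class u))\<^sup>2)" by simp
 qed (use C in simp)
qed

lemma zero_H0: "(%_. 0) \<in> H0 \<sigma> \<Omega>" "grad_class (%_. 0) = 0"
proof -
 have "(%_. 0) \<in> test_functions \<Omega>"
 proof -
  have "Ck k (%_::real^'n. 0 :: real)" for k
  proof (induction k)
   case (Suc k)
   have "partial_deriv j (%_::real^'n. 0 :: real) = (%_. 0)" for j
    by (rule ext, subst partial_deriv_eqI[OF has_derivative_const]) simp
   then show ?case using Suc by simp
  qed simp
  then show ?thesis by (simp add: test_functions_def)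
 qed
 then show z: "(%_. 0) \<in> H0 \<sigma> \<Omega>" by (rule test_H0)
 show "grad_class (%_. 0) = 0" using H0_lin(3)[OF z z, of 0 0] by simp
qed

lemma grad_space_subspace: "subspace (grad_class ` H0 \<sigma> \<Omega>)"
 unfolding subspace_def
proof (intro conjI ballI allI)
 show "0 \<in> grad_class ` H0 \<sigma> \<Omega>" using zero_H0 by (metis image_eqI)
 fix x y c assume "x \<in> grad_class ` H0 \<sigma> \<Omega>" "y \<in> grad_class ` H0 \<sigma> \<Omega>"
 then obtain u v where uv: "u \<in> H0 \<sigma> \<Omega>" "v \<in> H0 \<sigma> \<Omega>" "x = grad_class u" "y = grad_class v" by blast
 show "x + y \<in> grad_class ` H0 \<sigma> \<Omega>"
  by (rule image_eqI[OF _ H0_lin(1)[OF uv(1,2), of 1 1]]) (simp only: H0_lin(3)[OF uv(1,2)] uv scaleR_one)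
 show "c *\<^sub>R x \<in> grad_class ` H0 \<sigma> \<Omega>"
  by (rule image_eqI[OF _ H0_lin(1)[OF uv(1,1), of c 0]]) (simp only: H0_lin(3)[OF uv(1,1)] uv scaleR_zero_left add_0_right)
qed

text \<open>A convergent sequence of gradients can be replaced by gradients of test functions. By
\<open>test_norm_bound\<close> these test functions are Cauchy in the mean square, and their limit has the right
gradient, where convergence in the Gagliardo seminorm follows from Fatou's lemma.\<close>

lemma grad_space_closed: "closed (grad_class ` H0 \<sigma> \<Omega>)"
 unfolding closed_sequential_limits
proof (intro allI impI, elim conjE)
 fix U W assume U: "\<forall>n. U n \<in> grad_class ` H0 \<sigma> \<Omega>" and W: "U \<longlonglongrightarrow> W"
 have "\<exists>\<phi>. \<phi> \<in> test_functions \<Omega> \<and> norm (grad_class \<phi> - U n) < 1 / Suc n" for n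
 proof -
  obtain u where u: "u \<in> H0 \<sigma> \<Omega>" "U n = grad_class u" using U by blast
  obtain \<phi> where a: "approx \<phi> u" by (rule H0_approx[OF u(1)]) (rule that)
  have "\<forall>\<^sub>F k in sequentially. dist (grad_class (\<phi> k)) (grad_class u) < 1 / Suc n"
   by (rule tendstoD[OF approx_grad_class[OF a]]) simp
  then obtain k where "dist (grad_class (\<phi> k)) (grad_class u) < 1 / Suc n" by (auto simp: eventually_sequentially)
  then show ?thesis using approxD(2)[OF a, of k] u(2) by (auto simp: dist_norm)
 qed
 then obtain \<phi> where \<phi>: "!!n. \<phi> n \<in> test_functions \<Omega>" "!!n. norm (grad_class (\<phi> n) - U n) < 1 / Suc n" by metis
 have "(%n. grad_class (\<phi> n) - U n) \<longlonglongrightarrow> 0"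
 proof (rule tendsto_norm_zero_cancel, rule tendsto_sandwich[OF _ _ tendsto_const LIMSEQ_Suc[OF lim_const_over_n[of "1 :: real"]]])
  show "\<forall>\<^sub>F n in sequentially. norm (grad_class (\<phi> n) - U n) <= 1 / real (Suc n)"
   using \<phi>(2) by (intro always_eventually allI less_imp_le) simp
 qed simp
 from tendsto_add[OF this W] have lim: "(%n. grad_class (\<phi> n)) \<longlonglongrightarrow> W" by simp
 obtain C where C: "0 < C" "!!\<phi>. \<phi> \<in> test_functions \<Omega> ==> Hs_norm_sq \<sigma> \<phi> <= ennreal (C * (norm (grad_class \<phi>))\<^sup>2)"
  by (rule test_norm_bound) (rule that)
 have Cau: "\<exists>N. \<forall>m\<ge>N. \<forall>n\<ge>N. Hs_norm_sq \<sigma> (%x. \<phi> m x - \<phi> n x) <= ennreal e" if e: "0 < e" for e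
 proof -
  have "0 < sqrt (e / C)" using e C(1) by simp
  from metric_CauchyD[OF LIMSEQ_imp_Cauchy[OF lim] this]
  obtain N where N: "!!m n. m \<ge> N ==> n \<ge> N ==> norm (grad_class (\<phi> m) - grad_class (\<phi> n)) < sqrt (e / C)"
   by (auto simp: dist_norm)
  have "Hs_norm_sq \<sigma> (%x. \<phi> m x - \<phi> n x) <= ennreal e" if mn: "m \<ge> N" "n \<ge> N" for m n
  proof -
   have "(norm (grad_class (\<phi> m) - grad_class (\<phi> n)))\<^sup>2 <= (sqrt (e / C))\<^sup>2"
    by (rule power_mono[OF less_imp_le[OF N[OF mn]]]) simp
   then have "C * (norm (grad_class (\<phi> m) - grad_class (\<phi> n)))\<^sup>2 <= e" using C(1) e by (simp add: field_simps)
   then have "ennreal (C * (norm (grad_class (%x. \<phi> m x - \<phi> n x)))\<^sup>2) <= ennreal e"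
    unfolding H0_diff(2)[OF test_H0[OF \<phi>(1)] test_H0[OF \<phi>(1)]] by (rule ennreal_leI)
   then show ?thesis using C(2)[OF test_functions_diff[OF \<phi>(1) \<phi>(1)], of m n] by (rule order_trans[rotated])
  qed
  then show ?thesis by blast
 qed
 have Cau2: "\<exists>N. \<forall>m\<ge>N. \<forall>n\<ge>N. (NL x. ennreal ((norm (\<phi> m x - \<phi> n x))\<^sup>2)) <= ennreal e" if e: "0 < e" for e
 proof -
  obtain N where N: "\<forall>m\<ge>N. \<forall>n\<ge>N. Hs_norm_sq \<sigma> (%x. \<phi> m x - \<phi> n x) <= ennreal e" using Cau[OF e] by (rule exE)
  have "(NL x. ennreal ((norm (\<phi> m x - \<phi> n x))\<^sup>2)) <= Hs_norm_sq \<sigma> (%x. \<phi> m x - \<phi> n x)" for m n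
   by (simp add: Hs_norm_sq_eq nn_integral_completion)
  then show ?thesis using N order_trans by blast
 qed
 obtain u r where u: "u \<in> \<L>" and r: "strict_mono (r :: nat => nat)"
  and ae: "AE x in lebesgue. (%k. \<phi> (r k) x) \<longlonglongrightarrow> u x"
  and L2: "(%n. NL x. ennreal ((norm (\<phi> n x - u x))\<^sup>2)) \<longlonglongrightarrow> 0"
  by (rule square_integral_Cauchy_limit[OF test_lebesgue[OF \<phi>(1)]], rule Cau2, assumption) (rule that)
 have G: "(%n. gagliardo \<sigma> (%x. \<phi> n x - u x)) \<longlonglongrightarrow> 0"
  unfolding tendsto_0_iff_eventually_le_ennreal
 proof (intro allI impI)
  fix e :: real assume e: "0 < e"
  obtain N where N: "\<forall>m\<ge>N. \<forall>n\<ge>N. Hs_norm_sq \<sigma> (%x. \<phi> m x - \<phi> n x) <= ennreal e" using Cau[OF e] by (rule exE)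
  have "gagliardo \<sigma> (%x. \<phi> n x - u x) <= ennreal e" if n: "N <= n" for n
  proof (rule gagliardo_le_of_AE_tendsto[where v = "%k x. \<phi> n x - \<phi> (r k) x"])
   show "(%x. \<phi> n x - \<phi> (r k) x) \<in> \<B>" for k
    by (intro borel_measurable_diff Cc_fun_borel[OF Cc_fun_test[OF \<phi>(1)]])
   show "AE x in lebesgue. (%k. \<phi> n x - \<phi> (r k) x) \<longlonglongrightarrow> \<phi> n x - u x"
    using ae by eventually_elim (intro tendsto_diff tendsto_const)
   have "gagliardo \<sigma> (%x. \<phi> n x - \<phi> (r k) x) <= ennreal e" if "N <= k" for k
   proof -
    have "N <= r k" using seq_suble[OF r, of k] that by linarith
    then have "Hs_norm_sq \<sigma> (%x. \<phi> n x - \<phi> (r k) x) <= ennreal e" using N n by blast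
    moreover have "gagliardo \<sigma> (%x. \<phi> n x - \<phi> (r k) x) <= Hs_norm_sq \<sigma> (%x. \<phi> n x - \<phi> (r k) x)" by (simp add: Hs_norm_sq_eq)
    ultimately show ?thesis by (rule order_trans[rotated])
   qed
   then show "\<forall>\<^sub>F k in sequentially. gagliardo \<sigma> (%x. \<phi> n x - \<phi> (r k) x) <= ennreal e"
    by (rule eventually_sequentiallyI)
  qed
  then show "\<forall>\<^sub>F n in sequentially. gagliardo \<sigma> (%x. \<phi> n x - u x) <= ennreal e"
   by (rule eventually_sequentiallyI)
 qed
 have "(%n. Hs_norm_sq \<sigma> (%x. \<phi> n x - u x)) \<longlonglongrightarrow> 0"
  using tendsto_add[OF L2 G] by (simp add: Hs_norm_sq_eq nn_integral_completion)
 then have a: "approx \<phi> u" using u \<phi>(1) by (simp add: approx_def)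
 have "W = grad_class u" by (rule LIMSEQ_unique[OF lim approx_grad_class[OF a]])
 then show "W \<in> grad_class ` H0 \<sigma> \<Omega>" using approx_H0[OF a] by blast
qed

end

section \<open>The load functional\<close>

context fractional_domain
begin

lemma H0_borel_representative:
 assumes u: "u \<in> H0 \<sigma> \<Omega>" and m: "emeasure lborel \<Omega> <= ennreal m"
 obtains u' where "u' \<in> \<B>" "AE x in lebesgue. u x = u' x"
  "emeasure lborel {x. u' x ~= 0} <= ennreal m" "gagliardo \<sigma> u' = gagliardo \<sigma> u"
proof -
 obtain \<phi> where a: "approx \<phi> u" by (rule H0_approx[OF u]) (rule that)
 obtain u' where u': "u' \<in> \<B>" "AE x in lebesgue. u x = u' x" "AE x in lborel. u x = u' x"
  by (rule lebesgue_borel_representative[OF approxD(1)[OF a]]) (rule that)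
 have "AE x in lebesgue. x \<in> {x. u' x ~= 0} --> x \<in> \<Omega>"
  using approx_vanishes[OF a] u'(2) by eventually_elim auto
 then have "AE x in lborel. x \<in> {x. u' x ~= 0} --> x \<in> \<Omega>" by (simp add: AE_completion_iff)
 then have "emeasure lborel {x. u' x ~= 0} <= emeasure lborel \<Omega>"
  by (rule emeasure_mono_AE) (use \<Omega> in simp)
 then have e: "emeasure lborel {x. u' x ~= 0} <= ennreal m" using m by (rule order_trans)
 show thesis by (rule that[OF u'(1,2) e gagliardo_cong_AE[OF u'(2), symmetric]])
qed

text \<open>Young's inequality suffices in place of Hoelder's, since the pairing is only needed for
functions of seminorm at most \<open>1\<close> and is homogeneous.\<close>

lemma young_pairing:
 fixes F u u' :: "real^'n => real" and p r A K :: real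
 assumes p: "1 < p" "1 < r" "1 / p + 1 / r = 1"
  and F[measurable]: "F \<in> \<L>" and A: "(NL x. ennreal (\<bar>F x\<bar> powr p)) <= ennreal A" "0 <= A"
  and u': "u' \<in> \<B>" "AE x in lebesgue. u x = u' x" and K: "(NN x. ennreal (\<bar>u' x\<bar> powr r)) <= ennreal K" "0 <= K"
 shows "(NL x. ennreal \<bar>F x * u x\<bar>) <= ennreal (A + K)"
proof -
 have um[measurable]: "u' \<in> \<L>" by (rule measurable_completion) (use u'(1) in simp)
 have "(NL x. ennreal \<bar>F x * u x\<bar>) <= (NL x. ennreal (\<bar>F x\<bar> powr p) + ennreal (\<bar>u' x\<bar> powr r))"
 proof (rule nn_integral_mono_AE, use u'(2) in eventually_elim)
  fix x assume x: "u x = u' x"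
  have "\<bar>F x * u x\<bar> = \<bar>F x\<bar> * \<bar>u' x\<bar>" by (simp add: x abs_mult)
  also have "... <= \<bar>F x\<bar> powr p / p + \<bar>u' x\<bar> powr r / r" by (rule Youngs_inequality[OF p]) simp_all
  also have "... <= \<bar>F x\<bar> powr p + \<bar>u' x\<bar> powr r"
  proof (rule add_mono)
   show "\<bar>F x\<bar> powr p / p <= \<bar>F x\<bar> powr p" using p(1) mult_left_mono[of 1 p "\<bar>F x\<bar> powr p"] by (simp add: divide_le_eq)
   show "\<bar>u' x\<bar> powr r / r <= \<bar>u' x\<bar> powr r" using p(2) mult_left_mono[of 1 r "\<bar>u' x\<bar> powr r"] by (simp add: divide_le_eq)
  qed
  finally have "ennreal \<bar>F x * u x\<bar> <= ennreal (\<bar>F x\<bar> powr p + \<bar>u' x\<bar> powr r)" by (rule ennreal_leI)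
  then show "ennreal \<bar>F x * u x\<bar> <= ennreal (\<bar>F x\<bar> powr p) + ennreal (\<bar>u' x\<bar> powr r)" by simp
 qed
 also have "... = (NL x. ennreal (\<bar>F x\<bar> powr p)) + (NL x. ennreal (\<bar>u' x\<bar> powr r))"
  by (rule nn_integral_add) measurable
 also have "... <= ennreal A + ennreal K" unfolding nn_integral_completion[of lborel "%x. ennreal (\<bar>u' x\<bar> powr r)"] by (rule add_mono[OF A(1) K(1)])
 also have "... = ennreal (A + K)" using A(2) K(2) by simp
 finally show ?thesis .
qed

text \<open>The exponent \<open>two_sharp\<close> is conjugate to the exponent of the Sobolev embedding in the subcritical case
and to a finite exponent in the critical one; in the supercritical case \<open>u\<close> is bounded.\<close>

lemma load_pairing_unit:
 fixes F :: "real^'n => real" and q :: real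
 assumes q: "1 < q" and F[measurable]: "F \<in> \<L>"
  and Fp: "integrable lebesgue (%x. \<bar>F x\<bar> powr two_sharp CARD('n) \<sigma> q)"
 obtains K where "0 <= K" "!!u. u \<in> H0 \<sigma> \<Omega> ==> gagliardo \<sigma> u <= 1 ==> (NL x. ennreal \<bar>F x * u x\<bar>) <= ennreal K"
proof -
 obtain m where m: "0 < m" "emeasure lborel \<Omega> <= ennreal m" "emeasure lebesgue \<Omega> <= ennreal m" by (rule volume_finite) (rule that)
 define A where "A = (LINT x|lebesgue. \<bar>F x\<bar> powr two_sharp CARD('n) \<sigma> q)"
 have A: "(NL x. ennreal (\<bar>F x\<bar> powr two_sharp CARD('n) \<sigma> q)) <= ennreal A" "0 <= A"
  using nn_integral_eq_integral[OF Fp] by (simp_all add: A_def)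
 define N where "N = real CARD('n)"
 have N: "1 <= N" unfolding N_def using zero_less_card_finite[where 'a='n] by linarith
 consider "\<sigma> < N / 2" | "\<sigma> = N / 2" | "N / 2 < \<sigma>" by linarith
 then show thesis
 proof cases
  case 1
  then have 1: "\<sigma> < real CARD('n) / 2" by (simp add: N_def)
  define r where "r = 2 * N / (N - 2 * \<sigma>)"
  define p where "p = 2 * N / (N + 2 * \<sigma>)"
  have pe: "two_sharp CARD('n) \<sigma> q = p" using 1 by (simp add: two_sharp_def p_def N_def)
  obtain K where K: "0 <= K" "!!(u :: real^'n => real) m. u \<in> \<B> ==> emeasure lborel {y. u y ~= 0} <= ennreal m ==>
    gagliardo \<sigma> u <= 1 ==> (NN x. ennreal (\<bar>u x\<bar> powr r)) <= ennreal K"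
   by (rule fractional_sobolev_subcritical[OF \<sigma>(1) 1, folded N_def, folded r_def]) (rule that)
  have d: "0 < N + 2 * \<sigma>" "0 < N - 2 * \<sigma>" using 1 \<sigma>(1) N by (simp_all add: N_def)
  have pr: "1 < p" "1 < r" using d \<sigma>(1) by (simp_all add: p_def r_def less_divide_eq)
  have "1 / p + 1 / r = ((N + 2 * \<sigma>) + (N - 2 * \<sigma>)) / (2 * N)" unfolding p_def r_def by (subst add_divide_distrib) simp
  moreover have "(N + 2 * \<sigma>) + (N - 2 * \<sigma>) = 2 * N" by simp
  ultimately have pr1: "1 / p + 1 / r = 1" using N by (simp only:) simp
  show thesis
  proof (rule that[of "A + K"])
   fix u assume u: "u \<in> H0 \<sigma> \<Omega>" "gagliardo \<sigma> u <= 1"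
   obtain u' where u': "u' \<in> \<B>" "AE x in lebesgue. u x = u' x"
    "emeasure lborel {x. u' x ~= 0} <= ennreal m" "gagliardo \<sigma> u' = gagliardo \<sigma> u"
    by (rule H0_borel_representative[OF u(1) m(2)]) (rule that)
   have "(NN x. ennreal (\<bar>u' x\<bar> powr r)) <= ennreal K" by (rule K(2)[OF u'(1,3)]) (use u u' in simp)
   from young_pairing[OF pr pr1 F A[unfolded pe] u'(1,2) this K(1)]
   show "(NL x. ennreal \<bar>F x * u x\<bar>) <= ennreal (A + K)" .
  qed (use A K in simp)
 next
  case 2
  then have 2: "\<sigma> = real CARD('n) / 2" by (simp add: N_def)
  define p where "p = q / (q - 1)"
  have pe: "two_sharp CARD('n) \<sigma> q = p" using 2 by (simp add: two_sharp_def p_def)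
  have p1: "1 < p" using q by (simp add: p_def less_divide_eq)
  have pq: "1 / p + 1 / q = 1" using q by (simp add: p_def field_simps)
  obtain k :: nat where k: "q <= real k" using real_arch_simple by blast
  obtain K where "K \<ge> 0 \<and> (\<forall>u :: real^'n => real. u \<in> \<B> --> emeasure lborel {y. u y ~= 0} <= ennreal m -->
   gagliardo \<sigma> u <= 1 --> (NN x. ennreal (\<bar>u x\<bar> powr (2 + 2 * real k))) <= ennreal K)"
   using fractional_sobolev_critical[OF \<sigma>(1) 2 m(1), of k] by (elim exE)
  note K = conjunct1[OF this] conjunct2[OF this, rule_format]
  show thesis
  proof (rule that[of "A + (m + K)"])
   fix u assume u: "u \<in> H0 \<sigma> \<Omega>" "gagliardo \<sigma> u <= 1"
   obtain u' where u': "u' \<in> \<B>" "AE x in lebesgue. u x = u' x"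
    "emeasure lborel {x. u' x ~= 0} <= ennreal m" "gagliardo \<sigma> u' = gagliardo \<sigma> u"
    by (rule H0_borel_representative[OF u(1) m(2)]) (rule that)
   note [measurable] = u'(1)
   have "(NN x. ennreal (\<bar>u' x\<bar> powr q)) <= (NN x. indicator {x. u' x ~= 0} x + ennreal (\<bar>u' x\<bar> powr (2 + 2 * real k)))"
   proof (rule nn_integral_mono)
    fix x
    consider "u' x = 0" | "u' x ~= 0" "\<bar>u' x\<bar> <= 1" | "1 < \<bar>u' x\<bar>" by linarith
    then show "ennreal (\<bar>u' x\<bar> powr q) <= indicator {x. u' x ~= 0} x + ennreal (\<bar>u' x\<bar> powr (2 + 2 * real k))"
    proof cases
     case 1 then show ?thesis by simp
    next
     case 2
     have "\<bar>u' x\<bar> powr q <= 1" using powr_mono2[of q "\<bar>u' x\<bar>" 1] 2 q by simp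
     then have "ennreal (\<bar>u' x\<bar> powr q) <= ennreal 1" by (rule ennreal_leI)
     then show ?thesis using 2 by (simp add: add_increasing2)
    next
     case 3
     have "\<bar>u' x\<bar> powr q <= \<bar>u' x\<bar> powr (2 + 2 * real k)" by (rule powr_mono) (use 3 k q in linarith)+
     then have "ennreal (\<bar>u' x\<bar> powr q) <= ennreal (\<bar>u' x\<bar> powr (2 + 2 * real k))" by (rule ennreal_leI)
     then show ?thesis by (rule order_trans) simp
    qed
   qed
   also have "... = emeasure lborel {x. u' x ~= 0} + (NN x. ennreal (\<bar>u' x\<bar> powr (2 + 2 * real k)))"
    by (subst nn_integral_add) (simp_all add: nn_integral_indicator)
   also have "... <= ennreal m + ennreal K"
    by (rule add_mono[OF u'(3) K(2)[OF u'(1,3)]]) (use u u' in simp)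
   also have "... = ennreal (m + K)" using m(1) K(1) by simp
   finally have "(NN x. ennreal (\<bar>u' x\<bar> powr q)) <= ennreal (m + K)" .
   from young_pairing[OF p1 q pq F A[unfolded pe] u'(1,2) this]
   show "(NL x. ennreal \<bar>F x * u x\<bar>) <= ennreal (A + (m + K))" using m(1) K(1) by simp
  qed (use A K m in simp)
 next
  case 3
  then have 3: "real CARD('n) / 2 < \<sigma>" by (simp add: N_def)
  have pe: "two_sharp CARD('n) \<sigma> q = 1" using 3 by (simp add: two_sharp_def)
  obtain D where D: "0 <= D" "!!u :: real^'n => real. u \<in> \<B> ==> emeasure lborel {y. u y ~= 0} <= ennreal m ==>
    gagliardo \<sigma> u <= 1 ==> (AE x in lborel. \<bar>u x\<bar> <= D)"
   by (rule fractional_sobolev_supercritical[OF 3 m(1)]) (rule that)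
  show thesis
  proof (rule that[of "D * A"])
   fix u assume u: "u \<in> H0 \<sigma> \<Omega>" "gagliardo \<sigma> u <= 1"
   obtain u' where u': "u' \<in> \<B>" "AE x in lebesgue. u x = u' x"
    "emeasure lborel {x. u' x ~= 0} <= ennreal m" "gagliardo \<sigma> u' = gagliardo \<sigma> u"
    by (rule H0_borel_representative[OF u(1) m(2)]) (rule that)
   have "AE x in lborel. \<bar>u' x\<bar> <= D" by (rule D(2)[OF u'(1,3)]) (use u u' in simp)
   then have ae: "AE x in lebesgue. \<bar>u' x\<bar> <= D" by (rule AE_completion)
   have "(NL x. ennreal \<bar>F x * u x\<bar>) <= (NL x. ennreal D * ennreal (\<bar>F x\<bar> powr 1))"
   proof (rule nn_integral_mono_AE, use ae u'(2) in eventually_elim)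
    fix x assume x: "\<bar>u' x\<bar> <= D" "u x = u' x"
    have "\<bar>F x * u x\<bar> <= D * \<bar>F x\<bar> powr 1"
     using mult_right_mono[OF x(1), of "\<bar>F x\<bar>"] by (simp add: x(2) abs_mult mult.commute)
    then have "ennreal \<bar>F x * u x\<bar> <= ennreal (D * \<bar>F x\<bar> powr 1)" by (rule ennreal_leI)
    then show "ennreal \<bar>F x * u x\<bar> <= ennreal D * ennreal (\<bar>F x\<bar> powr 1)" using D(1) by (simp only: ennreal_mult powr_ge_zero)
   qed
   also have "... = ennreal D * (NL x. ennreal (\<bar>F x\<bar> powr 1))" by (rule nn_integral_cmult) measurable
   also have "... <= ennreal D * ennreal A" by (rule mult_left_mono[OF A(1)[unfolded pe]]) simp
   also have "... = ennreal (D * A)" using D(1) A(2) by (simp add: ennreal_mult)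
   finally show "(NL x. ennreal \<bar>F x * u x\<bar>) <= ennreal (D * A)" .
  qed (use D A in simp)
 qed
qed

lemma load_pairing:
 fixes f :: "real^'n => real" and q :: real
 assumes q: "1 < q" and f: "f \<in> Lp_on (two_sharp CARD('n) \<sigma> q) \<Omega>"
 obtains C where "0 <= C" "!!u. u \<in> H0 \<sigma> \<Omega> ==> integrable (lebesgue_on \<Omega>) (%x. f x * u x)"
  "!!u. u \<in> H0 \<sigma> \<Omega> ==> \<bar>LINT x|lebesgue_on \<Omega>. f x * u x\<bar> <= C * norm (grad_class u)"
proof -
 define F where "F x = indicator \<Omega> x * f x" for x
 have \<Omega>': "\<Omega> \<inter> space lebesgue \<in> sets lebesgue" using \<Omega>_lebesgue by simp
 have F: "F \<in> \<L>"
  using f borel_measurable_restrict_space_iff[OF \<Omega>', of f] by (simp add: Lp_on_def F_def[abs_def])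
 have "integrable lebesgue (%x. indicator \<Omega> x *\<^sub>R (\<bar>f x\<bar> powr two_sharp CARD('n) \<sigma> q))"
  using f integrable_restrict_space[OF \<Omega>', of "%x. \<bar>f x\<bar> powr two_sharp CARD('n) \<sigma> q"] by (simp add: Lp_on_def)
 moreover have "indicator \<Omega> x *\<^sub>R (\<bar>f x\<bar> powr two_sharp CARD('n) \<sigma> q) = \<bar>F x\<bar> powr two_sharp CARD('n) \<sigma> q" for x
  by (simp add: F_def indicator_def)
 ultimately have Fp: "integrable lebesgue (%x. \<bar>F x\<bar> powr two_sharp CARD('n) \<sigma> q)" by simp
 obtain K where K: "0 <= K" "!!u. u \<in> H0 \<sigma> \<Omega> ==> gagliardo \<sigma> u <= 1 ==> (NL x. ennreal \<bar>F x * u x\<bar>) <= ennreal K"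
  by (rule load_pairing_unit[OF q F Fp]) (rule that)
 obtain C where C: "0 < C" "!!u. u \<in> H0 \<sigma> \<Omega> ==> Hs_norm_sq \<sigma> u <= ennreal (C * (norm (grad_class u))\<^sup>2)"
  by (rule H0_norm_bound) (rule that)
 have main: "(NL x. ennreal \<bar>F x * u x\<bar>) <= ennreal (sqrt C * K * norm (grad_class u))" if u: "u \<in> H0 \<sigma> \<Omega>" for u
 proof (cases "grad_class u = 0")
  case True
  have "(NL x. ennreal ((u x)\<^sup>2)) <= Hs_norm_sq \<sigma> u" by (simp add: Hs_norm_sq_eq nn_integral_completion)
  also have "... <= 0" using C(2)[OF u] True by simp
  finally have "(NL x. ennreal ((u x)\<^sup>2)) = 0" by simp
  moreover have "(%x. ennreal ((u x)\<^sup>2)) \<in> \<L>"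
   using borel_measurable_integrable[OF H0_frac_grad(3)[OF u]] by measurable
  ultimately have "AE x in lebesgue. ennreal ((u x)\<^sup>2) = 0" by (simp add: nn_integral_0_iff_AE)
  then have "AE x in lebesgue. ennreal \<bar>F x * u x\<bar> = 0" by eventually_elim simp
  then have "(NL x. ennreal \<bar>F x * u x\<bar>) = (\<integral>\<^sup>+x. 0 \<partial>(lebesgue :: (real^'n) measure))" by (rule nn_integral_cong_AE)
  then show ?thesis by simp
 next
  case False
  define t where "t = 1 / (sqrt C * norm (grad_class u))"
  have t: "0 < t" using False C(1) by (simp add: t_def)
  note w = H0_lin(1)[OF u u, of t 0, simplified] H0_lin(3)[OF u u, of t 0, simplified]
  have "gagliardo \<sigma> (%x. t * u x) <= Hs_norm_sq \<sigma> (%x. t * u x)" by (simp add: Hs_norm_sq_eq)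
  also have "... <= ennreal (C * (norm (t *\<^sub>R grad_class u))\<^sup>2)" using C(2)[OF w(1)] w(2) by simp
  also have "C * (norm (t *\<^sub>R grad_class u))\<^sup>2 = 1"
   using False C(1) by (simp add: t_def power_mult_distrib power_divide)
  finally have "gagliardo \<sigma> (%x. t * u x) <= 1" by simp
  from K(2)[OF w(1) this] have le: "(NL x. ennreal \<bar>F x * (t * u x)\<bar>) <= ennreal K" .
  have "(NL x. ennreal \<bar>F x * u x\<bar>) = (NL x. ennreal (1 / t) * ennreal \<bar>F x * (t * u x)\<bar>)"
  proof (rule nn_integral_cong)
   fix x
   have "\<bar>F x * u x\<bar> = 1 / t * \<bar>F x * (t * u x)\<bar>" using t by (simp add: abs_mult)
   then show "ennreal \<bar>F x * u x\<bar> = ennreal (1 / t) * ennreal \<bar>F x * (t * u x)\<bar>"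
    using t by (simp only: ennreal_mult[symmetric] abs_ge_zero zero_le_divide_1_iff less_imp_le)
  qed
  also have "... = ennreal (1 / t) * (NL x. ennreal \<bar>F x * (t * u x)\<bar>)"
   by (intro nn_integral_cmult measurable_compose[OF _ measurable_ennreal] borel_measurable_abs borel_measurable_times borel_measurable_const
     F borel_measurable_integrable[OF H0_frac_grad(3)[OF u]])
  also have "... <= ennreal (1 / t) * ennreal K" by (rule mult_left_mono[OF le]) simp
  also have "... = ennreal (sqrt C * K * norm (grad_class u))"
   using t K(1) by (subst ennreal_mult[symmetric]) (simp_all add: t_def ac_simps)
  finally show ?thesis .
 qed
 have rs: "indicator \<Omega> x *\<^sub>R (f x * u x) = F x * u x" for u x by (simp add: F_def)
 have int: "integrable lebesgue (%x. F x * u x)" if u: "u \<in> H0 \<sigma> \<Omega>" for u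
 proof (rule integrableI_bounded)
  show "(%x. F x * u x) \<in> \<L>"
   by (intro borel_measurable_times F borel_measurable_integrable[OF H0_frac_grad(3)[OF u]])
  show "(NL x. ennreal (norm (F x * u x))) < \<infinity>"
   using order_le_less_trans[OF main[OF u], of \<infinity>] by simp
 qed
 show thesis
 proof (rule that[of "sqrt C * K"])
  show "0 <= sqrt C * K" using C(1) K(1) by simp
  fix u assume u: "u \<in> H0 \<sigma> \<Omega>"
  show "integrable (lebesgue_on \<Omega>) (%x. f x * u x)"
   unfolding integrable_restrict_space[OF \<Omega>'] rs by (rule int[OF u])
  have "ennreal \<bar>LINT x|lebesgue. F x * u x\<bar> <= (NL x. ennreal (norm (F x * u x)))"
   using integral_norm_bound_ennreal[OF int[OF u]] by simp
  also have "... <= ennreal (sqrt C * K * norm (grad_class u))" using main[OF u] by simp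
  finally show "\<bar>LINT x|lebesgue_on \<Omega>. f x * u x\<bar> <= sqrt C * K * norm (grad_class u)"
   unfolding integral_restrict_space[OF \<Omega>'] rs
   by (subst (asm) ennreal_le_iff) (use C K in simp_all)
 qed
qed

text \<open>A functional on \<open>H0\<close> that is bounded by the gradient norm depends on the gradient only.\<close>

lemma dual_riesz:
 assumes F: "F \<in> H0_dual \<sigma> \<Omega>"
 shows "\<exists>z. \<forall>u\<in>H0 \<sigma> \<Omega>. F u = z \<bullet> grad_class u"
proof -
 have "\<exists>C. \<forall>u\<in>H0 \<sigma> \<Omega>. \<bar>F u\<bar> <= C * H0_norm \<sigma> u" using F by (simp add: H0_dual_def)
 then obtain C where C0: "\<forall>u\<in>H0 \<sigma> \<Omega>. \<bar>F u\<bar> <= C * H0_norm \<sigma> u" by (rule exE)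
 have C: "\<bar>F u\<bar> <= C * norm (grad_class u)" if "u \<in> H0 \<sigma> \<Omega>" for u using C0[rule_format, OF that] H0_norm_eq[OF that] by simp
 have lin: "F (%x. a * u x + b * v x) = a * F u + b * F v" if "u \<in> H0 \<sigma> \<Omega>" "v \<in> H0 \<sigma> \<Omega>" for u v a b
  using F that by (simp add: H0_dual_def)
 have eq: "F u = F v" if uv: "u \<in> H0 \<sigma> \<Omega>" "v \<in> H0 \<sigma> \<Omega>" "grad_class u = grad_class v" for u v
  using C[OF H0_diff(1)[OF uv(1,2)]] lin[OF uv(1,2), of 1 "-1"] H0_diff(2)[OF uv(1,2)] uv(3) by simp
 define R where "R U = (SOME u. u \<in> H0 \<sigma> \<Omega> \<and> grad_class u = U)" for U
 have R: "R U \<in> H0 \<sigma> \<Omega>" "grad_class (R U) = U" if "U \<in> grad_class ` H0 \<sigma> \<Omega>" for U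
 proof -
  have "\<exists>u. u \<in> H0 \<sigma> \<Omega> \<and> grad_class u = U" using that by blast
  from someI_ex[OF this] show "R U \<in> H0 \<sigma> \<Omega>" "grad_class (R U) = U" unfolding R_def by blast+
 qed
 have "\<exists>z\<in>grad_class ` H0 \<sigma> \<Omega>. \<forall>U\<in>grad_class ` H0 \<sigma> \<Omega>. F (R U) = z \<bullet> U"
 proof (rule riesz_representation[OF grad_space_closed grad_space_subspace])
  fix U W a b assume UW: "U \<in> grad_class ` H0 \<sigma> \<Omega>" "W \<in> grad_class ` H0 \<sigma> \<Omega>"
  have m: "a *\<^sub>R U + b *\<^sub>R W \<in> grad_class ` H0 \<sigma> \<Omega>"
   by (intro subspace_add subspace_scale grad_space_subspace UW)
  have "F (R (a *\<^sub>R U + b *\<^sub>R W)) = F (%x. a * R U x + b * R W x)"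
   by (rule eq[OF R(1)[OF m] H0_lin(1)[OF R(1)[OF UW(1)] R(1)[OF UW(2)]]])
    (simp add: H0_lin(3)[OF R(1)[OF UW(1)] R(1)[OF UW(2)]] R(2)[OF m] R(2)[OF UW(1)] R(2)[OF UW(2)])
  then show "F (R (a *\<^sub>R U + b *\<^sub>R W)) = a * F (R U) + b * F (R W)"
   by (simp add: lin[OF R(1)[OF UW(1)] R(1)[OF UW(2)]])
  show "\<bar>F (R U)\<bar> <= C * norm U" using C[OF R(1)[OF UW(1)]] R(2)[OF UW(1)] by simp
 qed
 then obtain z where z: "\<forall>U\<in>grad_class ` H0 \<sigma> \<Omega>. F (R U) = z \<bullet> U" by (elim bexE)
 have "F u = z \<bullet> grad_class u" if u: "u \<in> H0 \<sigma> \<Omega>" for u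
 proof -
  have m: "grad_class u \<in> grad_class ` H0 \<sigma> \<Omega>" using u by blast
  have "F u = F (R (grad_class u))" by (rule eq[OF u R(1)[OF m] R(2)[OF m, symmetric]])
  then show ?thesis using z m by simp
 qed
 then show ?thesis by blast
qed

end

section \<open>Matrix fields acting on square integrable fields\<close>

lemma matrix_field_L2:
 fixes A :: "real^'n => real^'n^'n"
 assumes A: "A \<in> \<L>" and M: "0 <= M" "AE x in lebesgue. \<forall>\<xi>. norm (A x *v \<xi>) <= M * norm \<xi>"
  and g: "g \<in> L2"
 shows "(%x. A x *v g x) \<in> L2" "norm (L2_class (%x. A x *v g x)) <= M * norm (L2_class g)"
proof -
 have m: "(%x. A x *v g x) \<in> \<L>"
 proof (subst borel_measurable_euclidean_space, rule ballI)
  fix i :: "real^'n" assume "i \<in> Basis"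
  then have "\<exists>j. i = axis j 1" by (simp add: Basis_vec_def)
  then obtain j where j: "i = axis j 1" by (rule exE)
  have Ac: "(%x. A x $ j $ k) \<in> \<L>" for k
  proof -
   have "(%x. A x \<bullet> axis j (axis k 1)) \<in> \<L>"
    by (intro borel_measurable_inner A borel_measurable_const)
   then show ?thesis by (simp add: inner_axis)
  qed
  have "(%x. (A x *v g x) \<bullet> i) = (%x. \<Sum>k\<in>UNIV. A x $ j $ k * g x $ k)"
   unfolding j by (simp add: inner_axis matrix_vector_mult_def)
  moreover have "(%x. \<Sum>k\<in>UNIV. A x $ j $ k * g x $ k) \<in> \<L>"
   by (intro borel_measurable_sum borel_measurable_times Ac L2_component_measurable[OF g])
  ultimately show "(%x. (A x *v g x) \<bullet> i) \<in> \<L>" by (simp only:)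
 qed
 have le: "AE x in lebesgue. (norm (A x *v g x))\<^sup>2 <= M\<^sup>2 * (norm (g x))\<^sup>2"
  using M(2)
 proof eventually_elim
  fix x assume "\<forall>\<xi>. norm (A x *v \<xi>) <= M * norm \<xi>"
  then have "norm (A x *v g x) <= M * norm (g x)" by blast
  then have "(norm (A x *v g x))\<^sup>2 <= (M * norm (g x))\<^sup>2" by (rule power_mono) simp
  then show "(norm (A x *v g x))\<^sup>2 <= M\<^sup>2 * (norm (g x))\<^sup>2" by (simp add: power_mult_distrib)
 qed
 have gi: "integrable lebesgue (%x. M\<^sup>2 * (norm (g x))\<^sup>2)" using g by (simp add: L2_def)
 have Ai: "integrable lebesgue (%x. (norm (A x *v g x))\<^sup>2)"
 proof (rule Bochner_Integration.integrable_bound[OF gi])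
  show "(%x. (norm (A x *v g x))\<^sup>2) \<in> \<L>" by (intro borel_measurable_power measurable_compose[OF m borel_measurable_norm])
  show "AE x in lebesgue. norm ((norm (A x *v g x))\<^sup>2) <= norm (M\<^sup>2 * (norm (g x))\<^sup>2)" using le by eventually_elim simp
 qed
 show s: "(%x. A x *v g x) \<in> L2" using m Ai by (simp add: L2_def)
 have "(norm (L2_class (%x. A x *v g x)))\<^sup>2 <= (LINT x|lebesgue. M\<^sup>2 * (norm (g x))\<^sup>2)"
  unfolding L2_class_norm[OF s] by (rule integral_mono_AE[OF Ai gi le])
 also have "... = (M * norm (L2_class g))\<^sup>2" by (simp add: L2_class_norm[OF g] power_mult_distrib)
 finally show "norm (L2_class (%x. A x *v g x)) <= M * norm (L2_class g)"
  by (rule power2_le_imp_le) (use M in simp)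
qed

lemma L2_fun_lin: "AE x in lebesgue. L2_fun (a *\<^sub>R U + b *\<^sub>R W) x = a *\<^sub>R L2_fun U x + b *\<^sub>R L2_fun W x"
proof -
 have s: "(%x. a *\<^sub>R L2_fun U x + b *\<^sub>R L2_fun W x) \<in> L2" by (intro L2_add L2_scaleR L2_fun_in_L2)
 have "a *\<^sub>R U + b *\<^sub>R W = L2_class (%x. a *\<^sub>R L2_fun U x + b *\<^sub>R L2_fun W x)"
  using L2_class_scaleR[OF L2_fun_in_L2, of a U] L2_class_scaleR[OF L2_fun_in_L2, of b W]
  by (simp add: L2_class_add L2_scaleR L2_fun_in_L2)
 then show ?thesis using L2_fun_class[OF s] by simp
qed

text \<open>The excess of \<open>\<bar>W\<bar>\<close> over \<open>\<gamma>\<close> is bounded by the distance of \<open>W\<close> to any field that satisfies the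
constraint.\<close>

lemma norm_constraint_closed:
 fixes \<gamma> :: "real^'n => real"
 assumes \<gamma>: "\<gamma> \<in> \<L>"
 shows "closed {W. AE x in lebesgue. norm (L2_fun W x) <= \<gamma> x}"
 unfolding closed_sequential_limits
proof (intro allI impI, elim conjE)
 fix X W assume X: "\<forall>n. X n \<in> {W. AE x in lebesgue. norm (L2_fun W x) <= \<gamma> x}" and lim: "X \<longlonglongrightarrow> W"
 define h where "h x = max 0 (norm (L2_fun W x) - \<gamma> x)" for x
 have h[measurable]: "h \<in> \<L>"
  unfolding h_def[abs_def] by (intro borel_measurable_max borel_measurable_const borel_measurable_diff measurable_compose[OF L2_measurable[OF L2_fun_in_L2] borel_measurable_norm] \<gamma>)
 have "(%n. norm (W - X n)) \<longlonglongrightarrow> norm (W - W)" by (intro tendsto_norm tendsto_diff tendsto_const lim)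
 then have "(%n. ennreal ((norm (W - X n))\<^sup>2)) \<longlonglongrightarrow> ennreal (0\<^sup>2)" by (intro tendsto_ennrealI tendsto_power) simp
 moreover have "(NL x. ennreal ((h x)\<^sup>2)) <= ennreal ((norm (W - X n))\<^sup>2)" for n
 proof -
  have s: "(%x. L2_fun W x - L2_fun (X n) x) \<in> L2" by (intro L2_diff L2_fun_in_L2)
  have "W - X n = L2_class (%x. L2_fun W x - L2_fun (X n) x)"
   using L2_class_diff[OF L2_fun_in_L2 L2_fun_in_L2, of W "X n"] by simp
  then have "ennreal ((norm (W - X n))\<^sup>2) = (NL x. ennreal ((norm (L2_fun W x - L2_fun (X n) x))\<^sup>2))"
   by (simp add: L2_class_norm_nn[OF s])
  moreover have "AE x in lebesgue. norm (L2_fun (X n) x) <= \<gamma> x" using X by blast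
  then have "(NL x. ennreal ((h x)\<^sup>2)) <= (NL x. ennreal ((norm (L2_fun W x - L2_fun (X n) x))\<^sup>2))"
  proof (intro nn_integral_mono_AE, eventually_elim)
   fix x assume "norm (L2_fun (X n) x) <= \<gamma> x"
   then have "h x <= norm (L2_fun W x - L2_fun (X n) x)"
    using norm_triangle_ineq2[of "L2_fun W x" "L2_fun (X n) x"] by (simp add: h_def)
   then show "ennreal ((h x)\<^sup>2) <= ennreal ((norm (L2_fun W x - L2_fun (X n) x))\<^sup>2)"
    by (intro ennreal_leI power_mono) (simp_all add: h_def)
  qed
  ultimately show ?thesis by simp
 qed
 ultimately have "(NL x. ennreal ((h x)\<^sup>2)) <= ennreal (0\<^sup>2)"
  by (intro LIMSEQ_le_const) auto
 then have "AE x in lebesgue. ennreal ((h x)\<^sup>2) = 0" by (simp add: nn_integral_0_iff_AE)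
 then have "AE x in lebesgue. norm (L2_fun W x) <= \<gamma> x" by eventually_elim (simp add: h_def max_def split: if_splits)
 then show "W \<in> {W. AE x in lebesgue. norm (L2_fun W x) <= \<gamma> x}" by simp
qed

section \<open>The quasi-variational inequality\<close>

text \<open>The elementary inequality behind the continuity of the constraint sets: two thresholds that are at
least \<open>\<nu>\<close> and differ by at most \<open>e\<close> differ by at most the factor \<open>1 + e / \<nu>\<close>.\<close>

lemma constraint_scaling:
 fixes \<nu> e s t :: real
 assumes "0 < \<nu>" "\<nu> <= s" "0 <= e" "\<bar>s - t\<bar> <= e"
 shows "\<nu> / (\<nu> + e) * t <= s"
proof -
 have "\<nu> * t <= \<nu> * (s + e)" using assms by (intro mult_left_mono) auto
 also have "... <= s * (\<nu> + e)" using mult_right_mono[OF assms(2,3)] by (simp add: algebra_simps)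
 finally show ?thesis using assms by (simp add: divide_le_eq)
qed

context fractional_domain
begin

text \<open>Some element of \<open>H0\<close> with gradient \<open>U\<close>; the operator \<open>G\<close> is evaluated there.\<close>

definition rep :: "'n L2_field => real^'n => real" where
 "rep U = (SOME u. u \<in> H0 \<sigma> \<Omega> \<and> grad_class u = U)"

lemma rep:
 assumes "U \<in> grad_class ` H0 \<sigma> \<Omega>"
 shows "rep U \<in> H0 \<sigma> \<Omega>" "grad_class (rep U) = U"
proof -
 have "\<exists>u. u \<in> H0 \<sigma> \<Omega> \<and> grad_class u = U" using assms by blast
 from someI_ex[OF this] show "rep U \<in> H0 \<sigma> \<Omega>" "grad_class (rep U) = U" unfolding rep_def by blast+
qed

text \<open>By \<open>dual_riesz\<close> the functionals on \<open>H0\<close> are inner products with fields.\<close>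

lemma rep_weak_conv:
 assumes Us: "!!n. Us n \<in> grad_class ` H0 \<sigma> \<Omega>" and U: "U \<in> grad_class ` H0 \<sigma> \<Omega>" and w: "weakly_tendsto Us U"
 shows "H0_weak_conv \<sigma> \<Omega> (%n. rep (Us n)) (rep U)"
 unfolding H0_weak_conv_def
proof (intro conjI allI ballI)
 fix F assume "F \<in> H0_dual \<sigma> \<Omega>"
 then obtain z where z: "\<forall>u\<in>H0 \<sigma> \<Omega>. F u = z \<bullet> grad_class u" using dual_riesz by blast
 have F: "F (rep W) = W \<bullet> z" if "W \<in> grad_class ` H0 \<sigma> \<Omega>" for W
  using z rep[OF that] by (simp add: inner_commute)
 show "(%n. F (rep (Us n))) \<longlonglongrightarrow> F (rep U)"
  unfolding F[OF Us] F[OF U] using w by (simp add: weakly_tendsto_def)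
qed (use rep Us U in auto)

definition gradient_constraint :: "(real^'n => real) => 'n L2_field set" where
 "gradient_constraint \<gamma> = {W \<in> grad_class ` H0 \<sigma> \<Omega>. AE x in lebesgue. norm (L2_fun W x) <= \<gamma> x}"

lemma gradient_constraint_scale:
 assumes W: "W \<in> gradient_constraint \<gamma>" and c: "0 <= c" and le: "AE x in lebesgue. c * \<gamma> x <= \<gamma>' x"
 shows "c *\<^sub>R W \<in> gradient_constraint \<gamma>'"
proof -
 have "AE x in lebesgue. norm (L2_fun W x) <= \<gamma> x" using W by (simp add: gradient_constraint_def)
 moreover have "AE x in lebesgue. L2_fun (c *\<^sub>R W) x = c *\<^sub>R L2_fun W x" using L2_fun_lin[of c W 0 W] by simp
 ultimately have "AE x in lebesgue. norm (L2_fun (c *\<^sub>R W) x) <= \<gamma>' x"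
  using le
 proof eventually_elim
  fix x assume "norm (L2_fun W x) <= \<gamma> x" "L2_fun (c *\<^sub>R W) x = c *\<^sub>R L2_fun W x" "c * \<gamma> x <= \<gamma>' x"
  then show "norm (L2_fun (c *\<^sub>R W) x) <= \<gamma>' x" using mult_left_mono[of "norm (L2_fun W x)" "\<gamma> x" c] c by simp
 qed
 then show ?thesis using W subspace_scale[OF grad_space_subspace] by (simp add: gradient_constraint_def)
qed

lemma gradient_constraint_convex: "convex (gradient_constraint \<gamma>)"
 unfolding convex_def
proof (intro ballI allI impI)
 fix U W and s t :: real
 assume U: "U \<in> gradient_constraint \<gamma>" and W: "W \<in> gradient_constraint \<gamma>" and st: "0 <= s" "0 <= t" "s + t = 1"
 have "AE x in lebesgue. norm (L2_fun U x) <= \<gamma> x" "AE x in lebesgue. norm (L2_fun W x) <= \<gamma> x"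
  using U W by (simp_all add: gradient_constraint_def)
 then have "AE x in lebesgue. norm (L2_fun (s *\<^sub>R U + t *\<^sub>R W) x) <= \<gamma> x"
  using L2_fun_lin[of s U t W]
 proof eventually_elim
  fix x assume 1: "norm (L2_fun U x) <= \<gamma> x" and 2: "norm (L2_fun W x) <= \<gamma> x" and 3: "L2_fun (s *\<^sub>R U + t *\<^sub>R W) x = s *\<^sub>R L2_fun U x + t *\<^sub>R L2_fun W x"
  have "norm (s *\<^sub>R L2_fun U x + t *\<^sub>R L2_fun W x) <= norm (s *\<^sub>R L2_fun U x) + norm (t *\<^sub>R L2_fun W x)" by (rule norm_triangle_ineq)
  also have "... <= s * \<gamma> x + t * \<gamma> x" using mult_left_mono[OF 1 st(1)] mult_left_mono[OF 2 st(2)] st by simp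
  also have "... = \<gamma> x" using st(3) by (simp add: distrib_right[symmetric])
  finally show "norm (L2_fun (s *\<^sub>R U + t *\<^sub>R W) x) <= \<gamma> x" by (simp only: 3)
 qed
 moreover have "s *\<^sub>R U + t *\<^sub>R W \<in> grad_class ` H0 \<sigma> \<Omega>"
  by (intro subspace_add subspace_scale grad_space_subspace) (use U W in \<open>simp_all add: gradient_constraint_def\<close>)
 ultimately show "s *\<^sub>R U + t *\<^sub>R W \<in> gradient_constraint \<gamma>" by (simp add: gradient_constraint_def)
qed

lemma gradient_constraint_closed:
 assumes "\<gamma> \<in> \<L>" shows "closed (gradient_constraint \<gamma>)"
proof -
 have "gradient_constraint \<gamma> = grad_class ` H0 \<sigma> \<Omega> \<inter> {W. AE x in lebesgue. norm (L2_fun W x) <= \<gamma> x}"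
  by (auto simp: gradient_constraint_def)
 then show ?thesis using closed_Int[OF grad_space_closed norm_constraint_closed[OF assms]] by simp
qed

lemma grad_class_constraint:
 assumes u: "u \<in> H0 \<sigma> \<Omega>"
 shows "grad_class u \<in> gradient_constraint \<gamma> \<longleftrightarrow> u \<in> constraint_set \<sigma> \<Omega> \<gamma>"
proof -
 have ae: "AE x in lebesgue. L2_fun (grad_class u) x = frac_grad \<sigma> u x"
  unfolding grad_class_def by (rule L2_fun_class[OF H0_frac_grad(2)[OF u]])
 have "(AE x in lebesgue. norm (L2_fun (grad_class u) x) <= \<gamma> x) \<longleftrightarrow> (AE x in lebesgue. norm (frac_grad \<sigma> u x) <= \<gamma> x)"
 proof
  assume "AE x in lebesgue. norm (L2_fun (grad_class u) x) <= \<gamma> x"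
  then show "AE x in lebesgue. norm (frac_grad \<sigma> u x) <= \<gamma> x" using ae by eventually_elim simp
 next
  assume "AE x in lebesgue. norm (frac_grad \<sigma> u x) <= \<gamma> x"
  then show "AE x in lebesgue. norm (L2_fun (grad_class u) x) <= \<gamma> x" using ae by eventually_elim simp
 qed
 then show ?thesis using u by (simp add: gradient_constraint_def constraint_set_def)
qed

end

theorem theorem4p2:
  fixes \<Omega> :: "(real^'n) set"
    and \<sigma> \<nu> q a_low a_up :: real
    and f :: "real^'n \<Rightarrow> real"
    and A :: "real^'n \<Rightarrow> real^'n^'n"
    and G :: "(real^'n \<Rightarrow> real) \<Rightarrow> (real^'n \<Rightarrow> real)"
  assumes "0 < \<sigma>" "\<sigma> < 1"
    and "bounded_lipschitz_domain \<Omega>"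
    and "A \<in> borel_measurable lebesgue" "bounded (range A)"
    and "0 < a_low" "0 < a_up"
    and "AE x in lebesgue. \<forall>\<xi> \<eta>.
           a_low * (norm \<xi>)\<^sup>2 \<le> (A x *v \<xi>) \<bullet> \<xi> \<and> (A x *v \<xi>) \<bullet> \<eta> \<le> a_up * norm \<xi> * norm \<eta>"
    and "0 < \<nu>"
    and "1 < q"
    and "f \<in> Lp_on (two_sharp CARD('n) \<sigma> q) \<Omega>"
    and "operator_H0_Linf_ge \<sigma> \<Omega> \<nu> G"
    and "bounded_operator \<sigma> \<Omega> G"
    and "completely_continuous \<sigma> \<Omega> G"
  shows "\<exists>u. u \<in> constraint_set \<sigma> \<Omega> (G u) \<and>
           (\<forall>v \<in> constraint_set \<sigma> \<Omega> (G u).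
              (LINT x|lebesgue. (A x *v frac_grad \<sigma> u x) \<bullet> frac_grad \<sigma> (\<lambda>y. v y - u y) x)
                \<ge> (LINT x|lebesgue_on \<Omega>. f x * (v x - u x)))"
proof -
 interpret fractional_domain \<Omega> \<sigma>
  by unfold_locales (use assms(1-3) in \<open>simp_all add: bounded_lipschitz_domain_def\<close>)
 let ?V = "grad_class ` H0 \<sigma> \<Omega>"
 note A = assms(4) and a = assms(6) and \<nu> = assms(9)
 have up: "AE x in lebesgue. \<forall>\<xi>. norm (A x *v \<xi>) <= a_up * norm \<xi>"
  using assms(8)
 proof eventually_elim
  fix x assume x: "\<forall>\<xi> \<eta>. a_low * (norm \<xi>)\<^sup>2 <= (A x *v \<xi>) \<bullet> \<xi> \<and> (A x *v \<xi>) \<bullet> \<eta> <= a_up * norm \<xi> * norm \<eta>"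
  show "\<forall>\<xi>. norm (A x *v \<xi>) <= a_up * norm \<xi>"
  proof
   fix \<xi>
  (* The upper bound, tested with the vector A x \<xi> itself. *)
   have "norm (A x *v \<xi>) * norm (A x *v \<xi>) <= (a_up * norm \<xi>) * norm (A x *v \<xi>)"
    using x[rule_format, of \<xi> "A x *v \<xi>"] by (simp add: power2_norm_eq_inner[symmetric] power2_eq_square)
   then show "norm (A x *v \<xi>) <= a_up * norm \<xi>"
    using assms(7) by (cases "A x *v \<xi> = 0") simp_all
  qed
 qed
 have up0: "0 <= a_up" using assms(7) by simp
 note As = matrix_field_L2[OF A up0 up]
 define T where "T U = L2_class (%x. A x *v L2_fun U x)" for U
 have T_class: "T (L2_class g) = L2_class (%x. A x *v g x)" if g: "g \<in> L2" for g
  unfolding T_def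
 proof (subst L2_class_eq_iff[OF As(1)[OF L2_fun_in_L2] As(1)[OF g]])
  show "AE x in lebesgue. A x *v L2_fun (L2_class g) x = A x *v g x"
   using L2_fun_class[OF g] by eventually_elim simp
 qed
 have T: "bounded_linear T"
 proof (rule bounded_linear_intro[where K = a_up])
  fix U W :: "'n L2_field" and c :: real
  have "T (U + W) = L2_class (%x. A x *v (L2_fun U x + L2_fun W x))"
   using T_class[OF L2_add[OF L2_fun_in_L2 L2_fun_in_L2], of U W] L2_class_add[OF L2_fun_in_L2 L2_fun_in_L2, of U W] by simp
  also have "... = T U + T W"
   unfolding T_def L2_class_add[OF As(1)[OF L2_fun_in_L2] As(1)[OF L2_fun_in_L2]] by (simp add: matrix_vector_right_distrib)
  finally show "T (U + W) = T U + T W" .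
  have "T (c *\<^sub>R U) = L2_class (%x. A x *v (c *\<^sub>R L2_fun U x))"
   using T_class[OF L2_scaleR[OF L2_fun_in_L2], of c U] L2_class_scaleR[OF L2_fun_in_L2, of c U] by simp
  also have "... = c *\<^sub>R T U"
   unfolding T_def L2_class_scaleR[OF As(1)[OF L2_fun_in_L2]] by (simp add: matrix_vector_mult_scaleR)
  finally show "T (c *\<^sub>R U) = c *\<^sub>R T U" .
  show "norm (T U) <= norm U * a_up"
   using As(2)[OF L2_fun_in_L2, of U] by (simp add: T_def mult.commute)
 qed
 have coercive: "a_low * (norm U)\<^sup>2 <= T U \<bullet> U" for U
 proof -
  have "a_low * (norm U)\<^sup>2 = (LINT x|lebesgue. a_low * (norm (L2_fun U x))\<^sup>2)"
   using L2_class_norm[OF L2_fun_in_L2, of U] by simp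
  also have "... <= (LINT x|lebesgue. (A x *v L2_fun U x) \<bullet> L2_fun U x)"
  proof (rule integral_mono_AE)
   show "integrable lebesgue (%x. a_low * (norm (L2_fun U x))\<^sup>2)" using L2_fun_in_L2[of U] by (simp add: L2_def)
   show "integrable lebesgue (%x. (A x *v L2_fun U x) \<bullet> L2_fun U x)"
    by (rule L2_inner_integrable[OF As(1)[OF L2_fun_in_L2] L2_fun_in_L2])
   show "AE x in lebesgue. a_low * (norm (L2_fun U x))\<^sup>2 <= (A x *v L2_fun U x) \<bullet> L2_fun U x"
    using assms(8) by eventually_elim blast
  qed
  also have "... = T U \<bullet> U"
   using L2_class_inner[OF As(1)[OF L2_fun_in_L2] L2_fun_in_L2, of U U] by (simp add: T_def)
  finally show ?thesis .
 qed
 obtain C where C: "0 <= C" "!!u. u \<in> H0 \<sigma> \<Omega> ==> integrable (lebesgue_on \<Omega>) (%x. f x * u x)"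
  "!!u. u \<in> H0 \<sigma> \<Omega> ==> \<bar>LINT x|lebesgue_on \<Omega>. f x * u x\<bar> <= C * norm (grad_class u)"
  by (rule load_pairing[OF assms(10,11)]) (rule that)
 have "(%u. LINT x|lebesgue_on \<Omega>. f x * u x) \<in> H0_dual \<sigma> \<Omega>"
  unfolding H0_dual_def
 proof (intro CollectI conjI ballI allI)
  fix u v a b assume uv: "u \<in> H0 \<sigma> \<Omega>" "v \<in> H0 \<sigma> \<Omega>"
  have "(%x. f x * (a * u x + b * v x)) = (%x. a * (f x * u x) + b * (f x * v x))" by (simp add: algebra_simps)
  then show "(LINT x|lebesgue_on \<Omega>. f x * (a * u x + b * v x)) = a * (LINT x|lebesgue_on \<Omega>. f x * u x) + b * (LINT x|lebesgue_on \<Omega>. f x * v x)"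
   using C(2)[OF uv(1)] C(2)[OF uv(2)] by simp
 next
  show "\<exists>C. \<forall>u\<in>H0 \<sigma> \<Omega>. \<bar>LINT x|lebesgue_on \<Omega>. f x * u x\<bar> <= C * H0_norm \<sigma> u"
   using C(3) H0_norm_eq by (intro exI[of _ C]) simp
 qed
 then obtain l where l: "\<forall>u\<in>H0 \<sigma> \<Omega>. (LINT x|lebesgue_on \<Omega>. f x * u x) = l \<bullet> grad_class u"
  using dual_riesz by blast
 have G: "G u \<in> \<L>" "AE x in lebesgue. \<nu> <= G u x" if "u \<in> H0 \<sigma> \<Omega>" for u
  using assms(12) that by (simp_all add: operator_H0_Linf_ge_def Linf_ge_def)
 define K where "K U = gradient_constraint (G (rep U))" for U
 have "\<exists>U\<in>?V. U \<in> K U \<and> (\<forall>W\<in>K U. (T U - l) \<bullet> (W - U) \<ge> 0)"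
 proof (rule quasi_variational_inequality_solvable[OF grad_space_closed grad_space_subspace T a coercive])
  fix U assume U: "U \<in> ?V"
  show "closed (K U)" unfolding K_def by (rule gradient_constraint_closed[OF G(1)[OF rep(1)[OF U]]])
  show "convex (K U)" unfolding K_def by (rule gradient_constraint_convex)
  show "K U \<subseteq> ?V" by (auto simp: K_def gradient_constraint_def)
  have "AE x in lebesgue. norm (frac_grad \<sigma> (%_. 0) x) <= G (rep U) x"
   using G(2)[OF rep(1)[OF U]] H0_lin(2)[OF zero_H0(1) zero_H0(1), of 0 0]
   by eventually_elim (use \<nu> in simp)
  then show "0 \<in> K U"
   using grad_class_constraint[OF zero_H0(1), of "G (rep U)"] zero_H0 by (simp add: K_def constraint_set_def)
 next
  fix Us U assume Us: "!!n. Us n \<in> ?V" and U: "U \<in> ?V" and w: "weakly_tendsto Us U"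
  define e where "e n = Linf_norm (%x. G (rep (Us n)) x - G (rep U) x)" for n
  have e: "e \<longlonglongrightarrow> 0"
   using assms(14) rep_weak_conv[OF Us U w] unfolding completely_continuous_def e_def by blast
  define d where "d n = max 0 (real_of_ereal (e n))" for n
  have d: "d \<longlonglongrightarrow> 0"
  proof -
   have "(%n. real_of_ereal (e n)) \<longlonglongrightarrow> real_of_ereal 0"
    using e by (intro lim_real_of_ereal) (simp add: zero_ereal_def)
   then have "(%n. max 0 (real_of_ereal (e n))) \<longlonglongrightarrow> max 0 (real_of_ereal 0)"
    by (intro tendsto_max tendsto_const)
   then show ?thesis by (simp add: d_def[abs_def])
  qed
  (* The distance e n is finite for large n; the factor 0 serves the finitely many other n. *)
  define c where "c n = (if e n = \<infinity> then 0 else \<nu> / (\<nu> + d n))" for n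
  have d0: "0 <= d n" for n by (simp add: d_def)
  have c01: "0 <= c n" "c n <= 1" for n using \<nu> d0[of n] by (simp_all add: c_def divide_le_eq)
  have "(%n. \<nu> / (\<nu> + d n)) \<longlonglongrightarrow> \<nu> / (\<nu> + 0)"
   by (intro tendsto_divide tendsto_add tendsto_const d) (use \<nu> in simp)
  moreover have "\<forall>\<^sub>F n in sequentially. \<nu> / (\<nu> + d n) = c n"
  proof -
   have "\<forall>\<^sub>F n in sequentially. e n < \<infinity>" by (rule order_tendstoD(2)[OF e]) simp
   then show ?thesis by eventually_elim (auto simp: c_def)
  qed
  ultimately have "c \<longlonglongrightarrow> \<nu> / (\<nu> + 0)" by (rule Lim_transform_eventually)
  then have c1: "c \<longlonglongrightarrow> 1" using \<nu> by simp
  have ce: "AE x in lebesgue. c n * G (rep U) x <= G (rep (Us n)) x \<and> c n * G (rep (Us n)) x <= G (rep U) x" for n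
  proof (cases "e n = \<infinity>")
   case True
   show ?thesis using G(2)[OF rep(1)[OF U]] G(2)[OF rep(1)[OF Us[of n]]]
    by eventually_elim (use True \<nu> in \<open>simp add: c_def\<close>)
  next
   case False
   have "AE x in lebesgue. ereal \<bar>G (rep (Us n)) x - G (rep U) x\<bar> <= e n"
    unfolding e_def Linf_norm_def by (rule esssup_AE)
   then show ?thesis
    using G(2)[OF rep(1)[OF U]] G(2)[OF rep(1)[OF Us[of n]]]
   proof eventually_elim
    fix x assume 1: "ereal \<bar>G (rep (Us n)) x - G (rep U) x\<bar> <= e n" and 2: "\<nu> <= G (rep U) x" and 3: "\<nu> <= G (rep (Us n)) x"
    have 4: "\<bar>G (rep (Us n)) x - G (rep U) x\<bar> <= d n"
     using 1 False by (cases "e n") (auto simp: d_def)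
    have "\<nu> / (\<nu> + d n) * G (rep U) x <= G (rep (Us n)) x" by (rule constraint_scaling[OF \<nu> 3 d0 4])
    moreover have "\<nu> / (\<nu> + d n) * G (rep (Us n)) x <= G (rep U) x"
     by (rule constraint_scaling[OF \<nu> 2 d0]) (use 4 in linarith)
    ultimately show "c n * G (rep U) x <= G (rep (Us n)) x \<and> c n * G (rep (Us n)) x <= G (rep U) x"
     using False by (simp add: c_def)
   qed
  qed
  have "\<forall>n. \<forall>w\<in>K U. c n *\<^sub>R w \<in> K (Us n)"
   unfolding K_def by (intro allI ballI gradient_constraint_scale c01) (use ce in \<open>auto elim: eventually_mono\<close>)
  moreover have "\<forall>n. \<forall>w\<in>K (Us n). c n *\<^sub>R w \<in> K U"
   unfolding K_def by (intro allI ballI gradient_constraint_scale c01) (use ce in \<open>auto elim: eventually_mono\<close>)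
  ultimately show "\<exists>c. (\<forall>n. 0 <= c n \<and> c n <= 1) \<and> c \<longlonglongrightarrow> 1 \<and> (\<forall>n. \<forall>w\<in>K U. c n *\<^sub>R w \<in> K (Us n)) \<and> (\<forall>n. \<forall>w\<in>K (Us n). c n *\<^sub>R w \<in> K U)"
   using c01 c1 by blast
 qed
 then obtain U where U: "U \<in> ?V" "U \<in> K U" "\<forall>W\<in>K U. (T U - l) \<bullet> (W - U) \<ge> 0" by (elim bexE conjE)
 define u where "u = rep U"
 note u = rep(1)[OF U(1), folded u_def] rep(2)[OF U(1), folded u_def]
 show ?thesis
 proof (intro exI[of _ u] conjI ballI)
  show "u \<in> constraint_set \<sigma> \<Omega> (G u)"
   using U(2) grad_class_constraint[OF u(1), of "G u"] u(2) by (simp add: K_def u_def)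
  fix v assume v: "v \<in> constraint_set \<sigma> \<Omega> (G u)"
  then have vH: "v \<in> H0 \<sigma> \<Omega>" by (simp add: constraint_set_def)
  note d = H0_diff[OF vH u(1)]
  have "grad_class v \<in> K U"
   using grad_class_constraint[OF vH, of "G u"] v by (simp add: K_def u_def)
  then have "l \<bullet> (grad_class v - U) <= T U \<bullet> (grad_class v - U)" using U(3) by (simp add: inner_diff_left)
  moreover have "grad_class v - U = L2_class (frac_grad \<sigma> (%y. v y - u y))"
   using d(2) u(2) by (simp add: grad_class_def)
  moreover have "T U = L2_class (%x. A x *v frac_grad \<sigma> u x)"
   using T_class[OF H0_frac_grad(2)[OF u(1)]] u(2) by (simp add: grad_class_def)
  ultimately have "l \<bullet> (grad_class v - U) <= (LINT x|lebesgue. (A x *v frac_grad \<sigma> u x) \<bullet> frac_grad \<sigma> (%y. v y - u y) x)"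
   by (simp add: L2_class_inner As(1) H0_frac_grad(2) u(1) d(1))
  moreover have "(LINT x|lebesgue_on \<Omega>. f x * (v x - u x)) = l \<bullet> (grad_class v - U)"
   using l d(1,2) u(2) by simp
  ultimately show "(LINT x|lebesgue_on \<Omega>. f x * (v x - u x)) <= (LINT x|lebesgue. (A x *v frac_grad \<sigma> u x) \<bullet> frac_grad \<sigma> (%y. v y - u y) x)"
   by simp
 qed
qed

end
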